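(* Let $N\ge2$, let $\Omega\subset\mathbb{R}^N$ be a bounded open set, let $\lambda_i>0$ and $p_i>1$ for $i=1,\dots,N$, and let $\overline p$ be the harmonic mean of $p_1,\dots,p_N$, with $\overline p<N$. Let $a:\Omega\times\mathbb{R}\times\mathbb{R}^N\to\mathbb{R}^N$ be a Carathéodory function with components $a_j$ such that, for a.e. $x\in\Omega$, all $s\in\mathbb{R}$ and all $\xi,\xi'\in\mathbb{R}^N$, $$a(x,s,\xi)\cdot\xi\ge\sum_{i=1}^N\lambda_i|\xi_i|^{p_i},$$ $$|a_j(x,s,\xi)|\le\beta\left[h(x)+|s|^{\overline p}+\sum_{i=1}^N|\xi_i|^{p_i}\right]^{1/p_j'}\quad(j=1,\dots,N),\ \text{ with }\beta>0,\ h\in L^1(\Omega),$$ $$[a(x,s,\xi)-a(x,s,\xi')]\cdot(\xi-\xi')>0\quad\text{for }\xi\ne\xi'.$$ Let $f\in L^{(\overline p^* )',\overline p'}(\Omega)$ and $g_i\in L^{p_i'}(\Omega)$ for $i=1,\dots,N$. If $u$ is a weak solution to $$-\operatorname{div}(a(x,u,\nabla u))=f-\sum_{i=1}^N\frac{\partial g_i}{\partial x_i}\ \text{ in }\Omega,\qquad u=0\ \text{ on }\partial\Omega,$$ then there exists a positive constant $C$ such that $$u^{\bigstar}(x)\le C\,v(x)\quad\text{for a.e. }x\in\Omega^{\bigstar},$$ where, for $x\in\Omega^{\bigstar}$, $$v(x)=\int_{\omega_N|x|^N}^{|\Omega|}\frac{1}{\Lambda^{\frac1{\overline p-1}}N\omega_N^{1/N}t^{1/N'}}\left(\frac{t^{1/N}f^{**}(t)}{N\omega_N^{1/N}}+(\overline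 p\Lambda)^{1/\overline p}\left(\overline p'G(t)\right)^{1/\overline p'}\right)^{\frac1{\overline p-1}}dt$$ is the spherically symmetric solution to $$-\operatorname{div}\left(\Lambda|\nabla v|^{\overline p-2}\nabla v\right)=f^{\bigstar}(x)+\operatorname{div}\left((\overline p\Lambda)^{1/\overline p}\left(\overline p'G(\omega_N|x|^N)\right)^{1/\overline p'}\frac{x}{|x|}\right)\ \text{in }\Omega^{\bigstar},\qquad v=0\ \text{on }\partial\Omega^{\bigstar},$$ and $G$ is the pseudo-rearrangement of $\displaystyle\sum_{i=1}^N\frac{|g_i|^{p_i'}}{p_i'(\lambda_ip_i)^{p_i'/p_i}}$ with respect to $u$. Moreover $$\sum_{i=1}^N\int_\Omega\left|\frac{\partial u}{\partial x_i}\right|^{p_i}dx\le C\int_{\Omega^{\bigstar}}|\nabla v|^{\overline p}\,dx .$$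
   Context: For an exponent $q>1$, $q'=q/(q-1)$; $N'=N/(N-1)$. The harmonic mean $\overline p$ is given by $\frac1{\overline p}=\frac1N\sum_{i=1}^N\frac1{p_i}$, and $\overline p^*=N\overline p/(N-\overline p)$. $\omega_N$ is the measure of the unit ball of $\mathbb{R}^N$, $\Gamma$ is the Gamma function, and $$\Lambda=\frac{2^{\overline p}(\overline p-1)^{\overline p-1}}{\overline p^{\overline p}}\left[\frac{\prod_{i=1}^Np_i^{1/p_i}(p_i')^{1/p_i'}\Gamma(1+1/p_i')}{\omega_N\Gamma(1+N/\overline p')}\right]^{\overline p/N}\left(\prod_{i=1}^N\lambda_i^{1/p_i}\right)^{\overline p/N}.$$ For measurable $u$ on $\Omega$: $\mu_u(t)=|\{x\in\Omega:|u(x)|>t\}|$; $u^*(s)=\sup\{t>0:\mu_u(t)>s\}$; $u^{**}(s)=\frac1s\int_0^su^*(r)\,dr$; $u^{\bigstar}(x)=u^*(\omega_N|x|^N)$; $\Omega^{\bigstar}$ is the ball centered at the origin with $|\Omega^{\bigstar}|=|\Omega|$. Lorentz space $L^{p,q}(\Omega)$, $q<\infty$: measurable $h$ with $\left(\int_0^{|\Omega|}[s^{1/p}h^*(s)]^q\frac{ds}s\right)^{1/q}<\infty$. Pseudo-rearrangement: for $u$ measurable on $\Omega$ and $h\in L^1(\Omega)$, a function $H$ on $(0,|\Omega|)$ is the pseudo-rearrangement of $h$ with respect to $u$ if there is a family of measurable sets $E(s)\subseteq\Omega$, $s\in(0,|\Omega|)$, with $|E(s)|=s$, $E(s_1)\subseteq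 E(s_2)$ whenever $s_1\le s_2$, $E(s)=\{x\in\Omega:|u(x)|>u^*(s)\}$ whenever $s=\mu_u(t)$ for some $t$, and $H(s)=\frac{d}{ds}\int_{E(s)}h(x)\,dx$ for a.e. $s\in(0,|\Omega|)$. $W_0^{1,\overrightarrow p}(\Omega)$, $\overrightarrow p=(p_1,\dots,p_N)$, is the closure of $C_0^\infty(\Omega)$ in the norm $\sum_{i=1}^N\|\partial_{x_i}u\|_{L^{p_i}(\Omega)}$. A weak solution is $u\in W_0^{1,\overrightarrow p}(\Omega)$ with $$\int_\Omega a(x,u,\nabla u)\cdot\nabla\varphi\,dx=\int_\Omega\left(f\varphi+\sum_{i=1}^Ng_i\varphi_{x_i}\right)dx\quad\text{for all }\varphi\in C_c^\infty(\Omega).$$ *)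

theory Defs
  imports "HOL-Analysis.Analysis"
begin

section \<open>Exponents and constants\<close>

text \<open>The space dimension is \<open>N = CARD('n)\<close>; the vectors of exponents and of ellipticity
  constants are functions on the index type \<open>'n\<close>.\<close>

definition conj_exp :: "real \<Rightarrow> real" where
  "conj_exp q = q / (q - 1)"

definition harm_mean :: "('n::finite \<Rightarrow> real) \<Rightarrow> real" where
  "harm_mean p = 1 / ((1 / real CARD('n)) * (\<Sum>i\<in>UNIV. 1 / p i))"

definition sobolev_exp :: "('n::finite \<Rightarrow> real) \<Rightarrow> real" where
  "sobolev_exp p = real CARD('n) * harm_mean p / (real CARD('n) - harm_mean p)"

definition Lambda :: "('n::finite \<Rightarrow> real) \<Rightarrow> ('n \<Rightarrow> real) \<Rightarrow> real" where
  "Lambda p lam =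
     (let N = real CARD('n); P = harm_mean p in
        2 powr P * (P - 1) powr (P - 1) / P powr P
      * ((\<Prod>i\<in>UNIV. p i powr (1 / p i) * conj_exp (p i) powr (1 / conj_exp (p i))
                     * Gamma (1 + 1 / conj_exp (p i)))
          / (unit_ball_vol N * Gamma (1 + N / conj_exp P))) powr (P / N)
      * (\<Prod>i\<in>UNIV. lam i powr (1 / p i)) powr (P / N))"


section \<open>Rearrangements\<close>

definition distr_fun :: "(real^'n::finite) set \<Rightarrow> (real^'n \<Rightarrow> real) \<Rightarrow> real \<Rightarrow> real" where
  "distr_fun \<Omega> u t = measure lebesgue {x \<in> \<Omega>. \<bar>u x\<bar> > t}"

text \<open>The supremum is taken in \<open>[0,\<infinity>]\<close>, so that of the empty set is \<open>0\<close>. For \<open>s > 0\<close> and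
  \<open>\<Omega>\<close> of finite measure the set below is bounded; for unbounded \<open>u\<close>, the value at \<open>s = 0\<close>
  (where the supremum would be infinite) is unspecified.\<close>

definition decr_rearr :: "(real^'n::finite) set \<Rightarrow> (real^'n \<Rightarrow> real) \<Rightarrow> real \<Rightarrow> real" where
  "decr_rearr \<Omega> u s = Sup (insert 0 {t. t > 0 \<and> distr_fun \<Omega> u t > s})"

definition max_rearr :: "(real^'n::finite) set \<Rightarrow> (real^'n \<Rightarrow> real) \<Rightarrow> real \<Rightarrow> real" where
  "max_rearr \<Omega> u s = (1 / s) * (LINT r|lebesgue_on {0<..<s}. decr_rearr \<Omega> u r)"

definition sym_rearr :: "(real^'n::finite) set \<Rightarrow> (real^'n \<Rightarrow> real) \<Rightarrow> real^'n \<Rightarrow> real" where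
  "sym_rearr \<Omega> u x = decr_rearr \<Omega> u (unit_ball_vol (real CARD('n)) * norm x ^ CARD('n))"

definition sym_dom :: "(real^'n::finite) set \<Rightarrow> (real^'n) set" where
  "sym_dom \<Omega> = ball 0 (root CARD('n) (measure lebesgue \<Omega> / unit_ball_vol (real CARD('n))))"

definition Lorentz :: "(real^'n::finite) set \<Rightarrow> real \<Rightarrow> real \<Rightarrow> (real^'n \<Rightarrow> real) \<Rightarrow> bool" where
  "Lorentz \<Omega> p q f \<longleftrightarrow>
     f \<in> borel_measurable (lebesgue_on \<Omega>) \<and>
     (\<integral>\<^sup>+ s. ennreal ((s powr (1 / p) * decr_rearr \<Omega> f s) powr q / s)
        \<partial>lebesgue_on {0<..<measure lebesgue \<Omega>}) < \<infinity>"

definition pseudo_rearr ::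
  "(real^'n::finite) set \<Rightarrow> (real^'n \<Rightarrow> real) \<Rightarrow> (real^'n \<Rightarrow> real) \<Rightarrow> (real \<Rightarrow> real) \<Rightarrow> bool" where
  "pseudo_rearr \<Omega> u h H \<longleftrightarrow>
     u \<in> borel_measurable (lebesgue_on \<Omega>) \<and> integrable (lebesgue_on \<Omega>) h \<and>
     (\<exists>E. (\<forall>s\<in>{0<..<measure lebesgue \<Omega>}.
             E s \<in> sets lebesgue \<and> E s \<subseteq> \<Omega> \<and> measure lebesgue (E s) = s) \<and>
          (\<forall>s\<^sub>1\<in>{0<..<measure lebesgue \<Omega>}. \<forall>s\<^sub>2\<in>{0<..<measure lebesgue \<Omega>}.
             s\<^sub>1 \<le> s\<^sub>2 \<longrightarrow> E s\<^sub>1 \<subseteq> E s\<^sub>2) \<and>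
          (\<forall>s\<in>{0<..<measure lebesgue \<Omega>}. (\<exists>t. s = distr_fun \<Omega> u t) \<longrightarrow>
             E s = {x \<in> \<Omega>. \<bar>u x\<bar> > decr_rearr \<Omega> u s}) \<and>
          (AE s in lebesgue_on {0<..<measure lebesgue \<Omega>}.
             ((\<lambda>\<sigma>. LINT x|lebesgue_on (E \<sigma>). h x) has_real_derivative H s) (at s)))"


section \<open>Function spaces\<close>

definition partial_deriv :: "'n::finite \<Rightarrow> (real^'n \<Rightarrow> real) \<Rightarrow> real^'n \<Rightarrow> real" where
  "partial_deriv i \<phi> x = frechet_derivative \<phi> (at x) (axis i 1)"

definition gradient :: "(real^'n::finite \<Rightarrow> real) \<Rightarrow> real^'n \<Rightarrow> real^'n" where
  "gradient \<phi> x = (\<chi> i. partial_deriv i \<phi> x)"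

primrec Ck :: "nat \<Rightarrow> (real^'n::finite \<Rightarrow> real) \<Rightarrow> bool" where
  "Ck 0 \<phi> \<longleftrightarrow> continuous_on UNIV \<phi>"
| "Ck (Suc k) \<phi> \<longleftrightarrow> (\<forall>x. \<phi> differentiable (at x)) \<and> (\<forall>i. Ck k (partial_deriv i \<phi>))"

definition test_funs :: "(real^'n::finite) set \<Rightarrow> (real^'n \<Rightarrow> real) set" where
  "test_funs \<Omega> = {\<phi>. (\<forall>k. Ck k \<phi>) \<and> compact (closure {x. \<phi> x \<noteq> 0}) \<and> closure {x. \<phi> x \<noteq> 0} \<subseteq> \<Omega>}"

definition Lp :: "(real^'n::finite) set \<Rightarrow> real \<Rightarrow> (real^'n \<Rightarrow> real) \<Rightarrow> bool" where
  "Lp \<Omega> q f \<longleftrightarrow> f \<in> borel_measurable (lebesgue_on \<Omega>)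
             \<and> integrable (lebesgue_on \<Omega>) (\<lambda>x. \<bar>f x\<bar> powr q)"

definition Lp_norm :: "(real^'n::finite) set \<Rightarrow> real \<Rightarrow> (real^'n \<Rightarrow> real) \<Rightarrow> real" where
  "Lp_norm \<Omega> q f = (LINT x|lebesgue_on \<Omega>. \<bar>f x\<bar> powr q) powr (1 / q)"

definition L1_loc :: "(real^'n::finite) set \<Rightarrow> (real^'n \<Rightarrow> real) \<Rightarrow> bool" where
  "L1_loc \<Omega> f \<longleftrightarrow> (\<forall>K. compact K \<and> K \<subseteq> \<Omega> \<longrightarrow> integrable (lebesgue_on K) f)"

definition is_weak_grad ::
  "(real^'n::finite) set \<Rightarrow> (real^'n \<Rightarrow> real) \<Rightarrow> (real^'n \<Rightarrow> real^'n) \<Rightarrow> bool" where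
  "is_weak_grad \<Omega> u D \<longleftrightarrow> L1_loc \<Omega> u \<and>
     (\<forall>i. L1_loc \<Omega> (\<lambda>x. D x $ i) \<and>
       (\<forall>\<phi>\<in>test_funs \<Omega>. (LINT x|lebesgue_on \<Omega>. u x * partial_deriv i \<phi> x)
                       = - (LINT x|lebesgue_on \<Omega>. D x $ i * \<phi> x)))"

text \<open>Weak gradients are unique up to null sets; an arbitrary representative is chosen.\<close>

definition weak_grad :: "(real^'n::finite) set \<Rightarrow> (real^'n \<Rightarrow> real) \<Rightarrow> real^'n \<Rightarrow> real^'n" where
  "weak_grad \<Omega> u = (SOME D. is_weak_grad \<Omega> u D)"

text \<open>The closure of the test functions in the norm \<open>\<Sum>\<^sub>i \<parallel>\<partial>\<^sub>i u\<parallel>\<close> for bounded \<open>\<Omega>\<close>. This expression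
  is only a seminorm on weakly differentiable functions (it vanishes on constants). By the
  Poincare inequality, test functions that are Cauchy for it also converge in \<open>L\<^sup>1(\<Omega>)\<close>;
  the element of the closure is the \<open>L\<^sup>1\<close> limit.\<close>

definition W0 :: "(real^'n::finite) set \<Rightarrow> ('n \<Rightarrow> real) \<Rightarrow> (real^'n \<Rightarrow> real) \<Rightarrow> bool" where
  "W0 \<Omega> p u \<longleftrightarrow>
     Lp \<Omega> 1 u \<and> (\<exists>D. is_weak_grad \<Omega> u D) \<and> (\<forall>i. Lp \<Omega> (p i) (\<lambda>x. weak_grad \<Omega> u x $ i)) \<and>
     (\<exists>\<phi>. (\<forall>k. \<phi> k \<in> test_funs \<Omega>) \<and>
          (\<lambda>k. Lp_norm \<Omega> 1 (\<lambda>x. \<phi> k x - u x)) \<longlonglongrightarrow> 0 \<and>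
          (\<lambda>k::nat. \<Sum>i\<in>UNIV. Lp_norm \<Omega> (p i) (\<lambda>x. partial_deriv i (\<phi> k) x - weak_grad \<Omega> u x $ i))
            \<longlonglongrightarrow> 0)"


section \<open>The boundary value problems\<close>

text \<open>Weak solutions of \<open>-div (a(x,u,\<nabla>u)) = f - \<Sum>\<^sub>i \<partial>\<^sub>i g\<^sub>i\<close> in \<open>\<Omega>\<close>, \<open>u = 0\<close> on the boundary.\<close>

definition weak_solution ::
  "(real^'n::finite) set \<Rightarrow> ('n \<Rightarrow> real) \<Rightarrow> (real^'n \<Rightarrow> real \<Rightarrow> real^'n \<Rightarrow> real^'n) \<Rightarrow>
   (real^'n \<Rightarrow> real) \<Rightarrow> ('n \<Rightarrow> real^'n \<Rightarrow> real) \<Rightarrow> (real^'n \<Rightarrow> real) \<Rightarrow> bool" where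
  "weak_solution \<Omega> p a f g u \<longleftrightarrow> W0 \<Omega> p u \<and>
     (\<forall>\<phi>\<in>test_funs \<Omega>.
        integrable (lebesgue_on \<Omega>) (\<lambda>x. a x (u x) (weak_grad \<Omega> u x) \<bullet> gradient \<phi> x) \<and>
        integrable (lebesgue_on \<Omega>) (\<lambda>x. f x * \<phi> x + (\<Sum>i\<in>UNIV. g i x * partial_deriv i \<phi> x)) \<and>
        (LINT x|lebesgue_on \<Omega>. a x (u x) (weak_grad \<Omega> u x) \<bullet> gradient \<phi> x)
        = (LINT x|lebesgue_on \<Omega>. f x * \<phi> x + (\<Sum>i\<in>UNIV. g i x * partial_deriv i \<phi> x)))"

definition Caratheodory ::
  "(real^'n::finite) set \<Rightarrow> (real^'n \<Rightarrow> real \<Rightarrow> real^'n \<Rightarrow> real^'n) \<Rightarrow> bool" where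
  "Caratheodory \<Omega> a \<longleftrightarrow>
     (\<forall>s \<xi>. (\<lambda>x. a x s \<xi>) \<in> borel_measurable (lebesgue_on \<Omega>)) \<and>
     (AE x in lebesgue_on \<Omega>. continuous_on UNIV (\<lambda>(s, \<xi>). a x s \<xi>))"

text \<open>The bound \<open>h\<close> in the growth condition has to be nonnegative for its right-hand side to make
  sense, since the bracket equals \<open>h(x)\<close> at \<open>s = 0\<close>, \<open>\<xi> = 0\<close>.\<close>

definition structure_conds ::
  "(real^'n::finite) set \<Rightarrow> ('n \<Rightarrow> real) \<Rightarrow> ('n \<Rightarrow> real) \<Rightarrow> real \<Rightarrow> (real^'n \<Rightarrow> real) \<Rightarrow>
   (real^'n \<Rightarrow> real \<Rightarrow> real^'n \<Rightarrow> real^'n) \<Rightarrow> bool" where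
  "structure_conds \<Omega> p lam \<beta> h a \<longleftrightarrow>
     Caratheodory \<Omega> a \<and> \<beta> > 0 \<and>
     integrable (lebesgue_on \<Omega>) h \<and> (AE x in lebesgue_on \<Omega>. h x \<ge> 0) \<and>
     (AE x in lebesgue_on \<Omega>. \<forall>s \<xi>. a x s \<xi> \<bullet> \<xi> \<ge> (\<Sum>i\<in>UNIV. lam i * \<bar>\<xi> $ i\<bar> powr p i)) \<and>
     (AE x in lebesgue_on \<Omega>. \<forall>s \<xi> j. \<bar>a x s \<xi> $ j\<bar>
        \<le> \<beta> * (h x + \<bar>s\<bar> powr harm_mean p + (\<Sum>i\<in>UNIV. \<bar>\<xi> $ i\<bar> powr p i))
                powr (1 / conj_exp (p j))) \<and>
     (AE x in lebesgue_on \<Omega>. \<forall>s \<xi> \<xi>'. \<xi> \<noteq> \<xi>' \<longrightarrow> (a x s \<xi> - a x s \<xi>') \<bullet> (\<xi> - \<xi>') > 0)"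

definition g_density ::
  "('n::finite \<Rightarrow> real) \<Rightarrow> ('n \<Rightarrow> real) \<Rightarrow> ('n \<Rightarrow> real^'n \<Rightarrow> real) \<Rightarrow> real^'n \<Rightarrow> real" where
  "g_density p lam g x =
     (\<Sum>i\<in>UNIV. \<bar>g i x\<bar> powr conj_exp (p i)
               / (conj_exp (p i) * (lam i * p i) powr (conj_exp (p i) / p i)))"

definition G_term :: "('n::finite \<Rightarrow> real) \<Rightarrow> ('n \<Rightarrow> real) \<Rightarrow> (real \<Rightarrow> real) \<Rightarrow> real \<Rightarrow> real" where
  "G_term p lam G t =
     (harm_mean p * Lambda p lam) powr (1 / harm_mean p)
     * (conj_exp (harm_mean p) * G t) powr (1 / conj_exp (harm_mean p))"

definition sym_sol ::
  "(real^'n::finite) set \<Rightarrow> ('n \<Rightarrow> real) \<Rightarrow> ('n \<Rightarrow> real) \<Rightarrow> (real^'n \<Rightarrow> real) \<Rightarrow> (real \<Rightarrow> real) \<Rightarrow>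
   real^'n \<Rightarrow> real" where
  "sym_sol \<Omega> p lam f G x =
     (let N = real CARD('n); \<omega> = unit_ball_vol N; P = harm_mean p in
      LINT t|lebesgue_on {\<omega> * norm x ^ CARD('n)<..<measure lebesgue \<Omega>}.
        1 / (Lambda p lam powr (1 / (P - 1)) * N * \<omega> powr (1 / N) * t powr (1 / conj_exp N))
        * (t powr (1 / N) * max_rearr \<Omega> f t / (N * \<omega> powr (1 / N)) + G_term p lam G t)
            powr (1 / (P - 1)))"

text \<open>Weak solutions of
  \<open>-div (\<Lambda> |\<nabla>v|\<^bsup>P-2\<^esup> \<nabla>v) = f\<^sup>\<star> + div (G_term(\<omega>|x|\<^sup>N) x/|x|)\<close> in the symmetrized ball, with zero
  boundary values, where \<open>P = harm_mean p\<close>. The divergence on the right enters with a plus sign,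
  hence the minus sign in the components passed to \<open>weak_solution\<close>.\<close>

definition sym_weak_solution ::
  "(real^'n::finite) set \<Rightarrow> ('n \<Rightarrow> real) \<Rightarrow> ('n \<Rightarrow> real) \<Rightarrow> (real^'n \<Rightarrow> real) \<Rightarrow> (real \<Rightarrow> real) \<Rightarrow>
   (real^'n \<Rightarrow> real) \<Rightarrow> bool" where
  "sym_weak_solution \<Omega> p lam f G v \<longleftrightarrow>
     weak_solution (sym_dom \<Omega>) (\<lambda>i. harm_mean p)
       (\<lambda>x s \<xi>. Lambda p lam *\<^sub>R (norm \<xi> powr (harm_mean p - 2) *\<^sub>R \<xi>))
       (sym_rearr \<Omega> f)
       (\<lambda>i x. - (G_term p lam G (unit_ball_vol (real CARD('n)) * norm x ^ CARD('n)) * (x $ i / norm x)))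
       v"

definition spherically_symmetric :: "(real^'n::finite) set \<Rightarrow> (real^'n \<Rightarrow> real) \<Rightarrow> bool" where
  "spherically_symmetric B v \<longleftrightarrow> (\<forall>x\<in>B. \<forall>y\<in>B. norm x = norm y \<longrightarrow> v x = v y)"

end

theory Submission
 imports Defs "HOL-Real_Asymp.Real_Asymp"
begin

text \<open>
 Since the constant \<open>C\<close> is free, crude substitutes for the sharp inequalities suffice. Testing the
 equation with truncations of \<open>u\<close> bounds its anisotropic energy between two levels. The \<open>L\<^sup>1\<close> change
 of a truncation under a translation is controlled by that energy, and averaging over the translations in a
 box of twice the measure of the support, with sides adapted to the exponents, bounds from
 below what an isoperimetric inequality would bound. The outcome is a differential inequality for \<open>u\<^sup>*\<close>,
 whose integration bounds \<open>u\<^sup>*\<close> by the primitive that defines \<open>v\<close>; total energies are compared in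
 the same way.

 The gradient of \<open>v\<close> is explicit, and Hardy's inequality shows that it lies in \<open>L\<^sup>P\<close>, where \<open>P\<close> is the
 harmonic mean; approximating its radial profile by smooth functions puts \<open>v\<close> into the
 Sobolev space. The weak equation follows by writing the radial flux as a superposition of
 dilations of the load, and uniqueness from strict monotonicity.
\<close>

text \<open>A priori the rearrangement of u is only monotone and G is only an a.e. derivative, so no
  step differentiates the rearrangement. The energy and translation bounds are applied between two
  arbitrary levels, which yields an inequality between increments, and a gauge-integral argument
  sums the increments. The absolute continuity needed there comes from the sets of the
  pseudo-rearrangement.

  The harmonic mean P enters through the shape of the box. If B_i bounds the L^1 norm of the i-th
  derivative in a slab between two levels, sides proportional to 1/B_i make all terms of the
  translation bound equal, and their common value is a multiple of the geometric mean of the B_i. As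
  B_i contains the energy to the power 1/p_i, this mean contains it to the power 1/P.

  The constants arise from the box, from Young's inequality and from the powers that relate the
  bound to v. They depend only on the dimension, the exponents and the ellipticity constants, which
  permits one C for all domains and data.\<close>

notation (input) abs ("|'(_')|")

abbreviation (input) ind where "ind \<equiv> indicator"
abbreviation (input) pd where "pd \<equiv> partial_deriv"
abbreviation (input) BM where "BM \<equiv> borel_measurable"
abbreviation (input) LB where "LB \<equiv> lebesgue_on"
abbreviation (input) nn_lborel (binder "NN " 10) where "nn_lborel f \<equiv> nn_integral lborel f"
abbreviation (input) seq_lim (infix "\<leadsto>" 60) where "f \<leadsto> l \<equiv> (f \<longlongrightarrow> l) sequentially"

section \<open>Smooth functions\<close>

primrec Ck1 :: "nat => (real => real) => bool" where
 "Ck1 0 f \<longleftrightarrow> continuous_on UNIV f"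
| "Ck1 (Suc k) f \<longleftrightarrow> (\<exists>f'. (\<forall>x. (f has_real_derivative f' x) (at x)) & Ck1 k f')"

definition smooth1 :: "(real => real) => bool" where
 "smooth1 f \<longleftrightarrow> (\<forall>k. Ck1 k f)"

lemma smooth1_derivE:
 assumes "smooth1 f"
 obtains f' where "!!x. (f has_real_derivative f' x) (at x)" "smooth1 f'"
proof -
 have "Ck1 (Suc 0) f" using assms by (auto simp: smooth1_def simp del: Ck1.simps)
 then obtain f' where f': "!!x. (f has_real_derivative f' x) (at x)" by auto
 have "Ck1 k f'" for k
 proof -
  have "Ck1 (Suc k) f" using assms by (auto simp: smooth1_def simp del: Ck1.simps)
  then obtain g where g: "!!x. (f has_real_derivative g x) (at x)" "Ck1 k g" by auto
  have "f' = g" using f' g(1) by (metis DERIV_unique ext)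
  with g show ?thesis by simp
 qed
 with f' that show ?thesis by (auto simp: smooth1_def)
qed

lemma Ck1_Suc_imp: "Ck1 (Suc k) f ==> Ck1 k f"
proof (induction k arbitrary: f)
 case 0
 thus ?case by (auto intro!: continuous_at_imp_continuous_on intro: DERIV_isCont)
next
 case (Suc k)
 then obtain f' where "\<forall>x. (f has_real_derivative f' x) (at x)" "Ck1 (Suc k) f'" by (metis Ck1.simps(2))
 with Suc.IH show ?case by auto
qed

lemma smooth1_continuous: "smooth1 f ==> continuous_on S f"
 by (metis Ck1.simps(1) continuous_on_subset smooth1_def subset_UNIV)

lemma smooth1_intro:
 assumes "!!x. (f has_real_derivative f' x) (at x)" "smooth1 f'"
 shows "smooth1 f"
proof -
 have "Ck1 (Suc k) f" for k using assms by (auto simp: smooth1_def)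
 thus ?thesis unfolding smooth1_def using Ck1_Suc_imp by blast
qed

lemma Ck1_const: "Ck1 k (%_. c)"
 by (induction k arbitrary: c) (auto intro!: exI[of _ "%_. 0"])

lemma smooth1_const [simp]: "smooth1 (%_. c)"
 by (simp add: smooth1_def Ck1_const)

lemma smooth1_ident [simp]: "smooth1 (%x. x)"
 by (rule smooth1_intro[where f' = "%_. 1"]) auto

lemma Ck1_add: "Ck1 k f ==> Ck1 k g ==> Ck1 k (%x. f x + g x)"
proof (induction k arbitrary: f g)
 case 0
 thus ?case by (auto intro: continuous_intros)
next
 case (Suc k)
 then obtain f' g' where "\<forall>x. (f has_real_derivative f' x) (at x)" "Ck1 k f'"
  "\<forall>x. (g has_real_derivative g' x) (at x)" "Ck1 k g'" by auto
 with Suc.IH show ?case by (auto intro!: exI[of _ "%x. f' x + g' x"] derivative_eq_intros)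
qed

lemma smooth1_add: "smooth1 f ==> smooth1 g ==> smooth1 (%x. f x + g x)"
 by (simp add: smooth1_def Ck1_add)

lemma Ck1_mult: "Ck1 k f ==> Ck1 k g ==> Ck1 k (%x. f x * g x)"
proof (induction k arbitrary: f g)
 case 0
 thus ?case by (auto intro: continuous_intros)
next
 case (Suc k)
 from Suc.prems obtain f' g' where *: "\<forall>x. (f has_real_derivative f' x) (at x)" "Ck1 k f'"
  "\<forall>x. (g has_real_derivative g' x) (at x)" "Ck1 k g'" by auto
 have "Ck1 k (%x. f' x * g x + f x * g' x)" using Suc * by (intro Ck1_add Suc.IH Ck1_Suc_imp[of k f] Ck1_Suc_imp[of k g])
 with * show ?case by (auto intro!: exI[of _ "%x. f' x * g x + f x * g' x"] derivative_eq_intros)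
qed

lemma smooth1_mult: "smooth1 f ==> smooth1 g ==> smooth1 (%x. f x * g x)"
 by (simp add: smooth1_def Ck1_mult)

lemma smooth1_diff: "smooth1 f ==> smooth1 g ==> smooth1 (%x. f x - g x)"
 using smooth1_add[of f "%x. (-1) * g x"] smooth1_mult[of "%_. -1" g] by simp

lemma Ck1_compose: "smooth1 f ==> Ck1 k g ==> Ck1 k (%x. f (g x))"
proof (induction k arbitrary: f g)
 case 0
 thus ?case by (auto intro: continuous_on_compose2[OF smooth1_continuous[of f UNIV]])
next
 case (Suc k)
 obtain f' where f': "!!x. (f has_real_derivative f' x) (at x)" "smooth1 f'" using smooth1_derivE[OF \<open>smooth1 f\<close>] by blast
 from Suc.prems obtain g' where g': "\<forall>x. (g has_real_derivative g' x) (at x)" "Ck1 k g'" by auto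
 have "Ck1 k (%x. f' (g x) * g' x)" by (rule Ck1_mult[OF Suc.IH[OF f'(2) Ck1_Suc_imp[OF Suc.prems(2)]] g'(2)])
 moreover have "((%x. f (g x)) has_real_derivative f' (g x) * g' x) (at x)" for x using DERIV_chain2[OF f'(1)] g' by blast
 ultimately show ?case by (auto intro!: exI[of _ "%x. f' (g x) * g' x"])
qed

lemma smooth1_compose: "smooth1 f ==> smooth1 g ==> smooth1 (%x. f (g x))"
 using Ck1_compose by (auto simp: smooth1_def)

lemma smooth1_exp: "smooth1 exp"
proof -
 have "Ck1 k exp" for k by (induction k) (auto intro!: exI[of _ exp] continuous_intros derivative_intros)
 thus ?thesis by (simp add: smooth1_def)
qed

section \<open>A flat exponential and smooth approximations of interval indicators\<close>

definition flat_exp :: "real => real" where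
 "flat_exp x = (if x > 0 then exp (- (1/x)) else 0)"

text \<open>On the right of 0 the substitution y = 1/x turns this into the decay of a polynomial
  times exp(-y); on the left the function is 0.\<close>

lemma poly_flat_exp_tendsto: "((%x. poly p (1/x) * flat_exp x) \<longlongrightarrow> 0) (at (0::real))"
proof -
 have "((%y. poly p y * exp (- y)) \<longlongrightarrow> 0) at_top"
 proof (induction p)
  case 0
  thus ?case by simp
 next
  case (pCons a p)
  have "((%y::real. y ^ Suc n * exp (- y)) \<longlongrightarrow> 0) at_top" for n by real_asymp
  have *: "((%y. coeff (pCons a p) n * (y ^ n * exp (- y))) \<longlongrightarrow> 0) at_top" for n by (rule tendsto_mult_right_zero) real_asymp
  have "((%y. \<Sum>n\<le>degree (pCons a p). coeff (pCons a p) n * (y ^ n * exp (- y))) \<longlongrightarrow> 0) at_top"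
   using tendsto_sum[of "{..degree (pCons a p)}", OF *] by simp
  thus ?case by (simp add: poly_altdef sum_distrib_right mult.assoc)
 qed
 hence "((%x. poly p (1/x) * exp (- (1/x))) \<longlongrightarrow> 0) (at_right 0)" by (rule filterlim_compose) real_asymp
 hence "((%x. poly p (1/x) * flat_exp x) \<longlongrightarrow> 0) (at_right 0)" by (rule Lim_transform_eventually)
   (auto simp: eventually_at_right_less flat_exp_def eventually_at_filter)
 moreover have "((%x. poly p (1/x) * flat_exp x) \<longlongrightarrow> 0) (at_left 0)" by (rule Lim_transform_eventually[of "%_. 0"])
   (auto simp: flat_exp_def eventually_at_filter)
 ultimately show ?thesis by (simp add: filterlim_split_at)
qed

text \<open>The family p(1/x) \<open>flat_exp\<close> x is closed under differentiation: 1/x has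
  derivative -1/x^2, so p becomes y^2 (p - p') in the variable y = 1/x. Smoothness then follows by
  induction over the family.\<close>

lemma poly_flat_exp_deriv:
 defines "q \<equiv> %p. [:0, 0, 1:] * (p - pderiv p)"
 shows "((%x. poly p (1/x) * flat_exp x) has_real_derivative
      poly (q p) (1/x) * flat_exp x) (at x)"
proof -
 consider "x > 0" | "x < 0" | "x = 0" by linarith
 thus ?thesis
 proof cases
  case 1
  have "((%x. poly p (1/x) * exp (- (1/x))) has_real_derivative
      poly (q p) (1/x) * flat_exp x) (at x)" using 1 unfolding q_def
   by (auto intro!: derivative_eq_intros DERIV_chain2[OF poly_DERIV] simp: field_simps power2_eq_square flat_exp_def)
  show ?thesis by (rule has_field_derivative_transform_within_open[OF \<open>(_ has_real_derivative _) _\<close>, where S = "{0<..}"])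
    (use 1 in \<open>auto simp: flat_exp_def\<close>)
 next
  case 2
  show ?thesis by (rule has_field_derivative_transform_within_open[where S = "{..<0}" and f = "%_. 0"])
    (use 2 in \<open>auto simp: flat_exp_def\<close>)
 next
  case 3
  \<comment> \<open>The difference quotient at 0 is again a member of the family:
    \<open>pCons 0 p\<close> evaluated at 1/h is p(1/h)/h, and \<open>flat_exp\<close> vanishes at
    0.\<close>
  have "((%h. poly (pCons 0 p) (1/h) * flat_exp h) \<longlongrightarrow> 0) (at 0)" by (rule poly_flat_exp_tendsto)
  thus ?thesis unfolding DERIV_def 3 by (simp add: flat_exp_def)
 qed
qed

lemma smooth1_flat_exp: "smooth1 flat_exp"
proof -
 have "Ck1 k (%x. poly p (1/x) * flat_exp x)" for k p
 proof (induction k arbitrary: p)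
  case 0
  thus ?case by (auto intro!: continuous_at_imp_continuous_on DERIV_isCont[OF poly_flat_exp_deriv])
 next
  case (Suc k)
  thus ?case unfolding Ck1.simps(2) by (intro exI[of _ "%x. poly ([:0, 0, 1:] * (p - pderiv p)) (1/x) * flat_exp x"] conjI allI
    poly_flat_exp_deriv)
 qed
 from this[of _ "[:1:]"] show ?thesis by (simp add: smooth1_def)
qed

lemma flat_exp_pos: "x > 0 ==> flat_exp x > 0"
 and flat_exp_zero: "x \<le> 0 ==> flat_exp x = 0"
 and flat_exp_nonneg: "flat_exp x \<ge> 0" by (auto simp: flat_exp_def)

text \<open>The product of the two flat exponentials is positive exactly on (a,b). Thus 1 - exp(-n
  w) is smooth, lies below the indicator of (a,b), and tends to it pointwise.\<close>

definition step_approx :: "real => real => nat => real => real" where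
 "step_approx a b n x = 1 - exp (- (real n * (flat_exp (x - a) * flat_exp (b - x))))"

lemma step_approx_smooth: "smooth1 (step_approx a b n)"
proof -
 have 1: "smooth1 (%x. flat_exp (x - a))" "smooth1 (%x. flat_exp (b - x))" by (auto intro!: smooth1_compose[OF smooth1_flat_exp] smooth1_diff)
 hence "smooth1 (%x. (- real n) * (flat_exp (x - a) * flat_exp (b - x)))" by (intro smooth1_mult) auto
 hence "smooth1 (%x. exp ((- real n) * (flat_exp (x - a) * flat_exp (b - x))))" by (rule smooth1_compose[OF smooth1_exp])
 hence "smooth1 (%x. 1 - exp ((- real n) * (flat_exp (x - a) * flat_exp (b - x))))" by (intro smooth1_diff) auto
 thus ?thesis by (simp add: step_approx_def[abs_def])
qed

lemma step_approx_bounds: "0 \<le> step_approx a b n x" "step_approx a b n x \<le> 1"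
 by (auto simp: step_approx_def flat_exp_nonneg)

lemma step_approx_outside: "x \<notin> {a<..<b} ==> step_approx a b n x = 0"
 by (auto simp: step_approx_def flat_exp_zero not_less)

lemma step_approx_le: "step_approx a b n x \<le> ind {a<..<b} x"
 using step_approx_bounds step_approx_outside by (auto simp: indicator_def)

lemma step_approx_tendsto: "(%n. step_approx a b n x) \<leadsto> ind {a<..<b} x"
proof (cases "x \<in> {a<..<b}")
 case True
 define c where "c = flat_exp (x - a) * flat_exp (b - x)"
 have "c > 0" using True by (auto simp: c_def flat_exp_pos)
 hence "(%n. 1 - exp (- (real n * c))) \<leadsto> 1" by real_asymp
 with True show ?thesis by (simp add: step_approx_def c_def)
next
 case False
 thus ?thesis by (simp add: step_approx_outside)
qed

section \<open>Calculus of partial derivatives and test functions\<close>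

lemma partial_deriv_has_derivative:
 assumes "(\<phi> has_derivative D) (at x)"
 shows "pd i \<phi> x = D (axis i 1)" unfolding partial_deriv_def using frechet_derivative_at[OF assms] by simp

lemma partial_deriv_compose:
 assumes "(f has_real_derivative f') (at (\<phi> x))" "\<phi> differentiable (at x)"
 shows "(%x. f (\<phi> x)) differentiable (at x)"
  "pd i (%x. f (\<phi> x)) x = f' * pd i \<phi> x"
proof -
 have 1: "(\<phi> has_derivative frechet_derivative \<phi> (at x)) (at x)" using assms(2) by (simp add: frechet_derivative_works)
 have 2: "((%x. f (\<phi> x)) has_derivative (%h. f' * frechet_derivative \<phi> (at x) h)) (at x)"
  using has_derivative_compose[OF 1, of f "(*) f'"] assms(1) by (simp add: has_field_derivative_def)
 thus "(%x. f (\<phi> x)) differentiable (at x)" by (auto simp: differentiable_def)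
 show "pd i (%x. f (\<phi> x)) x = f' * pd i \<phi> x" using partial_deriv_has_derivative[OF 2] by (simp add: partial_deriv_def)
qed

lemma partial_deriv_mult:
 assumes "\<phi> differentiable (at x)" "\<psi> differentiable (at x)"
 shows "pd i (%x. \<phi> x * \<psi> x) x = \<phi> x * pd i \<psi> x + pd i \<phi> x * \<psi> x"
 using partial_deriv_has_derivative[OF has_derivative_mult[OF
   assms[unfolded frechet_derivative_works]]] by (simp add: partial_deriv_def)

lemma partial_deriv_add:
 assumes "\<phi> differentiable (at x)" "\<psi> differentiable (at x)"
 shows "pd i (%x. \<phi> x + \<psi> x) x = pd i \<phi> x + pd i \<psi> x" using partial_deriv_has_derivative[OF has_derivative_add[OF
   assms[unfolded frechet_derivative_works]]] by (simp add: partial_deriv_def)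

lemma Ck_Suc_imp: "Ck (Suc k) \<phi> ==> Ck k \<phi>"
proof (induction k arbitrary: \<phi>)
 case 0
 thus ?case by (auto intro!: continuous_at_imp_continuous_on differentiable_imp_continuous_within)
next
 case (Suc k)
 thus ?case by (metis Ck.simps(2))
qed

lemma Ck_const: "Ck k (%_::real^'n::finite. c)"
proof (induction k arbitrary: c)
 case (Suc k)
 have "pd i (%_::real^'n. c) = (%_. 0)" for i using partial_deriv_has_derivative[OF has_derivative_const] by auto
 with Suc show ?case by auto
qed auto

lemma Ck_coord: "Ck k (%x::real^'n::finite. x $ j)"
proof (cases k)
 case (Suc k')
 have *: "((%x. x $ j) has_derivative (%x. x $ j)) (at x)" for x :: "real^'n"

  by (rule bounded_linear_imp_has_derivative[OF bounded_linear_vec_nth])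
 have "pd i (%x::real^'n. x $ j) = (%_. axis i 1 $ j)" for i :: 'n using partial_deriv_has_derivative[OF *] by auto
 thus ?thesis using * by (auto simp: Suc Ck_const differentiable_def)
qed (auto intro: continuous_intros)

lemma Ck_add: "Ck k \<phi> ==> Ck k \<psi> ==> Ck k (%x. \<phi> x + \<psi> x)"
proof (induction k arbitrary: \<phi> \<psi>)
 case 0
 thus ?case by (auto intro: continuous_intros)
next
 case (Suc k)
 hence "pd i (%x. \<phi> x + \<psi> x) = (%x. pd i \<phi> x + pd i \<psi> x)" for i by (auto simp: partial_deriv_add)
 with Suc show ?case by auto
qed

lemma Ck_mult: "Ck k \<phi> ==> Ck k \<psi> ==> Ck k (%x. \<phi> x * \<psi> x)"
proof (induction k arbitrary: \<phi> \<psi>)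
 case 0
 thus ?case by (auto intro: continuous_intros)
next
 case (Suc k)
 hence "pd i (%x. \<phi> x * \<psi> x)
   = (%x. \<phi> x * pd i \<psi> x + pd i \<phi> x * \<psi> x)" for i by (auto simp: partial_deriv_mult)
 moreover have "Ck k (%x. \<phi> x * pd i \<psi> x + pd i \<phi> x * \<psi> x)" for i
  using Suc by (intro Ck_add Suc.IH Ck_Suc_imp[of k \<phi>] Ck_Suc_imp[of k \<psi>]) auto
 ultimately show ?case using Suc.prems by auto
qed

lemma Ck_compose: "smooth1 f ==> Ck k \<phi> ==> Ck k (%x. f (\<phi> x))"
proof (induction k arbitrary: f \<phi>)
 case 0
 thus ?case by (auto intro: continuous_on_compose2[OF smooth1_continuous[of f UNIV]])
next
 case (Suc k)
 obtain f' where f': "!!x. (f has_real_derivative f' x) (at x)" "smooth1 f'" using smooth1_derivE[OF \<open>smooth1 f\<close>] by blast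
 have d: "\<phi> differentiable (at x)" for x using Suc.prems by auto
 have "pd i (%x. f (\<phi> x)) = (%x. f' (\<phi> x) * pd i \<phi> x)" for i using partial_deriv_compose(2)[OF f'(1) d] by auto
 moreover have "Ck k (%x. f' (\<phi> x) * pd i \<phi> x)" for i
  by (rule Ck_mult[OF Suc.IH[OF f'(2) Ck_Suc_imp[OF Suc.prems(2)]]]) (use Suc.prems in auto)
 ultimately show ?case using partial_deriv_compose(1)[OF f'(1) d] by auto
qed

lemma Ck_sum: "finite I ==> (!!i. i \<in> I ==> Ck k (\<phi> i)) ==> Ck k (%x. \<Sum>i\<in>I. \<phi> i x)"
 by (induction I rule: finite_induct) (auto simp: Ck_const Ck_add)

lemma Ck_prod: "finite I ==> (!!i. i \<in> I ==> Ck k (\<phi> i)) ==> Ck k (%x. \<Prod>i\<in>I. \<phi> i x)"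
 by (induction I rule: finite_induct) (auto simp: Ck_const Ck_mult)

lemma Ck_norm_sq: "Ck k (%x::real^'n::finite. (norm x)\<^sup>2)"
proof -
 have "(%x::real^'n. (norm x)\<^sup>2) = (%x. \<Sum>i\<in>UNIV. x $ i * x $ i)" by (simp add: power2_norm_eq_inner inner_vec_def)
 thus ?thesis by (auto intro!: Ck_sum Ck_mult Ck_coord)
qed

lemma partial_deriv_norm_sq: "pd i (%x::real^'n::finite. (norm x)\<^sup>2) x = 2 * x $ i"
proof -
 have "((%x::real^'n. (norm x)\<^sup>2) has_derivative (%h. 2 * (x \<bullet> h))) (at x)"
  unfolding power2_norm_eq_inner by (auto intro!: derivative_eq_intros simp: inner_commute)
 thus ?thesis by (simp add: partial_deriv_has_derivative inner_axis)
qed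

lemma test_funs_Ck: "\<phi> \<in> test_funs \<Omega> ==> Ck k \<phi>"
 by (auto simp: test_funs_def)

lemma test_funs_diff: "\<phi> \<in> test_funs \<Omega> ==> \<phi> differentiable (at x)"
 using test_funs_Ck[of \<phi> \<Omega> "Suc 0"] by simp

lemma test_funs_continuous: "\<phi> \<in> test_funs \<Omega> ==> continuous_on S \<phi>"
 using test_funs_Ck[of \<phi> \<Omega> 0] by (simp add: continuous_on_subset[OF _ subset_UNIV])

lemma test_funs_outside: "\<phi> \<in> test_funs \<Omega> ==> x \<notin> \<Omega> ==> \<phi> x = 0"
 using closure_subset[of "{x. \<phi> x \<noteq> 0}"] unfolding test_funs_def by blast

lemma test_funs_support_mono:
 assumes "\<phi> \<in> test_funs \<Omega>" "!!k. Ck k \<psi>" "!!x. \<phi> x = 0 ==> \<psi> x = 0"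
 shows "\<psi> \<in> test_funs \<Omega>"
proof -
 have *: "closure {x. \<psi> x \<noteq> 0} \<subseteq> closure {x. \<phi> x \<noteq> 0}" using assms(3) by (intro closure_mono) blast
 have "bounded (closure {x. \<phi> x \<noteq> 0})" using assms(1) by (auto simp: test_funs_def intro: compact_imp_bounded)
 hence "compact (closure {x. \<psi> x \<noteq> 0})" using bounded_subset[OF _ *] by (simp add: compact_eq_bounded_closed)
 thus ?thesis using assms(1,2) * unfolding test_funs_def by blast
qed

lemma test_funs_compose:
 assumes "\<phi> \<in> test_funs \<Omega>" "smooth1 \<eta>" "\<eta> 0 = 0"
 shows "(%x. \<eta> (\<phi> x)) \<in> test_funs \<Omega>" by (rule test_funs_support_mono[OF assms(1)])
  (use assms in \<open>auto intro: Ck_compose test_funs_Ck\<close>)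

section \<open>Translations and integration by parts\<close>

text \<open>Stated with upper bounds A and B in place of the integrals, so that finiteness and the
  estimate come from one application. Young's inequality is applied after normalizing by A^(1/p) and
  B^(1/q); vanishing A or B is treated apart because the normalization divides by them.\<close>

lemma nn_Holder:
 fixes f g :: "'a => real"
 assumes [measurable]: "f \<in> BM M" "g \<in> BM M"
  and pq: "p > 1" "q > 1" "1/p + 1/q = 1" and "A \<ge> 0" "B \<ge> 0"
  and A: "(\<integral>\<^sup>+x. ennreal ( |(f x)| powr p) \<partial>M) \<le> ennreal A"
  and B: "(\<integral>\<^sup>+x. ennreal ( |(g x)| powr q) \<partial>M) \<le> ennreal B"
 shows "(\<integral>\<^sup>+x. ennreal |(f x * g x)| \<partial>M) \<le> ennreal (A powr (1/p) * B powr (1/q))"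
proof (cases "A = 0 \<or> B = 0")
 case True
 have "AE x in M. f x * g x = 0"
 proof -
  have "AE x in M. f x = 0 \<or> g x = 0"
  proof (cases "A = 0")
   case True
   with A have "(\<integral>\<^sup>+x. ennreal ( |(f x)| powr p) \<partial>M) = 0" by simp
   hence "AE x in M. ennreal ( |(f x)| powr p) = 0" by (subst (asm) nn_integral_0_iff_AE) auto
   thus ?thesis by (auto simp: ennreal_eq_0_iff)
  next
   case False
   with True B have "(\<integral>\<^sup>+x. ennreal ( |(g x)| powr q) \<partial>M) = 0" by simp
   hence "AE x in M. ennreal ( |(g x)| powr q) = 0" by (subst (asm) nn_integral_0_iff_AE) auto
   thus ?thesis by (auto simp: ennreal_eq_0_iff)
  qed
  thus ?thesis by auto
 qed
 hence "AE x in M. ennreal |(f x * g x)| = 0" by auto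
 hence "(\<integral>\<^sup>+x. ennreal |(f x * g x)| \<partial>M) = (\<integral>\<^sup>+x. 0 \<partial>M)" by (rule nn_integral_cong_AE)
 thus ?thesis by simp
next
 case False
 hence AB: "A > 0" "B > 0" using assms by auto
 define a b where "a = A powr (1/p)" and "b = B powr (1/q)"
 have ab: "a > 0" "b > 0" "a powr p = A" "b powr q = B" using AB pq by (auto simp: a_def b_def powr_powr)
 have le: "ennreal |(f x * g x)| \<le> ennreal (a * b / (p * A)) * ennreal ( |(f x)| powr p)
   + ennreal (a * b / (q * B)) * ennreal ( |(g x)| powr q)" for x
 proof -
  have "( |(f x)| / a) * ( |(g x)| / b) \<le> ( |(f x)| / a) powr p / p + ( |(g x)| / b) powr q / q" using ab pq by (intro Youngs_inequality) auto
  also have "\<dots> = |(f x)| powr p / (p * A) + |(g x)| powr q / (q * B)" using ab by (simp add: powr_divide mult.commute)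
  finally have "a * b * (( |(f x)| / a) * ( |(g x)| / b)) \<le> a * b * ( |(f x)| powr p / (p * A) + |(g x)| powr q / (q * B))"
   using ab by (intro mult_left_mono) auto
  also have "a * b * (( |(f x)| / a) * ( |(g x)| / b)) = |(f x * g x)|" using ab by (simp add: abs_mult)
  finally have "|(f x * g x)| \<le> a * b / (p * A) * |(f x)| powr p + a * b / (q * B) * |(g x)| powr q" by (simp add: algebra_simps)
  thus ?thesis using ab AB pq by (simp flip: ennreal_mult' ennreal_plus)
 qed
 have "(\<integral>\<^sup>+x. ennreal |(f x * g x)| \<partial>M)
   \<le> (\<integral>\<^sup>+x. ennreal (a * b / (p * A)) * ennreal ( |(f x)| powr p)
     + ennreal (a * b / (q * B)) * ennreal ( |(g x)| powr q) \<partial>M)" by (intro nn_integral_mono le)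
 also have "\<dots> = ennreal (a * b / (p * A)) * (\<integral>\<^sup>+x. ennreal ( |(f x)| powr p) \<partial>M)
    + ennreal (a * b / (q * B)) * (\<integral>\<^sup>+x. ennreal ( |(g x)| powr q) \<partial>M)" by (simp add: nn_integral_add nn_integral_cmult)
 also have "\<dots> \<le> ennreal (a * b / (p * A)) * ennreal A + ennreal (a * b / (q * B)) * ennreal B" by (intro add_mono mult_left_mono A B) auto
 also have "\<dots> = ennreal (a * b / (p * A) * A + a * b / (q * B) * B)" using ab AB pq by (simp flip: ennreal_mult' ennreal_plus)
 also have "a * b / (p * A) * A + a * b / (q * B) * B = a * b * (1/p + 1/q)" using AB by (simp add: field_simps)
 finally show ?thesis using pq by (simp add: a_def b_def)
qed

lemma lborel_translation_nn:
 fixes f :: "'a::euclidean_space => ennreal"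
 assumes "f \<in> BM borel"
 shows "(NN x. f (x + c)) = (NN x. f x)"
proof -
 have "(NN x. f x) = (\<integral>\<^sup>+x. f x \<partial>distr lborel borel ((+) c))" by (simp add: lborel_distr_plus)
 also have "\<dots> = (NN x. f (c + x))" using assms by (subst nn_integral_distr) auto
 finally show ?thesis by (simp add: add.commute)
qed

lemma lborel_translation_integral:
 fixes f :: "'a::euclidean_space => real"
 assumes "f \<in> BM borel"
 shows "(LBINT x. f (x + c)) = (LBINT x. f x)"
proof -
 have "(LBINT x. f x) = (LINT x|distr lborel borel ((+) c). f x)" by (simp add: lborel_distr_plus)
 also have "\<dots> = (LBINT x. f (c + x))" using assms by (subst integral_distr) auto
 finally show ?thesis by (simp add: add.commute)
qed

lemma lborel_translation_integrable:
 fixes f :: "'a::euclidean_space => real"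
 assumes "integrable lborel f"
 shows "integrable lborel (%x. f (x + c))"
proof -
 have "integrable (distr lborel borel ((+) c)) f" using assms by (simp add: lborel_distr_plus)
 hence "integrable lborel (%x. f (c + x))" using borel_measurable_integrable[OF assms] by (subst (asm) integrable_distr_eq) auto
 thus ?thesis by (simp add: add.commute)
qed

definition C1 :: "(real^'n::finite => real) => bool" where
 "C1 \<phi> \<longleftrightarrow> Ck (Suc 0) \<phi>"

lemma C1_diff: "C1 \<phi> ==> \<phi> differentiable (at x)"
 and C1_pd: "C1 \<phi> ==> continuous_on UNIV (pd i \<phi>)" by (auto simp: C1_def)

lemma C1_cont: "C1 \<phi> ==> continuous_on UNIV \<phi>"
 using Ck_Suc_imp[of 0 \<phi>] by (simp add: C1_def)

lemma C1_borel [measurable_dest]: "C1 \<phi> ==> \<phi> \<in> BM borel"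
 by (simp add: C1_cont borel_measurable_continuous_onI)

lemma C1_pd_borel [measurable_dest]: "C1 \<phi> ==> pd i \<phi> \<in> BM borel"
 by (simp add: C1_pd borel_measurable_continuous_onI)

lemma test_funs_C1: "\<phi> \<in> test_funs \<Omega> ==> C1 \<phi>"
 unfolding C1_def by (rule test_funs_Ck)

lemma C1_mult: "C1 \<phi> ==> C1 \<psi> ==> C1 (%x. \<phi> x * \<psi> x)"
 unfolding C1_def by (rule Ck_mult)

lemma gradient_inner: "gradient \<phi> x \<bullet> y = (\<Sum>i\<in>UNIV. pd i \<phi> x * y $ i)"
 by (simp add: gradient_def inner_vec_def)

lemma frechet_derivative_gradient:
 assumes "\<phi> differentiable (at x)"
 shows "frechet_derivative \<phi> (at x) y = gradient \<phi> x \<bullet> y"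
proof -
 have l: "linear (frechet_derivative \<phi> (at x))" using assms by (simp add: linear_frechet_derivative)
 have "frechet_derivative \<phi> (at x) y = frechet_derivative \<phi> (at x) (\<Sum>i\<in>UNIV. y $ i *\<^sub>R axis i 1)"
  using basis_expansion[of y] by (simp add: vector_scalar_mult_def scaleR_vec_def)
 also have "\<dots> = (\<Sum>i\<in>UNIV. y $ i * pd i \<phi> x)" by (simp add: linear_sum[OF l] linear_cmul[OF l] partial_deriv_def)
 finally show ?thesis by (simp add: gradient_inner mult.commute)
qed

lemma C1_line_deriv:
 assumes "C1 \<phi>"
 shows "((%\<tau>. \<phi> (x + \<tau> *\<^sub>R y)) has_real_derivative gradient \<phi> (x + \<tau> *\<^sub>R y) \<bullet> y) (at \<tau>)"
proof -
 have 1: "((%\<tau>. x + \<tau> *\<^sub>R y) has_derivative (%h. h *\<^sub>R y)) (at \<tau>)" by (auto intro!: derivative_eq_intros)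
 have 2: "(\<phi> has_derivative frechet_derivative \<phi> (at (x + \<tau> *\<^sub>R y))) (at (x + \<tau> *\<^sub>R y))"
  using C1_diff[OF assms] by (simp add: frechet_derivative_works)
 have "((%\<tau>. \<phi> (x + \<tau> *\<^sub>R y)) has_derivative (%h. frechet_derivative \<phi> (at (x + \<tau> *\<^sub>R y)) (h *\<^sub>R y))) (at \<tau>)"
  using has_derivative_compose[OF 1 2] .
 thus ?thesis unfolding has_field_derivative_def by (rule has_derivative_eq_rhs) (auto simp: frechet_derivative_gradient C1_diff[OF assms])
qed

lemma C1_grad_cont:
 assumes "C1 \<phi>" "continuous_on S f"
 shows "continuous_on S (%z. gradient \<phi> (f z) \<bullet> y)"
proof -
 have "continuous_on S (%z. pd i \<phi> (f z))" for i using continuous_on_compose2[OF C1_pd[OF assms(1)] assms(2) subset_UNIV] .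
 thus ?thesis unfolding gradient_inner by (intro continuous_on_sum continuous_on_mult_right)
qed

lemma C1_increment_integral:
 assumes "C1 \<phi>"
 shows "integrable lborel (%\<tau>. gradient \<phi> (x + \<tau> *\<^sub>R y) \<bullet> y * ind {0..1} \<tau>)"
  "(LBINT \<tau>. gradient \<phi> (x + \<tau> *\<^sub>R y) \<bullet> y * ind {0..1} \<tau>) = \<phi> (x + y) - \<phi> x"
proof -
 have cc: "isCont (%\<tau>. gradient \<phi> (x + \<tau> *\<^sub>R y) \<bullet> y) \<tau>" for \<tau> :: real
  using C1_grad_cont[OF assms, of UNIV "%\<tau>. x + \<tau> *\<^sub>R y" y] by (simp add: continuous_on_eq_continuous_at continuous_intros)
 have "has_bochner_integral lborel (%\<tau>. gradient \<phi> (x + \<tau> *\<^sub>R y) \<bullet> y * ind {0..1} \<tau>)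
  (\<phi> (x + 1 *\<^sub>R y) - \<phi> (x + 0 *\<^sub>R y))"
  by (rule has_bochner_integral_FTC_Icc_real[where F = "%\<tau>. \<phi> (x + \<tau> *\<^sub>R y)"])
   (auto intro!: C1_line_deriv[OF assms] cc)
 thus "integrable lborel (%\<tau>. gradient \<phi> (x + \<tau> *\<^sub>R y) \<bullet> y * ind {0..1} \<tau>)"
  "(LBINT \<tau>. gradient \<phi> (x + \<tau> *\<^sub>R y) \<bullet> y * ind {0..1} \<tau>) = \<phi> (x + y) - \<phi> x"
  by (auto simp: has_bochner_integral_iff)
qed

text \<open>Jensen's inequality on the segment from x to x + y: the increment is the mean of the
  directional derivative, and Hoelder's inequality against the indicator of [0,1] moves the power
  inside.\<close>

lemma C1_increment_le:
 assumes "C1 \<phi>" "p \<ge> 1"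
 shows "ennreal ( |(\<phi> (x + y) - \<phi> x)| powr p)
  \<le> (NN \<tau>. ennreal ( |(gradient \<phi> (x + \<tau> *\<^sub>R y) \<bullet> y)| powr p) * ind {0..1} \<tau>)"
proof -
 define g where "g \<tau> = gradient \<phi> (x + \<tau> *\<^sub>R y) \<bullet> y" for \<tau>
 have [measurable]: "g \<in> BM borel" unfolding g_def by (intro borel_measurable_continuous_onI C1_grad_cont assms continuous_intros)
 have "ennreal (norm (\<phi> (x + y) - \<phi> x)) \<le> (NN \<tau>. norm (g \<tau> * ind {0..1} \<tau>))"
  unfolding C1_increment_integral(2)[OF assms(1), symmetric] g_def by (rule integral_norm_bound_ennreal[OF C1_increment_integral(1)[OF assms(1)]])
 hence 1: "ennreal |(\<phi> (x + y) - \<phi> x)| \<le> (NN \<tau>. ennreal |(g \<tau> * ind {0..1} \<tau>)|)" by simp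
 have ind: "ennreal ( |(g \<tau> * ind {0..1} \<tau>)| powr p) = ennreal ( |(g \<tau>)| powr p) * ind {0..1} \<tau>" for \<tau>
  using assms(2) by (auto simp: indicator_def)
 show ?thesis
 proof (cases "p = 1")
  case True
  with 1 ind show ?thesis by (simp add: g_def)
 next
  case False
  hence p: "p > 1" using assms by simp
  define q where "q = p / (p - 1)"
  have q: "q > 1" "1/p + 1/q = 1" using p by (auto simp: q_def field_simps)
  define I where "I = (NN \<tau>. ennreal ( |(g \<tau> * ind {0..1} \<tau>)| powr p))"
  show ?thesis
  proof (cases "I = \<infinity>")
   case True
   thus ?thesis using ind by (simp add: I_def g_def)
  next
   case False
   then obtain A where A: "I = ennreal A" "A \<ge> 0" by (cases I) auto
   have "(NN \<tau>. ennreal |(g \<tau> * ind {0..1} \<tau> * ind {0..1} \<tau>)|)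
     \<le> ennreal (A powr (1/p) * 1 powr (1/q))"
   proof (rule nn_Holder[OF _ _ p q])
    have e: "ennreal ( |(indicat_real {0..1} \<tau>)| powr q) = ind {0..1} \<tau>" for \<tau> :: real using q by (auto simp: indicator_def)
    show "(NN \<tau>. ennreal ( |(indicat_real {0..1::real} \<tau>)| powr q)) \<le> ennreal 1" unfolding e by simp
   qed (use A in \<open>auto simp: I_def\<close>)
   also have "(%\<tau>. ennreal |(g \<tau> * ind {0..1} \<tau> * ind {0..1} \<tau>)|) = (%\<tau>. ennreal |(g \<tau> * ind {0..1} \<tau>)|)"
    by (auto simp: indicator_def)
   finally have "ennreal |(\<phi> (x + y) - \<phi> x)| \<le> ennreal (A powr (1/p) * 1 powr (1/q))" by (rule order_trans[OF 1])
   hence "|(\<phi> (x + y) - \<phi> x)| \<le> A powr (1/p)" by (subst (asm) ennreal_le_iff) auto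
   hence "|(\<phi> (x + y) - \<phi> x)| powr p \<le> (A powr (1/p)) powr p" using p by (intro powr_mono2) linarith+
   also have "\<dots> = A" using p A by (simp add: powr_powr)
   finally have "ennreal ( |(\<phi> (x + y) - \<phi> x)| powr p) \<le> I" using A by simp
   thus ?thesis using ind by (simp add: I_def g_def)
  qed
 qed
qed

text \<open>After integration over x, Tonelli's theorem and translation invariance make the integral
  independent of the position on the segment.\<close>

lemma translation_Lp:
 assumes "C1 \<phi>" "p \<ge> 1"
 shows "(NN x. ennreal ( |(\<phi> (x + y) - \<phi> x)| powr p))
  \<le> (NN x. ennreal ( |(gradient \<phi> x \<bullet> y)| powr p))"
proof -
 define G where "G z = ennreal ( |(gradient \<phi> z \<bullet> y)| powr p)" for z
 have c: "continuous_on UNIV (%z. gradient \<phi> z \<bullet> y)" by (intro C1_grad_cont assms continuous_intros)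
 hence [measurable]: "(%z. gradient \<phi> z \<bullet> y) \<in> BM borel" by (rule borel_measurable_continuous_onI)
 have [measurable]: "G \<in> BM borel" unfolding G_def by measurable
 have "(NN x. ennreal ( |(\<phi> (x + y) - \<phi> x)| powr p))
   \<le> (NN x. (NN \<tau>. G (x + \<tau> *\<^sub>R y) * ind {0..1} \<tau>))" unfolding G_def by (intro nn_integral_mono C1_increment_le assms)
 also have "\<dots> = (NN \<tau>. (NN x. G (x + \<tau> *\<^sub>R y) * ind {0..1} \<tau>))" by (rule lborel_pair.Fubini'[symmetric]) measurable
 also have "\<dots> = (NN \<tau>. (NN x. G x) * ind {0..1::real} \<tau>)" by (simp add: nn_integral_multc lborel_translation_nn)
 also have "\<dots> = (NN x. G x)" by (simp add: nn_integral_cmult)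
 finally show ?thesis by (simp add: G_def)
qed

lemma translation_L1:
 assumes "C1 \<phi>"
 shows "(NN x. ennreal |(\<phi> (x + y) - \<phi> x)|)
  \<le> (\<Sum>i\<in>UNIV. ennreal |(y $ i)| * (NN x. ennreal |(pd i \<phi> x)|))"
proof -
 note [measurable] = C1_pd_borel[OF assms]
 have "(NN x. ennreal |(\<phi> (x + y) - \<phi> x)|) \<le> (NN x. ennreal |(gradient \<phi> x \<bullet> y)|)"
  using translation_Lp[OF assms, of 1 y] by simp
 also have "\<dots> \<le> (NN x. (\<Sum>i\<in>UNIV. ennreal |(y $ i)| * ennreal |(pd i \<phi> x)|))"
 proof (intro nn_integral_mono)
  fix x
  have "|(gradient \<phi> x \<bullet> y)| \<le> (\<Sum>i\<in>UNIV. |(y $ i)| * |(pd i \<phi> x)|)"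
   unfolding gradient_inner by (rule order_trans[OF sum_abs]) (simp add: abs_mult mult.commute)
  thus "ennreal |(gradient \<phi> x \<bullet> y)| \<le> (\<Sum>i\<in>UNIV. ennreal |(y $ i)| * ennreal |(pd i \<phi> x)|)"
   by (simp add: sum_nonneg flip: ennreal_mult')
 qed
 also have "\<dots> = (\<Sum>i\<in>UNIV. ennreal |(y $ i)| * (NN x. ennreal |(pd i \<phi> x)|))" by (simp add: nn_integral_sum nn_integral_cmult)
 finally show ?thesis .
qed

text \<open>The shift by L along an axis leaves \<Omega>, so on \<Omega> the increment is just
  -\<phi>(x). The translation bound is therefore already a Poincare inequality.\<close>

lemma Poincare:
 assumes "\<phi> \<in> test_funs \<Omega>" "p \<ge> 1" "L \<ge> 0" and L: "!!x. x \<in> \<Omega> ==> x + axis i L \<notin> \<Omega>"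
 shows "(NN x. ennreal ( |(\<phi> x)| powr p))
  \<le> ennreal (L powr p) * (NN x. ennreal ( |(pd i \<phi> x)| powr p))"
proof -
 have C: "C1 \<phi>" using assms(1) by (rule test_funs_C1)
 note [measurable] = C1_pd_borel[OF C]
 have g: "|(gradient \<phi> x \<bullet> axis i L)| powr p = L powr p * |(pd i \<phi> x)| powr p" for x
  using assms by (simp add: inner_axis gradient_def abs_mult powr_mult mult.commute)
 have "(NN x. ennreal ( |(\<phi> x)| powr p)) \<le> (NN x. ennreal ( |(\<phi> (x + axis i L) - \<phi> x)| powr p))"
 proof (intro nn_integral_mono)
  fix x
  show "ennreal ( |(\<phi> x)| powr p) \<le> ennreal ( |(\<phi> (x + axis i L) - \<phi> x)| powr p)"
  proof (cases "x \<in> \<Omega>")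
   case True
   hence "\<phi> (x + axis i L) = 0" using test_funs_outside[OF assms(1) L] by simp
   thus ?thesis by simp
  next
   case False
   hence "\<phi> x = 0" using test_funs_outside[OF assms(1)] by simp
   thus ?thesis by simp
  qed
 qed
 also have "\<dots> \<le> (NN x. ennreal ( |(gradient \<phi> x \<bullet> axis i L)| powr p))" by (intro translation_Lp C assms)
 also have "\<dots> = ennreal (L powr p) * (NN x. ennreal ( |(pd i \<phi> x)| powr p))" by (simp add: g ennreal_mult' nn_integral_cmult)
 finally show ?thesis .
qed

lemma norm_axis_eq: "norm (axis i c :: real^'n::finite) = |(c)|"
 by (simp add: norm_eq_sqrt_inner inner_axis_axis)

lemma bounded_shift_outside:
 assumes "bounded (\<Omega> :: (real^'n::finite) set)"
 obtains L where "L > 0" "!!x i. x \<in> \<Omega> ==> x + axis i L \<notin> \<Omega>"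
proof -
 obtain B where B: "B > 0" "!!x. x \<in> \<Omega> ==> norm x \<le> B" using assms bounded_pos by blast
 have False if "x \<in> \<Omega>" "x + axis i (2 * B + 1) \<in> \<Omega>" for x and i :: 'n
 proof -
  have "norm (axis i (2 * B + 1) :: real^'n) \<le> norm (x + axis i (2 * B + 1)) + norm x" by (metis add_diff_cancel_left' norm_triangle_ineq4)
  with B that show False by (smt (verit) norm_axis_eq real_norm_def)
 qed
 thus ?thesis using B that[of "2 * B + 1"] by (auto simp: add_pos_pos)
qed

lemma partial_deriv_outside_support:
 assumes "x \<notin> closure {x. \<phi> x \<noteq> 0}"
 shows "pd i \<phi> x = 0"
proof -
 have "((%_. 0) has_derivative (%_. 0)) (at x)" by simp
 hence "(\<phi> has_derivative (%_. 0)) (at x)" by (rule has_derivative_transform_within_open[where s = "- closure {x. \<phi> x \<noteq> 0}"])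
   (use assms closure_subset[of "{x. \<phi> x \<noteq> 0}"] in auto)
 thus ?thesis by (simp add: partial_deriv_has_derivative)
qed

lemma continuous_compact_support_integrable:
 fixes f :: "'a::euclidean_space => real"
 assumes "continuous_on UNIV f" "compact K" "!!x. x \<notin> K ==> f x = 0"
 shows "integrable lborel f"
proof -
 have "integrable lborel (%x. ind K x *\<^sub>R f x)" using assms(1,2) by (intro borel_integrable_compact) (auto intro: continuous_on_subset)
 also have "(%x. ind K x *\<^sub>R f x) = f" using assms(3) by (fastforce simp: indicator_def)
 finally show ?thesis .
qed

text \<open>The difference quotients have vanishing integrals.\<close>

lemma integral_partial_deriv:
 fixes \<zeta> :: "real^'n::finite => real"
 assumes "C1 \<zeta>" "compact K" "!!x. x \<notin> K ==> \<zeta> x = 0"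
 shows "(LBINT x. pd i \<zeta> x) = 0"
proof -
 have sub: "closure {x. \<zeta> x \<noteq> 0} \<subseteq> K" using assms(2,3) by (intro closure_minimal compact_imp_closed) auto
 hence pd0: "pd i \<zeta> x = 0" if "x \<notin> K" for x using that partial_deriv_outside_support by blast
 obtain B where B: "!!x. |(pd i \<zeta> x)| \<le> B"
 proof -
  have "bounded (pd i \<zeta> ` K)" using C1_pd[OF assms(1), of i] assms(2)
   by (intro compact_imp_bounded compact_continuous_image) (auto intro: continuous_on_subset)
  then obtain B where "B > 0" "!!x. x \<in> K ==> |(pd i \<zeta> x)| \<le> B" by (auto simp: bounded_pos)
  hence "|(pd i \<zeta> x)| \<le> B" for x using pd0[of x] by (cases "x \<in> K") auto
  thus ?thesis by (rule that)
 qed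
 have B0: "B \<ge> 0" using B[of 0] by linarith
 obtain R where R: "!!x. x \<in> K ==> norm x \<le> R" using assms(2) compact_imp_bounded bounded_iff by metis
 define h where "h n = inverse (real (Suc n))" for n
 have h: "0 < h n" "h n \<le> 1" for n by (auto simp: h_def field_simps)
 have inner: "gradient \<zeta> z \<bullet> axis i c = c * pd i \<zeta> z" for z c by (simp add: inner_axis gradient_def)
 have inc: "|(\<zeta> (x + axis i (h n)) - \<zeta> x)| \<le> B * h n" for x n
 proof -
  have "ennreal |(\<zeta> (x + axis i (h n)) - \<zeta> x)|
   \<le> (NN \<tau>. ennreal |(gradient \<zeta> (x + \<tau> *\<^sub>R axis i (h n)) \<bullet> axis i (h n))| * ind {0..1} \<tau>)"
   using C1_increment_le[OF assms(1), of 1 x "axis i (h n)"] by simp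
  also have "\<dots> \<le> (NN \<tau>. ennreal (B * h n) * ind {0..1::real} \<tau>)" using B h(1)[of n] unfolding inner
   by (intro nn_integral_mono mult_right_mono ennreal_leI)
    (auto simp: abs_mult mult.commute intro!: mult_right_mono)
  also have "\<dots> = ennreal (B * h n)" by (simp add: nn_integral_cmult)
  finally show ?thesis using B0 h(1)[of n] by (simp add: ennreal_le_iff)
 qed
 define q where "q n x = (\<zeta> (x + axis i (h n)) - \<zeta> x) / h n" for n x
 have [measurable]: "\<zeta> \<in> BM borel" "pd i \<zeta> \<in> BM borel" using assms(1) by (auto intro: C1_borel C1_pd_borel)
 have intz: "integrable lborel \<zeta>" using continuous_compact_support_integrable[OF C1_cont[OF assms(1)] assms(2,3)] .
 have intz': "integrable lborel (%x. \<zeta> (x + c))" for c using intz by (rule lborel_translation_integrable)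
 have "(%n. LBINT x. q n x) \<leadsto> (LBINT x. pd i \<zeta> x)"
 proof (rule integral_dominated_convergence[where s = q and f = "pd i \<zeta>" and w = "%x. B * ind (cball 0 (R + 1)) x"])
  show "AE x in lborel. (%n. q n x) \<leadsto> pd i \<zeta> x"
  proof (rule AE_I2)
   fix x
   have "((%\<tau>. \<zeta> (x + \<tau> *\<^sub>R axis i 1)) has_real_derivative gradient \<zeta> (x + 0 *\<^sub>R axis i 1) \<bullet> axis i 1) (at 0)"
    by (rule C1_line_deriv[OF assms(1)])
   hence "((%d. (\<zeta> (x + d *\<^sub>R axis i 1) - \<zeta> x) / d) \<longlongrightarrow> pd i \<zeta> x) (at 0)" by (simp add: DERIV_def inner)
   moreover have "filterlim h (at 0) sequentially" unfolding h_def by real_asymp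
   ultimately have "(%n. (\<zeta> (x + h n *\<^sub>R axis i 1) - \<zeta> x) / h n) \<leadsto> pd i \<zeta> x" by (rule filterlim_compose)
   moreover have "c *\<^sub>R axis i 1 = (axis i c :: real^'n)" for c by (simp add: vec_eq_iff axis_def)
   ultimately show "(%n. q n x) \<leadsto> pd i \<zeta> x" by (simp add: q_def)
  qed
  show "AE x in lborel. norm (q n x) \<le> B * ind (cball 0 (R + 1)) x" for n
  proof (rule AE_I2)
   fix x
   show "norm (q n x) \<le> B * ind (cball 0 (R + 1)) x"
   proof (cases "norm x \<le> R + 1")
    case True
    thus ?thesis using inc[of x n] h(1)[of n] by (simp add: q_def field_simps)
   next
    case False
    have "norm x \<le> norm (x + axis i (h n)) + norm (axis i (h n) :: real^'n)" by (metis add_diff_cancel_right' norm_triangle_ineq4)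
    moreover have "norm (axis i (h n) :: real^'n) \<le> 1" using h[of n] by (simp add: norm_axis_eq)
    ultimately have "x \<notin> K" "x + axis i (h n) \<notin> K" using False R by fastforce+
    thus ?thesis using assms(3) False by (simp add: q_def)
   qed
  qed
  show "integrable lborel (%x. B * ind (cball 0 (R + 1)) x)"
   by (intro integrable_mult_right integrable_real_indicator) (use emeasure_bounded_finite[OF bounded_cball, of 0 "R + 1"] in auto)
 qed (simp_all add: q_def[abs_def])
 moreover have "(LBINT x. q n x) = 0" for n using intz intz' lborel_translation_integral[of \<zeta> "axis i (h n)"] by (simp add: q_def)
 ultimately show ?thesis by (simp add: LIMSEQ_const_iff)
qed

lemma integration_by_parts:
 assumes "C1 \<phi>" "C1 \<psi>" "compact K" "!!x. x \<notin> K ==> \<phi> x = 0"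
 shows "(LBINT x. \<phi> x * pd i \<psi> x) = - (LBINT x. pd i \<phi> x * \<psi> x)"
proof -
 have pd: "pd i (%x. \<phi> x * \<psi> x) x = \<phi> x * pd i \<psi> x + pd i \<phi> x * \<psi> x" for x
  using assms by (intro partial_deriv_mult C1_diff)
 have sub: "closure {x. \<phi> x \<noteq> 0} \<subseteq> K" using assms(3,4) by (intro closure_minimal compact_imp_closed) auto
 hence pd0: "pd i \<phi> x = 0" if "x \<notin> K" for x using that partial_deriv_outside_support by blast
 have i1: "integrable lborel (%x. \<phi> x * pd i \<psi> x)"
  by (rule continuous_compact_support_integrable[OF continuous_on_mult[OF C1_cont C1_pd] assms(3)])
   (use assms(1,2) in \<open>auto simp: assms(4)\<close>)
 have i2: "integrable lborel (%x. pd i \<phi> x * \<psi> x)"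
  by (rule continuous_compact_support_integrable[OF continuous_on_mult[OF C1_pd C1_cont] assms(3)])
   (use assms(1,2) in \<open>auto simp: pd0\<close>)
 have "(LBINT x. pd i (%x. \<phi> x * \<psi> x) x) = 0" by (rule integral_partial_deriv[OF _ assms(3)]) (auto intro!: C1_mult assms simp: assms(4))
 thus ?thesis unfolding pd using i1 i2 by simp
qed

lemma AE_translation:
 assumes "AE x in lborel. P (x :: 'a::euclidean_space)"
 shows "AE x in lborel. P (x + c)"
proof -
 obtain N where N: "{x. \<not> P x} \<subseteq> N" "N \<in> null_sets lborel" using assms by (auto simp: eventually_ae_filter)
 have "AE x in distr lborel borel ((+) c). x \<notin> N" using AE_not_in[OF N(2)] unfolding lborel_distr_plus .
 hence "AE x in lborel. c + x \<notin> N" using N(2) by (subst (asm) AE_distr_iff) (auto simp: null_sets_def)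
 thus ?thesis using N(1) by (auto simp: add.commute elim!: eventually_mono)
qed

text \<open>Fatou's lemma; a.e. convergence at x + y holds because translations preserve null sets.
  It carries translation bounds from test functions to truncations of Sobolev functions.\<close>

lemma translation_bound_limit:
 fixes w :: "real^'n::finite => real"
 assumes [measurable]: "!!k. W k \<in> BM borel" "w \<in> BM borel"
  and lim: "AE x in lborel. (%k. W k x) \<leadsto> w x"
  and bd: "!!k y. (NN x. ennreal |(W k (x + y) - W k x)|) \<le> ennreal (\<Sum>i\<in>UNIV. |(y $ i)| * B k i)"
  and B: "!!i. (%k. B k i) \<leadsto> b i"
 shows "(NN x. ennreal |(w (x + y) - w x)|) \<le> ennreal (\<Sum>i\<in>UNIV. |(y $ i)| * b i)"
proof -
 have "(NN x. ennreal |(w (x + y) - w x)|)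
   = (NN x. liminf (%k. ennreal |(W k (x + y) - W k x)|))"
 proof (rule nn_integral_cong_AE)
  show "AE x in lborel. ennreal |(w (x + y) - w x)| = liminf (%k. ennreal |(W k (x + y) - W k x)|)" using lim AE_translation[OF lim, of y]
  proof eventually_elim
   case (elim x)
   hence "(%k. ennreal |(W k (x + y) - W k x)|) \<leadsto> ennreal |(w (x + y) - w x)|" by (intro tendsto_ennrealI tendsto_rabs tendsto_diff)
   thus ?case by (rule lim_imp_Liminf[OF sequentially_bot, symmetric])
  qed
 qed
 also have "\<dots> \<le> liminf (%k. NN x. ennreal |(W k (x + y) - W k x)|)" by (rule nn_integral_liminf) measurable
 also have "\<dots> \<le> liminf (%k. ennreal (\<Sum>i\<in>UNIV. |(y $ i)| * B k i))" by (intro Liminf_mono always_eventually allI bd)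
 also have "\<dots> = ennreal (\<Sum>i\<in>UNIV. |(y $ i)| * b i)" by (intro lim_imp_Liminf tendsto_ennrealI tendsto_sum tendsto_mult_left B) auto
 finally show ?thesis .
qed

text \<open>Averaging the translation bound over a box whose volume is twice that of the support
 replaces the isoperimetric inequality: the translates of the support meet \<open>E\<close> in at most half
 of the box on average.\<close>

lemma box_isoperimetric:
 fixes w :: "real^'n::finite => real"
 assumes [measurable]: "w \<in> BM borel" "E \<in> sets borel" "S \<in> sets borel"
  and w: "!!x. |(w x)| \<le> \<delta>" "!!x. x \<in> E ==> |(w x)| = \<delta>" "!!x. x \<notin> S ==> w x = 0"
  and S: "emeasure lborel S \<le> ennreal \<sigma>" "\<sigma> > 0"
  and E: "ennreal s \<le> emeasure lborel E"
  and tr: "!!y. (NN x. ennreal |(w (x + y) - w x)|) \<le> ennreal (\<Sum>i\<in>UNIV. |(y $ i)| * B i)"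
  and B: "!!i. B i \<ge> 0" and L: "!!i. L i > 0" "(\<Prod>i\<in>UNIV. L i) = 2 * \<sigma>"
 shows "\<delta> * s \<le> 2 * (\<Sum>i\<in>UNIV. L i * B i)"
proof (cases "\<delta> = 0 \<or> s \<le> 0")
 case True
 have d0: "\<delta> \<ge> 0" using w(1)[of 0] by linarith
 moreover have "0 \<le> (\<Sum>i\<in>UNIV. L i * B i)" using B L(1) by (intro sum_nonneg mult_nonneg_nonneg) (auto intro: less_imp_le)
 moreover have "\<delta> * s \<le> 0" using True d0 by (auto intro: mult_nonneg_nonpos)
 ultimately show ?thesis by linarith
next
 case False
 hence \<delta>: "\<delta> > 0" and s: "s > 0" using w(1)[of 0] by auto
 define Q where "Q = cbox 0 (\<chi> i. L i)"
 define T where "T = (\<Sum>i\<in>UNIV. L i * B i)"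
 have T0: "T \<ge> 0" unfolding T_def using B L(1) by (intro sum_nonneg mult_nonneg_nonneg) (auto intro: less_imp_le)
 have [measurable]: "Q \<in> sets borel" by (simp add: Q_def)
 have ne: "Q \<noteq> {}" unfolding Q_def using L(1) by (auto simp: interval_ne_empty_cart intro: less_imp_le)
 have "emeasure lborel Q = ennreal (measure lborel Q)"
  unfolding Q_def by (rule emeasure_eq_ennreal_measure) (use emeasure_bounded_finite[OF bounded_cbox, of 0 "\<chi> i. L i"] in auto)
 also have "measure lborel Q = 2 * \<sigma>" using content_cbox_cart[OF ne[unfolded Q_def]] L(2) by (simp add: Q_def)
 finally have eQ: "emeasure lborel Q = ennreal (2 * \<sigma>)" .
 \<comment> \<open>\<open>I\<close> is estimated in both orders of integration. For fixed y the
   translation bound applies. For fixed x in E, the y in the box with x + y outside S have measure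
   at least \<sigma>, and each of them contributes an increment \<delta>.\<close>
 define I where "I = (NN y. (NN x. ennreal |(w (x + y) - w x)| * ind E x * ind Q y))"
 have "I \<le> (NN y. ennreal T * ind Q y)" unfolding I_def
 proof (intro nn_integral_mono)
  fix y
  show "(NN x. ennreal |(w (x + y) - w x)| * ind E x * ind Q y) \<le> ennreal T * ind Q y"
  proof (cases "y \<in> Q")
   case True
   hence y: "|(y $ i)| \<le> L i" for i by (simp add: Q_def mem_box_cart)
   have "(NN x. ennreal |(w (x + y) - w x)| * ind E x * ind Q y)
     \<le> (NN x. ennreal |(w (x + y) - w x)|)" by (intro nn_integral_mono) (auto simp: indicator_def)
   also have "\<dots> \<le> ennreal (\<Sum>i\<in>UNIV. |(y $ i)| * B i)" by (rule tr)
   also have "\<dots> \<le> ennreal T" unfolding T_def by (intro ennreal_leI sum_mono mult_right_mono y B)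
   finally show ?thesis using True by simp
  qed simp
 qed
 also have "\<dots> = ennreal (T * (2 * \<sigma>))" using T0 by (simp add: nn_integral_cmult eQ ennreal_mult')
 finally have upper: "I \<le> ennreal (T * (2 * \<sigma>))" .
 have low: "ennreal (\<delta> * \<sigma>) \<le> (NN y. ennreal |(w (x + y) - w x)| * ind Q y)" (is "_ \<le> ?J")
  if "x \<in> E" for x
 proof -
  have "ennreal (\<delta> * (2 * \<sigma>)) = (NN y. ennreal \<delta> * ind Q y)" using \<delta> by (simp add: nn_integral_cmult eQ ennreal_mult')
  also have "\<dots> \<le> (NN y. ennreal |(w (x + y) - w x)| * ind Q y + ennreal \<delta> * ind S (y + x))"
  proof (intro nn_integral_mono)
   fix y
   show "ennreal \<delta> * ind Q y \<le> ennreal |(w (x + y) - w x)| * ind Q y + ennreal \<delta> * ind S (y + x)"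
   proof (cases "x + y \<in> S")
    case True
    thus ?thesis by (auto simp: indicator_def add.commute)
   next
    case False
    hence "|(w (x + y) - w x)| = \<delta>" using w(2,3) that by simp
    thus ?thesis by (auto simp: indicator_def)
   qed
  qed
  also have "\<dots> = ?J + (NN y. ennreal \<delta> * ind S (y + x))" by (rule nn_integral_add) measurable
  also have "(NN y. ennreal \<delta> * ind S (y + x)) = (NN y. ennreal \<delta> * ind S y)" by (rule lborel_translation_nn) measurable
  also have "\<dots> = ennreal \<delta> * emeasure lborel S" by (simp add: nn_integral_cmult)
  also have "\<dots> \<le> ennreal \<delta> * ennreal \<sigma>" by (intro mult_left_mono S) simp
  also have "\<dots> = ennreal (\<delta> * \<sigma>)" using \<delta> by (simp add: ennreal_mult')
  finally have *: "ennreal (\<delta> * (2 * \<sigma>)) \<le> ?J + ennreal (\<delta> * \<sigma>)" by (simp add: add_left_mono)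
  show ?thesis
  proof (cases ?J)
   case (real r)
   hence "ennreal (\<delta> * (2 * \<sigma>)) \<le> ennreal (r + \<delta> * \<sigma>)" using * \<delta> S(2) by (simp add: ennreal_plus)
   hence "\<delta> * (2 * \<sigma>) \<le> r + \<delta> * \<sigma>" using real \<delta> S(2) by (subst (asm) ennreal_le_iff) auto
   thus ?thesis unfolding real by (intro ennreal_leI) simp
  qed simp
 qed
 have "ennreal (\<delta> * \<sigma> * s) = ennreal (\<delta> * \<sigma>) * ennreal s" using \<delta> S(2) by (simp add: ennreal_mult')
 also have "\<dots> \<le> ennreal (\<delta> * \<sigma>) * emeasure lborel E" by (intro mult_left_mono E) simp
 also have "\<dots> = (NN x. ennreal (\<delta> * \<sigma>) * ind E x)" by (simp add: nn_integral_cmult)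
 also have "\<dots> \<le> (NN x. (NN y. ennreal |(w (x + y) - w x)| * ind E x * ind Q y))"
  by (intro nn_integral_mono) (use low in \<open>auto simp: indicator_def\<close>)
 also have "\<dots> = I" unfolding I_def by (rule lborel_pair.Fubini') measurable
 also note upper
 finally have "\<delta> * \<sigma> * s \<le> T * (2 * \<sigma>)" using T0 S(2) by (subst (asm) ennreal_le_iff) auto
 thus ?thesis using S(2) by (simp add: T_def field_simps)
qed

section \<open>Borel representatives and the fundamental lemma\<close>

lemma borel_version:
 fixes h :: "'a::euclidean_space => real"
 assumes "h \<in> BM (LB S)" "S \<in> sets borel"
 obtains h' where "h' \<in> BM borel" "!!x. x \<notin> S ==> h' x = 0"
  "AE x in lborel. x \<in> S --> h x = h' x"
proof -
 have "(%x. ind S x *\<^sub>R h x) \<in> BM lebesgue" using assms by (subst borel_measurable_restrict_space_iff[symmetric]) auto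
 then obtain g where g: "g \<in> BM lborel" "AE x in lborel. ind S x *\<^sub>R h x = g x" using completion_ex_borel_measurable_real by blast
 show ?thesis
 proof
  show "(%x. ind S x * g x) \<in> BM borel" using g(1) assms(2) by measurable
  show "AE x in lborel. x \<in> S --> h x = ind S x * g x" using g(2) by eventually_elim auto
 qed auto
qed

lemma AE_lebesgue_on_iff:
 fixes S :: "'a::euclidean_space set"
 assumes "S \<in> sets borel"
 shows "(AE x in LB S. P x) \<longleftrightarrow> (AE x in lborel. x \<in> S --> P x)"
 using assms by (subst AE_restrict_space_iff) (auto simp: AE_completion_iff)

text \<open>Moves integrals over \<Omega> to \<open>lborel\<close>, where Tonelli's theorem and
  changes of variables are applied. Completeness of \<open>lebesgue\<close> makes even the
  measurability of f a conclusion.\<close>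

lemma integral_lebesgue_on_cong_borel:
 fixes f g :: "'a::euclidean_space => real"
 assumes S: "S \<in> sets borel" and g[measurable]: "g \<in> BM borel"
  and eq: "AE x in lborel. x \<in> S --> f x = g x"
 shows "integrable (LB S) f \<longleftrightarrow> integrable lborel (%x. ind S x * g x)"
  "(LINT x|LB S. f x) = (LBINT x. ind S x * g x)"
  "f \<in> BM (LB S)"
proof -
 have [measurable]: "S \<in> sets borel" by fact
 have [simp]: "S \<in> sets lebesgue" using S by simp
 have gl: "(%x. ind S x * g x) \<in> BM borel" by measurable
 hence gl': "(%x. ind S x *\<^sub>R g x) \<in> BM lebesgue" by (intro measurable_completion) simp
 have ae: "AE x in lebesgue. ind S x *\<^sub>R g x = ind S x *\<^sub>R f x" using eq by (intro AE_completion) (auto simp: indicator_def)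
 have fl: "(%x. ind S x *\<^sub>R f x) \<in> BM lebesgue" by (rule borel_measurable_AE[OF gl' ae])
 thus "f \<in> BM (LB S)" by (subst borel_measurable_restrict_space_iff) auto
 show "integrable (LB S) f \<longleftrightarrow> integrable lborel (%x. ind S x * g x)"
  using integrable_cong_AE[OF gl' fl ae] integrable_completion[of "%x. ind S x * g x" lborel] gl by (simp add: integrable_restrict_space)
 show "(LINT x|LB S. f x) = (LBINT x. ind S x * g x)" using integral_cong_AE[OF gl' fl ae] integral_completion[of "%x. ind S x * g x" lborel] gl
  by (simp add: integral_restrict_space)
qed

lemma nn_integral_lebesgue_on:
 fixes f :: "'a::euclidean_space => ennreal"
 assumes "S \<in> sets borel"
 shows "(\<integral>\<^sup>+x. f x \<partial>lebesgue_on S) = (NN x. f x * ind S x)"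
 using assms by (simp add: nn_integral_restrict_space nn_integral_completion)

lemma test_fun_box:
 fixes a b :: "real^'n::finite"
 defines "\<phi> \<equiv> %n x. \<Prod>i\<in>UNIV. step_approx (a $ i) (b $ i) n (x $ i)"
 assumes "cbox a b \<subseteq> \<Omega>"
 shows "\<phi> n \<in> test_funs \<Omega>" "0 \<le> \<phi> n x" "\<phi> n x \<le> ind (box a b) x"
  "(%n. \<phi> n x) \<leadsto> ind (box a b) x"
proof -
 have ind: "(\<Prod>i\<in>UNIV. ind {a $ i<..<b $ i} (x $ i)) = (ind (box a b) x :: real)" for x
  by (auto simp: indicator_def mem_box_cart prod_zero_iff)
 show 0: "0 \<le> \<phi> n x" for n x unfolding \<phi>_def by (intro prod_nonneg) (simp add: step_approx_bounds)
 show le: "\<phi> n x \<le> ind (box a b) x" for n x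
  unfolding \<phi>_def ind[symmetric] by (intro prod_mono) (simp add: step_approx_bounds step_approx_le)
 show "(%n. \<phi> n x) \<leadsto> ind (box a b) x" unfolding \<phi>_def ind[symmetric] by (intro tendsto_prod step_approx_tendsto)
 have z: "\<phi> n x = 0" if "x \<notin> box a b" for x using le[of n x] 0[of n x] that by simp
 have cl: "closure {x. \<phi> n x \<noteq> 0} \<subseteq> cbox a b" using z box_subset_cbox by (intro closure_minimal) (auto intro: closed_cbox)
 moreover have "compact (closure {x. \<phi> n x \<noteq> 0})" using cl by (meson bounded_cbox bounded_subset closed_closure compact_eq_bounded_closed)
 moreover have "Ck k (\<phi> n)" for k unfolding \<phi>_def by (intro Ck_prod Ck_compose[OF step_approx_smooth] Ck_coord) auto
 ultimately show "\<phi> n \<in> test_funs \<Omega>" using assms(2) by (auto simp: test_funs_def)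
qed

text \<open>Smooth approximations of box indicators show that h has integral zero over every box
  whose closure lies in \<Omega>. Boxes are stable under intersection and generate the Borel sets,
  so inside such a box h integrates to zero over all Borel sets and vanishes a.e.; countably many
  boxes cover \<Omega>.\<close>

lemma fundamental_lemma:
 fixes h :: "real^'n::finite => real"
 assumes "open \<Omega>" and loc: "L1_loc \<Omega> h"
  and test: "!!\<phi>. \<phi> \<in> test_funs \<Omega> ==> (LINT x|LB \<Omega>. h x * \<phi> x) = 0"
 shows "AE x in LB \<Omega>. h x = 0"
proof -
 have \<Omega>[measurable]: "\<Omega> \<in> sets borel" using assms(1) by simp
 have box0: "integrable (LB (cbox a b)) h" "(LINT x|LB (box a b). h x) = 0" if ab: "cbox a b \<subseteq> \<Omega>" for a b
 proof -
  show i: "integrable (LB (cbox a b)) h" using loc ab by (auto simp: L1_loc_def)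
  define hc where "hc x = ind (cbox a b) x * h x" for x
  have i2: "integrable lebesgue hc" using i by (simp add: integrable_restrict_space hc_def[abs_def])
  define \<phi> where "\<phi> n x = (\<Prod>i\<in>UNIV. step_approx (a $ i) (b $ i) n (x $ i))" for n x
  have \<phi>: "\<phi> n \<in> test_funs \<Omega>" "0 \<le> \<phi> n x" "\<phi> n x \<le> ind (box a b) x"
   "(%n. \<phi> n x) \<leadsto> ind (box a b) x" for n x
   using test_fun_box(1)[OF ab, of n] test_fun_box(2,3)[OF ab, of n x] test_fun_box(4)[OF ab, of x] by (simp_all add: \<phi>_def[abs_def])
  have [measurable]: "\<phi> n \<in> BM lebesgue" for n using C1_borel[OF test_funs_C1[OF \<phi>(1)]] by (intro measurable_completion) simp
  have z: "\<phi> n x = 0" if "x \<notin> box a b" for x n using \<phi>(2,3)[of n x] that by simp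
  have eq: "hc x * \<phi> n x = ind \<Omega> x *\<^sub>R (h x * \<phi> n x)" for n x
   using z[of x n] ab box_subset_cbox[of a b] by (cases "x \<in> box a b") (auto simp: hc_def indicator_def)
  have "(%n. LINT x|lebesgue. hc x * \<phi> n x)
    \<leadsto> (LINT x|lebesgue. hc x * ind (box a b) x)"
  proof (rule integral_dominated_convergence[where w = "%x. norm (hc x)"])
   have [measurable]: "hc \<in> BM lebesgue" using i2 by simp
   have [measurable]: "box a b \<in> sets lebesgue" by simp
   show "(%x. hc x * \<phi> n x) \<in> BM lebesgue" for n by measurable
   show "(%x. hc x * ind (box a b) x) \<in> BM lebesgue" by measurable
   show "integrable lebesgue (%x. norm (hc x))" using i2 by (rule integrable_norm)
   show "AE x in lebesgue. (%n. hc x * \<phi> n x)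
     \<leadsto> hc x * ind (box a b) x" by (intro AE_I2 tendsto_mult_left \<phi>)
   have "|(\<phi> n x)| \<le> 1" for n x using \<phi>(2,3)[of n x] by (cases "x \<in> box a b") auto
   thus "AE x in lebesgue. norm (hc x * \<phi> n x) \<le> norm (hc x)" for n by (intro AE_I2) (simp add: abs_mult mult_left_le mult_nonneg_nonneg)
  qed
  moreover have "(LINT x|lebesgue. hc x * \<phi> n x) = 0" for n using test[OF \<phi>(1), of n] unfolding eq by (simp add: integral_restrict_space)
  ultimately have "(LINT x|lebesgue. hc x * ind (box a b) x) = 0" by (simp add: LIMSEQ_const_iff)
  also have "(%x. hc x * ind (box a b) x) = (%x. ind (box a b) x *\<^sub>R h x)"
   using box_subset_cbox[of a b] by (auto simp: hc_def indicator_def fun_eq_iff)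
  finally show "(LINT x|LB (box a b). h x) = 0" by (simp add: integral_restrict_space)
 qed
 have main: "AE x in lborel. x \<in> box c d --> h x = 0" if cd: "cbox c d \<subseteq> \<Omega>" for c d
 proof -
  have i: "integrable (LB (box c d)) h"
  proof -
   have "integrable lebesgue (%x. ind (box c d) x *\<^sub>R (ind (cbox c d) x *\<^sub>R h x))" using box0(1)[OF cd]
    by (intro integrable_mult_indicator[of "box c d" lebesgue "%x. ind (cbox c d) x *\<^sub>R h x"])
     (auto simp: integrable_restrict_space)
   also have "(%x. ind (box c d) x *\<^sub>R (ind (cbox c d) x *\<^sub>R h x)) = (%x. ind (box c d) x *\<^sub>R h x)"
    using box_subset_cbox[of c d] by (auto simp: indicator_def fun_eq_iff)
   finally show ?thesis by (simp add: integrable_restrict_space)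
  qed
  obtain g where g[measurable]: "g \<in> BM borel" and g0: "!!x. x \<notin> box c d ==> g x = 0"
   and gh: "AE x in lborel. x \<in> box c d --> h x = g x"
   by (rule borel_version[OF borel_measurable_integrable[OF i] borel_open[OF open_box]]) (rule that)
  have gi: "integrable lborel g"
  proof -
   have "integrable lborel (%x. ind (box c d) x * g x)" using integral_lebesgue_on_cong_borel(1)[OF _ g gh] i by simp
   also have "(%x. ind (box c d) x * g x) = g" using g0 by (fastforce simp: indicator_def)
   finally show ?thesis .
  qed
  \<comment> \<open>Since g vanishes outside \<open>box c d\<close>, an arbitrary box may be
    replaced by its intersection with it, whose closure stays in \<Omega>.\<close>
  have g_box: "(LBINT x. ind (box a b) x * g x) = 0" for a b
  proof -
   obtain e f where ef: "box a b \<inter> box c d = box e f" using box_Int_box by blast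
   have "(LBINT x. ind (box a b) x * g x) = (LBINT x. ind (box e f) x * g x)"
    using g0 unfolding ef[symmetric] by (intro Bochner_Integration.integral_cong) (auto simp: indicator_def)
   also have "\<dots> = (LINT x|LB (box e f). h x)"
    by (rule integral_lebesgue_on_cong_borel(2)[symmetric]) (use gh ef in \<open>auto elim: eventually_mono\<close>)
   also have "\<dots> = 0"
   proof (cases "box e f = {}")
    case False
    have "cbox e f = closure (box e f)" using False by (simp add: closure_box)
    also have "\<dots> \<subseteq> cbox c d" using ef box_subset_cbox[of c d] by (intro closure_minimal) auto
    finally show ?thesis using cd by (intro box0(2)) auto
   qed simp
   finally show ?thesis .
  qed
  have "set_lebesgue_integral lborel A g = 0" if A: "A \<in> sets lborel" for A
  proof -
   have Am: "A \<in> sigma_sets UNIV (range (%(a, b). box a b))" using A by (simp add: borel_eq_box)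
   have IS: "Int_stable (range (%(a, b). box a b :: (real^'n) set))" by (auto simp: Int_stable_def box_Int_box)
   show ?thesis
   proof (rule sigma_sets_induct_disjoint[OF IS _ Am, where P = "%A. set_lebesgue_integral lborel A g = 0"])
    fix A :: "(real^'n) set" assume "A \<in> range (%(a, b). box a b)"
    thus "set_lebesgue_integral lborel A g = 0" using g_box by (auto simp: set_lebesgue_integral_def)
   next
    fix A :: "(real^'n) set" assume compl: "A \<in> sigma_sets UNIV (range (%(a, b). box a b))"
     "set_lebesgue_integral lborel A g = 0"
    have [measurable]: "A \<in> sets borel" using compl by (simp add: borel_eq_box)
    have "(%x. ind (box c d) x * g x) = g" using g0 by (fastforce simp: indicator_def)
    with g_box[of c d] have 0: "(LBINT x. g x) = 0" by simp
    have si: "integrable lborel (%x. ind A x *\<^sub>R g x)" using gi by (intro integrable_mult_indicator) auto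
    have "(LBINT x. ind (UNIV - A) x *\<^sub>R g x) = (LBINT x. g x - ind A x *\<^sub>R g x)"
     by (intro Bochner_Integration.integral_cong) (auto simp: indicator_def)
    also have "\<dots> = 0" using gi si compl(2) 0 by (simp add: set_lebesgue_integral_def)
    finally show "set_lebesgue_integral lborel (UNIV - A) g = 0" by (simp add: set_lebesgue_integral_def)
   next
    fix A :: "nat => (real^'n) set"
    assume union: "disjoint_family A" "range A \<subseteq> sigma_sets UNIV (range (%(a, b). box a b))"
     "!!i. set_lebesgue_integral lborel (A i) g = 0"
    have m: "A i \<in> sets borel" for i using union(2) by (auto simp: borel_eq_box)
    have "set_lebesgue_integral lborel (\<Union>i. A i) g = (\<Sum>i. set_lebesgue_integral lborel (A i) g)"
    proof (rule lebesgue_integral_countable_add)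
     show "set_integrable lborel (\<Union>i. A i) g" unfolding set_integrable_def using m by (intro integrable_mult_indicator[OF _ gi]) auto
    qed (use union m in \<open>auto simp: disjoint_family_on_def\<close>)
    thus "set_lebesgue_integral lborel (\<Union>i. A i) g = 0" using union by simp
   qed (auto simp: set_lebesgue_integral_def)
  qed
  hence "AE x in lborel. g x = 0" by (rule sigma_finite_measure.density_zero[OF sigma_finite_lborel gi])
  with gh show ?thesis by eventually_elim auto
 qed
 obtain \<D> where D: "countable \<D>" "\<D> \<subseteq> Pow \<Omega>" "!!X. X \<in> \<D> ==> \<exists>a b. X = cbox a b" "\<Union>\<D> = \<Omega>"
  using open_countable_Union_open_cbox[OF assms(1)] by blast
 have "AE x in lborel. \<forall>X\<in>\<D>. x \<in> X --> h x = 0"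
 proof (rule AE_ball_countable'[OF _ D(1)])
  fix X assume X: "X \<in> \<D>"
  obtain a b where ab: "X = cbox a b" using D(3)[OF X] by blast
  have "negligible (cbox a b - box a b)" by (rule negligible_frontier_interval)
  hence "AE x in lebesgue. x \<notin> cbox a b - box a b" by (intro AE_not_in) (simp add: negligible_iff_null_sets)
  hence "AE x in lborel. x \<notin> cbox a b - box a b" by (simp add: AE_completion_iff)
  moreover have "AE x in lborel. x \<in> box a b --> h x = 0" using main X D(2) ab by blast
  ultimately show "AE x in lborel. x \<in> X --> h x = 0" unfolding ab by eventually_elim auto
 qed
 thus ?thesis using D(4) by (subst AE_lebesgue_on_iff) (auto elim!: eventually_mono)
qed

section \<open>Pairings of dual powers and smooth truncations\<close>

lemma conj_exp_props:
 assumes "p > 1"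
 shows "conj_exp p > 1" "1/p + 1 / conj_exp p = 1" "1 / conj_exp p = 1 - 1/p" using assms by (auto simp: conj_exp_def field_simps)

lemma abs_add_powr_le:
 assumes "p \<ge> 0"
 shows "|(a + b :: real)| powr p \<le> 2 powr p * ( |(a)| powr p + |(b)| powr p)"
proof -
 have "|(a + b)| powr p \<le> (2 * max |(a)| |(b)|) powr p" using assms by (intro powr_mono2) auto
 also have "\<dots> = 2 powr p * max |(a)| |(b)| powr p" by (simp add: powr_mult)
 also have "\<dots> \<le> 2 powr p * ( |(a)| powr p + |(b)| powr p)" by (intro mult_left_mono) (auto simp: max_def)
 finally show ?thesis .
qed

lemma le_one_plus_powr: "0 \<le> y ==> 1 \<le> r ==> y \<le> 1 + y powr r" for y :: real
 using powr_mono[of 1 r y] by (cases "y \<le> 1") (auto intro: order_trans)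

lemma Lp_add_integrable:
 fixes f g :: "'a => real"
 assumes [measurable]: "f \<in> BM M" "g \<in> BM M" and "p \<ge> 0"
  and "integrable M (%x. |(f x)| powr p)" "integrable M (%x. |(g x)| powr p)"
 shows "integrable M (%x. |(f x + g x)| powr p)"
proof (rule Bochner_Integration.integrable_bound)
 show "integrable M (%x. 2 powr p * ( |(f x)| powr p + |(g x)| powr p))" using assms by simp
 show "AE x in M. norm ( |(f x + g x)| powr p) \<le> norm (2 powr p * ( |(f x)| powr p + |(g x)| powr p))"
  using abs_add_powr_le[OF assms(3)] by (intro AE_I2) simp
qed measurable

lemma Lp_diff_integrable:
 fixes f g :: "'a => real"
 assumes "f \<in> BM M" "g \<in> BM M" "p \<ge> 0"
  "integrable M (%x. |(f x)| powr p)" "integrable M (%x. |(g x)| powr p)"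
 shows "integrable M (%x. |(f x - g x)| powr p)" using Lp_add_integrable[of f M "%x. - g x" p] assms by simp

lemma Holder_integrable:
 fixes b c :: "'a => real"
 assumes [measurable]: "b \<in> BM M" "c \<in> BM M" and p: "p > 1"
  and b: "integrable M (%x. |(b x)| powr conj_exp p)" and c: "integrable M (%x. |(c x)| powr p)"
 shows "integrable M (%x. b x * c x)"
  "(LINT x|M. |(b x * c x)|) \<le> (LINT x|M. |(c x)| powr p) powr (1/p)
    * (LINT x|M. |(b x)| powr conj_exp p) powr (1 / conj_exp p)"
proof -
 have "(\<integral>\<^sup>+x. ennreal |(c x * b x)| \<partial>M) \<le> ennreal ((LINT x|M. |(c x)| powr p) powr (1/p)
    * (LINT x|M. |(b x)| powr conj_exp p) powr (1 / conj_exp p))" using conj_exp_props[OF p] by (intro nn_Holder p)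
   (auto simp: nn_integral_eq_integral[OF b] nn_integral_eq_integral[OF c])
 hence *: "(\<integral>\<^sup>+x. ennreal |(b x * c x)| \<partial>M) \<le> ennreal ((LINT x|M. |(c x)| powr p) powr (1/p)
    * (LINT x|M. |(b x)| powr conj_exp p) powr (1 / conj_exp p))" by (simp add: mult.commute)
 show i: "integrable M (%x. b x * c x)" by (rule integrableI_bounded) (use le_less_trans[OF *] in auto)
 have "ennreal (LINT x|M. |(b x * c x)|) = (\<integral>\<^sup>+x. ennreal |(b x * c x)| \<partial>M)"
  using i by (intro nn_integral_eq_integral[symmetric] integrable_abs) auto
 also note *
 finally show "(LINT x|M. |(b x * c x)|) \<le> (LINT x|M. |(c x)| powr p) powr (1/p)
    * (LINT x|M. |(b x)| powr conj_exp p) powr (1 / conj_exp p)" by (subst (asm) ennreal_le_iff) auto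
qed

text \<open>The gradients \<open>ck\<close> converge strongly in L^p, while the bounded factors
  \<open>\<theta>k\<close> converge only a.e. Splitting \<open>ck\<close> into c and
  \<open>ck\<close> - c, dominated convergence handles the first part and Hoelder's inequality the
  second.\<close>

lemma Lp_pairing_tendsto:
 fixes b c :: "'a => real"
 assumes [measurable]: "b \<in> BM M" "c \<in> BM M"
   "!!k. ck k \<in> BM M" "!!k. \<theta>k k \<in> BM M" "\<theta> \<in> BM M"
  and p: "p > 1"
  and b: "integrable M (%x. |(b x)| powr conj_exp p)" and c: "integrable M (%x. |(c x)| powr p)"
  and d: "!!k. integrable M (%x. |(ck k x - c x)| powr p)"
  and lim: "(%k. LINT x|M. |(ck k x - c x)| powr p) \<leadsto> 0"
  and B: "!!k x. |(\<theta>k k x)| \<le> B" and ae: "AE x in M. (%k. \<theta>k k x) \<leadsto> \<theta> x"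
 shows "!!k. integrable M (%x. b x * (\<theta>k k x * ck k x))"
  "integrable M (%x. b x * (\<theta> x * c x))"
  "(%k. LINT x|M. b x * (\<theta>k k x * ck k x)) \<leadsto> (LINT x|M. b x * (\<theta> x * c x))"
proof -
 have B0: "B \<ge> 0" using B[of 0 undefined] by linarith
 have mb: "|(y * (t * z))| \<le> B * |(y * z)|" if "|(t)| \<le> B" for t y z :: real
  using mult_right_mono[OF that, of "|(y * z)|"] by (simp add: abs_mult mult_ac)
 have bc: "integrable M (%x. b x * c x)" by (rule Holder_integrable(1)[OF _ _ p b c]) measurable
 have bd: "integrable M (%x. b x * (ck k x - c x))" for k by (rule Holder_integrable(1)[OF _ _ p b d]) measurable
 have i1: "integrable M (%x. b x * (\<theta>k k x * c x))" for k
 proof (rule Bochner_Integration.integrable_bound[OF integrable_mult_right[OF bc, of B]])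
  show "AE x in M. norm (b x * (\<theta>k k x * c x)) \<le> norm (B * (b x * c x))" using mb[OF B] B0 by (intro AE_I2) (simp add: abs_mult)
 qed measurable
 have i2: "integrable M (%x. b x * (\<theta>k k x * (ck k x - c x)))" for k
 proof (rule Bochner_Integration.integrable_bound[OF integrable_mult_right[OF bd, of B k]])
  show "AE x in M. norm (b x * (\<theta>k k x * (ck k x - c x))) \<le> norm (B * (b x * (ck k x - c x)))"
   using mb[OF B] B0 by (intro AE_I2) (simp add: abs_mult)
 qed measurable
 have eq: "b x * (\<theta>k k x * ck k x) = b x * (\<theta>k k x * c x) + b x * (\<theta>k k x * (ck k x - c x))" for k x by (simp add: algebra_simps)
 show "!!k. integrable M (%x. b x * (\<theta>k k x * ck k x))" unfolding eq using i1 i2 by simp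
 have "AE x in M. |(\<theta> x)| \<le> B" using ae
 proof eventually_elim
  case (elim x)
  hence "(%k. |(\<theta>k k x)|) \<leadsto> |(\<theta> x)|" by (rule tendsto_rabs)
  thus ?case by (rule LIMSEQ_le_const2) (use B in auto)
 qed
 hence "AE x in M. norm (b x * (\<theta> x * c x)) \<le> norm (B * (b x * c x))" by eventually_elim (use mb B0 in \<open>simp add: abs_mult\<close>)
 thus i0: "integrable M (%x. b x * (\<theta> x * c x))"
  by (intro Bochner_Integration.integrable_bound[OF integrable_mult_right[OF bc, of B]]) measurable
 have l1: "(%k. LINT x|M. b x * (\<theta>k k x * c x)) \<leadsto> (LINT x|M. b x * (\<theta> x * c x))"
 proof (rule integral_dominated_convergence[where s = "%k x. b x * (\<theta>k k x * c x)" and f = "%x. b x * (\<theta> x * c x)" and w = "%x. B * |(b x * c x)|"])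
  show "integrable M (%x. B * |(b x * c x)|)" using bc by simp
  show "AE x in M. (%k. b x * (\<theta>k k x * c x)) \<leadsto> b x * (\<theta> x * c x)"
   using ae by eventually_elim (intro tendsto_mult tendsto_const)
  show "AE x in M. norm (b x * (\<theta>k k x * c x)) \<le> B * |(b x * c x)|" for k using mb[OF B] by (intro AE_I2) simp
 qed measurable
 have l2: "(%k. LINT x|M. b x * (\<theta>k k x * (ck k x - c x))) \<leadsto> 0"
 proof (rule Lim_null_comparison)
  let ?U = "%k. B * ((LINT x|M. |(ck k x - c x)| powr p) powr (1/p)
    * (LINT x|M. |(b x)| powr conj_exp p) powr (1 / conj_exp p))"
  show "\<forall>\<^sub>F k in sequentially. norm (LINT x|M. b x * (\<theta>k k x * (ck k x - c x))) \<le> ?U k"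
  proof (intro always_eventually allI)
   fix k
   have "norm (LINT x|M. b x * (\<theta>k k x * (ck k x - c x))) \<le> (LINT x|M. norm (b x * (\<theta>k k x * (ck k x - c x))))"
    by (rule integral_norm_bound)
   also have "\<dots> \<le> (LINT x|M. B * |(b x * (ck k x - c x))|)"
    using mb[OF B] by (intro integral_mono integrable_norm i2 integrable_mult_right integrable_abs bd) simp
   also have "\<dots> \<le> ?U k" using B0 by (simp, intro mult_left_mono Holder_integrable(2) p b d) measurable
   finally show "norm (LINT x|M. b x * (\<theta>k k x * (ck k x - c x))) \<le> ?U k" .
  qed
  have "(%k. (LINT x|M. |(ck k x - c x)| powr p) powr (1/p)) \<leadsto> 0" using p by (intro tendsto_zero_powrI[OF lim tendsto_const]) auto
  thus "?U \<leadsto> 0" by (intro tendsto_mult_right_zero tendsto_mult_left_zero)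
 qed
 have "(%k. LINT x|M. b x * (\<theta>k k x * ck k x)) = (%k. (LINT x|M. b x * (\<theta>k k x * c x)) + (LINT x|M. b x * (\<theta>k k x * (ck k x - c x))))"
  unfolding eq using i1 i2 by simp
 thus "(%k. LINT x|M. b x * (\<theta>k k x * ck k x)) \<leadsto> (LINT x|M. b x * (\<theta> x * c x))" using tendsto_add[OF l1 l2] by simp
qed

text \<open>The weight \<kappa> is chosen so that the gradient term receives exactly half of the
  coercivity and can be absorbed. The other term is then 2^(q/p) times a summand of
  \<open>g_density\<close>; these factors add up to \<open>young_const\<close>.\<close>

lemma Young_half:
 fixes g D :: real
 assumes "p > 1" "lam > 0"
 defines "q \<equiv> conj_exp p"
 shows "|(g * D)| \<le> 1/2 * (lam * |(D)| powr p) + 2 powr (q / p) * ( |(g)| powr q / (q * (lam * p) powr (q / p)))"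
proof -
 define \<kappa> where "\<kappa> = (lam * p / 2) powr (1/p)"
 have \<kappa>: "\<kappa> > 0" "\<kappa> powr p = lam * p / 2" using assms by (auto simp: \<kappa>_def powr_powr)
 have \<kappa>q: "\<kappa> powr q = (lam * p) powr (q / p) / 2 powr (q / p)" using assms by (simp add: \<kappa>_def powr_powr powr_divide)
 have q: "q > 1" "1/p + 1/q = 1" using conj_exp_props[OF assms(1)] by (auto simp: q_def)
 have "|(g * D)| = (\<kappa> * |(D)|) * ( |(g)| / \<kappa>)" using \<kappa>(1) by (simp add: abs_mult)
 also have "\<dots> \<le> (\<kappa> * |(D)|) powr p / p + ( |(g)| / \<kappa>) powr q / q" using \<kappa> by (intro Youngs_inequality assms q) auto
 also have "(\<kappa> * |(D)|) powr p / p = 1/2 * (lam * |(D)| powr p)" using \<kappa>(1) assms(1) by (simp add: powr_mult \<kappa>(2))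
 also have "( |(g)| / \<kappa>) powr q / q = 2 powr (q / p) * ( |(g)| powr q / (q * (lam * p) powr (q / p)))"
  using \<kappa>(1) by (simp add: powr_divide \<kappa>q field_simps)
 finally show ?thesis .
qed

text \<open>The part of s between the levels a and b: an odd function whose modulus grows from 0 to
  b - a while |s| grows from a to b.\<close>

definition trunc :: "real => real => real => real" where
 "trunc a b s = sgn s * min (max ( |(s)| - a) 0) (b - a)"

lemma smooth1_antiderivative:
 assumes "smooth1 \<theta>"
 obtains \<eta> where "smooth1 \<eta>" "\<eta> 0 = 0" "!!x. (\<eta> has_real_derivative \<theta> x) (at x)"
proof -
 obtain F where F: "!!x::real. (F has_vector_derivative \<theta> x) (at x)"
  using einterval_antiderivative[of "-\<infinity>" "\<infinity>" \<theta>] smooth1_continuous[OF assms, of UNIV]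
  by (auto simp: continuous_on_eq_continuous_at)
 have d: "((%x. F x - F 0) has_real_derivative \<theta> x) (at x)" for x
  using F[of x] by (auto intro!: derivative_eq_intros simp: has_real_derivative_iff_has_vector_derivative)
 show ?thesis by (rule that[OF smooth1_intro[OF d assms] _ d]) simp
qed

lemma flat_step_even:
 assumes "!!x. \<theta> (- x) = \<theta> x" "!!x. (\<eta> has_real_derivative \<theta> x) (at x)" "\<eta> 0 = 0"
 shows "\<eta> (- x) = - \<eta> (x::real)"
proof -
 have "((%x. \<eta> x + \<eta> (- x)) has_real_derivative 0) (at x)" for x
 proof -
  have "((%x. \<eta> (- x)) has_real_derivative \<theta> (- x) * (- 1)) (at x)"
   by (rule DERIV_chain2[OF assms(2)]) (auto intro!: derivative_eq_intros)
  from DERIV_add[OF assms(2) this] show ?thesis by (simp add: assms(1))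
 qed
 hence "\<eta> x + \<eta> (- x) = \<eta> 0 + \<eta> (- 0)" by (intro DERIV_isconst_all[of "%x. \<eta> x + \<eta> (- x)"]) auto
 thus ?thesis using assms(3) by simp
qed

lemma step_approx_reflect: "step_approx a b n (- x) = step_approx (- b) (- a) n x"
proof -
 have "- x - a = - a - x" "b - - x = x - - b" by simp_all
 thus ?thesis unfolding step_approx_def by (simp only: mult.commute)
qed

text \<open>Only smooth functions of a test function are test functions, so \<open>trunc\<close> is
  approximated by antiderivatives of smooth even functions below the indicator of J. The second
  shape of J contains s = 0; it serves the total energy, which includes the set where u
  vanishes.\<close>

lemma smooth_truncation:
 assumes ab: "0 \<le> a" "a < b"
  and J: "J = {s. a < |(s)| & |(s)| < b} \<or> (a = 0 & J = {s. |(s)| < b})"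
 obtains \<eta> \<theta> where "!!n. smooth1 (\<eta> n)" "!!n. smooth1 (\<theta> n)" "!!n. \<eta> n 0 = 0"
  "!!n x. (\<eta> n has_real_derivative \<theta> n x) (at x)"
  "!!n x. 0 \<le> \<theta> n x" "!!n x. \<theta> n x \<le> ind J x"
  "!!x. (%n. \<theta> n x) \<leadsto> ind J x"
  "!!n x. |(\<eta> n x)| \<le> min (max ( |(x)| - a) 0) (b - a)"
  "!!x. (%n. \<eta> n x) \<leadsto> trunc a b x"
proof -
 have ex: "\<exists>\<theta>. (\<forall>n. smooth1 (\<theta> n)) & (\<forall>n x. 0 \<le> \<theta> n x & \<theta> n x \<le> ind J x & \<theta> n (- x) = \<theta> n x)
   & (\<forall>x. (%n. \<theta> n x) \<leadsto> ind J (x::real))" using J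
 proof
  assume J1: "J = {s. a < |(s)| & |(s)| < b}"
  have split: "ind J x = ind {a<..<b} x + (ind {-b<..<-a} x :: real)" for x using ab by (auto simp: J1 indicator_def)
  show ?thesis
  proof (intro exI[of _ "%n x. step_approx a b n x + step_approx (-b) (-a) n x"] conjI allI)
   show "smooth1 (%x. step_approx a b n x + step_approx (- b) (- a) n x)" for n by (intro smooth1_add step_approx_smooth)
   show "0 \<le> step_approx a b n x + step_approx (- b) (- a) n x" for n x by (intro add_nonneg_nonneg step_approx_bounds)
   show "step_approx a b n x + step_approx (- b) (- a) n x \<le> ind J x" for n x unfolding split by (intro add_mono step_approx_le)
   show "step_approx a b n (- x) + step_approx (- b) (- a) n (- x) = step_approx a b n x + step_approx (- b) (- a) n x" for n x
    by (simp add: step_approx_reflect)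
   show "(%n. step_approx a b n x + step_approx (- b) (- a) n x) \<leadsto> ind J x" for x unfolding split by (intro tendsto_add step_approx_tendsto)
  qed
 next
  assume J2: "a = 0 & J = {s. |(s)| < b}"
  hence JI: "J = {-b<..<b}" by auto
  show ?thesis unfolding JI by (intro exI[of _ "%n x. step_approx (-b) b n x"] conjI allI step_approx_smooth step_approx_bounds
     step_approx_le step_approx_tendsto) (simp add: step_approx_reflect)
 qed
 obtain \<theta> where \<theta>: "!!n. smooth1 (\<theta> n)" "!!n x. 0 \<le> \<theta> n x" "!!n x. \<theta> n x \<le> ind J x"
  "!!n x. \<theta> n (- x) = \<theta> n x" "!!x. (%n. \<theta> n x) \<leadsto> ind J (x::real)" using ex by blast
 have "\<exists>\<eta>. smooth1 \<eta> & \<eta> 0 = 0 & (\<forall>x. (\<eta> has_real_derivative \<theta> n x) (at x))" for n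
  using smooth1_antiderivative[OF \<theta>(1)] by metis
 then obtain \<eta> where \<eta>: "!!n. smooth1 (\<eta> n)" "!!n. \<eta> n 0 = 0" "!!n x. (\<eta> n has_real_derivative \<theta> n x) (at x)" by metis
 define m where "m s = min (max (s - a) 0) (b - a)" for s
 \<comment> \<open>The two shapes of J differ on the half-line only at the point 0, which does not
   affect the integrals.\<close>
 have Jpos: "ind J x * ind {0..s} x = (ind ({a<..<b} \<inter> {0..s}) x :: real)"
  if "x \<noteq> 0" for x s :: real using J ab that by (auto simp: indicator_def)
 have [measurable]: "J \<in> sets borel" using J by (elim disjE) (auto intro!: borel_open open_Collect_less open_Collect_conj continuous_intros)
 have [measurable]: "\<theta> n \<in> BM borel" for n by (intro borel_measurable_continuous_onI smooth1_continuous \<theta>)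
 have AEJ: "AE x in lborel. ind J x * ind {0..s} x = (ind ({a<..<b} \<inter> {0..s}) x :: real)" for s
  using AE_lborel_singleton[of 0] by eventually_elim (rule Jpos)
 have int_J: "(LBINT x. ind J x * ind {0..s} x) = m s" if s: "s \<ge> 0" for s :: real
 proof -
  have "(LBINT x. ind J x * ind {0..s} x) = (LBINT x. ind ({a<..<b} \<inter> {0..s}) x :: real)" by (intro integral_cong_AE AEJ) measurable
  also have "\<dots> = measure lborel ({a<..<b} \<inter> {0..s})" by simp
  also have "\<dots> = m s"
  proof (cases "s \<le> a \<or> b \<le> s")
   case True
   thus ?thesis
   proof
    assume "s \<le> a"
    hence "{a<..<b} \<inter> {0..s} = {}" by auto
    thus ?thesis using \<open>s \<le> a\<close> ab by (simp add: m_def)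
   next
    assume "b \<le> s"
    hence "{a<..<b} \<inter> {0..s} = {a<..<b}" using ab by auto
    thus ?thesis using \<open>b \<le> s\<close> ab by (simp add: m_def)
   qed
  next
   case False
   hence "{a<..<b} \<inter> {0..s} = {a<..s}" using ab by auto
   thus ?thesis using False ab by (simp add: m_def)
  qed
  finally show ?thesis .
 qed
 have \<eta>int: "integrable lborel (%x. \<theta> n x * ind {0..s} x)"
  "\<eta> n s = (LBINT x. \<theta> n x * ind {0..s} x)" if "s \<ge> 0" for n s
 proof -
  have "has_bochner_integral lborel (%x. \<theta> n x * ind {0..s} x) (\<eta> n s - \<eta> n 0)"
   using that \<eta>(3) smooth1_continuous[OF \<theta>(1), of UNIV n]
   by (intro has_bochner_integral_FTC_Icc_real) (auto simp: continuous_on_eq_continuous_at)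
  thus "integrable lborel (%x. \<theta> n x * ind {0..s} x)"
   "\<eta> n s = (LBINT x. \<theta> n x * ind {0..s} x)" using \<eta>(2) by (auto simp: has_bochner_integral_iff)
 qed
 have Jint: "integrable lborel (%x. ind J x * ind {0..s} x :: real)" for s :: real
  by (rule Bochner_Integration.integrable_bound[where f = "ind {0..s} :: real => real"])
   (auto simp: indicator_def emeasure_lborel_Icc_eq intro!: integrable_real_indicator)
 have pos: "0 \<le> \<eta> n s" "\<eta> n s \<le> m s" "(%n. \<eta> n s) \<leadsto> m s" if s: "s \<ge> 0" for n s
 proof -
  show "0 \<le> \<eta> n s" unfolding \<eta>int(2)[OF s] by (intro integral_nonneg_AE AE_I2) (simp add: \<theta>)
  show "\<eta> n s \<le> m s" unfolding \<eta>int(2)[OF s] int_J[OF s, symmetric]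
   by (intro integral_mono \<eta>int(1) s Jint mult_right_mono \<theta>) auto
  show "(%n. \<eta> n s) \<leadsto> m s" unfolding \<eta>int(2)[OF s] int_J[OF s, symmetric]
  proof (rule integral_dominated_convergence[where s = "%n x. \<theta> n x * ind {0..s} x" and f = "%x. ind J x * ind {0..s} x" and w = "%x. ind J x * ind {0..s} x"])
   show "AE x in lborel. norm (\<theta> n x * ind {0..s} x) \<le> ind J x * ind {0..s} x" for n
    using \<theta>(2,3)[of n] by (intro AE_I2) (auto simp: indicator_def)
   show "integrable lborel (%x. ind J x * ind {0..s} x :: real)" by (rule Jint)
   show "AE x in lborel. (%n. \<theta> n x * ind {0..s} x) \<leadsto> ind J x * ind {0..s} x" by (intro AE_I2 tendsto_mult_right \<theta>(5))
  qed measurable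
 qed
 have odd: "\<eta> n (- x) = - \<eta> n x" for n x by (rule flat_step_even[OF \<theta>(4) \<eta>(3,2)])
 show ?thesis
 proof (rule that[of \<eta> \<theta>])
  show "|(\<eta> n x)| \<le> min (max ( |(x)| - a) 0) (b - a)" for n x
   using pos(1,2)[of "|(x)|" n] odd[of n x] by (cases "x \<ge> 0") (auto simp: m_def)
  show "(%n. \<eta> n x) \<leadsto> trunc a b x" for x
  proof (cases "x \<ge> 0")
   case True
   have "m x = trunc a b x" using True ab by (cases "x = 0") (auto simp: m_def trunc_def)
   with pos(3)[OF True] show ?thesis by simp
  next
   case False
   have "- m (- x) = trunc a b x" using False by (auto simp: m_def trunc_def)
   moreover have "(%n. - \<eta> n (- x)) \<leadsto> - m (- x)" using pos(3)[of "- x"] False by (intro tendsto_minus) auto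
   ultimately show ?thesis by (simp add: odd)
  qed
 qed (rule \<theta> \<eta>)+
qed

section \<open>Energy estimates between levels\<close>

lemma borel_imp_lebesgue_on:
 fixes f :: "'a::euclidean_space => real"
 shows "f \<in> BM borel ==> f \<in> BM (LB S)" by (intro measurable_restrict_space1 measurable_completion) simp

lemma partial_deriv_outside:
 assumes "\<phi> \<in> test_funs \<Omega>" "x \<notin> \<Omega>"
 shows "pd i \<phi> x = 0" using assms by (intro partial_deriv_outside_support) (auto simp: test_funs_def)

lemma test_fun_bounded:
 assumes "\<phi> \<in> test_funs \<Omega>"
 obtains B where "B \<ge> 0" "!!x. |(\<phi> x)| \<le> B" "!!i x. |(pd i \<phi> x)| \<le> B"
proof -
 define K where "K = closure {x. \<phi> x \<noteq> 0}"
 have K: "compact K" using assms by (simp add: K_def test_funs_def)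
 have bd: "\<exists>B. \<forall>x. |(f x)| \<le> B" if "continuous_on UNIV f" "!!x. x \<notin> K ==> f x = 0" for f :: "real^'a => real"
 proof -
  have "bounded (f ` K)" using that(1) K by (intro compact_imp_bounded compact_continuous_image) (auto intro: continuous_on_subset)
  then obtain B where B: "B > 0" "!!x. x \<in> K ==> |(f x)| \<le> B" by (auto simp: bounded_pos)
  have "|(f x)| \<le> B" for x using B that(2)[of x] by (cases "x \<in> K") auto
  thus ?thesis by blast
 qed
 have "\<phi> x = 0" if "x \<notin> K" for x using that closure_subset[of "{x. \<phi> x \<noteq> 0}"] unfolding K_def by blast
 then obtain B0 where B0: "!!x. |(\<phi> x)| \<le> B0" using bd[OF C1_cont[OF test_funs_C1[OF assms]]] by blast
 have "\<exists>B. \<forall>x. |(pd i \<phi> x)| \<le> B" for i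
  by (rule bd[OF C1_pd[OF test_funs_C1[OF assms]]]) (auto simp: K_def intro: partial_deriv_outside_support)
 then obtain Bi where Bi: "!!i x. |(pd i \<phi> x)| \<le> Bi i" by metis
 have le: "Bi i \<le> (\<Sum>i\<in>UNIV. |(Bi i)|)" for i using member_le_sum[of i UNIV "%i. |(Bi i)|"] by (simp add: abs_le_iff)
 have s0: "0 \<le> (\<Sum>i\<in>UNIV. |(Bi i)|)" by (intro sum_nonneg) auto
 have "|(pd i \<phi> x)| \<le> |(B0)| + (\<Sum>i\<in>UNIV. |(Bi i)|)" for i x using Bi[of i x] le[of i] by linarith
 moreover have "|(\<phi> x)| \<le> |(B0)| + (\<Sum>i\<in>UNIV. |(Bi i)|)" for x using B0[of x] s0 by linarith
 moreover have "0 \<le> |(B0)| + (\<Sum>i\<in>UNIV. |(Bi i)|)" using s0 by linarith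
 ultimately show ?thesis by (intro that)
qed

text \<open>A gradient candidate D together with the approximating test functions; that D is the
  weak gradient is derived later. In this form the locale serves the given solution as well as the
  explicit radial function, where D is a formula.\<close>

locale w0_approx =
 fixes \<Omega> :: "(real^'n::finite) set" and p :: "'n => real" and u :: "real^'n => real"
  and D :: "real^'n => real^'n" and \<phi> :: "nat => real^'n => real"
 assumes op: "open \<Omega>" and bdd: "bounded \<Omega>" and p: "!!i. p i > 1"
  and u_meas [measurable]: "u \<in> BM (LB \<Omega>)" and u_int: "integrable (LB \<Omega>) u"
  and D_meas [measurable]: "!!i. (%x. D x $ i) \<in> BM (LB \<Omega>)"
  and D_int: "!!i. integrable (LB \<Omega>) (%x. |(D x $ i)| powr p i)"
  and \<phi>: "!!k. \<phi> k \<in> test_funs \<Omega>"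
  and L1: "(%k. LINT x|LB \<Omega>. |(\<phi> k x - u x)|) \<leadsto> 0"
  and ae: "AE x in LB \<Omega>. (%k. \<phi> k x) \<leadsto> u x"
  and Lp_lim: "!!i. (%k. LINT x|LB \<Omega>. |(pd i (\<phi> k) x - D x $ i)| powr p i) \<leadsto> 0"
begin

abbreviation "M \<equiv> LB \<Omega>"

lemma \<Omega>_borel [measurable]: "\<Omega> \<in> sets borel" using op by simp

lemma fin: "finite_measure M"
 using op bdd by (intro finite_measure_lebesgue_on bounded_set_imp_lmeasurable) auto

sublocale finite_measure M by (rule fin)

lemma test_meas [measurable]:
 assumes "\<psi> \<in> test_funs \<Omega>'"
 shows "\<psi> \<in> BM M" "pd i \<psi> \<in> BM M" using C1_borel[OF test_funs_C1[OF assms]] C1_pd_borel[OF test_funs_C1[OF assms]]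
 by (auto intro: borel_imp_lebesgue_on)

lemma test_pd_Lp:
 assumes "\<psi> \<in> test_funs \<Omega>'" "r \<ge> 0"
 shows "integrable M (%x. |(pd i \<psi> x)| powr r)"
proof -
 obtain B where B: "B \<ge> 0" "!!i x. |(pd i \<psi> x)| \<le> B" using test_fun_bounded[OF assms(1)] by metis
 note [measurable] = test_meas[OF assms(1)]
 show ?thesis by (rule integrable_const_bound[where B = "B powr r"])
   (use B assms(2) in \<open>auto intro!: AE_I2 powr_mono2\<close>)
qed

lemma pd_meas [measurable]: "\<phi> k \<in> BM M" "pd i (\<phi> k) \<in> BM M"
 using test_meas[OF \<phi>] by auto

lemma pd_diff_int: "integrable M (%x. |(pd i (\<phi> k) x - D x $ i)| powr p i)"
 using p[of i] by (intro Lp_diff_integrable D_int test_pd_Lp[OF \<phi>]) auto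

lemma pairing:
 assumes [measurable]: "b \<in> BM M" and b: "integrable M (%x. |(b x)| powr conj_exp (p i))"
  and \<theta>: "continuous_on UNIV \<theta>" "!!x. |(\<theta> x)| \<le> B"
 shows "integrable M (%x. b x * (\<theta> (\<phi> k x) * pd i (\<phi> k) x))"
  "integrable M (%x. b x * (\<theta> (u x) * D x $ i))"
  "(%k. LINT x|M. b x * (\<theta> (\<phi> k x) * pd i (\<phi> k) x)) \<leadsto> (LINT x|M. b x * (\<theta> (u x) * D x $ i))"
proof -
 have [measurable]: "\<theta> \<in> BM borel" by (rule borel_measurable_continuous_onI[OF \<theta>(1)])
 have a: "AE x in M. (%k. \<theta> (\<phi> k x)) \<leadsto> \<theta> (u x)"
  using ae by eventually_elim (rule continuous_on_tendsto_compose[OF \<theta>(1)], auto)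
 note P = Lp_pairing_tendsto[where ck = "%k. pd i (\<phi> k)" and c = "%x. D x $ i" and \<theta>k = "%k x. \<theta> (\<phi> k x)"
   and \<theta> = "%x. \<theta> (u x)", OF _ _ _ _ _ p b D_int pd_diff_int Lp_lim \<theta>(2) a]
 show "integrable M (%x. b x * (\<theta> (\<phi> k x) * pd i (\<phi> k) x))" by (rule P(1)) measurable
 show "integrable M (%x. b x * (\<theta> (u x) * D x $ i))" by (rule P(2)) measurable
 show "(%k. LINT x|M. b x * (\<theta> (\<phi> k x) * pd i (\<phi> k) x)) \<leadsto> (LINT x|M. b x * (\<theta> (u x) * D x $ i))"
  by (rule P(3)) measurable
qed

text \<open>\<eta>(\<phi>_k) is an admissible test function by the chain rule. The limit in k turns
  an equation known for test functions into one tested with \<eta>(u).\<close>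

lemma testing:
 assumes [measurable]: "!!i. b i \<in> BM M"
  and b: "!!i. integrable M (%x. |(b i x)| powr conj_exp (p i))"
  and f: "integrable M f"
  and eq: "!!\<psi>. \<psi> \<in> test_funs \<Omega> ==> (\<Sum>i\<in>UNIV. LINT x|M. b i x * pd i \<psi> x) = (LINT x|M. f x * \<psi> x)"
  and \<eta>: "smooth1 \<eta>" "\<eta> 0 = 0" "!!x. (\<eta> has_real_derivative \<theta> x) (at x)" "smooth1 \<theta>"
   "!!x. |(\<eta> x)| \<le> B" "!!x. |(\<theta> x)| \<le> B"
 shows "(\<Sum>i\<in>UNIV. LINT x|M. b i x * (\<theta> (u x) * D x $ i)) = (LINT x|M. f x * \<eta> (u x))"
proof -
 have [measurable]: "f \<in> BM M" using f by simp
 have [measurable]: "\<eta> \<in> BM borel" by (rule borel_measurable_continuous_onI[OF smooth1_continuous[OF \<eta>(1)]])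
 have "(%k. \<Sum>i\<in>UNIV. LINT x|M. b i x * (\<theta> (\<phi> k x) * pd i (\<phi> k) x))
   \<leadsto> (\<Sum>i\<in>UNIV. LINT x|M. b i x * (\<theta> (u x) * D x $ i))"
  by (intro tendsto_sum pairing(3)[OF _ b smooth1_continuous[OF \<eta>(4)] \<eta>(6)]) measurable
 moreover have "(\<Sum>i\<in>UNIV. LINT x|M. b i x * (\<theta> (\<phi> k x) * pd i (\<phi> k) x)) = (LINT x|M. f x * \<eta> (\<phi> k x))" for k
  using eq[OF test_funs_compose[OF \<phi> \<eta>(1,2)], of k] by (simp add: partial_deriv_compose(2)[OF \<eta>(3) test_funs_diff[OF \<phi>]])
 moreover have "(%k. LINT x|M. f x * \<eta> (\<phi> k x)) \<leadsto> (LINT x|M. f x * \<eta> (u x))"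
 proof (rule integral_dominated_convergence[where s = "%k x. f x * \<eta> (\<phi> k x)" and f = "%x. f x * \<eta> (u x)" and w = "%x. |(f x)| * B"])
  show "AE x in M. (%k. f x * \<eta> (\<phi> k x)) \<leadsto> f x * \<eta> (u x)" using ae by eventually_elim
    (rule tendsto_mult_left, rule continuous_on_tendsto_compose[OF smooth1_continuous[OF \<eta>(1), of UNIV]], auto)
  show "AE x in M. norm (f x * \<eta> (\<phi> k x)) \<le> |(f x)| * B" for k by (intro AE_I2) (simp add: abs_mult \<eta>(5) mult_left_mono)
  show "integrable M (%x. |(f x)| * B)" using f by simp
 qed measurable
 ultimately show ?thesis using LIMSEQ_unique by fastforce
qed

text \<open>The Poincare inequality for the approximating test functions, passed to the limit by
  Fatou's lemma. The factor 2^p comes from splitting their derivatives into D and the error.\<close>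

lemma Poincare_limit:
 obtains L where "L > 0"
  "!!i. (\<integral>\<^sup>+x. ennreal ( |(u x)| powr p i) \<partial>M) \<le> ennreal (L powr p i * (2 powr p i * (LINT x|M. |(D x $ i)| powr p i)))"
proof -
 obtain L where L: "L > 0" "!!x i. x \<in> \<Omega> ==> x + axis i L \<notin> \<Omega>" using bounded_shift_outside[OF bdd] by blast
 have "(\<integral>\<^sup>+x. ennreal ( |(u x)| powr p i) \<partial>M) \<le> ennreal (L powr p i * (2 powr p i * (LINT x|M. |(D x $ i)| powr p i)))" for i
 proof -
  have p0: "p i > 0" using p[of i] by simp
  define I where "I k = (LINT x|M. |(pd i (\<phi> k) x - D x $ i)| powr p i)" for k
  define d where "d = (LINT x|M. |(D x $ i)| powr p i)"
  have bk: "(\<integral>\<^sup>+x. ennreal ( |(\<phi> k x)| powr p i) \<partial>M) \<le> ennreal (L powr p i * (2 powr p i * (I k + d)))" for k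
  proof -
   have "(\<integral>\<^sup>+x. ennreal ( |(\<phi> k x)| powr p i) \<partial>M) = (NN x. ennreal ( |(\<phi> k x)| powr p i))"
    using test_funs_outside[OF \<phi>] p0 by (subst nn_integral_lebesgue_on) (auto intro!: nn_integral_cong simp: indicator_def)
   also have "\<dots> \<le> ennreal (L powr p i) * (NN x. ennreal ( |(pd i (\<phi> k) x)| powr p i))"
    using p[of i] L by (intro Poincare[OF \<phi>]) auto
   also have "(NN x. ennreal ( |(pd i (\<phi> k) x)| powr p i)) = (\<integral>\<^sup>+x. ennreal ( |(pd i (\<phi> k) x)| powr p i) \<partial>M)"
    using partial_deriv_outside[OF \<phi>] p0 by (subst nn_integral_lebesgue_on) (auto intro!: nn_integral_cong simp: indicator_def)
   also have "\<dots> \<le> (\<integral>\<^sup>+x. ennreal (2 powr p i * ( |(pd i (\<phi> k) x - D x $ i)| powr p i + |(D x $ i)| powr p i)) \<partial>M)"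
   proof (intro nn_integral_mono ennreal_leI)
    fix x
    show "|(pd i (\<phi> k) x)| powr p i \<le> 2 powr p i * ( |(pd i (\<phi> k) x - D x $ i)| powr p i + |(D x $ i)| powr p i)"
     using abs_add_powr_le[of "p i" "pd i (\<phi> k) x - D x $ i" "D x $ i"] p0 by simp
   qed
   also have "\<dots> = ennreal (2 powr p i * (I k + d))" unfolding I_def d_def using pd_diff_int[of i k] D_int[of i]
    by (subst nn_integral_eq_integral) auto
   finally show ?thesis by (simp add: ennreal_mult' mult_left_mono)
  qed
  have "(\<integral>\<^sup>+x. ennreal ( |(u x)| powr p i) \<partial>M) = (\<integral>\<^sup>+x. liminf (%k. ennreal ( |(\<phi> k x)| powr p i)) \<partial>M)"
  proof (rule nn_integral_cong_AE)
   show "AE x in M. ennreal ( |(u x)| powr p i) = liminf (%k. ennreal ( |(\<phi> k x)| powr p i))" using ae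
   proof eventually_elim
    case (elim x)
    have "(%k. |(\<phi> k x)| powr p i) \<leadsto> |(u x)| powr p i" using p0 by (intro tendsto_powr' tendsto_rabs elim tendsto_const) auto
    hence "(%k. ennreal ( |(\<phi> k x)| powr p i)) \<leadsto> ennreal ( |(u x)| powr p i)" by (rule tendsto_ennrealI)
    thus ?case by (rule lim_imp_Liminf[OF sequentially_bot, symmetric])
   qed
  qed
  also have "\<dots> \<le> liminf (%k. \<integral>\<^sup>+x. ennreal ( |(\<phi> k x)| powr p i) \<partial>M)" by (rule nn_integral_liminf) measurable
  also have "\<dots> \<le> liminf (%k. ennreal (L powr p i * (2 powr p i * (I k + d))))" by (intro Liminf_mono always_eventually allI bk)
  also have "\<dots> = ennreal (L powr p i * (2 powr p i * (0 + d)))" unfolding I_def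
   by (intro lim_imp_Liminf tendsto_ennrealI tendsto_mult_left tendsto_add Lp_lim tendsto_const) auto
  finally show ?thesis by (simp add: d_def)
 qed
 with L(1) show ?thesis by (rule that)
qed

lemma u_Lp: "integrable M (%x. |(u x)| powr p i)"
proof -
 obtain L where L: "(\<integral>\<^sup>+x. ennreal ( |(u x)| powr p i) \<partial>M) \<le> ennreal (L powr p i * (2 powr p i * (LINT x|M. |(D x $ i)| powr p i)))"
  using Poincare_limit by metis
 show ?thesis by (rule integrableI_bounded) (use le_less_trans[OF L] in auto)
qed

text \<open>Testing with smooth truncations of u concentrates the equation on the slab J. Coercivity
  gives the full energy there, and the terms with g take back at most half of it by
  \<open>Young_half\<close>.\<close>

lemma energy_slice:
 fixes g :: "'n => real^'n => real"
 assumes lam: "!!i. lam i > 0"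
  and [measurable]: "!!i. A i \<in> BM M" "!!i. g i \<in> BM M"
  and A: "!!i. integrable M (%x. |(A i x)| powr conj_exp (p i))"
  and g: "!!i. integrable M (%x. |(g i x)| powr conj_exp (p i))"
  and f: "integrable M f"
  and eq: "!!\<psi>. \<psi> \<in> test_funs \<Omega> ==> (\<Sum>i\<in>UNIV. LINT x|M. (A i x - g i x) * pd i \<psi> x) = (LINT x|M. f x * \<psi> x)"
  and coer: "AE x in M. (\<Sum>i\<in>UNIV. A i x * D x $ i) \<ge> (\<Sum>i\<in>UNIV. lam i * |(D x $ i)| powr p i)"
  and ab: "0 \<le> a" "a < b"
  and J: "J = {s. a < |(s)| & |(s)| < b} \<or> (a = 0 & J = {s. |(s)| < b})"
 shows "1/2 * (LINT x|M. ind J (u x) * (\<Sum>i\<in>UNIV. lam i * |(D x $ i)| powr p i))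
  \<le> (LINT x|M. |(f x)| * min (max ( |(u x)| - a) 0) (b - a))
   + (\<Sum>i\<in>UNIV. 2 powr (conj_exp (p i) / p i)) * (LINT x|M. ind J (u x) * g_density p lam g x)"
proof -
 define q where "q i = conj_exp (p i)" for i
 have q: "q i > 1" for i using conj_exp_props[OF p] by (simp add: q_def)
 define m where "m s = min (max ( |(s)| - a) 0) (b - a)" for s
 define en where "en x = (\<Sum>i\<in>UNIV. lam i * |(D x $ i)| powr p i)" for x
 define C0 where "C0 = (\<Sum>i\<in>UNIV. 2 powr (q i / p i) :: real)"
 define de where "de = g_density p lam g"
 have [measurable]: "f \<in> BM M" using f by simp
 have [measurable]: "J \<in> sets borel" using J by (elim disjE) (auto intro!: borel_open open_Collect_less open_Collect_conj continuous_intros)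
 have en_int: "integrable M en" unfolding en_def using D_int by auto
 have en0: "en x \<ge> 0" for x unfolding en_def using lam by (intro sum_nonneg mult_nonneg_nonneg) (auto intro: less_imp_le)
 have de_int: "integrable M de" unfolding de_def g_density_def[abs_def] using g by auto
 have de0: "de x \<ge> 0" for x unfolding de_def g_density_def using less_imp_le[OF less_trans[OF zero_less_one q]]
  by (intro sum_nonneg divide_nonneg_nonneg mult_nonneg_nonneg) (auto simp: q_def)
 have [measurable]: "en \<in> BM M" "de \<in> BM M" using en_int de_int by auto
 have C0: "C0 \<ge> 0" unfolding C0_def by (intro sum_nonneg) auto
 have b_int: "integrable M (%x. |(A i x - g i x)| powr conj_exp (p i))" for i using q[of i] by (intro Lp_diff_integrable A g) (auto simp: q_def)
 have ptw: "AE x in M. (\<Sum>i\<in>UNIV. (A i x - g i x) * D x $ i) \<ge> 1/2 * en x - C0 * de x" using coer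
 proof eventually_elim
  case (elim x)
  have t0: "0 \<le> |(g i x)| powr q i / (q i * (lam i * p i) powr (q i / p i))" for i
   using q[of i] by (intro divide_nonneg_nonneg mult_nonneg_nonneg) auto
  have "(\<Sum>i\<in>UNIV. |(g i x * D x $ i)|) \<le> (\<Sum>i\<in>UNIV. 1/2 * (lam i * |(D x $ i)| powr p i)
    + C0 * ( |(g i x)| powr q i / (q i * (lam i * p i) powr (q i / p i))))"
  proof (intro sum_mono)
   fix i
   have "2 powr (q i / p i) \<le> C0" unfolding C0_def by (intro member_le_sum) auto
   hence "2 powr (q i / p i) * ( |(g i x)| powr q i / (q i * (lam i * p i) powr (q i / p i)))
     \<le> C0 * ( |(g i x)| powr q i / (q i * (lam i * p i) powr (q i / p i)))" by (rule mult_right_mono) (rule t0)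
   with Young_half[OF p[of i] lam[of i], of "g i x" "D x $ i"]
   show "|(g i x * D x $ i)| \<le> 1/2 * (lam i * |(D x $ i)| powr p i)
    + C0 * ( |(g i x)| powr q i / (q i * (lam i * p i) powr (q i / p i)))" by (simp add: q_def)
  qed
  also have "\<dots> = 1/2 * en x + C0 * de x" by (simp add: sum.distrib sum_distrib_left en_def de_def g_density_def q_def)
  finally have 1: "(\<Sum>i\<in>UNIV. g i x * D x $ i) \<le> 1/2 * en x + C0 * de x" by (smt (verit) sum_mono)
  have "(\<Sum>i\<in>UNIV. (A i x - g i x) * D x $ i) = (\<Sum>i\<in>UNIV. A i x * D x $ i) - (\<Sum>i\<in>UNIV. g i x * D x $ i)"
   by (simp add: left_diff_distrib sum_subtractf)
  with 1 elim show ?case by (simp add: en_def)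
 qed
 obtain \<eta> \<theta> where \<eta>: "!!n. smooth1 (\<eta> n)" "!!n. smooth1 (\<theta> n)" "!!n. \<eta> n 0 = 0"
  "!!n x. (\<eta> n has_real_derivative \<theta> n x) (at x)"
  "!!n x. 0 \<le> \<theta> n x" "!!n x. \<theta> n x \<le> ind J x"
  "!!x. (%n. \<theta> n x) \<leadsto> ind J x"
  "!!n x. |(\<eta> n x)| \<le> min (max ( |(x)| - a) 0) (b - a)"
  "!!x. (%n. \<eta> n x) \<leadsto> trunc a b x" by (rule smooth_truncation[OF ab J]) (rule that)
 have [measurable]: "\<theta> n \<in> BM borel" "\<eta> n \<in> BM borel" for n by (intro borel_measurable_continuous_onI smooth1_continuous \<eta>)+
 have \<theta>1: "|(\<theta> n x)| \<le> 1" for n x using \<eta>(5,6)[of n x] by (cases "x \<in> J") auto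
 have \<theta>_bound: "integrable M (%x. \<theta> n (u x) * F x)" "integrable M (%x. ind J (u x) * F x)"
  if "integrable M F" for n F
 proof -
  have [measurable]: "F \<in> BM M" using that by simp
  show "integrable M (%x. \<theta> n (u x) * F x)" "integrable M (%x. ind J (u x) * F x)" by (rule Bochner_Integration.integrable_bound[OF that];
     auto intro!: AE_I2 simp: abs_mult \<theta>1 mult_left_le_one_le indicator_def)+
 qed
 have m_int: "integrable M (%x. |(f x)| * m (u x))" by (rule Bochner_Integration.integrable_bound[where f = "%x. (b - a) * f x"])
   (use f ab in \<open>auto intro!: AE_I2 simp: m_def abs_mult mult.commute intro: mult_left_mono\<close>)
 \<comment> \<open>On the right \<open>\<theta> n\<close> is already replaced by the indicator of J,
   so the bound is uniform in n and only the left side has to converge.\<close>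
 have step: "1/2 * (LINT x|M. \<theta> n (u x) * en x) \<le> (LINT x|M. |(f x)| * m (u x)) + C0 * (LINT x|M. ind J (u x) * de x)" for n
 proof -
  define B where "B = max 1 (b - a)"
  have BB: "|(\<eta> n x)| \<le> B" "|(\<theta> n x)| \<le> B" for x using \<eta>(8)[of n x] \<theta>1[of n x] by (auto simp: B_def)
  have pi: "integrable M (%x. (A i x - g i x) * (\<theta> n (u x) * D x $ i))" for i
   by (rule pairing(2)[OF _ b_int smooth1_continuous[OF \<eta>(2)] BB(2)]) measurable
  have "(\<Sum>i\<in>UNIV. LINT x|M. (A i x - g i x) * (\<theta> n (u x) * D x $ i)) = (LINT x|M. f x * \<eta> n (u x))"
   by (rule testing[OF _ b_int f eq \<eta>(1,3,4,2) BB]) auto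
  hence e1: "(LINT x|M. \<theta> n (u x) * (\<Sum>i\<in>UNIV. (A i x - g i x) * D x $ i)) = (LINT x|M. f x * \<eta> n (u x))"
   using pi by (simp add: sum_distrib_left mult_ac)
  have pi2: "integrable M (%x. \<theta> n (u x) * (\<Sum>i\<in>UNIV. (A i x - g i x) * D x $ i))" using pi by (simp add: sum_distrib_left mult_ac)
  have "(LINT x|M. \<theta> n (u x) * (1/2 * en x - C0 * de x)) \<le> (LINT x|M. \<theta> n (u x) * (\<Sum>i\<in>UNIV. (A i x - g i x) * D x $ i))"
  proof (rule integral_mono_AE[OF _ pi2])
   show "integrable M (%x. \<theta> n (u x) * (1/2 * en x - C0 * de x))" using en_int de_int by (intro \<theta>_bound(1)) auto
   show "AE x in M. \<theta> n (u x) * (1/2 * en x - C0 * de x) \<le> \<theta> n (u x) * (\<Sum>i\<in>UNIV. (A i x - g i x) * D x $ i)"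
    using ptw by eventually_elim (rule mult_left_mono, auto simp: \<eta>(5))
  qed
  also note e1
  also have "(LINT x|M. f x * \<eta> n (u x)) \<le> (LINT x|M. |(f x)| * m (u x))"
  proof (intro integral_mono m_int)
   have em: "|(\<eta> n s)| \<le> |(m s)|" for s using \<eta>(8)[of n s] unfolding m_def by linarith
   show fe: "f x * \<eta> n (u x) \<le> |(f x)| * m (u x)" for x
   proof -
    have "f x * \<eta> n (u x) \<le> |(f x)| * |(\<eta> n (u x))|" by (metis abs_ge_self abs_mult)
    also have "\<dots> \<le> |(f x)| * m (u x)" using \<eta>(8) by (intro mult_left_mono) (auto simp: m_def)
    finally show ?thesis .
   qed
   show "integrable M (%x. f x * \<eta> n (u x))" by (rule Bochner_Integration.integrable_bound[OF m_int])
     (use em in \<open>auto intro!: AE_I2 mult_left_mono simp: abs_mult\<close>)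
  qed
  also have "(LINT x|M. \<theta> n (u x) * (1/2 * en x - C0 * de x)) = 1/2 * (LINT x|M. \<theta> n (u x) * en x) - C0 * (LINT x|M. \<theta> n (u x) * de x)"
   using \<theta>_bound(1)[OF en_int] \<theta>_bound(1)[OF de_int] by (simp add: right_diff_distrib mult.left_commute)
  finally have 1: "1/2 * (LINT x|M. \<theta> n (u x) * en x) \<le> (LINT x|M. |(f x)| * m (u x)) + C0 * (LINT x|M. \<theta> n (u x) * de x)" by simp
  have "(LINT x|M. \<theta> n (u x) * de x) \<le> (LINT x|M. ind J (u x) * de x)"
   by (intro integral_mono \<theta>_bound de_int mult_right_mono \<eta> de0)
  thus ?thesis using 1 C0 by (smt (verit) mult_left_mono)
 qed
 have "(%n. LINT x|M. \<theta> n (u x) * en x) \<leadsto> (LINT x|M. ind J (u x) * en x)"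
 proof (rule integral_dominated_convergence[where s = "%n x. \<theta> n (u x) * en x" and f = "%x. ind J (u x) * en x" and w = en])
  show "AE x in M. (%n. \<theta> n (u x) * en x) \<leadsto> ind J (u x) * en x" by (intro AE_I2 tendsto_mult_right \<eta>)
  show "AE x in M. norm (\<theta> n (u x) * en x) \<le> en x" for n by (intro AE_I2) (simp add: abs_mult \<theta>1 en0 mult_left_le_one_le)
 qed (use en_int in auto)
 hence "1/2 * (LINT x|M. ind J (u x) * en x) \<le> (LINT x|M. |(f x)| * m (u x)) + C0 * (LINT x|M. ind J (u x) * de x)"
  using step by (intro LIMSEQ_le_const2[OF tendsto_mult_left]) auto
 thus ?thesis by (simp add: m_def[abs_def] en_def C0_def q_def de_def)
qed

text \<open>Two successive limits: first over the test functions for a fixed smooth truncation,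
  whose continuous derivative passes through a.e. convergence, and then over the truncations. The
  derivative of \<open>trunc\<close> itself is discontinuous, so the limits are not taken
  together.\<close>

lemma trunc_translation:
 assumes ab: "0 \<le> a" "a < b" and J: "J = {s. a < |(s)| & |(s)| < b}"
  and [measurable]: "v \<in> BM borel" and v0: "!!x. x \<notin> \<Omega> ==> v x = 0"
  and uv: "AE x in lborel. x \<in> \<Omega> --> u x = v x"
 shows "(NN x. ennreal |(trunc a b (v (x + y)) - trunc a b (v x))|)
  \<le> ennreal (\<Sum>i\<in>UNIV. |(y $ i)| * (LINT x|M. ind J (u x) * |(D x $ i)|))"
proof -
 obtain \<eta> \<theta> where \<eta>: "!!n. smooth1 (\<eta> n)" "!!n. smooth1 (\<theta> n)" "!!n. \<eta> n 0 = 0"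
  "!!n x. (\<eta> n has_real_derivative \<theta> n x) (at x)"
  "!!n x. 0 \<le> \<theta> n x" "!!n x. \<theta> n x \<le> ind J x"
  "!!x. (%n. \<theta> n x) \<leadsto> ind J x"
  "!!n x. |(\<eta> n x)| \<le> min (max ( |(x)| - a) 0) (b - a)"
  "!!x. (%n. \<eta> n x) \<leadsto> trunc a b x" by (rule smooth_truncation[OF ab disjI1[OF J]]) (rule that)
 have [measurable]: "\<theta> n \<in> BM borel" "\<eta> n \<in> BM borel" for n by (intro borel_measurable_continuous_onI smooth1_continuous \<eta>)+
 have [measurable]: "trunc a b \<in> BM borel" unfolding trunc_def[abs_def] by measurable
 have [measurable]: "J \<in> sets borel" unfolding J by (auto intro!: borel_open open_Collect_less open_Collect_conj continuous_intros)
 have \<theta>1: "|(\<theta> n x)| \<le> 1" for n x using \<eta>(5,6)[of n x] by (cases "x \<in> J") auto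
 have absD: "integrable M (%x. |(D x $ i)|)" for i
  using Holder_integrable(1)[of "%_. 1" M "%x. D x $ i" "p i"] p D_int by (auto intro: integrable_abs)
 have lborel_ae: "AE x in lborel. (%k. \<phi> k x) \<leadsto> v x"
 proof -
  have "AE x in lborel. x \<in> \<Omega> --> (%k. \<phi> k x) \<leadsto> u x" using ae by (simp add: AE_lebesgue_on_iff)
  thus ?thesis using uv
  proof eventually_elim
   case (elim x)
   thus ?case using v0[of x] test_funs_outside[OF \<phi>, of x] by (cases "x \<in> \<Omega>") auto
  qed
 qed
 have step: "(NN x. ennreal |(\<eta> n (v (x + y)) - \<eta> n (v x))|)
  \<le> ennreal (\<Sum>i\<in>UNIV. |(y $ i)| * (LINT x|M. \<theta> n (u x) * |(D x $ i)|))" for n y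
 proof (rule translation_bound_limit[where w = "%x. \<eta> n (v x)" and W = "%k x. \<eta> n (\<phi> k x)"
   and b = "%i. LINT x|M. \<theta> n (u x) * |(D x $ i)|"
   and B = "%k i. LINT x|M. \<theta> n (\<phi> k x) * |(pd i (\<phi> k) x)|"])
  show "(%x. \<eta> n (\<phi> k x)) \<in> BM borel" for k using C1_borel[OF test_funs_C1[OF \<phi>], of k] by measurable
  show "(%x. \<eta> n (v x)) \<in> BM borel" by measurable
  show "AE x in lborel. (%k. \<eta> n (\<phi> k x)) \<leadsto> \<eta> n (v x)"
   using lborel_ae by eventually_elim (rule continuous_on_tendsto_compose[OF smooth1_continuous[OF \<eta>(1), of UNIV]], auto)
  show "(NN x. ennreal |(\<eta> n (\<phi> k (x + y)) - \<eta> n (\<phi> k x))|)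
   \<le> ennreal (\<Sum>i\<in>UNIV. |(y $ i)| * (LINT x|M. \<theta> n (\<phi> k x) * |(pd i (\<phi> k) x)|))" for k y
  proof -
   have t: "(%x. \<eta> n (\<phi> k x)) \<in> test_funs \<Omega>" by (rule test_funs_compose[OF \<phi> \<eta>(1,3)])
   have pd: "pd i (%x. \<eta> n (\<phi> k x)) x = \<theta> n (\<phi> k x) * pd i (\<phi> k) x" for i x
    by (rule partial_deriv_compose(2)[OF \<eta>(4) test_funs_diff[OF \<phi>]])
   have i: "(NN x. ennreal |(pd i (%x. \<eta> n (\<phi> k x)) x)|) = ennreal (LINT x|M. \<theta> n (\<phi> k x) * |(pd i (\<phi> k) x)|)" for i
   proof -
    have "(NN x. ennreal |(pd i (%x. \<eta> n (\<phi> k x)) x)|) = (\<integral>\<^sup>+x. ennreal |(pd i (%x. \<eta> n (\<phi> k x)) x)| \<partial>M)"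
     using partial_deriv_outside[OF t] by (subst nn_integral_lebesgue_on) (auto intro!: nn_integral_cong simp: indicator_def)
    also have "\<dots> = ennreal (LINT x|M. |(pd i (%x. \<eta> n (\<phi> k x)) x)|)"
     using test_pd_Lp[OF t, of 1 i] by (intro nn_integral_eq_integral) auto
    finally show ?thesis unfolding pd by (simp add: abs_mult \<eta>(5))
   qed
   have nn: "0 \<le> (LINT x|M. \<theta> n (\<phi> k x) * |(pd i (\<phi> k) x)|)" for i by (intro integral_nonneg_AE AE_I2) (simp add: \<eta>(5))
   show ?thesis using translation_L1[OF test_funs_C1[OF t], of y] unfolding i by (simp add: nn sum_nonneg flip: ennreal_mult')
  qed
  show "(%k. LINT x|M. \<theta> n (\<phi> k x) * |(pd i (\<phi> k) x)|) \<leadsto> (LINT x|M. \<theta> n (u x) * |(D x $ i)|)" for i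
  proof -
   have di: "integrable M (%x. |( |(pd i (\<phi> k) x)| - |(D x $ i)|)| powr p i)" for k
    using p[of i] by (intro Lp_diff_integrable) (auto intro: D_int test_pd_Lp[OF \<phi>])
   \<comment> \<open>The reverse triangle inequality transfers strong convergence of the derivatives
     to their absolute values, to which \<open>Lp_pairing_tendsto\<close> is applied with b =
     1.\<close>
   have l: "(%k. LINT x|M. |( |(pd i (\<phi> k) x)| - |(D x $ i)|)| powr p i) \<leadsto> 0"
   proof (rule tendsto_sandwich[OF _ _ tendsto_const Lp_lim[of i]])
    show "\<forall>\<^sub>F k in sequentially. 0 \<le> (LINT x|M. |( |(pd i (\<phi> k) x)| - |(D x $ i)|)| powr p i)"
     by (intro always_eventually allI integral_nonneg_AE AE_I2) auto
    show "\<forall>\<^sub>F k in sequentially. (LINT x|M. |( |(pd i (\<phi> k) x)| - |(D x $ i)|)| powr p i)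
      \<le> (LINT x|M. |(pd i (\<phi> k) x - D x $ i)| powr p i)"
     using p[of i] by (intro always_eventually allI integral_mono di pd_diff_int powr_mono2) auto
   qed
   have a: "AE x in M. (%k. \<theta> n (\<phi> k x)) \<leadsto> \<theta> n (u x)"
    using ae by eventually_elim (rule continuous_on_tendsto_compose[OF smooth1_continuous[OF \<eta>(2), of UNIV]], auto)
   have "(%k. LINT x|M. 1 * (\<theta> n (\<phi> k x) * |(pd i (\<phi> k) x)|)) \<leadsto> (LINT x|M. 1 * (\<theta> n (u x) * |(D x $ i)|))"
    by (rule Lp_pairing_tendsto(3)[OF _ _ _ _ _ p _ _ di l \<theta>1 a]) (use D_int in auto)
   thus ?thesis by simp
  qed
 qed
 show ?thesis
 proof (rule translation_bound_limit[where w = "%x. trunc a b (v x)" and W = "%n x. \<eta> n (v x)" and b = "%i. LINT x|M. ind J (u x) * |(D x $ i)|"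
    and B = "%n i. LINT x|M. \<theta> n (u x) * |(D x $ i)|"])
  show "AE x in lborel. (%k. \<eta> k (v x)) \<leadsto> trunc a b (v x)" by (intro AE_I2 \<eta>)
  show "(NN x. ennreal |(\<eta> n (v (x + y)) - \<eta> n (v x))|)
   \<le> ennreal (\<Sum>i\<in>UNIV. |(y $ i)| * (LINT x|M. \<theta> n (u x) * |(D x $ i)|))" for n y by (rule step)
  show "(%n. LINT x|M. \<theta> n (u x) * |(D x $ i)|) \<leadsto> (LINT x|M. ind J (u x) * |(D x $ i)|)" for i
  proof (rule integral_dominated_convergence[where s = "%n x. \<theta> n (u x) * |(D x $ i)|" and f = "%x. ind J (u x) * |(D x $ i)|" and w = "%x. |(D x $ i)|"])
   show "AE x in M. (%n. \<theta> n (u x) * |(D x $ i)|) \<leadsto> ind J (u x) * |(D x $ i)|" by (intro AE_I2 tendsto_mult_right \<eta>)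
   show "AE x in M. norm (\<theta> n (u x) * |(D x $ i)|) \<le> |(D x $ i)|" for n by (intro AE_I2) (simp add: abs_mult \<theta>1 mult_left_le_one_le)
  qed (use absD in auto)
 qed measurable
qed

end

lemma harm_mean_sum: "(\<Sum>i\<in>UNIV. 1/p i) = real CARD('n) / harm_mean p" for p :: "'n::finite => real"
 by (simp add: harm_mean_def)

lemma harm_mean_gt_1:
 fixes p :: "'n::finite => real"
 assumes "!!i. p i > 1"
 shows "harm_mean p > 1"
proof -
 have "1/p i < 1" for i using assms[of i] by (simp add: divide_less_eq)
 hence "(\<Sum>i\<in>(UNIV::'n set). 1/p i) < (\<Sum>i\<in>(UNIV::'n set). 1)" by (intro sum_strict_mono) auto
 moreover have "(\<Sum>i\<in>(UNIV::'n set). 1/p i) > 0" using assms by (intro sum_pos) (auto intro: less_trans[OF zero_less_one])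
 ultimately show ?thesis by (simp add: harm_mean_def field_simps)
qed

text \<open>Some exponent is at least the harmonic mean. The Poincare inequality in that exponent
  makes |u|^P, which occurs in the growth condition, integrable.\<close>

lemma harm_mean_le_max:
 fixes p :: "'n::finite => real"
 assumes "!!i. p i > 1"
 obtains i where "harm_mean p \<le> p i"
proof -
 have "\<exists>i. harm_mean p \<le> p i"
 proof (rule ccontr)
  assume "\<nexists>i. harm_mean p \<le> p i"
  hence *: "p i < harm_mean p" for i by (auto simp: not_le)
  have "(\<Sum>i\<in>(UNIV::'n set). 1 / harm_mean p) < (\<Sum>i\<in>(UNIV::'n set). 1/p i)"
   using assms * by (intro sum_strict_mono divide_strict_left_mono mult_pos_pos)
    (auto intro: less_trans[OF zero_less_one] harm_mean_gt_1)
  thus False by (simp add: harm_mean_sum)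
 qed
 thus ?thesis using that by blast
qed

text \<open>The norms in the definition of \<open>W0\<close> give convergence in the mean; a
  subsequence converges also a.e.\<close>

lemma W0_imp_approx:
 fixes \<Omega> :: "(real^'n::finite) set"
 assumes "open \<Omega>" "bounded \<Omega>" "!!i. p i > 1" "W0 \<Omega> p u"
 obtains \<phi> where "w0_approx \<Omega> p u (weak_grad \<Omega> u) \<phi>"
proof -
 let ?M = "LB \<Omega>"
 let ?D = "weak_grad \<Omega> u"
 interpret finite_measure ?M using assms by (intro finite_measure_lebesgue_on bounded_set_imp_lmeasurable) auto
 obtain \<phi> where \<phi>: "!!k. \<phi> k \<in> test_funs \<Omega>"
  and l1: "(%k. Lp_norm \<Omega> 1 (%x. \<phi> k x - u x)) \<leadsto> 0"
  and lp: "(%k::nat. \<Sum>i\<in>UNIV. Lp_norm \<Omega> (p i) (%x. pd i (\<phi> k) x - ?D x $ i)) \<leadsto> 0" using assms(4) by (auto simp: W0_def)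
 have [measurable]: "u \<in> BM ?M" and ui: "integrable ?M (%x. |(u x)| powr 1)" using assms(4) by (auto simp: W0_def Lp_def)
 have "integrable ?M (%x. |(u x)|)" using ui by simp
 hence u_int: "integrable ?M u" by (rule integrable_abs_cancel) measurable
 have D: "(%x. ?D x $ i) \<in> BM ?M" "integrable ?M (%x. |(?D x $ i)| powr p i)" for i using assms(4) by (auto simp: W0_def Lp_def)
 have [measurable]: "\<phi> k \<in> BM ?M" for k using C1_borel[OF test_funs_C1[OF \<phi>]] by (rule borel_imp_lebesgue_on)
 have \<phi>_int: "integrable ?M (\<phi> k)" for k
 proof -
  obtain B where "!!x. |(\<phi> k x)| \<le> B" using test_fun_bounded[OF \<phi>] by metis
  thus ?thesis by (intro integrable_const_bound[where B = B]) auto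
 qed
 have L1: "(%k. LINT x|?M. |(\<phi> k x - u x)|) \<leadsto> 0" using l1 by (simp add: Lp_norm_def integral_nonneg_AE)
 have Lpi: "(%k. LINT x|?M. |(pd i (\<phi> k) x - ?D x $ i)| powr p i) \<leadsto> 0" for i
 proof -
  have p0: "p i > 0" using assms(3)[of i] by simp
  have n: "(%k. Lp_norm \<Omega> (p i) (%x. pd i (\<phi> k) x - ?D x $ i)) \<leadsto> 0"
  proof (rule tendsto_sandwich[OF _ _ tendsto_const lp]; intro always_eventually allI)
   fix k
   show "0 \<le> Lp_norm \<Omega> (p i) (%x. pd i (\<phi> k) x - ?D x $ i)" by (simp add: Lp_norm_def)
   show "Lp_norm \<Omega> (p i) (%x. pd i (\<phi> k) x - ?D x $ i)
     \<le> (\<Sum>i\<in>UNIV. Lp_norm \<Omega> (p i) (%x. pd i (\<phi> k) x - ?D x $ i))"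
    by (rule member_le_sum[where f = "%i. Lp_norm \<Omega> (p i) (%x. pd i (\<phi> k) x - ?D x $ i)"])
     (auto simp: Lp_norm_def)
  qed
  have "(%k. Lp_norm \<Omega> (p i) (%x. pd i (\<phi> k) x - ?D x $ i) powr p i) \<leadsto> 0"
   using p0 by (intro tendsto_zero_powrI[OF n tendsto_const]) (auto simp: Lp_norm_def)
  thus ?thesis using p0 by (simp add: Lp_norm_def powr_powr integral_nonneg_AE)
 qed
 obtain r where r: "strict_mono r" "AE x in ?M. (%n. \<phi> (r n) x - u x) \<leadsto> 0"
  using tendsto_L1_AE_subseq[of ?M "%k x. \<phi> k x - u x"] \<phi>_int u_int L1 by auto
 have "w0_approx \<Omega> p u ?D (%k. \<phi> (r k))"
 proof
  show "AE x in ?M. (%k. \<phi> (r k) x) \<leadsto> u x" using r(2) by eventually_elim (simp add: LIM_zero_iff)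
  show "(%k. LINT x|?M. |(\<phi> (r k) x - u x)|) \<leadsto> 0" using LIMSEQ_subseq_LIMSEQ[OF L1 r(1)] by (simp add: o_def)
  show "(%k. LINT x|?M. |(pd i (\<phi> (r k)) x - ?D x $ i)| powr p i) \<leadsto> 0" for i
   using LIMSEQ_subseq_LIMSEQ[OF Lpi r(1)] by (simp add: o_def)
 qed (use assms D u_int \<phi> in auto)
 thus ?thesis by (rule that)
qed

text \<open>The pair (u, D) is a limit of simple functions. For a simple function the composition is
  pieced together from finitely many slices \<open>a x s \<xi>\<close> with constant s and \<xi>,
  and continuity in (s, \<xi>) passes to the limit outside a null set.\<close>

lemma Caratheodory_measurable:
 fixes \<Omega> :: "(real^'n::finite) set"
 assumes C: "Caratheodory \<Omega> a" and \<Omega>: "\<Omega> \<in> sets borel"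
  and [measurable]: "u \<in> BM (LB \<Omega>)" "!!i. (%x. D x $ i) \<in> BM (LB \<Omega>)"
 shows "(%x. a x (u x) (D x) $ j) \<in> BM (LB \<Omega>)"
proof -
 let ?M = "LB \<Omega>"
 have am: "(%x. a x s \<xi> $ j) \<in> BM ?M" for s \<xi>
 proof -
  have [measurable]: "(%x. a x s \<xi>) \<in> BM ?M" using C by (auto simp: Caratheodory_def)
  have "(%x. a x s \<xi> \<bullet> axis j 1) \<in> BM ?M" by measurable
  thus ?thesis by (simp add: inner_axis)
 qed
 have [measurable]: "D \<in> BM ?M" unfolding borel_measurable_euclidean_space[of D] by (auto simp: Basis_vec_def inner_axis)
 define z where "z x = (u x, D x)" for x
 have z: "z \<in> BM ?M" unfolding z_def by measurable
 obtain F where F: "!!i. simple_function ?M (F i)" "!!x. x \<in> space ?M ==> (%i. F i x) \<leadsto> z x"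
  using borel_measurable_implies_sequence_metric[OF z, of "(0,0)"] by blast
 have Fm: "(%x. a x (fst (F i x)) (snd (F i x)) $ j) \<in> BM ?M" for i
 proof (rule measurable_compose_countable'[where I = "F i ` space ?M" and f = "%w x. a x (fst w) (snd w) $ j" and g = "F i"])
  have c: "countable (F i ` space ?M)" using simple_functionD(1)[OF F(1)] by (rule countable_finite)
  thus "countable (F i ` space ?M)" .
  show "F i \<in> measurable ?M (count_space (F i ` space ?M))"
   using simple_functionD(2)[OF F(1)] by (subst measurable_count_space_eq_countable[OF c]) auto
 qed (rule am)
 obtain N where N: "N \<in> null_sets ?M" "{x \<in> space ?M. \<not> continuous_on UNIV (%(s, \<xi>). a x s \<xi>)} \<subseteq> N"
  using C unfolding Caratheodory_def eventually_ae_filter by auto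
 have N': "N \<in> sets ?M" using N(1) by auto
 define g where "g x = (if x \<in> N then 0 else a x (u x) (D x) $ j)" for x
 have "g \<in> BM ?M"
 proof (rule borel_measurable_LIMSEQ_metric)
  show "(%x. if x \<in> N then 0 else a x (fst (F i x)) (snd (F i x)) $ j) \<in> BM ?M" for i using N' by (intro measurable_If_set Fm) auto
  show "(%i. if x \<in> N then 0 else a x (fst (F i x)) (snd (F i x)) $ j) \<leadsto> g x" if x: "x \<in> space ?M" for x
  proof (cases "x \<in> N")
   case False
   hence c: "continuous_on UNIV (%(s, \<xi>). a x s \<xi>)" using N(2) x by auto
   have "(%i. (%(s, \<xi>). a x s \<xi>) (F i x)) \<leadsto> (%(s, \<xi>). a x s \<xi>) (z x)"
    using F(2)[OF x] by (intro continuous_on_tendsto_compose[OF c]) auto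
   from tendsto_vec_nth[OF this, of j] show ?thesis using False by (simp add: g_def z_def case_prod_beta)
  qed (simp add: g_def)
 qed
 hence gl: "(%x. ind \<Omega> x *\<^sub>R g x) \<in> BM lebesgue" using \<Omega> by (subst (asm) borel_measurable_restrict_space_iff) auto
 have "AE x in ?M. x \<notin> N" using N(1) by (rule AE_not_in)
 hence "AE x in lebesgue. x \<in> \<Omega> --> x \<notin> N" using \<Omega> by (simp add: AE_restrict_space_iff)
 hence "AE x in lebesgue. ind \<Omega> x *\<^sub>R g x = ind \<Omega> x *\<^sub>R (a x (u x) (D x) $ j)" by eventually_elim (auto simp: g_def)
 from borel_measurable_AE[OF gl this] show ?thesis using \<Omega> by (subst borel_measurable_restrict_space_iff) auto
qed

text \<open>The exponent 1/p_j' in the growth condition is such that the p_j'-th power of the flux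
  is bounded by an integrable bracket. Hence the flux can be paired with the derivatives of W0
  functions.\<close>

lemma flux_integrable:
 fixes \<Omega> :: "(real^'n::finite) set"
 assumes "w0_approx \<Omega> p u D \<phi>" "structure_conds \<Omega> p lam \<beta> h a"
 shows "(%x. a x (u x) (D x) $ j) \<in> BM (LB \<Omega>)"
  "integrable (LB \<Omega>) (%x. |(a x (u x) (D x) $ j)| powr conj_exp (p j))"
proof -
 interpret w0_approx \<Omega> p u D \<phi> by fact
 have st: "Caratheodory \<Omega> a" "\<beta> > 0" "integrable M h" "AE x in M. h x \<ge> 0"
   "AE x in M. \<forall>s \<xi> j. |(a x s \<xi> $ j)|
    \<le> \<beta> * (h x + |(s)| powr harm_mean p + (\<Sum>i\<in>UNIV. |(\<xi> $ i)| powr p i)) powr (1 / conj_exp (p j))"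
  using assms(2) by (auto simp: structure_conds_def)
 define q where "q = conj_exp (p j)"
 have q: "q > 1" using conj_exp_props[OF p] by (simp add: q_def)
 show [measurable]: "(%x. a x (u x) (D x) $ j) \<in> BM M" by (rule Caratheodory_measurable[OF st(1) \<Omega>_borel]) auto
 define P where "P = harm_mean p"
 have P: "P > 1" using harm_mean_gt_1[OF p] by (simp add: P_def)
 obtain i where i: "P \<le> p i" using harm_mean_le_max[of p, OF p] unfolding P_def by blast
 have uP: "integrable M (%x. |(u x)| powr P)"
 proof (rule Bochner_Integration.integrable_bound[where f = "%x. 1 + |(u x)| powr p i"])
  show "integrable M (%x. 1 + |(u x)| powr p i)" using u_Lp[of i] by simp
  show "AE x in M. norm ( |(u x)| powr P) \<le> norm (1 + |(u x)| powr p i)"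
  proof (rule AE_I2)
   fix x
   show "norm ( |(u x)| powr P) \<le> norm (1 + |(u x)| powr p i)"
   proof (cases "|(u x)| \<le> 1")
    case True
    hence "|(u x)| powr P \<le> 1" using P by (intro powr_le1) auto
    thus ?thesis by simp (smt (verit) powr_ge_zero)
   next
    case False
    hence "|(u x)| powr P \<le> |(u x)| powr p i" using i by (intro powr_mono) auto
    thus ?thesis by simp
   qed
  qed
 qed measurable
 define X where "X x = h x + |(u x)| powr P + (\<Sum>i\<in>UNIV. |(D x $ i)| powr p i)" for x
 have X: "integrable M X" unfolding X_def using st(3) uP D_int by auto
 show "integrable M (%x. |(a x (u x) (D x) $ j)| powr conj_exp (p j))"
 proof (rule Bochner_Integration.integrable_bound[where f = "%x. \<beta> powr q * X x"])
  show "integrable M (%x. \<beta> powr q * X x)" using X by simp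
  show "AE x in M. norm ( |(a x (u x) (D x) $ j)| powr conj_exp (p j)) \<le> norm (\<beta> powr q * X x)" using st(4,5)
  proof eventually_elim
   case (elim x)
   have X0: "X x \<ge> 0" unfolding X_def using elim(1) by (intro add_nonneg_nonneg sum_nonneg) auto
   have "|(a x (u x) (D x) $ j)| \<le> \<beta> * X x powr (1/q)" using elim(2) by (simp add: X_def P_def q_def)
   hence "|(a x (u x) (D x) $ j)| powr q \<le> (\<beta> * X x powr (1/q)) powr q" using q by (intro powr_mono2) auto
   also have "\<dots> = \<beta> powr q * X x" using q st(2) X0 by (simp add: powr_mult powr_powr)
   finally show ?case using X0 by (simp add: q_def)
  qed
 qed measurable
qed

lemma weak_solution_energy_slice:
 fixes \<Omega> :: "(real^'n::finite) set"
 assumes W: "w0_approx \<Omega> p u (weak_grad \<Omega> u) \<phi>" and st: "structure_conds \<Omega> p lam \<beta> h a"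
  and sol: "weak_solution \<Omega> p a f g u" and lam: "!!i. lam i > 0"
  and f: "integrable (LB \<Omega>) f" and g: "!!i. Lp \<Omega> (conj_exp (p i)) (g i)"
  and ab: "0 \<le> s" "s < t"
  and J: "J = {r. s < |(r)| & |(r)| < t} \<or> (s = 0 & J = {r. |(r)| < t})"
 shows "1/2 * (LINT x|LB \<Omega>. ind J (u x) * (\<Sum>i\<in>UNIV. lam i * |(weak_grad \<Omega> u x $ i)| powr p i))
  \<le> (LINT x|LB \<Omega>. |(f x)| * min (max ( |(u x)| - s) 0) (t - s))
   + (\<Sum>i\<in>UNIV. 2 powr (conj_exp (p i) / p i)) * (LINT x|LB \<Omega>. ind J (u x) * g_density p lam g x)"
proof -
 interpret w0_approx \<Omega> p u "weak_grad \<Omega> u" \<phi> by fact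
 let ?D = "weak_grad \<Omega> u"
 note A = flux_integrable[OF W st]
 note [measurable] = A(1)
 have gm[measurable]: "g i \<in> BM M" and gi: "integrable M (%x. |(g i x)| powr conj_exp (p i))" for i using g by (auto simp: Lp_def)
 have eq: "(\<Sum>i\<in>UNIV. LINT x|M. (a x (u x) (?D x) $ i - g i x) * pd i \<psi> x) = (LINT x|M. f x * \<psi> x)"
  if \<psi>: "\<psi> \<in> test_funs \<Omega>" for \<psi>
 proof -
  note [measurable] = test_meas[OF \<psi>]
  have ia: "integrable M (%x. a x (u x) (?D x) $ i * pd i \<psi> x)" for i
   using p[of i] by (intro Holder_integrable(1)[OF _ _ p A(2)] test_pd_Lp[OF \<psi>]) auto
  have ig: "integrable M (%x. g i x * pd i \<psi> x)" for i using p[of i] by (intro Holder_integrable(1)[OF _ _ p gi] test_pd_Lp[OF \<psi>]) auto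
  obtain B where B: "!!x. |(\<psi> x)| \<le> B" using test_fun_bounded[OF \<psi>] by metis
  have [measurable]: "f \<in> BM M" using f by simp
  have if': "integrable M (%x. f x * \<psi> x)"
  proof (rule Bochner_Integration.integrable_bound[where f = "%x. B * f x"])
   have "|(f x * \<psi> x)| \<le> |(B * f x)|" for x using mult_left_mono[OF B[of x], of "|(f x)|"] B[of x] by (simp add: abs_mult mult.commute)
   thus "AE x in M. norm (f x * \<psi> x) \<le> norm (B * f x)" by simp
  qed (use f in auto)
  have "(LINT x|M. (\<Sum>i\<in>UNIV. a x (u x) (?D x) $ i * pd i \<psi> x))
    = (LINT x|M. f x * \<psi> x + (\<Sum>i\<in>UNIV. g i x * pd i \<psi> x))"
   using sol \<psi> by (simp add: weak_solution_def inner_vec_def gradient_def)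
  thus ?thesis using ia ig if' by (simp add: left_diff_distrib sum_subtractf)
 qed
 have coer: "AE x in M. (\<Sum>i\<in>UNIV. a x (u x) (?D x) $ i * ?D x $ i) \<ge> (\<Sum>i\<in>UNIV. lam i * |(?D x $ i)| powr p i)"
 proof -
  have "AE x in M. \<forall>s \<xi>. a x s \<xi> \<bullet> \<xi> \<ge> (\<Sum>i\<in>UNIV. lam i * |(\<xi> $ i)| powr p i)"
   using st by (simp add: structure_conds_def)
  thus ?thesis by eventually_elim (simp add: inner_vec_def)
 qed
 show ?thesis by (rule energy_slice[OF lam A(1) gm A(2) gi f eq coer ab J])
qed

text \<open>The factor 2 N is what \<open>box_isoperimetric\<close> leaves when its N summands
  coincide. The inner 2 is the ratio of the measures of box and support, and the product collects
  the factors \<open>lam i\<close> from Hoelder's inequality.\<close>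

definition geo_const :: "('n::finite => real) => ('n => real) => real" where
 "geo_const p lam = 2 * real CARD('n) * (2 * (\<Prod>i\<in>UNIV. lam i powr (- 1/p i))) powr (1 / real CARD('n))"

text \<open>A substitute for the combination of isoperimetric inequality and coarea formula on a
  slab: \<sigma> bounds the outer level set, s the inner one, m the measure of the slab and R its
  energy. The box sides equalize the directions, and the N-th root of the product of the derivative
  bounds turns the sum of the 1/p_i into N/P.\<close>

lemma (in w0_approx) slice_estimate:
 assumes lam: "!!i. lam i > 0" and ab: "0 \<le> a" "a < b"
  and S: "measure lebesgue {x \<in> \<Omega>. a < |(u x)|} \<le> \<sigma>" "\<sigma> > 0"
  and E: "s \<le> measure lebesgue {x \<in> \<Omega>. b \<le> |(u x)|}"
  and m: "measure lebesgue {x \<in> \<Omega>. a < |(u x)| & |(u x)| < b} \<le> m" "m > 0"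
  and R: "(LINT x|M. ind {r. a < |(r)| & |(r)| < b} (u x) * (\<Sum>i\<in>UNIV. lam i * |(D x $ i)| powr p i)) \<le> R" "R > 0"
 shows "(b - a) * s \<le> geo_const p lam * \<sigma> powr (1 / real CARD('n)) * m powr (1 - 1 / harm_mean p) * R powr (1 / harm_mean p)"
proof -
 define N where "N = real CARD('n)"
 define P where "P = harm_mean p"
 have N: "N > 0" by (simp add: N_def)
 define J where "J = {r. a < |(r)| & |(r)| < b}"
 have [measurable]: "J \<in> sets borel" unfolding J_def by (auto intro!: borel_open open_Collect_less open_Collect_conj continuous_intros)
 have \<Omega>l: "\<Omega> \<in> lmeasurable" using op bdd by (intro bounded_set_imp_lmeasurable) auto
 have setsM: "A \<in> sets lebesgue" if "A \<in> sets M" for A using that \<Omega>_borel by (auto simp: sets_restrict_space)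
 obtain v where v[measurable]: "v \<in> BM borel" and v0: "!!x. x \<notin> \<Omega> ==> v x = 0"
  and uv: "AE x in lborel. x \<in> \<Omega> --> u x = v x" by (rule borel_version[OF u_meas \<Omega>_borel]) (rule that)
 have meas_eq: "emeasure lborel {x \<in> \<Omega>. Q (v x)} = ennreal (measure lebesgue {x \<in> \<Omega>. Q (u x)})"
  if [measurable]: "Measurable.pred borel Q" for Q
 proof -
  have s1: "{x \<in> \<Omega>. Q (v x)} \<in> sets borel" by measurable
  have h: "{x \<in> space M. Q (u x)} \<in> sets M" by measurable
  have s2: "{x \<in> \<Omega>. Q (u x)} \<in> sets lebesgue" using setsM[OF h] by simp
  have "emeasure lborel {x \<in> \<Omega>. Q (v x)} = emeasure lebesgue {x \<in> \<Omega>. Q (v x)}" using s1 by simp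
  also have "\<dots> = emeasure lebesgue {x \<in> \<Omega>. Q (u x)}"
   using AE_completion[OF uv] s1 s2 by (intro emeasure_eq_AE) (auto elim!: eventually_mono)
  also have "\<dots> = ennreal (measure lebesgue {x \<in> \<Omega>. Q (u x)})"
  proof -
   have "{x \<in> \<Omega>. Q (u x)} \<in> lmeasurable" by (rule fmeasurableI2[OF \<Omega>l _ s2]) auto
   thus ?thesis by (rule emeasure_eq_measure2)
  qed
  finally show ?thesis .
 qed
 \<comment> \<open>Hoelder's inequality on the slab, of measure at most m, where the i-th derivative
   has p_i-energy at most \<open>R / lam i\<close>.\<close>
 define B where "B i = m powr (1 - 1/p i) * (R / lam i) powr (1/p i)" for i
 have B: "B i > 0" for i using m(2) R(2) lam[of i] by (simp add: B_def)
 have Bne: "B i \<noteq> 0" for i using B[of i] by simp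
 \<comment> \<open>\<tau> is the common value of the products \<open>L i * B i\<close>; it is fixed
   by the requirement that the box has volume 2 \<sigma>.\<close>
 define \<tau> where "\<tau> = (2 * \<sigma> * (\<Prod>i\<in>UNIV. B i)) powr (1/N)"
 have PB: "(\<Prod>i\<in>UNIV. B i) > 0" using B by (intro prod_pos) auto
 have \<tau>: "\<tau> > 0" using PB S(2) by (simp add: \<tau>_def Bne)
 have \<tau>N: "\<tau> ^ CARD('n) = 2 * \<sigma> * (\<Prod>i\<in>UNIV. B i)"
  using PB S(2) N by (simp add: \<tau>_def powr_power N_def del: prod_zero_iff)
 define L where "L i = \<tau> / B i" for i
 have L: "L i > 0" for i using \<tau> B by (simp add: L_def)
 have LP: "(\<Prod>i\<in>UNIV. L i) = 2 * \<sigma>" using PB by (simp add: L_def prod_dividef \<tau>N Bne)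
 have LB: "(\<Sum>i\<in>UNIV. L i * B i) = N * \<tau>"
 proof -
  have "L i * B i = \<tau>" for i using B[of i] by (simp add: L_def)
  thus ?thesis by (simp add: N_def)
 qed
 have grad: "(LINT x|M. ind J (u x) * |(D x $ i)|) \<le> B i" for i
 proof -
  define c where "c x = ind J (u x) * D x $ i" for x
  define o' where "o' x = (ind J (u x) :: real)" for x
  have [measurable]: "c \<in> BM M" "o' \<in> BM M" unfolding c_def[abs_def] o'_def[abs_def] by measurable
  have cp: "|(c x)| powr p i = ind J (u x) * |(D x $ i)| powr p i" for x using p[of i] by (simp add: c_def indicator_def)
  have ci: "integrable M (%x. |(c x)| powr p i)"
   unfolding cp by (rule Bochner_Integration.integrable_bound[OF D_int[of i]]) (auto simp: indicator_def)
  have q1: "conj_exp (p i) > 1" using conj_exp_props[OF p] by simp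
  have oq: "|(o' x)| powr conj_exp (p i) = o' x" for x using q1 by (simp add: o'_def indicator_def)
  have oi: "integrable M (%x. |(o' x)| powr conj_exp (p i))"
   unfolding oq by (rule integrable_const_bound[where B = 1]) (auto simp: o'_def indicator_def)
  have "(LINT x|M. ind J (u x) * |(D x $ i)|) = (LINT x|M. |(o' x * c x)|)"
   by (intro Bochner_Integration.integral_cong) (auto simp: o'_def c_def indicator_def)
  also have "\<dots> \<le> (LINT x|M. |(c x)| powr p i) powr (1/p i) * (LINT x|M. |(o' x)| powr conj_exp (p i)) powr (1 / conj_exp (p i))"
   by (rule Holder_integrable(2)[OF _ _ p oi ci]) auto
  also have "\<dots> \<le> (R / lam i) powr (1/p i) * m powr (1 / conj_exp (p i))"
  proof (intro mult_mono powr_mono2)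
   have "lam i * (LINT x|M. |(c x)| powr p i) \<le> (LINT x|M. ind J (u x) * (\<Sum>i\<in>UNIV. lam i * |(D x $ i)| powr p i))"
    unfolding cp integral_mult_right_zero[symmetric]
   proof (intro integral_mono)
    show "integrable M (%x. lam i * (ind J (u x) * |(D x $ i)| powr p i))" using ci by (simp add: cp)
    show "integrable M (%x. ind J (u x) * (\<Sum>i\<in>UNIV. lam i * |(D x $ i)| powr p i))"
     by (rule Bochner_Integration.integrable_bound[where f = "%x. \<Sum>i\<in>UNIV. lam i * |(D x $ i)| powr p i"])
      (use D_int in \<open>auto simp: indicator_def\<close>)
    show "lam i * (ind J (u x) * |(D x $ i)| powr p i) \<le> ind J (u x) * (\<Sum>i\<in>UNIV. lam i * |(D x $ i)| powr p i)" for x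
     using member_le_sum[of i UNIV "%i. lam i * |(D x $ i)| powr p i"] less_imp_le[OF lam] by (auto simp: indicator_def)
   qed
   also have "\<dots> \<le> R" using R(1) by (simp add: J_def)
   finally show "(LINT x|M. |(c x)| powr p i) \<le> R / lam i" using lam[of i] by (simp add: field_simps)
   have "(LINT x|M. |(o' x)| powr conj_exp (p i)) = (LINT x|M. ind {x \<in> space M. u x \<in> J} x)"
    unfolding oq by (intro Bochner_Integration.integral_cong) (auto simp: o'_def indicator_def)
   also have "\<dots> = measure M {x \<in> space M. u x \<in> J}" by (simp add: Int_absorb2)
   also have "{x \<in> space M. u x \<in> J} = {x \<in> \<Omega>. a < |(u x)| & |(u x)| < b}" by (simp add: J_def)
   also have "measure M {x \<in> \<Omega>. a < |(u x)| & |(u x)| < b} = measure lebesgue {x \<in> \<Omega>. a < |(u x)| & |(u x)| < b}"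
    using \<Omega>_borel by (intro measure_restrict_space) auto
   finally show "(LINT x|M. |(o' x)| powr conj_exp (p i)) \<le> m" using m(1) by simp
  qed (use p[of i] q1 R(2) lam[of i] in \<open>auto intro!: integral_nonneg_AE\<close>)
  finally show ?thesis by (simp add: B_def conj_exp_props(3)[OF p] mult.commute)
 qed
 have "(b - a) * s \<le> 2 * (\<Sum>i\<in>UNIV. L i * B i)"
 proof (rule box_isoperimetric[where w = "%x. trunc a b (v x)" and E = "{x \<in> \<Omega>. b \<le> |(v x)|}" and S = "{x \<in> \<Omega>. a < |(v x)|}" and \<sigma> = \<sigma>])
  have [measurable]: "trunc a b \<in> BM borel" unfolding trunc_def[abs_def] by measurable
  show "(%x. trunc a b (v x)) \<in> BM borel" by measurable
  show "{x \<in> \<Omega>. b \<le> |(v x)|} \<in> sets borel" "{x \<in> \<Omega>. a < |(v x)|} \<in> sets borel" by measurable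
  show "|(trunc a b (v x))| \<le> b - a" for x using ab by (auto simp: trunc_def abs_mult sgn_if)
  show "|(trunc a b (v x))| = b - a" if "x \<in> {x \<in> \<Omega>. b \<le> |(v x)|}" for x using that ab by (auto simp: trunc_def abs_mult sgn_if)
  show "trunc a b (v x) = 0" if "x \<notin> {x \<in> \<Omega>. a < |(v x)|}" for x using that ab v0[of x] by (auto simp: trunc_def)
  show "emeasure lborel {x \<in> \<Omega>. a < |(v x)|} \<le> ennreal \<sigma>" using S by (subst meas_eq) (auto intro: ennreal_leI)
  show "ennreal s \<le> emeasure lborel {x \<in> \<Omega>. b \<le> |(v x)|}" using E by (subst meas_eq) (auto intro: ennreal_leI)
  show "(NN x. ennreal |(trunc a b (v (x + y)) - trunc a b (v x))|) \<le> ennreal (\<Sum>i\<in>UNIV. |(y $ i)| * B i)" for y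
  proof -
   have "(NN x. ennreal |(trunc a b (v (x + y)) - trunc a b (v x))|)
    \<le> ennreal (\<Sum>i\<in>UNIV. |(y $ i)| * (LINT x|M. ind J (u x) * |(D x $ i)|))" by (rule trunc_translation[OF ab J_def v v0 uv])
   also have "\<dots> \<le> ennreal (\<Sum>i\<in>UNIV. |(y $ i)| * B i)" by (intro ennreal_leI sum_mono mult_left_mono grad) auto
   finally show ?thesis .
  qed
  show "0 \<le> B i" for i using B[of i] by simp
 qed (use S(2) L LP in auto)
 hence main: "(b - a) * s \<le> 2 * N * \<tau>" by (simp add: LB)
 have sp: "(\<Sum>i\<in>UNIV. 1/p i) = N / P" by (simp add: harm_mean_sum N_def P_def)
 have "(\<Prod>i\<in>UNIV. B i) = (\<Prod>i\<in>UNIV. m powr (1 - 1/p i)) * (\<Prod>i\<in>UNIV. R powr (1/p i)) * (\<Prod>i\<in>UNIV. lam i powr (- 1/p i))"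
 proof -
  have "B i = m powr (1 - 1/p i) * R powr (1/p i) * lam i powr (- 1/p i)" for i
   using less_imp_le[OF R(2)] less_imp_le[OF lam[of i]] by (simp add: B_def powr_divide powr_minus_divide)
  thus ?thesis by (simp add: prod.distrib)
 qed
 also have "(\<Prod>i\<in>(UNIV::'n set). m powr (1 - 1/p i)) = m powr (N - N / P)"
  using m(2) sp by (subst powr_sum[symmetric]) (auto simp: sum_subtractf N_def)
 also have "(\<Prod>i\<in>(UNIV::'n set). R powr (1/p i)) = R powr (N / P)" using R(2) sp by (subst powr_sum[symmetric]) auto
 finally have PBe: "(\<Prod>i\<in>UNIV. B i) = m powr (N - N / P) * R powr (N / P) * (\<Prod>i\<in>UNIV. lam i powr (- 1/p i))" .
 have lamP: "(\<Prod>i\<in>UNIV. lam i powr (- 1/p i)) > 0" using lam by (intro prod_pos) (auto simp: less_imp_neq[symmetric] dest: less_imp_neq)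
 have "\<tau> = (2 * (\<Prod>i\<in>UNIV. lam i powr (- 1/p i)) * \<sigma> * m powr (N - N / P) * R powr (N / P)) powr (1/N)"
  unfolding \<tau>_def PBe by (simp add: mult_ac)
 also have "\<dots> = (2 * (\<Prod>i\<in>UNIV. lam i powr (- 1/p i))) powr (1/N) * \<sigma> powr (1/N) * m powr (1 - 1/P) * R powr (1/P)"
 proof -
  have "(N - N / P) * (1/N) = 1 - 1/P" "(N / P) * (1/N) = 1/P" using N by (simp_all add: field_simps)
  thus ?thesis using lamP S(2) m(2) R(2) N by (simp add: powr_mult powr_powr)
 qed
 finally show ?thesis using main by (simp add: geo_const_def N_def P_def mult_ac)
qed

section \<open>Rearrangements\<close>

text \<open>A Henstock argument. On a fine tagged division, pieces tagged outside S are controlled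
  by H through the straddling condition. Pieces tagged in S have small total length, so there the
  Lipschitz part of the condition \<open>AC\<close> contributes little, while the increments of V
  add up to at most \<epsilon>.\<close>

lemma AC_upper_FTC:
 fixes U H :: "real => real"
 assumes ab: "a \<le> b" and S: "negligible S" and H: "(H has_integral I) {a..b}"
  and AC: "!!\<epsilon>. \<epsilon> > 0 ==> \<exists>L V. L \<ge> 0 & V b - V a \<le> \<epsilon> &
   (\<forall>x z. a \<le> x & x \<le> z & z \<le> b --> V x \<le> V z & U x - U z \<le> L * (z - x) + (V z - V x))"
  and straddle: "!!s \<epsilon>. s \<in> {a..b} - S ==> \<epsilon> > 0 ==> \<exists>\<gamma>>0. \<forall>x z. a \<le> x & x \<le> s & s \<le> z & z \<le> b & s - \<gamma> < x & z < s + \<gamma>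
    --> U x - U z \<le> (H s + \<epsilon>) * (z - x)"
 shows "U a - U b \<le> I"
proof (rule field_le_epsilon)
 fix e :: real assume "e > 0"
 \<comment> \<open>The denominator counts the errors: one \<epsilon> each for the Riemann sum, the
   pieces tagged in S and the variation of V, and \<epsilon> per unit of length from the straddling
   condition.\<close>
 define \<epsilon> where "\<epsilon> = e / (3 + (b - a))"
 have \<epsilon>: "\<epsilon> > 0" using \<open>e > 0\<close> ab by (simp add: \<epsilon>_def)
 obtain L V where LV: "L \<ge> 0" "V b - V a \<le> \<epsilon>"
  "!!x z. a \<le> x ==> x \<le> z ==> z \<le> b ==> V x \<le> V z & U x - U z \<le> L * (z - x) + (V z - V x)" using AC[OF \<epsilon>] by blast
 \<comment> \<open>Removing the values of H on S keeps its Riemann sum free of the tags in S, which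
   are charged to the indicator of S instead.\<close>
 define H' where "H' s = (if s \<in> S then 0 else H s)" for s
 have "(H' has_integral I) (cbox a b)" using has_integral_spike[OF S _ H, of H'] by (simp add: H'_def)
 from this[unfolded has_integral, rule_format, OF \<epsilon>] obtain g1 where g1': "gauge g1 &
  (\<forall>\<D>. \<D> tagged_division_of cbox a b & g1 fine \<D> --> norm ((\<Sum>(x,k)\<in>\<D>. measure lborel k *\<^sub>R H' x) - I) < \<epsilon>)"
  by (elim exE)
 hence g1: "gauge g1"
  "!!\<D>. \<D> tagged_division_of cbox a b ==> g1 fine \<D> ==> norm ((\<Sum>(x,k)\<in>\<D>. measure lborel k *\<^sub>R H' x) - I) < \<epsilon>"
  by (simp_all only: simp_thms)
 have S0: "(indicat_real S has_integral 0) (cbox a b)" using S by (simp add: negligible_def)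
 have "\<epsilon> / (L + 1) > 0" using \<epsilon> LV(1) by simp
 from S0[unfolded has_integral, rule_format, OF this] obtain g2 where g2': "gauge g2 &
  (\<forall>\<D>. \<D> tagged_division_of cbox a b & g2 fine \<D> --> norm ((\<Sum>(x,k)\<in>\<D>. measure lborel k *\<^sub>R indicat_real S x) - 0) < \<epsilon> / (L + 1))"
  by (elim exE)
 hence g2: "gauge g2"
  "!!\<D>. \<D> tagged_division_of cbox a b ==> g2 fine \<D> ==> norm ((\<Sum>(x,k)\<in>\<D>. measure lborel k *\<^sub>R indicat_real S x) - 0) < \<epsilon> / (L + 1)"
  by (simp_all only: simp_thms)
 have "\<exists>\<gamma>. \<forall>s. s \<in> {a..b} - S --> \<gamma> s > 0 & (\<forall>x z. a \<le> x & x \<le> s & s \<le> z & z \<le> b & s - \<gamma> s < x & z < s + \<gamma> s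
    --> U x - U z \<le> (H s + \<epsilon>) * (z - x))" using straddle[OF _ \<epsilon>] by (intro choice) blast
 then obtain \<gamma> where \<gamma>: "!!s. s \<in> {a..b} - S ==> \<gamma> s > 0"
  "!!s x z. s \<in> {a..b} - S ==> a \<le> x ==> x \<le> s ==> s \<le> z ==> z \<le> b ==> s - \<gamma> s < x ==> z < s + \<gamma> s
    ==> U x - U z \<le> (H s + \<epsilon>) * (z - x)" by blast
 define g3 where "g3 s = (if s \<in> {a..b} - S then ball s (\<gamma> s) else UNIV)" for s
 have g3: "gauge g3" unfolding gauge_def g3_def using \<gamma>(1) by auto
 obtain \<D> where \<D>: "\<D> tagged_division_of cbox a b" "(%x. g1 x \<inter> (g2 x \<inter> g3 x)) fine \<D>"
  using fine_division_exists[OF gauge_Int[OF g1(1) gauge_Int[OF g2(1) g3]], of a b] by blast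
 have fine: "g1 fine \<D>" "g2 fine \<D>" "g3 fine \<D>" using \<D>(2) by (auto simp: fine_def)
 have T: "\<D> tagged_division_of {a..b}" using \<D>(1) by simp
 have tel: "(\<Sum>(x,k)\<in>\<D>. W (Sup k) - W (Inf k)) = W b - W a" for W :: "real => real" by (rule additive_tagged_division_1[OF ab T])
 have piece: "U (Inf k) - U (Sup k) \<le> measure lborel k * H' x + \<epsilon> * measure lborel k + L * (measure lborel k * indicat_real S x) + (V (Sup k) - V (Inf k))"
  "measure lborel k = Sup k - Inf k"
  if xk: "(x, k) \<in> \<D>" for x k
 proof -
  obtain c d where k: "k = cbox c d" using tagged_division_ofD(4)[OF \<D>(1) xk] by blast
  have x: "x \<in> k" "k \<subseteq> cbox a b" using tagged_division_ofD(2,3)[OF \<D>(1) xk] by auto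
  have cd: "c \<le> x" "x \<le> d" using x k by auto
  hence cab: "a \<le> c" "d \<le> b" "c \<le> d" using x k by (auto simp: subset_iff)
  have SI: "Sup k = d" "Inf k = c" using k cab by auto
  show ct: "measure lborel k = Sup k - Inf k" using k cab SI by simp
  have Vm: "V c \<le> V d" using LV(3)[of c d] cab by auto
  show "U (Inf k) - U (Sup k) \<le> measure lborel k * H' x + \<epsilon> * measure lborel k + L * (measure lborel k * indicat_real S x) + (V (Sup k) - V (Inf k))"
  proof (cases "x \<in> S")
   case True
   thus ?thesis using LV(3)[of c d] cab \<epsilon> unfolding ct SI by (simp add: H'_def) (smt (verit) mult_nonneg_nonneg)
  next
   case False
   have xs: "x \<in> {a..b} - S" using False cd cab by auto
   have "k \<subseteq> g3 x" using fine(3) xk by (auto simp: fine_def)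
   hence "k \<subseteq> ball x (\<gamma> x)" using xs by (simp add: g3_def)
   hence "c \<in> ball x (\<gamma> x)" "d \<in> ball x (\<gamma> x)" using k cab by auto
   hence "x - \<gamma> x < c" "d < x + \<gamma> x" by (auto simp: dist_real_def)
   hence "U c - U d \<le> (H x + \<epsilon>) * (d - c)" using \<gamma>(2)[OF xs] cd cab by simp
   thus ?thesis using False Vm unfolding ct SI by (simp add: H'_def algebra_simps)
  qed
 qed
 have "U a - U b = (\<Sum>(x,k)\<in>\<D>. U (Inf k) - U (Sup k))" using tel[of "%s. - U s"] by (simp add: case_prod_beta)
 also have "\<dots> \<le> (\<Sum>(x,k)\<in>\<D>. measure lborel k * H' x + \<epsilon> * measure lborel k + L * (measure lborel k * indicat_real S x) + (V (Sup k) - V (Inf k)))"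
  using piece(1) by (intro sum_mono) auto
 also have "\<dots> = (\<Sum>(x,k)\<in>\<D>. measure lborel k * H' x) + \<epsilon> * (\<Sum>(x,k)\<in>\<D>. measure lborel k) + L * (\<Sum>(x,k)\<in>\<D>. measure lborel k * indicat_real S x)
   + (\<Sum>(x,k)\<in>\<D>. V (Sup k) - V (Inf k))" by (simp add: case_prod_beta sum.distrib sum_distrib_left)
 also have "(\<Sum>(x,k)\<in>\<D>. measure lborel k) = (\<Sum>(x,k)\<in>\<D>. Sup k - Inf k)" using piece(2) by (intro sum.cong) auto
 also have "\<dots> = b - a" by (rule tel[of "%x. x"])
 also have "(\<Sum>(x,k)\<in>\<D>. V (Sup k) - V (Inf k)) = V b - V a" by (rule tel)
 also have "(\<Sum>(x,k)\<in>\<D>. measure lborel k * H' x) + \<epsilon> * (b - a) + L * (\<Sum>(x,k)\<in>\<D>. measure lborel k * indicat_real S x) + (V b - V a)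
   \<le> (I + \<epsilon>) + \<epsilon> * (b - a) + \<epsilon> + \<epsilon>"
 proof -
  have 1: "(\<Sum>(x,k)\<in>\<D>. measure lborel k * H' x) \<le> I + \<epsilon>"
   using g1(2)[OF \<D>(1) fine(1)] by (simp add: abs_le_iff abs_less_iff)
  have "(\<Sum>(x,k)\<in>\<D>. measure lborel k * indicat_real S x) \<le> \<epsilon> / (L + 1)"
   using g2(2)[OF \<D>(1) fine(2)] by (simp add: abs_less_iff)
  hence "L * (\<Sum>(x,k)\<in>\<D>. measure lborel k * indicat_real S x) \<le> L * (\<epsilon> / (L + 1))" using LV(1) by (rule mult_left_mono)
  also have "\<dots> \<le> \<epsilon>" using LV(1) \<epsilon> by (simp add: field_simps)
  finally show ?thesis using 1 LV(2) by linarith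
 qed
 also have "\<dots> = I + \<epsilon> * (3 + (b - a))" by (simp add: algebra_simps)
 also have "\<epsilon> * (3 + (b - a)) = e" using ab by (simp add: \<epsilon>_def)
 finally show "U a - U b \<le> I + e" .
qed

section \<open>Distribution function and decreasing rearrangement\<close>

locale rearr =
 fixes \<Omega> :: "(real^'n::finite) set" and u :: "real^'n => real"
 assumes \<Omega>b [measurable]: "\<Omega> \<in> sets borel" and \<Omega>l: "\<Omega> \<in> lmeasurable"
  and um [measurable]: "u \<in> BM (LB \<Omega>)"
begin

abbreviation "MR \<equiv> LB \<Omega>"
abbreviation "T \<equiv> measure lebesgue \<Omega>"
abbreviation "\<mu> \<equiv> distr_fun \<Omega> u"
abbreviation "us \<equiv> decr_rearr \<Omega> u"

sublocale finite_measure MR by (rule finite_measure_lebesgue_on[OF \<Omega>l])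

lemma level_sets [measurable, simp]: "{x \<in> \<Omega>. t < |(u x)|} \<in> sets MR"
proof -
 have "{x \<in> space MR. t < |(u x)|} \<in> sets MR" by measurable
 thus ?thesis by simp
qed

lemma level_sets_lebesgue: "{x \<in> \<Omega>. t < |(u x)|} \<in> sets lebesgue"
proof -
 have \<Omega>s: "\<Omega> \<in> sets lebesgue" using \<Omega>b by simp
 obtain A where "A \<in> sets lebesgue" "{x \<in> \<Omega>. t < |(u x)|} = \<Omega> \<inter> A"
  using level_sets[of t] unfolding sets_restrict_space by blast
 with sets.Int[OF \<Omega>s] show ?thesis by metis
qed

lemma measure_M: "A \<subseteq> \<Omega> ==> measure MR A = measure lebesgue A"
 by (rule measure_restrict_space) auto

lemma mu_eq: "\<mu> t = measure MR {x \<in> space MR. t < |(u x)|}"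
 by (simp add: distr_fun_def measure_M)

lemma mu_antimono: "s \<le> t ==> \<mu> t \<le> \<mu> s"
 unfolding mu_eq by (rule finite_measure_mono) auto

lemma mu_le: "\<mu> t \<le> T"
 unfolding mu_eq using bounded_measure[of "{x \<in> space MR. t < |(u x)|}"] measure_M[of \<Omega>] by simp

lemma mu_nonneg: "0 \<le> \<mu> t" by (simp add: distr_fun_def)

lemma mu_borel [measurable]: "\<mu> \<in> BM borel"
proof -
 have "mono (%t. - \<mu> t)" by (auto simp: mono_def mu_antimono)
 hence "(%t. - \<mu> t) \<in> BM borel" by (rule borel_measurable_mono)
 thus ?thesis by simp
qed

text \<open>Right continuity of the distribution function: the sets where |u| exceeds t + 1/(n+1)
  increase to the set where |u| exceeds t.\<close>

lemma mu_right: assumes "s < \<mu> t" obtains t' where "t < t'" "s < \<mu> t'"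
proof -
 let ?A = "%n. {x \<in> space MR. t + 1 / real (Suc n) < |(u x)|}"
 have "(%n. measure MR (?A n)) \<leadsto> measure MR (\<Union>n. ?A n)"
 proof (rule finite_Lim_measure_incseq)
  show "incseq ?A"
  proof (rule incseq_SucI, rule subsetI)
   fix n x assume "x \<in> ?A n"
   moreover have "1 / real (Suc (Suc n)) \<le> 1 / real (Suc n)" by (simp add: frac_le)
   ultimately show "x \<in> ?A (Suc n)" by auto
  qed
 qed auto
 also have "(\<Union>n. ?A n) = {x \<in> space MR. t < |(u x)|}"
 proof (intro equalityI subsetI)
  fix x assume x: "x \<in> {x \<in> space MR. t < |(u x)|}"
  then obtain n where "inverse (real (Suc n)) < |(u x)| - t" using reals_Archimedean[of "|(u x)| - t"] by auto
  thus "x \<in> (\<Union>n. ?A n)" using x by (auto simp: inverse_eq_divide intro!: exI[of _ n])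
 next
  fix x assume "x \<in> (\<Union>n. ?A n)"
  then obtain n where "x \<in> space MR" "t + 1 / real (Suc n) < |(u x)|" by auto
  moreover have "t < t + 1 / real (Suc n)" by simp
  ultimately show "x \<in> {x \<in> space MR. t < |(u x)|}" by (blast intro: less_trans)
 qed
 finally have "(%n. \<mu> (t + 1 / real (Suc n))) \<leadsto> \<mu> t" by (simp add: mu_eq)
 hence "eventually (%n. s < \<mu> (t + 1 / real (Suc n))) sequentially" using assms by (rule order_tendstoD)
 then obtain n where "s < \<mu> (t + 1 / real (Suc n))" by (auto simp: eventually_sequentially)
 thus ?thesis by (intro that[of "t + 1 / real (Suc n)"]) auto
qed

lemma mu_tendsto_0: "(%n. \<mu> (real n)) \<leadsto> 0"
proof -
 let ?A = "%n. {x \<in> space MR. real n < |(u x)|}"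
 have "(%n. measure MR (?A n)) \<leadsto> measure MR (\<Inter>n. ?A n)" by (rule finite_Lim_measure_decseq) (auto simp: decseq_def)
 also have "(\<Inter>n. ?A n) = {}"
 proof -
  have "\<exists>n. \<not> real n < |(u x)|" for x using real_arch_simple[of "|(u x)|"] by (auto simp: not_less)
  thus ?thesis by auto
 qed
 finally show ?thesis by (simp add: mu_eq)
qed

lemma bdd: assumes "s > 0" shows "bdd_above (insert 0 {t. t > 0 & \<mu> t > s})"
proof -
 obtain n where n: "\<mu> (real n) < s" using order_tendstoD(2)[OF mu_tendsto_0 assms] by (auto simp: eventually_sequentially)
 have "t \<le> real n" if "\<mu> t > s" for t using mu_antimono[of "real n" t] that n by linarith
 thus ?thesis by (intro bdd_aboveI[of _ "real n"]) auto
qed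

lemma us_nonneg: "s > 0 ==> 0 \<le> us s"
 unfolding decr_rearr_def by (intro cSup_upper bdd) auto

text \<open>Right continuity of \<mu> makes the correspondence between \<mu> and its generalized
  inverse exact with strict inequalities. Later facts about the rearrangement are read off from this
  equivalence rather than from the supremum.\<close>

lemma us_gt_iff: assumes "s > 0" "t \<ge> 0" shows "t < us s \<longleftrightarrow> s < \<mu> t"
proof
 assume "t < us s"
 then obtain t' where t': "t' \<in> insert 0 {t. t > 0 & \<mu> t > s}" "t < t'"
  unfolding decr_rearr_def using less_cSup_iff[OF _ bdd[OF assms(1)]] by auto
 hence "\<mu> t' > s" using assms by auto
 thus "s < \<mu> t" using mu_antimono[of t t'] t' by simp
next
 assume "s < \<mu> t"
 then obtain t' where t': "t < t'" "s < \<mu> t'" by (rule mu_right)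
 hence "t' \<le> us s" unfolding decr_rearr_def using assms by (intro cSup_upper bdd) auto
 thus "t < us s" using t' by simp
qed

lemma us_antimono: "0 < s ==> s \<le> t ==> us t \<le> us s"
 using us_gt_iff[of t "us s"] us_gt_iff[of s "us s"] us_nonneg[of s] by linarith

lemma us_zero: "0 < s ==> T \<le> s ==> us s = 0"
 using us_gt_iff[of s 0] mu_le[of 0] us_nonneg[of s] by force

lemma us_borel: "(%s. ind {0<..} s * us s) \<in> BM borel"
proof -
 have "{s. c < ind {0<..} s * us s} \<in> sets borel" for c
 proof (cases "c < 0")
  case True
  have "0 \<le> ind {0<..} s * us s" for s using us_nonneg[of s] by (cases "s > 0") auto
  hence "{s. c < ind {0<..} s * us s} = UNIV" by (auto intro: less_le_trans[OF True])
  thus ?thesis by simp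
 next
  case False
  hence "{s. c < ind {0<..} s * us s} = {0<..} \<inter> {..<\<mu> c}" using us_gt_iff by (auto simp: indicator_def)
  thus ?thesis by simp
 qed
 thus ?thesis by (intro borel_measurableI_greater) (simp add: greaterThan_def vimage_def)
qed

lemma us_layer: "s > 0 ==> ennreal (us s) = (NN t. ind {t. 0 < t & s < \<mu> t} t)"
proof -
 assume s: "s > 0"
 have "{t. 0 < t & s < \<mu> t} = {0<..<us s}" using us_gt_iff[OF s] by auto
 thus ?thesis using us_nonneg[OF s] by simp
qed

lemma abs_layer: "ennreal |(y :: real)| = (NN t. ind {t. 0 < t & t < |(y)|} t)"
proof -
 have "{t. 0 < t & t < |(y)|} = {0<..<|(y)|}" by auto
 thus ?thesis by simp
qed

lemma borel_rep:
 obtains v where "v \<in> BM borel" "AE x in lborel. x \<in> \<Omega> --> u x = v x"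
  "!!t. emeasure lborel {x \<in> \<Omega>. t < |(v x)|} = ennreal (\<mu> t)"
proof -
 obtain v where v[measurable]: "v \<in> BM borel" and uv: "AE x in lborel. x \<in> \<Omega> --> u x = v x"
  by (rule borel_version[OF um \<Omega>b]) (rule that)
 have "emeasure lborel {x \<in> \<Omega>. t < |(v x)|} = ennreal (\<mu> t)" for t
 proof -
  have s1: "{x \<in> \<Omega>. t < |(v x)|} \<in> sets borel" by measurable
  note s2 = level_sets_lebesgue[of t]
  have "emeasure lborel {x \<in> \<Omega>. t < |(v x)|} = emeasure lebesgue {x \<in> \<Omega>. t < |(v x)|}" using s1 by simp
  also have "\<dots> = emeasure lebesgue {x \<in> \<Omega>. t < |(u x)|}"
   using AE_completion[OF uv] s1 s2 by (intro emeasure_eq_AE) (auto elim!: eventually_mono)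
  also have "\<dots> = ennreal (\<mu> t)" unfolding distr_fun_def
  proof -
   have "{x \<in> \<Omega>. t < |(u x)|} \<in> lmeasurable" by (rule fmeasurableI2[OF \<Omega>l _ s2]) auto
   thus "emeasure lebesgue {x \<in> \<Omega>. t < |(u x)|} = ennreal (measure lebesgue {x \<in> \<Omega>. t < |(u x)|})"
    by (rule emeasure_eq_measure2)
  qed
  finally show ?thesis .
 qed
 with v uv show ?thesis by (rule that)
qed

text \<open>Both sides are integrated over the level sets of \<open>u\<close>; a level set meets \<open>E\<close> in measure at
 most \<open>min \<bar>E\<bar> (\<mu> t)\<close>.\<close>

lemma integral_le_rearr:
 assumes [measurable]: "E \<in> sets borel" and E: "E \<subseteq> \<Omega>" "emeasure lborel E \<le> ennreal m" "m \<ge> 0"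
 shows "(\<integral>\<^sup>+x. ennreal |(u x)| * ind E x \<partial>MR) \<le> (NN s. ennreal (us s) * ind {0<..<m} s)"
proof -
 obtain v where v[measurable]: "v \<in> BM borel" and uv: "AE x in lborel. x \<in> \<Omega> --> u x = v x"
  and vm: "!!t. emeasure lborel {x \<in> \<Omega>. t < |(v x)|} = ennreal (\<mu> t)" by (rule borel_rep) (rule that)
 have "(\<integral>\<^sup>+x. ennreal |(u x)| * ind E x \<partial>MR) = (NN x. ennreal |(v x)| * ind E x)"
  unfolding nn_integral_lebesgue_on[OF \<Omega>b] using E(1) by (intro nn_integral_cong_AE eventually_mono[OF uv]) (auto simp: indicator_def)
 also have "\<dots> = (NN x. (NN t. ind {t. 0 < t & t < |(v x)|} t * ind E x))" by (intro nn_integral_cong) (simp add: abs_layer nn_integral_multc)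
 also have "\<dots> = (NN t. (NN x. ind {t. 0 < t & t < |(v x)|} t * ind E x))" by (rule lborel_pair.Fubini'[symmetric]) measurable
 also have "\<dots> \<le> (NN t. (NN s. ind {t. 0 < t & s < \<mu> t} t * ind {0<..<m} s))"
 proof (rule nn_integral_mono)
  fix t :: real
  show "(NN x. ind {t. 0 < t & t < |(v x)|} t * ind E x)
   \<le> (NN s. ind {t. 0 < t & s < \<mu> t} t * ind {0<..<m} s)"
  proof (cases "t > 0")
   case True
   have "(NN x. ind {t. 0 < t & t < |(v x)|} t * ind E x) = (NN x. ind (E \<inter> {x \<in> \<Omega>. t < |(v x)|}) x)"
    using True E(1) by (intro nn_integral_cong) (auto simp: indicator_def)
   also have "\<dots> = emeasure lborel (E \<inter> {x \<in> \<Omega>. t < |(v x)|})" by (rule nn_integral_indicator) measurable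
   also have "\<dots> \<le> ennreal (min m (\<mu> t))"
   proof -
    have "emeasure lborel (E \<inter> {x \<in> \<Omega>. t < |(v x)|}) \<le> ennreal m" by (rule order_trans[OF emeasure_mono E(2)]) auto
    moreover have "emeasure lborel (E \<inter> {x \<in> \<Omega>. t < |(v x)|}) \<le> ennreal (\<mu> t)"
     unfolding vm[symmetric] by (rule emeasure_mono) (auto, measurable)
    ultimately show ?thesis by (simp add: min_def)
   qed
   also have "\<dots> = emeasure lborel {0<..<min m (\<mu> t)}" using E(3) mu_nonneg[of t] by simp
   also have "\<dots> = (NN s. ind {0<..<min m (\<mu> t)} s)" by simp
   also have "\<dots> = (NN s. ind {t. 0 < t & s < \<mu> t} t * ind {0<..<m} s)" using True by (intro nn_integral_cong) (auto simp: indicator_def)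
   finally show ?thesis .
  qed simp
 qed
 also have "\<dots> = (NN s. (NN t. ind {t. 0 < t & s < \<mu> t} t * ind {0<..<m} s))" by (rule lborel_pair.Fubini') measurable
 also have "\<dots> = (NN s. ennreal (us s) * ind {0<..<m} s)" by (intro nn_integral_cong) (auto simp: nn_integral_multc us_layer indicator_def)
 finally show ?thesis .
qed

end

text \<open>Only u is decomposed into layers. Each level set of u is a set over which f integrates
  to at most the integral of its rearrangement up to the measure of the set; Tonelli's theorem then
  reassembles the layers of u.\<close>

lemma Hardy_Littlewood:
 assumes "rearr \<Omega> f" "rearr \<Omega> u"
 shows "(\<integral>\<^sup>+x. ennreal |(f x)| * ennreal |(u x)| \<partial>lebesgue_on \<Omega>)
  \<le> (NN s. ennreal (decr_rearr \<Omega> f s) * ennreal (decr_rearr \<Omega> u s) * ind {0<..} s)"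
proof -
 interpret f: rearr \<Omega> f by fact
 interpret u: rearr \<Omega> u by fact
 obtain v where v[measurable]: "v \<in> BM borel" and uv: "AE x in lborel. x \<in> \<Omega> --> u x = v x"
  and vm: "!!t. emeasure lborel {x \<in> \<Omega>. t < |(v x)|} = ennreal (u.\<mu> t)" by (rule u.borel_rep) (rule that)
 obtain g where g[measurable]: "g \<in> BM borel" and fg: "AE x in lborel. x \<in> \<Omega> --> f x = g x" by (rule f.borel_rep) (rule that)
 note [measurable] = u.\<Omega>b
 define fs where "fs s = ind {0<..} s * decr_rearr \<Omega> f s" for s :: real
 have [measurable]: "fs \<in> BM borel" unfolding fs_def by (rule f.us_borel)
 have "(\<integral>\<^sup>+x. ennreal |(f x)| * ennreal |(u x)| \<partial>lebesgue_on \<Omega>) = (NN x. ennreal |(g x)| * ennreal |(v x)| * ind \<Omega> x)"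
  unfolding nn_integral_lebesgue_on[OF u.\<Omega>b] by (intro nn_integral_cong_AE eventually_elim2[OF uv fg]) (auto simp: indicator_def)
 also have "\<dots> = (NN x. (NN t. ennreal |(g x)| * ind {t. 0 < t & t < |(v x)|} t * ind \<Omega> x))"
  by (intro nn_integral_cong) (simp add: u.abs_layer nn_integral_multc nn_integral_cmult)
 also have "\<dots> = (NN t. (NN x. ennreal |(g x)| * ind {t. 0 < t & t < |(v x)|} t * ind \<Omega> x))"
  by (rule lborel_pair.Fubini'[symmetric]) measurable
 also have "\<dots> \<le> (NN t. (NN s. ennreal (fs s) * ind {t. 0 < t & s < u.\<mu> t} t))"
 proof (rule nn_integral_mono)
  fix t :: real
  show "(NN x. ennreal |(g x)| * ind {t. 0 < t & t < |(v x)|} t * ind \<Omega> x)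
   \<le> (NN s. ennreal (fs s) * ind {t. 0 < t & s < u.\<mu> t} t)"
  proof (cases "t > 0")
   case True
   have "(NN x. ennreal |(g x)| * ind {t. 0 < t & t < |(v x)|} t * ind \<Omega> x)
     = (\<integral>\<^sup>+x. ennreal |(f x)| * ind {x \<in> \<Omega>. t < |(v x)|} x \<partial>lebesgue_on \<Omega>)"
    unfolding nn_integral_lebesgue_on[OF u.\<Omega>b] using True by (intro nn_integral_cong_AE eventually_mono[OF fg]) (auto simp: indicator_def)
   also have "\<dots> \<le> (NN s. ennreal (decr_rearr \<Omega> f s) * ind {0<..<u.\<mu> t} s)"
    by (rule f.integral_le_rearr) (auto simp: vm u.mu_nonneg)
   also have "\<dots> = (NN s. ennreal (fs s) * ind {t. 0 < t & s < u.\<mu> t} t)"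
    using True by (intro nn_integral_cong) (auto simp: indicator_def fs_def)
   finally show ?thesis .
  qed simp
 qed
 also have "\<dots> = (NN s. (NN t. ennreal (fs s) * ind {t. 0 < t & s < u.\<mu> t} t))" by (rule lborel_pair.Fubini') measurable
 also have "\<dots> = (NN s. ennreal (decr_rearr \<Omega> f s) * ennreal (decr_rearr \<Omega> u s) * ind {0<..} s)"
  by (intro nn_integral_cong) (auto simp: nn_integral_cmult u.us_layer indicator_def fs_def)
 finally show ?thesis .
qed

text \<open>Whichever of A y and B is the larger, it carries at least half of the right-hand side.
  With y the slope of the rearrangement this resolves the energy inequality, whose right-hand side
  contains y itself through the truncated load.\<close>

lemma power_inequality_bound:
 fixes y A B P :: real
 assumes "P > 1" "y \<ge> 0" "A \<ge> 0" "B \<ge> 0" "y powr P \<le> A * y + B"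
 shows "y \<le> (2 * A) powr (1 / (P - 1)) + (2 * B) powr (1/P)"
proof (cases "y = 0")
 case False
 hence y: "y > 0" using assms by simp
 show ?thesis
 proof (cases "B \<le> A * y")
  case True
  hence "y powr P \<le> 2 * A * y" using assms(5) by simp
  moreover have "y powr P = y powr (P - 1) * y" using y by (simp add: powr_diff)
  ultimately have "y powr (P - 1) \<le> 2 * A" using y by simp
  hence "(y powr (P - 1)) powr (1 / (P - 1)) \<le> (2 * A) powr (1 / (P - 1))" using assms by (intro powr_mono2) auto
  hence "y \<le> (2 * A) powr (1 / (P - 1))" using assms y by (simp add: powr_powr)
  thus ?thesis by (simp add: add_increasing2)
 next
  case False
  hence "y powr P \<le> 2 * B" using assms(5) by simp
  hence "(y powr P) powr (1/P) \<le> (2 * B) powr (1/P)" using assms by (intro powr_mono2) auto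
  hence "y \<le> (2 * B) powr (1/P)" using assms y by (simp add: powr_powr)
  thus ?thesis by (simp add: add_increasing)
 qed
qed auto

text \<open>The errors on the two sides of s add up because z - s and s - x are both nonnegative.
  Increments over intervals containing s are what tagged divisions require.\<close>

lemma DERIV_straddle:
 fixes K :: "real => real"
 assumes "(K has_real_derivative G) (at s)" "\<eta> > 0"
 obtains \<gamma> where "\<gamma> > 0" "!!x z. x \<le> s ==> s \<le> z ==> s - \<gamma> < x ==> z < s + \<gamma> ==> |((K z - K x) - G * (z - x))| \<le> \<eta> * (z - x)"
proof -
 have "(%y. (K y - K s) / (y - s)) \<midarrow>s\<rightarrow> G" using assms(1) by (simp add: has_field_derivative_iff)
 from LIM_D[OF this assms(2)] obtain \<gamma> where
  "\<gamma> > 0 & (\<forall>y. y \<noteq> s & norm (y - s) < \<gamma> --> norm ((K y - K s) / (y - s) - G) < \<eta>)" by (elim exE)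
 hence \<gamma>: "\<gamma> > 0" "!!y. y \<noteq> s ==> |(y - s)| < \<gamma> ==> |((K y - K s) / (y - s) - G)| < \<eta>" by simp_all
 have e: "|((K y - K s) - G * (y - s))| \<le> \<eta> * |(y - s)|" if "|(y - s)| < \<gamma>" for y
 proof (cases "y = s")
  case False
  have "(K y - K s) - G * (y - s) = ((K y - K s) / (y - s) - G) * (y - s)" using False by (simp add: field_simps)
  thus ?thesis using \<gamma>(2)[OF False that] by (simp add: abs_mult mult_right_mono)
 qed simp
 show ?thesis
 proof (rule that[OF \<gamma>(1)])
  fix x z assume xz: "x \<le> s" "s \<le> z" "s - \<gamma> < x" "z < s + \<gamma>"
  have "(K z - K x) - G * (z - x) = ((K z - K s) - G * (z - s)) - ((K x - K s) - G * (x - s))" by (simp add: algebra_simps)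
  moreover have "|((K z - K s) - G * (z - s))| \<le> \<eta> * (z - s)" using e[of z] xz by simp
  moreover have "|((K x - K s) - G * (x - s))| \<le> \<eta> * (s - x)" using e[of x] xz by simp
  moreover have "\<eta> * (z - x) = \<eta> * (z - s) + \<eta> * (s - x)" by (simp add: algebra_simps)
  ultimately show "|((K z - K x) - G * (z - x))| \<le> \<eta> * (z - x)" by linarith
 qed
qed

text \<open>Absolute continuity in the form available for pseudo-rearrangements: for each \<open>\<epsilon>\<close>, up to a
 Lipschitz part the total variation is at most \<open>\<epsilon>\<close>.\<close>

locale ac_primitive =
 fixes T :: real and K G :: "real => real" and Ktot :: real
 assumes K_mono: "!!x z. 0 < x ==> x \<le> z ==> z < T ==> K x \<le> K z"
  and K_nonneg: "!!x. 0 < x ==> x < T ==> 0 \<le> K x" and K_le: "!!x. 0 < x ==> x < T ==> K x \<le> Ktot"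
  and AC: "!!\<epsilon>. \<epsilon> > 0 ==> \<exists>L V. L \<ge> 0 & (\<forall>x z. 0 < x & x \<le> z & z < T --> V x \<le> V z & V z - V x \<le> \<epsilon> & K z - K x \<le> L * (z - x) + (V z - V x))"
  and deriv: "AE s in LB {0<..<T}. (K has_real_derivative G s) (at s)"
begin

lemma deriv_null:
 obtains S where "negligible S" "!!s. 0 < s ==> s < T ==> s \<notin> S ==> (K has_real_derivative G s) (at s)"
proof -
 have "AE s in lebesgue. s \<in> {0<..<T} --> (K has_real_derivative G s) (at s)" using deriv by (simp add: AE_restrict_space_iff)
 then obtain S where "S \<in> null_sets lebesgue" "{s \<in> space lebesgue. \<not> (s \<in> {0<..<T} --> (K has_real_derivative G s) (at s))} \<subseteq> S"
  unfolding eventually_ae_filter by blast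
 thus ?thesis by (intro that[of S]) (auto simp: negligible_iff_null_sets)
qed

lemma deriv_nonneg:
 assumes "0 < s" "s < T" "(K has_real_derivative G s) (at s)"
 shows "0 \<le> G s"
proof (rule ccontr)
 assume "\<not> 0 \<le> G s"
 hence "- G s / 2 > 0" by simp
 from DERIV_straddle[OF assms(3) this] obtain \<gamma> where
  \<gamma>: "\<gamma> > 0" "!!x z. x \<le> s ==> s \<le> z ==> s - \<gamma> < x ==> z < s + \<gamma> ==> |((K z - K x) - G s * (z - x))| \<le> - G s / 2 * (z - x)"
  by blast
 define z where "z = s + min (\<gamma> / 2) ((T - s) / 2)"
 have z: "s < z" "z < T" "z < s + \<gamma>" using \<gamma>(1) assms by (auto simp: z_def min_def field_simps)
 have "|((K z - K s) - G s * (z - s))| \<le> - G s / 2 * (z - s)" using \<gamma>(2)[of s z] z \<gamma>(1) by simp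
 moreover have "K s \<le> K z" using K_mono[of s z] assms z by simp
 moreover have "G s * (z - s) < 0" using \<open>\<not> 0 \<le> G s\<close> z by (simp add: mult_neg_pos)
 ultimately show False by (simp add: abs_le_iff)
qed

lemma AE_nonneg: "AE s in LB {0<..<T}. 0 \<le> G s"
proof -
 have "AE s in LB {0<..<T}. s \<in> {0<..<T}" by (rule AE_I2) simp
 thus ?thesis using deriv by eventually_elim (auto intro: deriv_nonneg)
qed

text \<open>G is given only as an a.e. derivative; it agrees a.e. with the limit of difference
  quotients of a Borel function.\<close>

lemma G_measurable: "G \<in> BM (LB {0<..<T})"
proof -
 \<comment> \<open>The constants on both sides extend K to a monotone function on the whole line,
   which is therefore Borel.\<close>
 define K' where "K' s = (if s \<le> 0 then 0 else if s < T then K s else max 0 Ktot)" for s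
 have "mono K'" unfolding mono_def K'_def using K_mono K_nonneg K_le by (auto intro: order_trans le_max_iff_disj[THEN iffD2])
 hence [measurable]: "K' \<in> BM borel" by (rule borel_measurable_mono)
 define q where "q n s = (K' (s + 1 / real (Suc n)) - K' s) / (1 / real (Suc n))" for n s
 have [measurable]: "q n \<in> BM borel" for n unfolding q_def by measurable
 define l where "l s = lim (%n. q n s)" for s
 have [measurable]: "l \<in> BM borel" unfolding l_def by measurable
 have "AE s in lborel. s \<in> {0<..<T} --> G s = l s"
 proof -
  have "AE s in lborel. s \<in> {0<..<T} --> (K has_real_derivative G s) (at s)" using deriv by (simp add: AE_lebesgue_on_iff)
  thus ?thesis
  proof eventually_elim
   case (elim s)
   show ?case
   proof
    assume s: "s \<in> {0<..<T}"
    hence "(K has_real_derivative G s) (at s)" using elim by simp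
    hence "((%h. (K (s + h) - K s) / h) \<longlongrightarrow> G s) (at 0)" by (simp add: DERIV_def)
    moreover have "filterlim (%n. 1 / real (Suc n)) (at 0) sequentially" by real_asymp
    ultimately have "(%n. (K (s + 1 / real (Suc n)) - K s) / (1 / real (Suc n))) \<leadsto> G s" by (rule filterlim_compose)
    moreover have "eventually (%n. (K (s + 1 / real (Suc n)) - K s) / (1 / real (Suc n)) = q n s) sequentially"
    proof -
     have "(%n. s + 1 / real (Suc n)) \<leadsto> s" by real_asymp
     hence "eventually (%n. s + 1 / real (Suc n) < T) sequentially" by (rule order_tendstoD) (use s in auto)
     thus ?thesis
     proof eventually_elim
      case (elim n)
      have "0 < s + 1 / real (Suc n)" using s by (simp add: add_pos_pos)
      thus ?case using s elim by (simp add: q_def K'_def)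
     qed
    qed
    ultimately have "(%n. q n s) \<leadsto> G s" by (rule Lim_transform_eventually)
    thus "G s = l s" by (simp add: l_def limI)
   qed
  qed
 qed
 thus ?thesis by (intro integral_lebesgue_on_cong_borel(3)[of _ l]) auto
qed

text \<open>The derivative of a monotone function integrates to at most the total increase. G is
  first cut off at height L, which makes it integrable on compact intervals; then
  \<open>AC_upper_FTC\<close> applies to K and the negative of the cut-off, where monotonicity of K
  supplies the \<open>AC\<close> condition with L = 0 and constant V.\<close>

lemma nn_G_le: "(\<integral>\<^sup>+s. ennreal (G s) * ind {0<..<T} s \<partial>lebesgue) \<le> ennreal Ktot"
proof -
 define Gm where "Gm L s = min (max (G s) 0) (real L)" for L :: nat and s
 have Gm0: "0 \<le> Gm L s" for L s by (simp add: Gm_def)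
 have sub: "(\<integral>\<^sup>+s. ennreal (Gm L s) * ind {a..b} s \<partial>lebesgue) \<le> ennreal Ktot" if ab: "0 < a" "a \<le> b" "b < T" for L a b
 proof -
  have "{a..b} \<subseteq> {0<..<T}" using ab by auto
  hence gm: "G \<in> BM (LB {a..b})" using G_measurable by (rule measurable_restrict_mono[rotated])
  have i: "integrable (LB {a..b}) (Gm L)"
  proof (rule finite_measure.integrable_const_bound[where B = "real L"])
   show "finite_measure (LB {a..b})" by (rule finite_measure_lebesgue_on) simp
   show "Gm L \<in> BM (LB {a..b})" unfolding Gm_def[abs_def] using gm by measurable
  qed (auto simp: Gm_def)
  obtain S where S: "negligible S" "!!s. 0 < s ==> s < T ==> s \<notin> S ==> (K has_real_derivative G s) (at s)" using deriv_null by blast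
  have "K a - K b \<le> - (LINT s|LB {a..b}. Gm L s)"
  proof (rule AC_upper_FTC[where U = K and a = a and b = b and H = "%s. - Gm L s" and S = S])
   show "((%s. - Gm L s) has_integral - (LINT s|LB {a..b}. Gm L s)) {a..b}" by (intro has_integral_neg has_integral_integral_lebesgue_on i) auto
   show "\<exists>L V. 0 \<le> L & V b - V a \<le> \<epsilon> & (\<forall>x z. a \<le> x & x \<le> z & z \<le> b --> V x \<le> V z & K x - K z \<le> L * (z - x) + (V z - V x))"
    if "\<epsilon> > 0" for \<epsilon> :: real using that K_mono ab by (intro exI[of _ 0] exI[of _ "%_. 0"]) auto
   show "\<exists>\<gamma>>0. \<forall>x z. a \<le> x & x \<le> s & s \<le> z & z \<le> b & s - \<gamma> < x & z < s + \<gamma> --> K x - K z \<le> (- Gm L s + \<epsilon>) * (z - x)"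
    if s: "s \<in> {a..b} - S" and e: "\<epsilon> > 0" for s \<epsilon>
   proof -
    have d: "(K has_real_derivative G s) (at s)" using S(2) s ab by auto
    have "Gm L s \<le> G s" using deriv_nonneg[OF _ _ d] s ab by (auto simp: Gm_def)
    hence Gle: "Gm L s \<le> G s" .
    obtain \<gamma> where \<gamma>: "\<gamma> > 0" "!!x z. x \<le> s ==> s \<le> z ==> s - \<gamma> < x ==> z < s + \<gamma> ==> |((K z - K x) - G s * (z - x))| \<le> \<epsilon> * (z - x)"
     using DERIV_straddle[OF d e] by blast
    show ?thesis
    proof (intro exI[of _ \<gamma>] conjI allI impI)
     fix x z assume xz: "a \<le> x & x \<le> s & s \<le> z & z \<le> b & s - \<gamma> < x & z < s + \<gamma>"
     hence "|((K z - K x) - G s * (z - x))| \<le> \<epsilon> * (z - x)" by (intro \<gamma>(2)) auto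
     thus "K x - K z \<le> (- Gm L s + \<epsilon>) * (z - x)" using xz mult_right_mono[OF Gle, of "z - x"] by (simp add: abs_le_iff algebra_simps)
    qed (rule \<gamma>(1))
   qed
  qed (use ab S in auto)
  hence "(LINT s|LB {a..b}. Gm L s) \<le> Ktot" using K_nonneg[of a] K_le[of b] ab by simp
  moreover have "(\<integral>\<^sup>+s. ennreal (Gm L s) * ind {a..b} s \<partial>lebesgue) = ennreal (LINT s|LB {a..b}. Gm L s)"
   using nn_integral_eq_integral[OF i] Gm0 by (simp add: nn_integral_restrict_space)
  ultimately show ?thesis by (simp add: ennreal_leI)
 qed
 \<comment> \<open>The offset 3 guarantees \<open>a n \<le> b n\<close> from n = 0 on while the
   intervals exhaust (0,T).\<close>
 define a b where "a n = T / real (n + 3)" and "b n = T - T / real (n + 3)" for n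
 have inc: "incseq (%n s. ennreal (Gm n s) * ind {a n..b n} s)" if "T > 0"
 proof (intro incseq_SucI le_funI mult_mono)
  fix n s
  show "ennreal (Gm n s) \<le> ennreal (Gm (Suc n) s)" unfolding Gm_def by (intro ennreal_leI min.mono) auto
  have "T / real (Suc n + 3) \<le> T / real (n + 3)" using that by (intro divide_left_mono) auto
  thus "ind {a n..b n} s \<le> (ind {a (Suc n)..b (Suc n)} s :: ennreal)" by (auto simp: a_def b_def indicator_def)
 qed auto
 show ?thesis
 proof (cases "T > 0")
  case True
  have ab: "0 < a n" "a n \<le> b n" "b n < T" for n using True by (auto simp: a_def b_def field_simps)
  have sup: "(SUP n. ennreal (Gm n s) * ind {a n..b n} s) = ennreal (G s) * ind {0<..<T} s" for s
  proof (cases "s \<in> {0<..<T}")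
   case True
   have "a \<leadsto> 0" "b \<leadsto> T" unfolding a_def b_def by real_asymp+
   hence ev: "eventually (%n. a n < s) sequentially" "eventually (%n. s < b n) sequentially" using True by (auto intro: order_tendstoD)
   obtain m :: nat where m: "G s \<le> real m" using real_arch_simple by blast
   have "eventually (%n. ennreal (Gm n s) * ind {a n..b n} s = ennreal (G s)) sequentially" using ev eventually_ge_at_top[of m]
   proof eventually_elim
    case (elim n)
    hence "G s \<le> real n" using m by simp
    hence "ennreal (Gm n s) = ennreal (G s)" by (simp add: Gm_def max_def ennreal_neg)
    thus ?case using elim by simp
   qed
   hence "(%n. ennreal (Gm n s) * ind {a n..b n} s) \<leadsto> ennreal (G s)" by (rule tendsto_eventually)
   moreover have "(%n. ennreal (Gm n s) * ind {a n..b n} s) \<leadsto> (SUP n. ennreal (Gm n s) * ind {a n..b n} s)"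
    using inc[OF \<open>T > 0\<close>] by (intro LIMSEQ_SUP) (auto simp: incseq_def le_fun_def)
   ultimately show ?thesis using True LIMSEQ_unique by fastforce
  next
   case False
   hence "s \<notin> {a n..b n}" for n using ab[of n] by auto
   thus ?thesis using False by simp
  qed
  have "(\<integral>\<^sup>+s. ennreal (G s) * ind {0<..<T} s \<partial>lebesgue) = (\<integral>\<^sup>+s. (SUP n. ennreal (Gm n s) * ind {a n..b n} s) \<partial>lebesgue)"
   by (simp add: sup)
  also have "\<dots> = (SUP n. \<integral>\<^sup>+s. ennreal (Gm n s) * ind {a n..b n} s \<partial>lebesgue)"
  proof (rule nn_integral_monotone_convergence_SUP[OF inc[OF True]])
   fix n
   have "{a n..b n} \<subseteq> {0<..<T}" using ab[of n] by auto
   hence gm: "G \<in> BM (LB {a n..b n})" using G_measurable by (rule measurable_restrict_mono[rotated])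
   have "(%s. ennreal (Gm n s)) \<in> BM (LB {a n..b n})" unfolding Gm_def[abs_def] using gm by measurable
   thus "(%s. ennreal (Gm n s) * ind {a n..b n} s) \<in> BM lebesgue" by (subst (asm) borel_measurable_restrict_space_iff_ennreal) auto
  qed
  also have "\<dots> \<le> ennreal Ktot" by (intro SUP_least sub ab)
  finally show ?thesis .
 qed (auto simp: not_less)
qed

text \<open>The inequality opposite to \<open>nn_G_le\<close>. Here absolute continuity of K is
  essential, since a singular part would not be seen by G.\<close>

lemma K_increment_le_nn:
 assumes ab: "0 < a" "a \<le> b" "b < T"
 shows "ennreal (K b - K a) \<le> (\<integral>\<^sup>+s. ennreal (G s) * ind {0<..<T} s \<partial>lebesgue)"
proof -
 have abT: "{a..b} \<subseteq> {0<..<T}" using ab by auto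
 have gm: "G \<in> BM (LB {a..b})" by (rule measurable_restrict_mono[OF G_measurable abT])
 define G' where "G' s = max (G s) 0" for s
 have G'0: "0 \<le> G' s" for s by (simp add: G'_def)
 have G'm: "G' \<in> BM (LB {a..b})" unfolding G'_def[abs_def] using gm by measurable
 have le: "(\<integral>\<^sup>+s. ennreal (G' s) \<partial>lebesgue_on {a..b}) \<le> (\<integral>\<^sup>+s. ennreal (G s) * ind {0<..<T} s \<partial>lebesgue)"
  using abT by (subst nn_integral_restrict_space) (auto intro!: nn_integral_mono simp: indicator_def G'_def max_def ennreal_neg)
 have i: "integrable (LB {a..b}) G'"
  by (rule integrableI_bounded[OF G'm]) (use le_less_trans[OF order_trans[OF le nn_G_le]] in \<open>auto simp: G'_def\<close>)
 obtain S where S: "negligible S" "!!s. 0 < s ==> s < T ==> s \<notin> S ==> (K has_real_derivative G s) (at s)" using deriv_null by blast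
 have "(- K a) - (- K b) \<le> (LINT s|LB {a..b}. G' s)"
 proof (rule AC_upper_FTC[where a = a and b = b and H = G' and S = S and U = "%s. - K s"])
  show "(G' has_integral (LINT s|LB {a..b}. G' s)) {a..b}" by (intro has_integral_integral_lebesgue_on i) auto
  show "\<exists>L V. 0 \<le> L & V b - V a \<le> \<epsilon> & (\<forall>x z. a \<le> x & x \<le> z & z \<le> b --> V x \<le> V z & - K x - - K z \<le> L * (z - x) + (V z - V x))"
   if e: "\<epsilon> > 0" for \<epsilon> :: real
  proof -
   obtain L V where "L \<ge> 0" "!!x z. 0 < x ==> x \<le> z ==> z < T ==> V x \<le> V z & V z - V x \<le> \<epsilon> & K z - K x \<le> L * (z - x) + (V z - V x)"
    using AC[OF e] by blast
   thus ?thesis using ab by (intro exI[of _ L] exI[of _ V]) auto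
  qed
  show "\<exists>\<gamma>>0. \<forall>x z. a \<le> x & x \<le> s & s \<le> z & z \<le> b & s - \<gamma> < x & z < s + \<gamma> --> - K x - - K z \<le> (G' s + \<epsilon>) * (z - x)"
   if s: "s \<in> {a..b} - S" and e: "\<epsilon> > 0" for s \<epsilon>
  proof -
   have d: "(K has_real_derivative G s) (at s)" using S(2) s ab by auto
   have "G' s = G s" using deriv_nonneg[OF _ _ d] s ab by (auto simp: G'_def)
   hence Geq: "G' s = G s" .
   obtain \<gamma> where \<gamma>: "\<gamma> > 0" "!!x z. x \<le> s ==> s \<le> z ==> s - \<gamma> < x ==> z < s + \<gamma> ==> |((K z - K x) - G s * (z - x))| \<le> \<epsilon> * (z - x)"
    using DERIV_straddle[OF d e] by blast
   show ?thesis
   proof (intro exI[of _ \<gamma>] conjI allI impI)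
    fix x z assume xz: "a \<le> x & x \<le> s & s \<le> z & z \<le> b & s - \<gamma> < x & z < s + \<gamma>"
    hence "|((K z - K x) - G s * (z - x))| \<le> \<epsilon> * (z - x)" by (intro \<gamma>(2)) auto
    thus "- K x - - K z \<le> (G' s + \<epsilon>) * (z - x)" by (simp add: Geq abs_le_iff algebra_simps)
   qed (rule \<gamma>(1))
  qed
 qed (use ab S in auto)
 hence "ennreal (K b - K a) \<le> ennreal (LINT s|LB {a..b}. G' s)" by (intro ennreal_leI) simp
 also have "\<dots> = (\<integral>\<^sup>+s. ennreal (G' s) \<partial>lebesgue_on {a..b})" using nn_integral_eq_integral[OF i] G'0 by simp
 also note le
 finally show ?thesis .
qed

text \<open>\<open>Hf\<close> bounds the difference quotients of \<open>U\<close>.\<close>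

lemma comparison_1d:
 fixes U F :: "real => real" and c C0 P N :: real
 assumes P: "P > 1" and N: "N > 0" and c: "c > 0" and C0: "C0 \<ge> 0"
  and U_anti: "!!x z. 0 < x ==> x \<le> z ==> z < T ==> U z \<le> U x"
  and F_mono: "!!x z. 0 < x ==> x \<le> z ==> z < T ==> F x \<le> F z" and F0: "!!x. 0 < x ==> x < T ==> 0 \<le> F x"
  and disc: "!!x z. 0 < x ==> x < z ==> z < T ==>
   (U x - U z) * x \<le> c * z powr (1/N) * (z - x) powr (1 - 1/P) * (2 * (U x - U z) * F z + 2 * C0 * (K z - K x)) powr (1/P)"
  and lim: "!!\<epsilon>. \<epsilon> > 0 ==> 0 < T ==> \<exists>b<T. \<forall>z. b \<le> z & 0 < z & z < T --> U z \<le> \<epsilon>"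
  and s: "0 < s" "s < T"
 defines "Hf \<equiv> %\<kappa> F g. (2 * (\<kappa> powr P * (2 * F))) powr (1 / (P - 1)) + (2 * (\<kappa> powr P * (2 * C0 * g))) powr (1/P)"
 shows "ennreal (U s) \<le> (\<integral>\<^sup>+t. ennreal (Hf (c * t powr (1/N) / t) (F t) (G t)) * ind {s<..<T} t \<partial>lebesgue)"
proof -
 have Hf_mono: "Hf \<kappa> F1 g \<le> Hf \<kappa>' F' g'" if "0 \<le> \<kappa>" "\<kappa> \<le> \<kappa>'" "0 \<le> F1" "F1 \<le> F'" "0 \<le> g" "g \<le> g'" for \<kappa> \<kappa>' F1 F' g g'
  unfolding Hf_def using that P C0 by (intro add_mono powr_mono2 mult_left_mono mult_mono mult_nonneg_nonneg) auto
 \<comment> \<open>Divide by m = z - x: the powers m^(1 - 1/P) and m^(1/P) multiply to m and cancel.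
   There remains y^P <= A y + B for the slope y, solved by
   \<open>power_inequality_bound\<close>.\<close>
 have quot: "U x - U z \<le> Hf (c * z powr (1/N) / x) (F z) ((K z - K x) / (z - x)) * (z - x)" if xz: "0 < x" "x < z" "z < T" for x z
 proof -
  define m where "m = z - x"
  define y where "y = (U x - U z) / m"
  define g where "g = (K z - K x) / m"
  define \<kappa> where "\<kappa> = c * z powr (1/N) / x"
  have m: "m > 0" using xz by (simp add: m_def)
  have y: "y \<ge> 0" using U_anti[of x z] xz m by (simp add: y_def)
  have g: "g \<ge> 0" using K_mono[of x z] xz m by (simp add: g_def)
  have \<kappa>: "\<kappa> > 0" using c xz by (simp add: \<kappa>_def)
  have Fz: "F z \<ge> 0" using F0[of z] xz by simp
  have eq: "U x - U z = y * m" "K z - K x = g * m" using m by (auto simp: y_def g_def)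
  have "y * m * x \<le> c * z powr (1/N) * m powr (1 - 1/P) * (m * (2 * y * F z + 2 * C0 * g)) powr (1/P)"
   using disc[OF xz] unfolding eq m_def[symmetric] by (simp add: algebra_simps)
  also have "(m * (2 * y * F z + 2 * C0 * g)) powr (1/P) = m powr (1/P) * (2 * y * F z + 2 * C0 * g) powr (1/P)" by (rule powr_mult)
  also have "c * z powr (1/N) * m powr (1 - 1/P) * (m powr (1/P) * (2 * y * F z + 2 * C0 * g) powr (1/P))
    = m * (c * z powr (1/N) * (2 * y * F z + 2 * C0 * g) powr (1/P))" using m by (simp add: powr_diff)
  finally have "y * x \<le> c * z powr (1/N) * (2 * y * F z + 2 * C0 * g) powr (1/P)" using m by (simp add: mult_ac)
  hence "y \<le> \<kappa> * (2 * y * F z + 2 * C0 * g) powr (1/P)" using xz(1) by (simp add: \<kappa>_def field_simps)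
  hence "y powr P \<le> (\<kappa> * (2 * y * F z + 2 * C0 * g) powr (1/P)) powr P" using y P by (intro powr_mono2) auto
  also have "\<dots> = \<kappa> powr P * (2 * y * F z + 2 * C0 * g)" using \<kappa> P y g Fz C0 by (simp add: powr_mult powr_powr)
  also have "\<dots> = (\<kappa> powr P * (2 * F z)) * y + \<kappa> powr P * (2 * C0 * g)" by (simp add: algebra_simps)
  finally have "y \<le> Hf \<kappa> (F z) g" unfolding Hf_def using P y Fz C0 g by (intro power_inequality_bound) auto
  hence "y * m \<le> Hf \<kappa> (F z) g * m" using m by (intro mult_right_mono) auto
  thus ?thesis unfolding eq(1) \<kappa>_def g_def m_def .
 qed
 define H where "H t = Hf (c * t powr (1/N) / t) (F t) (G t)" for t
 have H0: "H t \<ge> 0" for t by (simp add: H_def Hf_def)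
 obtain S1 where S1: "negligible S1" "!!s. 0 < s ==> s < T ==> s \<notin> S1 ==> (K has_real_derivative G s) (at s)" using deriv_null by blast
 have Fmon: "mono_on {0<..<T} F" using F_mono by (auto simp: mono_on_def)
 define S2 where "S2 = {t \<in> {0<..<T}. \<not> isCont F t}"
 have S2: "countable S2" using mono_on_ctble_discont_open[OF open_greaterThanLessThan Fmon] by (simp add: S2_def)
 have S: "negligible (S1 \<union> S2)" using S1(1) countable_imp_null_set_lborel[OF S2]
  by (simp add: negligible_iff_null_sets null_sets_completionI null_sets.Un)
 have Fborel: "F \<in> BM (LB {0<..<T})"
 proof -
  have "F \<in> BM (restrict_space borel {0<..<T})" by (rule borel_measurable_mono_on_fnc[OF Fmon])
  hence "(%t. ind {0<..<T} t *\<^sub>R F t) \<in> BM borel" by (subst (asm) borel_measurable_restrict_space_iff) auto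
  hence "(%t. ind {0<..<T} t *\<^sub>R F t) \<in> BM lebesgue" by (intro measurable_completion) simp
  thus ?thesis by (subst borel_measurable_restrict_space_iff) auto
 qed
 have Hm: "H \<in> BM (LB {0<..<T})"
 proof -
  note [measurable] = Fborel G_measurable
  have [measurable]: "(%t. t) \<in> BM (LB {0<..<T})" by (rule borel_imp_lebesgue_on) simp
  show ?thesis unfolding H_def[abs_def] Hf_def by measurable
 qed
 define I where "I = (\<integral>\<^sup>+t. ennreal (H t) * ind {s<..<T} t \<partial>lebesgue)"
 have incr: "ennreal (U s - U b) \<le> I" if b: "s < b" "b < T" and fin: "I < \<infinity>" for b
 proof -
  have sbT: "{s..b} \<subseteq> {0<..<T}" using s b by auto
  have Hm': "H \<in> BM (LB {s..b})" by (rule measurable_restrict_mono[OF Hm sbT])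
  have "(\<integral>\<^sup>+t. ennreal (H t) \<partial>lebesgue_on {s..b}) = (\<integral>\<^sup>+t. ennreal (H t) * ind {s..b} t \<partial>lebesgue)"
   by (simp add: nn_integral_restrict_space)
  also have "\<dots> = (\<integral>\<^sup>+t. ennreal (H t) * ind {s<..b} t \<partial>lebesgue)"
  proof (rule nn_integral_cong_AE)
   have "AE t in lebesgue. t \<noteq> s" by (intro AE_completion AE_lborel_singleton)
   thus "AE t in lebesgue. ennreal (H t) * ind {s..b} t = ennreal (H t) * ind {s<..b} t" by eventually_elim (auto simp: indicator_def)
  qed
  also have "\<dots> \<le> I" unfolding I_def using b by (intro nn_integral_mono) (auto simp: indicator_def)
  finally have le: "(\<integral>\<^sup>+t. ennreal (H t) \<partial>lebesgue_on {s..b}) \<le> I" .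
  have i: "integrable (LB {s..b}) H" by (rule integrableI_bounded[OF Hm']) (use le_less_trans[OF le fin] H0 in auto)
  have "U s - U b \<le> (LINT t|LB {s..b}. H t)"
  proof (rule AC_upper_FTC[where U = U and a = s and b = b and H = H and S = "S1 \<union> S2"])
   show "(H has_integral (LINT t|LB {s..b}. H t)) {s..b}" by (intro has_integral_integral_lebesgue_on i) auto
   \<comment> \<open>U inherits the \<open>AC\<close> condition from K. On [s,b] the coefficients
     are bounded, and increments of U are at most c1 times the length plus c2 times the increment of
     K.\<close>
   show "\<exists>L V. 0 \<le> L & V b - V s \<le> \<epsilon> & (\<forall>x z. s \<le> x & x \<le> z & z \<le> b --> V x \<le> V z & U x - U z \<le> L * (z - x) + (V z - V x))"
    if e: "\<epsilon> > 0" for \<epsilon> :: real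
   proof -
    define k where "k = (c * b powr (1/N) / s) powr P"
    define c1 where "c1 = (2 * (k * (2 * F b))) powr (1 / (P - 1)) + 1"
    define c2 where "c2 = 2 * (k * (2 * C0)) + 1"
    have k: "k \<ge> 0" by (simp add: k_def)
    have c12: "c1 \<ge> 0" "c2 > 0" using k C0 by (auto simp: c1_def c2_def intro!: add_nonneg_pos)
    have low: "U x - U z \<le> c1 * (z - x) + c2 * (K z - K x)" if xz: "s \<le> x" "x < z" "z \<le> b" for x z
    proof -
     define g where "g = (K z - K x) / (z - x)"
     have g: "g \<ge> 0" using K_mono[of x z] xz s b by (simp add: g_def)
     have Fz: "0 \<le> F z" "F z \<le> F b" using F0[of z] F_mono[of z b] xz s b by auto
     have \<kappa>: "c * z powr (1/N) / x \<le> c * b powr (1/N) / s" using c xz s N by (intro frac_le mult_left_mono powr_mono2) auto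
     have "Hf (c * z powr (1/N) / x) (F z) g \<le> Hf (c * b powr (1/N) / s) (F b) g" using c xz s g Fz \<kappa> by (intro Hf_mono) auto
     also have "\<dots> = (c1 - 1) + (2 * (k * (2 * C0 * g))) powr (1/P)" by (simp add: Hf_def c1_def k_def)
     \<comment> \<open>Since the root is not Lipschitz at 0, it is bounded by 1 + w. The constant
       goes into c1, and the rest is linear in the slope of K.\<close>
     also have "(2 * (k * (2 * C0 * g))) powr (1/P) \<le> 1 + 2 * (k * (2 * C0 * g))"
     proof -
      define w where "w = 2 * (k * (2 * C0 * g))"
      have w: "w \<ge> 0" using k C0 g by (simp add: w_def)
      have "w powr (1/P) \<le> 1 + w"
      proof (cases "w \<le> 1")
       case True
       hence "w powr (1/P) \<le> 1" using w P by (intro powr_le1) auto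
       thus ?thesis using w by simp
      next
       case False
       hence "w powr (1/P) \<le> w powr 1" using P by (intro powr_mono) auto
       thus ?thesis using False by simp
      qed
      thus ?thesis by (simp add: w_def)
     qed
     finally have h: "Hf (c * z powr (1/N) / x) (F z) g \<le> c1 + (c2 - 1) * g" by (simp add: c2_def)
     have "U x - U z \<le> Hf (c * z powr (1/N) / x) (F z) g * (z - x)" using quot[of x z] xz s b by (simp add: g_def)
     also have "\<dots> \<le> (c1 + c2 * g) * (z - x)" using h g xz by (intro mult_right_mono) (auto simp: algebra_simps)
     also have "\<dots> = c1 * (z - x) + c2 * (K z - K x)" using xz by (simp add: g_def distrib_right)
     finally show ?thesis .
    qed
    obtain L V where LV: "L \<ge> 0" "!!x z. 0 < x ==> x \<le> z ==> z < T ==> V x \<le> V z & V z - V x \<le> \<epsilon> / c2 & K z - K x \<le> L * (z - x) + (V z - V x)"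
     using AC[of "\<epsilon> / c2"] e c12 by auto
    show ?thesis
    proof (intro exI[of _ "c1 + c2 * L"] exI[of _ "%t. c2 * V t"] conjI allI impI)
     show "0 \<le> c1 + c2 * L" using c12 LV(1) by simp
     show "c2 * V b - c2 * V s \<le> \<epsilon>" using LV(2)[of s b] s b c12 by (simp add: field_simps)
     fix x z assume xz: "s \<le> x & x \<le> z & z \<le> b"
     have v: "V x \<le> V z" "K z - K x \<le> L * (z - x) + (V z - V x)" using LV(2)[of x z] xz s b by auto
     show "c2 * V x \<le> c2 * V z" using v(1) c12 by simp
     have "c2 * (K z - K x) \<le> c2 * (L * (z - x) + (V z - V x))" using v(2) c12 by (intro mult_left_mono) auto
     moreover have "U x - U z \<le> c1 * (z - x) + c2 * (K z - K x)" using low[of x z] xz by (cases "x = z") auto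
     ultimately show "U x - U z \<le> (c1 + c2 * L) * (z - x) + (c2 * V z - c2 * V x)" by (simp add: algebra_simps)
    qed
   qed
   show "\<exists>\<gamma>>0. \<forall>x z. s \<le> x & x \<le> r & r \<le> z & z \<le> b & r - \<gamma> < x & z < r + \<gamma> --> U x - U z \<le> (H r + \<epsilon>) * (z - x)"
    if r: "r \<in> {s..b} - (S1 \<union> S2)" and e: "\<epsilon> > 0" for r \<epsilon>
   proof -
    have r0: "0 < r" "r < T" using r s b by auto
    have d: "(K has_real_derivative G r) (at r)" using S1(2) r r0 by auto
    have G0: "G r \<ge> 0" by (rule deriv_nonneg[OF r0 d])
    have Fc: "isCont F r" using r r0 by (auto simp: S2_def)
    \<comment> \<open>Only points to the right are needed, because F is monotone and F(z) will be
      replaced by F(r + h). Continuity fails at most on the countable set \<open>S2\<close>.\<close>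
    have Fr: "((%h. F (r + h)) \<longlongrightarrow> F r) (at_right 0)"
    proof -
     have "(F \<longlongrightarrow> F r) (at_right r)" using Fc by (simp add: isCont_def filterlim_at_split)
     thus ?thesis by (simp add: filterlim_at_right_to_0[of F _ r] add.commute)
    qed
    have "((%h. Hf (c * (r + h) powr (1/N) / (r - h)) (F (r + h)) (G r + h)) \<longlongrightarrow> Hf (c * (r + 0) powr (1/N) / (r - 0)) (F r) (G r + 0)) (at_right 0)"
    proof -
     have id: "((%h::real. h) \<longlongrightarrow> 0) (at_right 0)" by (rule tendsto_ident_at)
     have k: "((%h. c * (r + h) powr (1/N) / (r - h)) \<longlongrightarrow> c * (r + 0) powr (1/N) / (r - 0)) (at_right 0)"
      using r0 by (intro tendsto_intros id) auto
     have kp: "((%h. (c * (r + h) powr (1/N) / (r - h)) powr P) \<longlongrightarrow> (c * (r + 0) powr (1/N) / (r - 0)) powr P) (at_right 0)"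
      using r0 c by (intro tendsto_powr k tendsto_const) auto
     have ev: "eventually (%h. 0 < h & h < T - r) (at_right (0::real))" using r0 by (auto simp: eventually_at_right_field intro!: exI[of _ "T - r"])
     show ?thesis unfolding Hf_def
     proof (intro tendsto_add tendsto_powr' tendsto_mult tendsto_const kp Fr id)
      show "2 * ((c * (r + 0) powr (1/N) / (r - 0)) powr P * (2 * F r)) \<noteq> 0 \<or> 0 < 1 / (P - 1) &
       (\<forall>\<^sub>F h in at_right 0. 0 \<le> 2 * ((c * (r + h) powr (1/N) / (r - h)) powr P * (2 * F (r + h))))"
       using P ev r0 by (intro disjI2 conjI) (auto elim!: eventually_mono intro!: mult_nonneg_nonneg F0)
      show "2 * ((c * (r + 0) powr (1/N) / (r - 0)) powr P * (2 * C0 * (G r + 0))) \<noteq> 0 \<or> 0 < 1/P &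
       (\<forall>\<^sub>F h in at_right 0. 0 \<le> 2 * ((c * (r + h) powr (1/N) / (r - h)) powr P * (2 * C0 * (G r + h))))"
       using P ev r0 G0 C0 by (intro disjI2 conjI) (auto elim!: eventually_mono)
     qed (rule k | use r0 c in simp)+
    qed
    hence "((%h. Hf (c * (r + h) powr (1/N) / (r - h)) (F (r + h)) (G r + h)) \<longlongrightarrow> H r) (at_right 0)" by (simp add: H_def)
    hence "eventually (%h. Hf (c * (r + h) powr (1/N) / (r - h)) (F (r + h)) (G r + h) < H r + \<epsilon>) (at_right 0)"
     using e by (intro order_tendstoD) auto
    \<comment> \<open>Choose h so small that \<open>Hf\<close> at the most unfavourable data within
      distance h of r still lies below H(r) + \<epsilon>. The same h then serves as tolerance for
      the slope of K.\<close>
    moreover have "eventually (%h. 0 < h & h < r & h < T - r) (at_right (0::real))"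
     using r0 by (auto simp: eventually_at_right_field intro!: exI[of _ "min r (T - r)"])
    ultimately have "eventually (%h. Hf (c * (r + h) powr (1/N) / (r - h)) (F (r + h)) (G r + h) < H r + \<epsilon> & 0 < h & h < r & h < T - r) (at_right 0)"
     by (rule eventually_conj)
    then obtain h where h: "Hf (c * (r + h) powr (1/N) / (r - h)) (F (r + h)) (G r + h) < H r + \<epsilon>" "0 < h" "h < r" "h < T - r"
     using eventually_happens[of _ "at_right (0::real)"] by (auto simp: trivial_limit_at_right_real)
    obtain \<gamma> where \<gamma>: "\<gamma> > 0" "!!x z. x \<le> r ==> r \<le> z ==> r - \<gamma> < x ==> z < r + \<gamma> ==> |((K z - K x) - G r * (z - x))| \<le> h * (z - x)"
     using DERIV_straddle[OF d h(2)] by blast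
    show ?thesis
    proof (intro exI[of _ "min \<gamma> h"] conjI allI impI)
     show "0 < min \<gamma> h" using \<gamma>(1) h by simp
     fix x z assume "s \<le> x & x \<le> r & r \<le> z & z \<le> b & r - min \<gamma> h < x & z < r + min \<gamma> h"
     hence xz: "s \<le> x" "x \<le> r" "r \<le> z" "z \<le> b" "r - \<gamma> < x" "z < r + \<gamma>" "r - h < x" "z < r + h" by auto
     show "U x - U z \<le> (H r + \<epsilon>) * (z - x)"
     proof (cases "x = z")
      case False
      hence m: "x < z" using xz by simp
      have "K z - K x \<le> (G r + h) * (z - x)" using \<gamma>(2)[of x z] xz by (simp add: abs_le_iff algebra_simps)
      hence g: "(K z - K x) / (z - x) \<le> G r + h" using m by (simp add: divide_le_eq)
      have "U x - U z \<le> Hf (c * z powr (1/N) / x) (F z) ((K z - K x) / (z - x)) * (z - x)" using quot[of x z] m s b xz by simp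
      also have "\<dots> \<le> Hf (c * (r + h) powr (1/N) / (r - h)) (F (r + h)) (G r + h) * (z - x)"
      proof (intro mult_right_mono Hf_mono g)
       show "c * z powr (1/N) / x \<le> c * (r + h) powr (1/N) / (r - h)" using c xz s h N by (intro frac_le mult_left_mono powr_mono2) auto
       show "0 \<le> F z" "F z \<le> F (r + h)" using F0[of z] F_mono[of z "r + h"] xz s b h by auto
       show "0 \<le> (K z - K x) / (z - x)" using K_mono[of x z] xz s b m by simp
      qed (use c xz s m in auto)
      also have "\<dots> \<le> (H r + \<epsilon>) * (z - x)" using h(1) m by (intro mult_right_mono) auto
      finally show ?thesis .
     qed simp
    qed
   qed
  qed (use b S in auto)
  hence "ennreal (U s - U b) \<le> ennreal (LINT t|LB {s..b}. H t)" by (rule ennreal_leI)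
  also have "\<dots> = (\<integral>\<^sup>+t. ennreal (H t) \<partial>lebesgue_on {s..b})" using nn_integral_eq_integral[OF i] H0 by simp
  also note le
  finally show ?thesis .
 qed
 have "ennreal (U s) \<le> I"
 proof (cases "I < \<infinity>")
  case True
  then obtain J where J: "I = ennreal J" "J \<ge> 0" by (cases I) auto
  have "U s \<le> J"
  \<comment> \<open>The increments only bound U(s) - U(b); the hypothesis \<open>lim\<close>, the
    boundary condition in disguise, makes U(b) small for b near T.\<close>
  proof (rule field_le_epsilon)
   fix \<epsilon> :: real assume e: "\<epsilon> > 0"
   have T0: "0 < T" using s by simp
   obtain b0 where b0: "b0 < T" "!!z. b0 \<le> z ==> 0 < z ==> z < T ==> U z \<le> \<epsilon>" using lim[OF e T0] by blast
   define b where "b = (max b0 s + T) / 2"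
   have b: "s < b" "b < T" "b0 \<le> b" using b0 s by (auto simp: b_def)
   have "U s - U b \<le> J" using incr[OF b(1,2) True] J by simp
   moreover have "U b \<le> \<epsilon>" using b0(2)[of b] b s by simp
   ultimately show "U s \<le> J + \<epsilon>" by simp
  qed
  thus ?thesis using J by (simp add: ennreal_leI)
 qed (simp add: not_less top_unique)
 thus ?thesis by (simp add: I_def H_def)
qed

end

section \<open>The sets of the pseudo-rearrangement and the primitive of the density\<close>

locale pseudo = rearr \<Omega> u for \<Omega> :: "(real^'a::finite) set" and u +
 fixes h :: "real^'a => real" and E :: "real => (real^'a) set" and G :: "real => real"
 assumes h_int: "integrable (LB \<Omega>) h" and h0: "!!x. h x \<ge> 0"
  and E_sets: "!!s. 0 < s ==> s < measure lebesgue \<Omega> ==> E s \<in> sets lebesgue"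
  and E_sub: "!!s. 0 < s ==> s < measure lebesgue \<Omega> ==> E s \<subseteq> \<Omega>"
  and E_meas: "!!s. 0 < s ==> s < measure lebesgue \<Omega> ==> measure lebesgue (E s) = s"
  and E_mono: "!!s t. 0 < s ==> s \<le> t ==> t < measure lebesgue \<Omega> ==> E s \<subseteq> E t"
  and E_lev: "!!t. 0 < distr_fun \<Omega> u t ==> distr_fun \<Omega> u t < measure lebesgue \<Omega> ==>
    E (distr_fun \<Omega> u t) = {x \<in> \<Omega>. |(u x)| > decr_rearr \<Omega> u (distr_fun \<Omega> u t)}"
  and E_deriv: "AE s in LB {0<..<measure lebesgue \<Omega>}.
    ((%\<sigma>. LINT x|LB (E \<sigma>). h x) has_real_derivative G s) (at s)"
begin

definition "K s = (LINT x|LB (E s). h x)"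

lemma E_M: "0 < s ==> s < T ==> E s \<in> sets MR"
 using E_sets[of s] E_sub[of s] by (auto simp: sets_restrict_space intro!: image_eqI[of _ _ "E s"])

lemma E_measM: "0 < s ==> s < T ==> measure MR (E s) = s"
 using E_meas E_sub by (simp add: measure_M)

lemma K_eq: "0 < s ==> s < T ==> K s = (LINT x|MR. ind (E s) x * h x)"
proof -
 assume s: "0 < s" "s < T"
 have "K s = (LINT x|lebesgue. ind (E s) x * h x)" using E_sets[OF s] by (simp add: K_def integral_restrict_space)
 also have "(%x. ind (E s) x * h x) = (%x. ind \<Omega> x *\<^sub>R (ind (E s) x * h x))" using E_sub[OF s] by (auto simp: indicator_def fun_eq_iff)
 finally show ?thesis using \<Omega>b by (simp add: integral_restrict_space)
qed

lemma ind_int: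
 fixes k :: "real^'a => real"
 assumes "A \<in> sets MR" "integrable MR k"
 shows "integrable MR (%x. ind A x * k x)" using integrable_mult_indicator[OF assms] by simp

lemma AE_subset_of_measure_eq:
 assumes "A \<in> sets MR" "B \<in> sets MR" "A \<subseteq> B" "measure MR B \<le> measure MR A"
 shows "AE x in MR. x \<in> B --> x \<in> A"
proof -
 have "measure MR (B - A) = 0" using finite_measure_Diff[OF assms(2,1,3)] finite_measure_mono[OF assms(3,2)] assms(4) by simp
 hence "B - A \<in> null_sets MR" using assms(1,2) by (auto simp: null_sets_def emeasure_eq_measure)
 from AE_not_in[OF this] show ?thesis by eventually_elim auto
qed

text \<open>If the level set has positive measure \<open>\<mu> t\<close>, it is contained in
  \<open>E (\<mu> t)\<close>, which is contained in \<open>E z\<close> because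
  \<open>\<mu> t \<le> z\<close>. If the measure is zero, the inclusion holds a.e. for trivial
  reasons.\<close>

lemma level_subset:
 assumes z: "0 < z" "z < T" and t: "us z \<le> t"
 shows "AE x in MR. t < |(u x)| --> x \<in> E z"
proof -
 have t0: "0 \<le> t" using t us_nonneg[OF z(1)] by simp
 have mt: "\<mu> t \<le> z" using us_gt_iff[OF z(1) t0] t by (simp add: not_less)
 show ?thesis
 proof (cases "\<mu> t = 0")
  case True
  hence "{x \<in> space MR. t < |(u x)|} \<in> null_sets MR" by (auto simp: null_sets_def emeasure_eq_measure mu_eq)
  from AE_not_in[OF this] AE_space show ?thesis by eventually_elim auto
 next
  case False
  hence m: "0 < \<mu> t" "\<mu> t < T" using mu_nonneg[of t] mt z by auto
  have "us (\<mu> t) \<le> t" using us_gt_iff[OF m(1) t0] by simp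
  hence "{x \<in> \<Omega>. t < |(u x)|} \<subseteq> E (\<mu> t)" unfolding E_lev[OF m] by auto
  also have "\<dots> \<subseteq> E z" using E_mono[OF m(1) mt z(2)] .
  finally show ?thesis by (intro AE_I2) auto
 qed
qed

text \<open>For t < \<open>us s\<close> we have s < \<open>\<mu> t\<close>. When
  \<open>\<mu> t\<close> < T, the set \<open>E (\<mu> t)\<close> contains E s and, having the
  measure of the level set of t that it includes, equals that level set a.e.; when
  \<open>\<mu> t\<close> = T the level set is everything. Rational t keep the exceptional sets
  countable and rise to \<open>us s\<close>.\<close>

lemma level_superset:
 assumes s: "0 < s" "s < T"
 shows "AE x in MR. x \<in> E s --> us s \<le> |(u x)|"
proof -
 have tau: "AE x in MR. x \<in> E s --> t < |(u x)|" if t: "0 \<le> t" "t < us s" for t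
 proof -
  have st: "s < \<mu> t" using us_gt_iff[OF s(1) t(1)] t(2) by simp
  show ?thesis
  proof (cases "\<mu> t < T")
   case True
   have m: "0 < \<mu> t" using st s by simp
   have "us (\<mu> t) \<le> t" using us_gt_iff[OF m t(1)] by simp
   hence "{x \<in> \<Omega>. t < |(u x)|} \<subseteq> E (\<mu> t)" unfolding E_lev[OF m True] by auto
   hence "AE x in MR. x \<in> E (\<mu> t) --> x \<in> {x \<in> \<Omega>. t < |(u x)|}"
    by (intro AE_subset_of_measure_eq E_M m True) (use E_measM[OF m True] in \<open>simp_all add: mu_eq\<close>)
   thus ?thesis by eventually_elim (use E_mono[OF s(1) less_imp_le[OF st] True] in auto)
  next
   case False
   hence "\<mu> t = T" using mu_le[of t] by simp
   hence "AE x in MR. x \<in> space MR --> x \<in> {x \<in> \<Omega>. t < |(u x)|}" by (intro AE_subset_of_measure_eq) (auto simp: mu_eq measure_M)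
   with AE_space show ?thesis by eventually_elim auto
  qed
 qed
 have "AE x in MR. \<forall>t\<in>\<rat> \<inter> {0..<us s}. x \<in> E s --> t < |(u x)|"
  by (intro AE_ball_countable' tau) (auto intro: countable_subset[OF _ countable_rat])
 thus ?thesis
 proof eventually_elim
  case (elim x)
  show ?case
  proof (intro impI, rule ccontr)
   assume x: "x \<in> E s" "\<not> us s \<le> |(u x)|"
   then obtain t where t: "t \<in> \<rat>" "|(u x)| < t" "t < us s" using Rats_dense_in_real[of "|(u x)|" "us s"] by auto
   moreover have "0 \<le> t" using t(2) by (rule order_trans[OF abs_ge_zero less_imp_le])
   ultimately have "t \<in> \<rat> \<inter> {0..<us s}" by auto
   hence "t < |(u x)|" using elim x(1) by blast
   thus False using t(2) by simp
  qed
 qed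
qed

lemma super_measure:
 assumes s: "0 < s" "s < T"
 shows "s \<le> measure lebesgue {x \<in> \<Omega>. us s \<le> |(u x)|}"
proof -
 have m: "{x \<in> \<Omega>. us s \<le> |(u x)|} \<in> sets MR"
 proof -
  have "{x \<in> space MR. us s \<le> |(u x)|} \<in> sets MR" by measurable
  thus ?thesis by simp
 qed
 have "s = measure MR (E s)" using E_measM[OF s] by simp
 also have "\<dots> \<le> measure MR {x \<in> \<Omega>. us s \<le> |(u x)|}"
 proof (rule finite_measure_mono_AE[OF _ m])
  show "AE x in MR. x \<in> E s --> x \<in> {x \<in> \<Omega>. us s \<le> |(u x)|}"
   using level_superset[OF s] by eventually_elim (use E_sub[OF s] in auto)
 qed
 finally show ?thesis by (simp add: measure_M)
qed

lemma K_diff: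
 assumes xz: "0 < x" "x \<le> z" "z < T"
 shows "K z - K x = (LINT y|MR. ind (E z - E x) y * h y)"
proof -
 have "K z - K x = (LINT y|MR. ind (E z) y * h y - ind (E x) y * h y)" using xz by (simp add: K_eq ind_int E_M h_int)
 also have "(%y. ind (E z) y * h y - ind (E x) y * h y) = (%y. ind (E z - E x) y * h y)" using E_mono[OF xz] by (auto simp: indicator_def fun_eq_iff)
 finally show ?thesis .
qed

text \<open>The two inclusions place the slab inside \<open>E z - E x\<close>, which has measure
  exactly z - x even where the rearrangement has plateaus. The density in the slab is therefore
  controlled by the increment of K.\<close>

lemma slab:
 assumes xz: "0 < x" "x < z" "z < T"
 defines "J \<equiv> {r. us z < |(r)| & |(r)| < us x}"
 shows "AE y in MR. u y \<in> J --> y \<in> E z - E x"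
  "measure lebesgue {y \<in> \<Omega>. us z < |(u y)| & |(u y)| < us x} \<le> z - x"
  "(LINT y|MR. ind J (u y) * h y) \<le> K z - K x"
proof -
 have x: "0 < x" "x < T" and z: "0 < z" "z < T" using xz by auto
 have sets: "E z - E x \<in> sets MR" using E_M[OF x] E_M[OF z] by auto
 show ae: "AE y in MR. u y \<in> J --> y \<in> E z - E x"
  using level_subset[OF z order_refl] level_superset[OF x] by eventually_elim (auto simp: J_def)
 have "measure lebesgue {y \<in> \<Omega>. us z < |(u y)| & |(u y)| < us x} = measure MR {y \<in> \<Omega>. us z < |(u y)| & |(u y)| < us x}"
  by (simp add: measure_M)
 also have "\<dots> \<le> measure MR (E z - E x)"
 proof (rule finite_measure_mono_AE[OF _ sets])
  show "AE y in MR. y \<in> {y \<in> \<Omega>. us z < |(u y)| & |(u y)| < us x} --> y \<in> E z - E x" using ae by eventually_elim (auto simp: J_def)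
 qed
 also have "\<dots> = z - x" using finite_measure_Diff[OF E_M[OF z] E_M[OF x] E_mono[OF x(1) less_imp_le[OF xz(2)] z(2)]]
   E_measM[OF x] E_measM[OF z] by linarith
 finally show "measure lebesgue {y \<in> \<Omega>. us z < |(u y)| & |(u y)| < us x} \<le> z - x" .
 have [measurable]: "J \<in> sets borel" unfolding J_def by (auto intro!: borel_open open_Collect_less open_Collect_conj continuous_intros)
 have [measurable]: "h \<in> BM MR" using h_int by simp
 show "(LINT y|MR. ind J (u y) * h y) \<le> K z - K x" unfolding K_diff[OF x(1) less_imp_le[OF xz(2)] z(2)]
 proof (rule integral_mono_AE)
  show "integrable MR (%y. ind J (u y) * h y)" by (rule Bochner_Integration.integrable_bound[OF h_int]) (auto simp: indicator_def)
  show "integrable MR (%y. ind (E z - E x) y * h y)" by (rule ind_int[OF sets h_int])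
  show "AE y in MR. ind J (u y) * h y \<le> ind (E z - E x) y * h y" using ae by eventually_elim (auto simp: indicator_def h0)
 qed
qed

text \<open>Cut h at height n. The bounded part has Lipschitz primitive with constant n because
  \<open>E z - E x\<close> has measure z - x; the remainder has integral below \<epsilon> for large
  n and furnishes V.\<close>

lemma ac: "ac_primitive T K G (LINT x|MR. h x)"
proof
 show "K x \<le> K z" if "0 < x" "x \<le> z" "z < T" for x z
 proof -
  have "0 \<le> K z - K x" unfolding K_diff[OF that] by (intro integral_nonneg_AE AE_I2) (simp add: h0)
  thus ?thesis by simp
 qed
 show "0 \<le> K x" if "0 < x" "x < T" for x unfolding K_eq[OF that] by (intro integral_nonneg_AE AE_I2) (simp add: h0)
 show "K x \<le> (LINT x|MR. h x)" if "0 < x" "x < T" for x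
  unfolding K_eq[OF that] by (intro integral_mono ind_int E_M h_int that) (auto simp: h0 indicator_def)
 show "AE s in LB {0<..<T}. (K has_real_derivative G s) (at s)" using E_deriv by (simp add: K_def[abs_def])
 show "\<exists>L V. 0 \<le> L & (\<forall>x z. 0 < x & x \<le> z & z < T --> V x \<le> V z & V z - V x \<le> \<epsilon> & K z - K x \<le> L * (z - x) + (V z - V x))"
  if e: "\<epsilon> > 0" for \<epsilon>
 proof -
  have [measurable]: "h \<in> BM MR" using h_int by simp
  define r where "r n x = h x - min (h x) (real n)" for n x
  have r: "0 \<le> r n x" "r n x \<le> h x" for n x using h0[of x] by (auto simp: r_def)
  have r_int: "integrable MR (r n)" for n
   by (rule Bochner_Integration.integrable_bound[OF h_int]) (use r h0 in \<open>auto simp: r_def[abs_def] intro!: AE_I2\<close>)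
  have "(%n. LINT x|MR. r n x) \<leadsto> (LINT x|MR. 0)"
  proof (rule integral_dominated_convergence[where s = r and f = "%_. 0" and w = h])
   show "AE x in MR. (%n. r n x) \<leadsto> 0"
   proof (intro AE_I2 tendsto_eventually)
    fix x
    obtain m :: nat where "h x \<le> real m" using real_arch_simple by blast
    thus "eventually (%n. r n x = 0) sequentially" unfolding eventually_sequentially by (intro exI[of _ m]) (auto simp: r_def min_def)
   qed
   show "AE x in MR. norm (r n x) \<le> h x" for n using r[of n] by (intro AE_I2) simp
  qed (use h_int in \<open>auto simp: r_def[abs_def]\<close>)
  hence "eventually (%n. (LINT x|MR. r n x) < \<epsilon>) sequentially" using e by (intro order_tendstoD) auto
  then obtain n where n: "(LINT x|MR. r n x) < \<epsilon>" by (auto simp: eventually_sequentially)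
  define V where "V s = (LINT x|MR. ind (E s) x * r n x)" for s
  show ?thesis
  proof (intro exI[of _ "real n"] exI[of _ V] conjI allI impI; (elim conjE)?)
   fix x z assume xz: "0 < x" "x \<le> z" "z < T"
   hence x: "0 < x" "x < T" and z: "0 < z" "z < T" by auto
   have sets: "E z - E x \<in> sets MR" using E_M[OF x] E_M[OF z] by auto
   have sub: "(E z - E x) \<inter> \<Omega> = E z - E x" using E_sub[OF z] by blast
   have V: "V z - V x = (LINT y|MR. ind (E z - E x) y * r n y)"
   proof -
    have "V z - V x = (LINT y|MR. ind (E z) y * r n y - ind (E x) y * r n y)" using x z by (simp add: V_def ind_int E_M r_int)
    also have "(%y. ind (E z) y * r n y - ind (E x) y * r n y) = (%y. ind (E z - E x) y * r n y)"
     using E_mono[OF xz] by (auto simp: indicator_def fun_eq_iff)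
    finally show ?thesis .
   qed
   have "0 \<le> V z - V x" unfolding V by (intro integral_nonneg_AE AE_I2) (simp add: r)
   thus "V x \<le> V z" by simp
   have "V z - V x \<le> (LINT x|MR. r n x)" unfolding V by (intro integral_mono ind_int sets r_int) (auto simp: r indicator_def)
   thus "V z - V x \<le> \<epsilon>" using n by simp
   have "K z - K x \<le> (LINT y|MR. real n * ind (E z - E x) y + ind (E z - E x) y * r n y)" unfolding K_diff[OF xz]
    using sets by (intro integral_mono ind_int h_int Bochner_Integration.integrable_add integrable_mult_right r_int integrable_real_indicator)
     (auto simp: indicator_def r_def less_top[symmetric])
   also have "\<dots> = real n * measure MR (E z - E x) + (V z - V x)" using sets sub unfolding V
    by (subst Bochner_Integration.integral_add) (auto intro!: ind_int r_int integrable_mult_right integrable_real_indicator simp: less_top[symmetric])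
   also have "measure MR (E z - E x) = z - x" using finite_measure_Diff[OF E_M[OF z] E_M[OF x] E_mono[OF xz]] E_measM[OF x] E_measM[OF z] by linarith
   finally show "K z - K x \<le> real n * (z - x) + (V z - V x)" .
  qed simp
 qed
qed

text \<open>As a tends to 0 and b to T, the sets E a and the complements of E b shrink to null sets,
  so the increments of K exhaust the whole integral of h.\<close>

lemma total_le_nn_G: "ennreal (LINT x|MR. h x) \<le> (\<integral>\<^sup>+s. ennreal (G s) * ind {0<..<T} s \<partial>lebesgue)"
proof (cases "T > 0")
 case False
 hence "T = 0" by (simp add: order_antisym)
 hence "\<Omega> \<in> null_sets lebesgue" using \<Omega>l by (auto simp: null_sets_def emeasure_eq_measure2)
 hence "space MR \<in> null_sets MR" by (auto simp: null_sets_restrict_space)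
 hence "AE x in MR. h x = 0" using AE_not_in AE_space by fastforce
 hence "(LINT x|MR. h x) = (LINT x|MR. 0)" using h_int by (intro integral_cong_AE) auto
 thus ?thesis by simp
next
 case True
 interpret ac_primitive T K G "LINT x|MR. h x" by (rule ac)
 define a b where "a n = T / real (n + 3)" and "b n = T - T / real (n + 3)" for n
 have ab: "0 < a n" "a n \<le> b n" "b n < T" for n using True by (auto simp: a_def b_def field_simps)
 have lim0: "(%n. LINT x|MR. ind (E n) x * h x) \<leadsto> 0" if "!!n. E n \<in> sets MR" "(%n. measure MR (E n)) \<leadsto> 0" "decseq E" for E :: "nat => _"
 proof -
  have m0: "measure MR (\<Inter>n. E n) = 0" using finite_Lim_measure_decseq[of E] that LIMSEQ_unique by (metis image_subsetI)
  have "(\<Inter>n. E n) \<in> null_sets MR" using that(1) m0 by (auto simp: null_sets_def emeasure_eq_measure)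
  hence ae: "AE x in MR. x \<notin> (\<Inter>n. E n)" by (rule AE_not_in)
  have "(%n. LINT x|MR. ind (E n) x * h x) \<leadsto> (LINT x|MR. 0)"
  proof (rule integral_dominated_convergence[where s = "%n x. ind (E n) x * h x" and f = "%_. 0" and w = h])
   show "AE x in MR. (%n. ind (E n) x * h x) \<leadsto> 0" using ae
   proof eventually_elim
    case (elim x)
    then obtain m where "x \<notin> E m" by auto
    hence "\<forall>n\<ge>m. x \<notin> E n" using that(3) by (auto simp: decseq_def)
    hence "eventually (%n. ind (E n) x * h x = 0) sequentially" unfolding eventually_sequentially by (intro exI[of _ m]) (auto simp: indicator_def)
    thus ?case by (rule tendsto_eventually)
   qed
   show "AE x in MR. norm (ind (E n) x * h x) \<le> h x" for n by (intro AE_I2) (simp add: h0 indicator_def)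
  qed (use h_int that(1) in \<open>auto intro!: borel_measurable_integrable[OF ind_int]\<close>)
  thus ?thesis by simp
 qed
 have mono_T: "T / real (Suc n + 3) \<le> T / real (n + 3)" for n using True by (intro divide_left_mono) auto
 have a0: "(%n. K (a n)) \<leadsto> 0"
 proof -
  have aT: "a n < T" for n using ab[of n] by linarith
  have "a (Suc n) \<le> a n" for n unfolding a_def by (rule mono_T)
  hence "decseq (%n. E (a n))" unfolding decseq_Suc_iff by (intro allI E_mono ab(1) aT)
  moreover have "(%n. measure MR (E (a n))) \<leadsto> 0"
  proof -
   have "a n < T" for n using ab[of n] by linarith
   hence "measure MR (E (a n)) = a n" for n using ab by (intro E_measM) auto
   thus ?thesis unfolding a_def by simp real_asymp
  qed
  ultimately have "(%n. LINT x|MR. ind (E (a n)) x * h x) \<leadsto> 0" using ab by (intro lim0 E_M) (auto intro: le_less_trans)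
  moreover have "K (a n) = (LINT x|MR. ind (E (a n)) x * h x)" for n using ab[of n] by (intro K_eq) auto
  ultimately show ?thesis by simp
 qed
 have b0: "(%n. (LINT x|MR. h x) - K (b n)) \<leadsto> 0"
 proof -
  have bn: "0 < b n" "b n < T" for n using ab[of n] by auto
  have sets: "space MR - E (b n) \<in> sets MR" for n using E_M[OF bn] by auto
  have "b n \<le> b (Suc n)" for n unfolding b_def using mono_T[of n] by linarith
  hence "E (b n) \<subseteq> E (b (Suc n))" for n by (intro E_mono bn)
  hence "decseq (%n. space MR - E (b n))" unfolding decseq_Suc_iff by blast
  moreover have "(%n. measure MR (space MR - E (b n))) \<leadsto> 0"
  proof -
   have "measure MR (space MR - E (b n)) = T / real (n + 3)" for n
    using finite_measure_compl[OF E_M[OF bn]] E_measM[OF bn] measure_M[of \<Omega>] by (simp add: b_def)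
   thus ?thesis by simp real_asymp
  qed
  ultimately have "(%n. LINT x|MR. ind (space MR - E (b n)) x * h x) \<leadsto> 0" by (intro lim0 sets)
  moreover have "(LINT x|MR. h x) - K (b n) = (LINT x|MR. ind (space MR - E (b n)) x * h x)" for n
  proof -
   have "(LINT x|MR. h x) - K (b n) = (LINT x|MR. h x - ind (E (b n)) x * h x)" using ind_int[OF E_M[OF bn] h_int] h_int by (simp add: K_eq[OF bn])
   also have "\<dots> = (LINT x|MR. ind (space MR - E (b n)) x * h x)" by (intro Bochner_Integration.integral_cong) (auto simp: indicator_def)
   finally show ?thesis .
  qed
  ultimately show ?thesis by simp
 qed
 have "(%n. (LINT x|MR. h x) - ((LINT x|MR. h x) - K (b n)) - K (a n)) \<leadsto> (LINT x|MR. h x) - 0 - 0"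
  by (intro tendsto_diff tendsto_const a0 b0)
 hence "(%n. ennreal (K (b n) - K (a n))) \<leadsto> ennreal (LINT x|MR. h x)" by (intro tendsto_ennrealI) simp
 thus ?thesis by (rule LIMSEQ_le_const2) (use K_increment_le_nn[OF ab] in auto)
qed

end

lemma pseudo_rearr_pseudo:
 assumes "\<Omega> \<in> sets borel" "\<Omega> \<in> lmeasurable" "pseudo_rearr \<Omega> u h G" "!!x. h x \<ge> 0"
 obtains E where "pseudo \<Omega> u h E G"
proof -
 obtain E where E': "\<forall>s\<in>{0<..<measure lebesgue \<Omega>}. E s \<in> sets lebesgue & E s \<subseteq> \<Omega> & measure lebesgue (E s) = s"
  "\<forall>s\<in>{0<..<measure lebesgue \<Omega>}. \<forall>t\<in>{0<..<measure lebesgue \<Omega>}. s \<le> t --> E s \<subseteq> E t"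
  "\<forall>s\<in>{0<..<measure lebesgue \<Omega>}. (\<exists>t. s = distr_fun \<Omega> u t) --> E s = {x \<in> \<Omega>. |(u x)| > decr_rearr \<Omega> u s}"
  "AE s in LB {0<..<measure lebesgue \<Omega>}. ((%\<sigma>. LINT x|LB (E \<sigma>). h x) has_real_derivative G s) (at s)"
  using assms(3) unfolding pseudo_rearr_def by (elim exE conjE) (rule that)
 have E: "!!s. s \<in> {0<..<measure lebesgue \<Omega>} ==> E s \<in> sets lebesgue & E s \<subseteq> \<Omega> & measure lebesgue (E s) = s"
  "!!s t. s \<in> {0<..<measure lebesgue \<Omega>} ==> t \<in> {0<..<measure lebesgue \<Omega>} ==> s \<le> t ==> E s \<subseteq> E t"
  "!!s. s \<in> {0<..<measure lebesgue \<Omega>} ==> (\<exists>t. s = distr_fun \<Omega> u t) ==> E s = {x \<in> \<Omega>. |(u x)| > decr_rearr \<Omega> u s}"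
  using E'(1) E'(2) E'(3) by blast+
 have um: "u \<in> BM (LB \<Omega>)" "integrable (LB \<Omega>) h" using assms(3) by (auto simp: pseudo_rearr_def)
 have "pseudo \<Omega> u h E G"
 proof (unfold_locales, goal_cases)
  \<comment> \<open>Goal 9 is \<open>E_mono\<close> and goal 10 is \<open>E_lev\<close>.\<close>
  case (9 s t) thus ?case by (intro E(2)) auto
 next
  case (10 t) thus ?case by (intro E(3)) auto
 qed (use assms E(1) E'(4) um in auto)
 thus ?thesis by (rule that)
qed

definition young_const :: "('n::finite => real) => real" where
 "young_const p = (\<Sum>i\<in>UNIV. 2 powr (conj_exp (p i) / p i))"

text \<open>The assumption \<open>energy\<close> is all that is retained of the equation: the
  operator a and the data g enter only through it and the density h.\<close>

locale comparison = w0_approx \<Omega> p u D \<phi> + pseudo \<Omega> u h E G + f: rearr \<Omega> f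
 for \<Omega> :: "(real^'a::finite) set" and p u D \<phi> and h :: "real^'a => real" and E :: "real => (real^'a) set" and G :: "real => real" and f :: "real^'a => real" +
 fixes lam :: "'a => real"
 assumes lam: "!!i. lam i > 0"
  and f_int: "integrable (LB \<Omega>) f"
  and fs_int: "integrable (LB {0<..<measure lebesgue \<Omega>}) (decr_rearr \<Omega> f)"
  and energy: "!!s t J. 0 \<le> s ==> s < t ==> J = {r. s < |(r)| & |(r)| < t} \<or> (s = 0 & J = {r. |(r)| < t}) ==>
   1/2 * (LINT x|LB \<Omega>. ind J (u x) * (\<Sum>i\<in>UNIV. lam i * |(D x $ i)| powr p i))
  \<le> (LINT x|LB \<Omega>. |(f x)| * min (max ( |(u x)| - s) 0) (t - s))
   + young_const p * (LINT x|LB \<Omega>. ind J (u x) * h x)"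
begin

definition "F s = (LINT r|LB {0<..<s}. decr_rearr \<Omega> f r)"

lemma F_eq:
 assumes "s \<le> T"
 shows "F s = (LINT r|LB {0<..<T}. ind {0<..<s} r * decr_rearr \<Omega> f r)"
proof -
 have "F s = (LINT r|lebesgue. ind {0<..<T} r *\<^sub>R (ind {0<..<s} r * decr_rearr \<Omega> f r))" unfolding F_def using assms
  by (subst integral_restrict_space) (auto intro!: Bochner_Integration.integral_cong simp: indicator_def)
 thus ?thesis by (subst integral_restrict_space) auto
qed

lemma F_int: "integrable (LB {0<..<T}) (%r. ind {0<..<s} r * decr_rearr \<Omega> f r)"
proof -
 have "{0<..<s} \<inter> {0<..<T} \<in> sets (LB {0<..<T})" by (auto simp: sets_restrict_space)
 from integrable_mult_indicator[OF this fs_int] show ?thesis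
  by (rule Bochner_Integration.integrable_cong[THEN iffD1, rotated -1]) (auto simp: indicator_def)
qed

lemma fs_nonneg: "r \<in> {0<..<T} ==> 0 \<le> decr_rearr \<Omega> f r"
 by (intro f.us_nonneg) auto

lemma F_mono:
 assumes "x \<le> z" "z \<le> T"
 shows "F x \<le> F z" unfolding F_eq[OF order_trans[OF assms]] F_eq[OF assms(2)]
 by (intro integral_mono F_int) (use assms(1) in \<open>auto simp: indicator_def fs_nonneg\<close>)

lemma F_nonneg: "z \<le> T ==> 0 \<le> F z"
 by (subst F_eq, simp, intro integral_nonneg_AE AE_I2) (auto simp: indicator_def fs_nonneg)

lemma nn_F: "z \<le> T ==> (NN s. ennreal (decr_rearr \<Omega> f s) * ind {0<..<z} s) = ennreal (F z)"
proof -
 assume z: "z \<le> T"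
 have "ennreal (F z) = (\<integral>\<^sup>+r. ennreal (ind {0<..<z} r * decr_rearr \<Omega> f r) \<partial>lebesgue_on {0<..<T})"
  unfolding F_eq[OF z] by (rule nn_integral_eq_integral[symmetric, OF F_int]) (auto simp: indicator_def fs_nonneg)
 also have "\<dots> = (NN r. ennreal (ind {0<..<z} r * decr_rearr \<Omega> f r) * ind {0<..<T} r)" by (rule nn_integral_lebesgue_on) simp
 also have "\<dots> = (NN s. ennreal (decr_rearr \<Omega> f s) * ind {0<..<z} s)" using z by (intro nn_integral_cong) (auto simp: indicator_def)
 finally show ?thesis by simp
qed

text \<open>The truncated factor is at most t - \<open>us z\<close> and is supported where |u|
  exceeds \<open>us z\<close>, a set of measure at most z; over such a set |f| integrates to at most
  F z.\<close>

lemma load_bound: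
 assumes z: "0 < z" "z < T" and t: "us z < t"
 shows "(LINT x|M. |(f x)| * min (max ( |(u x)| - us z) 0) (t - us z)) \<le> (t - us z) * F z"
proof -
 define a where "a = us z"
 have a0: "a \<ge> 0" using us_nonneg[OF z(1)] by (simp add: a_def)
 have mz: "\<mu> a \<le> z" using us_gt_iff[OF z(1) a0] by (simp add: a_def)
 obtain v where v[measurable]: "v \<in> BM borel" and uv: "AE x in lborel. x \<in> \<Omega> --> u x = v x"
  and vm: "!!t. emeasure lborel {x \<in> \<Omega>. t < |(v x)|} = ennreal (\<mu> t)" by (rule borel_rep) (rule that)
 have uvM: "AE x in M. u x = v x" using uv by (simp add: AE_lebesgue_on_iff)
 have fm[measurable]: "f \<in> BM M" using f_int by simp
 have "ennreal (LINT x|M. |(f x)| * min (max ( |(u x)| - a) 0) (t - a)) = (\<integral>\<^sup>+x. ennreal ( |(f x)| * min (max ( |(u x)| - a) 0) (t - a)) \<partial>M)"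
 proof (rule nn_integral_eq_integral[symmetric])
  show "integrable M (%x. |(f x)| * min (max ( |(u x)| - a) 0) (t - a))" by (rule Bochner_Integration.integrable_bound[where f = "%x. (t - a) * f x"])
    (use f_int t in \<open>auto intro!: AE_I2 simp: a_def abs_mult mult.commute intro: mult_left_mono\<close>)
 qed (use t in \<open>auto simp: a_def\<close>)
 also have "\<dots> \<le> (\<integral>\<^sup>+x. ennreal (t - a) * (ennreal |(f x)| * ind {x \<in> \<Omega>. a < |(v x)|} x) \<partial>M)"
 proof (rule nn_integral_mono_AE)
  show "AE x in M. ennreal ( |(f x)| * min (max ( |(u x)| - a) 0) (t - a)) \<le> ennreal (t - a) * (ennreal |(f x)| * ind {x \<in> \<Omega>. a < |(v x)|} x)"
   using uvM AE_space
  proof eventually_elim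
   case (elim x)
   have "|(f x)| * min (max ( |(v x)| - a) 0) (t - a) \<le> (t - a) * |(f x)|"
    using t by (subst mult.commute) (intro mult_right_mono, auto simp: a_def)
   thus ?case using elim t by (auto simp: indicator_def a_def simp flip: ennreal_mult' intro!: ennreal_leI)
  qed
 qed
 also have "\<dots> = ennreal (t - a) * (\<integral>\<^sup>+x. ennreal |(f x)| * ind {x \<in> \<Omega>. a < |(v x)|} x \<partial>M)"
 proof (rule nn_integral_cmult)
  have "{x \<in> \<Omega>. a < |(v x)|} \<in> sets borel" by measurable
  hence [measurable]: "{x \<in> \<Omega>. a < |(v x)|} \<in> sets M"
   by (auto simp: sets_restrict_space intro!: image_eqI[of _ _ "{x \<in> \<Omega>. a < |(v x)|}"])
  show "(%x. ennreal |(f x)| * ind {x \<in> \<Omega>. a < |(v x)|} x) \<in> BM M" by measurable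
 qed
 also have "\<dots> \<le> ennreal (t - a) * (NN s. ennreal (decr_rearr \<Omega> f s) * ind {0<..<z} s)"
  using mz z by (intro mult_left_mono f.integral_le_rearr) (auto simp: vm ennreal_leI)
 also have "\<dots> = ennreal (t - a) * ennreal (F z)" using z by (subst nn_F) auto
 also have "\<dots> = ennreal ((t - a) * F z)" using t F_nonneg[of z] z by (simp add: a_def ennreal_mult')
 finally have "ennreal (LINT x|M. |(f x)| * min (max ( |(u x)| - a) 0) (t - a)) \<le> ennreal ((t - a) * F z)" .
 moreover have "0 \<le> (t - a) * F z" using t F_nonneg[of z] z by (intro mult_nonneg_nonneg) (auto simp: a_def)
 ultimately show ?thesis by (simp add: a_def)
qed

lemma young_nonneg: "young_const p \<ge> 0" unfolding young_const_def by (intro sum_nonneg) auto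

lemma geo_pos: "geo_const p lam > 0"
proof -
 have "(\<Prod>i\<in>UNIV. lam i powr (- 1/p i)) > 0" using lam by (intro prod_pos) (auto simp: less_imp_neq[symmetric] dest: less_imp_neq)
 hence "0 < (2 * (\<Prod>i\<in>UNIV. lam i powr (- 1/p i))) powr (1 / real CARD('a))" by (subst powr_gt_zero) linarith
 thus ?thesis unfolding geo_const_def by (intro mult_pos_pos) auto
qed

text \<open>The slice estimate between the levels \<open>us z\<close> and \<open>us x\<close>, with
  \<open>slab\<close> and \<open>load_bound\<close> as inputs. If the two levels coincide the left
  side is 0.\<close>

lemma disc:
 assumes xz: "0 < x" "x < z" "z < T"
 shows "(us x - us z) * x \<le> geo_const p lam * z powr (1 / real CARD('a)) * (z - x) powr (1 - 1 / harm_mean p)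
  * (2 * (us x - us z) * F z + 2 * young_const p * (K z - K x)) powr (1 / harm_mean p)"
proof -
 interpret ac_primitive T K G "LINT x|M. h x" by (rule ac)
 have P: "harm_mean p > 1" by (rule harm_mean_gt_1[OF p])
 define R0 where "R0 = 2 * (us x - us z) * F z + 2 * young_const p * (K z - K x)"
 have anti: "us z \<le> us x" using us_antimono[of x z] xz by simp
 have z: "0 < z" "z < T" and x: "0 < x" "x < T" using xz by auto
 have R0: "R0 \<ge> 0" unfolding R0_def
  using anti F_nonneg[of z] z K_mono[of x z] xz young_nonneg by (intro add_nonneg_nonneg mult_nonneg_nonneg) auto
 show ?thesis
 proof (cases "us z = us x")
  case True
  thus ?thesis using geo_pos by (simp add: less_imp_le)
 next
  case False
  hence ab: "us z < us x" using anti by simp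
  have a0: "0 \<le> us z" using us_nonneg z by simp
  \<comment> \<open>\<open>slice_estimate\<close> asks for a positive energy bound, whereas R0 may
    vanish; the added e is removed by a limit.\<close>
  have est: "(us x - us z) * x \<le> geo_const p lam * z powr (1 / real CARD('a)) * (z - x) powr (1 - 1 / harm_mean p) * (R0 + e) powr (1 / harm_mean p)"
   if e: "e > 0" for e
  proof (rule slice_estimate[OF lam a0 ab])
   show "measure lebesgue {x \<in> \<Omega>. us z < |(u x)|} \<le> z" using us_gt_iff[OF z(1) a0] by (simp add: distr_fun_def not_less)
   show "x \<le> measure lebesgue {y \<in> \<Omega>. us x \<le> |(u y)|}" by (rule super_measure[OF x])
   show "measure lebesgue {y \<in> \<Omega>. us z < |(u y)| & |(u y)| < us x} \<le> z - x" by (rule slab(2)[OF xz])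
   have "1/2 * (LINT y|M. ind {r. us z < |(r)| & |(r)| < us x} (u y) * (\<Sum>i\<in>UNIV. lam i * |(D y $ i)| powr p i))
    \<le> (LINT y|M. |(f y)| * min (max ( |(u y)| - us z) 0) (us x - us z)) + young_const p * (LINT y|M. ind {r. us z < |(r)| & |(r)| < us x} (u y) * h y)"
    by (rule energy[OF a0 ab]) simp
   also have "\<dots> \<le> (us x - us z) * F z + young_const p * (K z - K x)"
    by (intro add_mono load_bound[OF z ab] mult_left_mono slab(3)[OF xz] young_nonneg)
   finally have "1/2 * (LINT y|M. ind {r. us z < |(r)| & |(r)| < us x} (u y) * (\<Sum>i\<in>UNIV. lam i * |(D y $ i)| powr p i))
    \<le> (us x - us z) * F z + young_const p * (K z - K x)" .
   moreover have "R0 = 2 * ((us x - us z) * F z) + 2 * (young_const p * (K z - K x))" by (simp add: R0_def)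
   ultimately show "(LINT y|M. ind {r. us z < |(r)| & |(r)| < us x} (u y) * (\<Sum>i\<in>UNIV. lam i * |(D y $ i)| powr p i)) \<le> R0 + e"
    using e by linarith
  qed (use xz e R0 in auto)
  have "((%e. geo_const p lam * z powr (1 / real CARD('a)) * (z - x) powr (1 - 1 / harm_mean p) * (R0 + e) powr (1 / harm_mean p))
   \<longlongrightarrow> geo_const p lam * z powr (1 / real CARD('a)) * (z - x) powr (1 - 1 / harm_mean p) * (R0 + 0) powr (1 / harm_mean p)) (at_right 0)"
   using P R0 by (intro tendsto_mult tendsto_const tendsto_powr' tendsto_add tendsto_ident_at)
    (auto simp: eventually_at_right_less eventually_at_filter intro!: always_eventually)
  from tendsto_lowerbound[OF this, of "(us x - us z) * x"] show ?thesis using est by (simp add: R0_def eventually_at_filter)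
 qed
qed

text \<open>The zero boundary values reappear here. With lower level 0 the slab below
  \<open>us z\<close> has measure at most T - z, because |u| is at least \<open>us z\<close> on a
  set of measure at least z. The slice estimate then makes \<open>us z * z\<close> vanish as z tends
  to T.\<close>

lemma us_lim:
 assumes e: "\<epsilon> > 0" and T0: "0 < T"
 shows "\<exists>b<T. \<forall>z. b \<le> z & 0 < z & z < T --> us z \<le> \<epsilon>"
proof -
 have P: "harm_mean p > 1" by (rule harm_mean_gt_1[OF p])
 define R where "R = (LINT y|M. (\<Sum>i\<in>UNIV. lam i * |(D y $ i)| powr p i)) + 1"
 have en_int: "integrable M (%y. \<Sum>i\<in>UNIV. lam i * |(D y $ i)| powr p i)" using D_int by auto
 have en0: "0 \<le> (\<Sum>i\<in>UNIV. lam i * |(D y $ i)| powr p i)" for y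
  using lam by (intro sum_nonneg mult_nonneg_nonneg) (auto intro: less_imp_le)
 have "0 \<le> (LINT y|M. (\<Sum>i\<in>UNIV. lam i * |(D y $ i)| powr p i))" by (intro integral_nonneg_AE AE_I2 en0)
 hence R: "R > 0" by (simp add: R_def)
 define B where "B = geo_const p lam * T powr (1 / real CARD('a)) * R powr (1 / harm_mean p)"
 have bound: "us z * z \<le> B * (T - z) powr (1 - 1 / harm_mean p)" if z: "0 < z" "z < T" for z
 proof (cases "us z = 0")
  case True
  thus ?thesis using geo_pos by (simp add: B_def less_imp_le)
 next
  case False
  hence uz: "0 < us z" using us_nonneg[OF z(1)] by simp
  have "(us z - 0) * z \<le> geo_const p lam * T powr (1 / real CARD('a)) * (T - z) powr (1 - 1 / harm_mean p) * R powr (1 / harm_mean p)"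
  proof (rule slice_estimate[OF lam order_refl uz])
   show "measure lebesgue {x \<in> \<Omega>. 0 < |(u x)|} \<le> T" using mu_le[of 0] by (simp add: distr_fun_def)
   show "z \<le> measure lebesgue {y \<in> \<Omega>. us z \<le> |(u y)|}" by (rule super_measure[OF z])
   have s: "{y \<in> space M. us z \<le> |(u y)|} \<in> sets M" "{y \<in> space M. 0 < |(u y)| & |(u y)| < us z} \<in> sets M"
   proof -
    have am: "(%y. |(u y)|) \<in> BM M" by measurable
    show "{y \<in> space M. us z \<le> |(u y)|} \<in> sets M" by (intro borel_measurable_le borel_measurable_const am)
    show "{y \<in> space M. 0 < |(u y)| & |(u y)| < us z} \<in> sets M"
     by (intro sets.sets_Collect_conj borel_measurable_less borel_measurable_const am)
   qed
   have "measure M {y \<in> space M. 0 < |(u y)| & |(u y)| < us z} \<le> measure M (space M - {y \<in> space M. us z \<le> |(u y)|})"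
    by (rule finite_measure_mono[OF _ sets.compl_sets[OF s(1)]]) (auto simp: not_le)
   also have "\<dots> = T - measure M {y \<in> space M. us z \<le> |(u y)|}" using finite_measure_compl[OF s(1)] measure_M[of \<Omega>] by simp
   finally show "measure lebesgue {y \<in> \<Omega>. 0 < |(u y)| & |(u y)| < us z} \<le> T - z" using super_measure[OF z] by (simp add: measure_M)
   have "(LINT y|M. ind {r. 0 < |(r)| & |(r)| < us z} (u y) * (\<Sum>i\<in>UNIV. lam i * |(D y $ i)| powr p i))
     \<le> (LINT y|M. (\<Sum>i\<in>UNIV. lam i * |(D y $ i)| powr p i))" by (rule integral_mono'[OF en_int]) (auto simp: indicator_def en0)
   thus "(LINT y|M. ind {r. 0 < |(r)| & |(r)| < us z} (u y) * (\<Sum>i\<in>UNIV. lam i * |(D y $ i)| powr p i)) \<le> R" by (simp add: R_def)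
  qed (use z T0 R in auto)
  thus ?thesis by (simp add: B_def mult_ac)
 qed
 have "((%z. B * (T - z) powr (1 - 1 / harm_mean p)) \<longlongrightarrow> B * (T - T) powr (1 - 1 / harm_mean p)) (at_left T)"
  using P by (intro tendsto_mult tendsto_const tendsto_powr' tendsto_diff tendsto_ident_at)
   (auto simp: eventually_at_filter intro!: always_eventually)
 hence "((%z. B * (T - z) powr (1 - 1 / harm_mean p)) \<longlongrightarrow> 0) (at_left T)" by simp
 hence "eventually (%z. B * (T - z) powr (1 - 1 / harm_mean p) < \<epsilon> * (T / 2)) (at_left T)" using e T0 by (intro order_tendstoD) auto
 then obtain b where b: "b < T" "!!z. b < z ==> z < T ==> B * (T - z) powr (1 - 1 / harm_mean p) < \<epsilon> * (T / 2)"
  by (auto simp: eventually_at_left_field)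
 define b' where "b' = (max b (T / 2) + T) / 2"
 have b': "b' < T" "b < b'" "T / 2 \<le> b'" using b T0 by (auto simp: b'_def)
 show ?thesis
 proof (intro exI[of _ b'] conjI allI impI b')
  fix z assume z: "b' \<le> z & 0 < z & z < T"
  have "us z * (T / 2) \<le> us z * z" using us_nonneg[of z] z b' by (intro mult_left_mono) auto
  also have "\<dots> \<le> \<epsilon> * (T / 2)" using bound[of z] b(2)[of z] z b' by simp
  finally show "us z \<le> \<epsilon>" using T0 by simp
 qed
qed

lemma us_le_nn:
 assumes s: "0 < s" "s < T"
 defines "P \<equiv> harm_mean p" and "N \<equiv> real CARD('a)"
 shows "ennreal (us s) \<le> (\<integral>\<^sup>+t. ennreal ((2 * ((geo_const p lam * t powr (1/N) / t) powr P * (2 * F t))) powr (1 / (P - 1))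
   + (2 * ((geo_const p lam * t powr (1/N) / t) powr P * (2 * young_const p * G t))) powr (1/P)) * ind {s<..<T} t \<partial>lebesgue)"
proof -
 interpret ac_primitive T K G "LINT x|M. h x" by (rule ac)
 show ?thesis unfolding P_def N_def by (rule comparison_1d[where U = us])
   (use harm_mean_gt_1[OF p] geo_pos young_nonneg us_antimono F_mono F_nonneg disc us_lim s in auto)
qed

text \<open>The truncations of \<open>u\<close> at height \<open>n\<close> replace \<open>u\<close> as a test function.\<close>

lemma total_energy:
 "ennreal (1/2 * (LINT x|M. (\<Sum>i\<in>UNIV. lam i * |(D x $ i)| powr p i)))
  \<le> (NN s. ennreal (decr_rearr \<Omega> f s) * ennreal (us s) * ind {0<..} s)
   + ennreal (young_const p) * ennreal (LINT x|M. h x)"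
proof -
 define en where "en x = (\<Sum>i\<in>UNIV. lam i * |(D x $ i)| powr p i)" for x
 have en_int: "integrable M en" unfolding en_def using D_int by auto
 have en0: "0 \<le> en y" for y unfolding en_def using lam by (intro sum_nonneg mult_nonneg_nonneg) (auto intro: less_imp_le)
 have fm[measurable]: "f \<in> BM M" using f_int by simp
 have [measurable]: "h \<in> BM M" using h_int by simp
 define HL where "HL = (NN s. ennreal (decr_rearr \<Omega> f s) * ennreal (us s) * ind {0<..} s)"
 \<comment> \<open>The sets J n include 0, so their union is the whole line; the summand 1 keeps the
   upper level positive for n = 0.\<close>
 define J where "J n = {r::real. |(r)| < real n + 1}" for n :: nat
 have [measurable]: "J n \<in> sets borel" for n unfolding J_def by (auto intro!: borel_open open_Collect_less continuous_intros)
 have step: "ennreal (1/2 * (LINT x|M. ind (J n) (u x) * en x)) \<le> HL + ennreal (young_const p) * ennreal (LINT x|M. h x)" for n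
 proof -
  have i1: "integrable M (%x. |(f x)| * min (max ( |(u x)| - 0) 0) (real n + 1 - 0))"
   by (rule Bochner_Integration.integrable_bound[where f = "%x. (real n + 1) * f x"])
    (use f_int in \<open>auto intro!: AE_I2 simp: abs_mult mult.commute intro: mult_left_mono\<close>)
  have "1/2 * (LINT x|M. ind (J n) (u x) * en x) \<le> (LINT x|M. |(f x)| * min (max ( |(u x)| - 0) 0) (real n + 1 - 0))
    + young_const p * (LINT x|M. ind (J n) (u x) * h x)" unfolding en_def by (rule energy) (auto simp: J_def)
  also have "\<dots> \<le> (LINT x|M. |(f x)| * min (max ( |(u x)| - 0) 0) (real n + 1 - 0)) + young_const p * (LINT x|M. h x)"
   by (intro add_left_mono mult_left_mono young_nonneg integral_mono'[OF h_int]) (auto simp: indicator_def h0)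
  finally have "ennreal (1/2 * (LINT x|M. ind (J n) (u x) * en x))
   \<le> ennreal ((LINT x|M. |(f x)| * min (max ( |(u x)| - 0) 0) (real n + 1 - 0)) + young_const p * (LINT x|M. h x))" by (rule ennreal_leI)
  also have "\<dots> = ennreal (LINT x|M. |(f x)| * min (max ( |(u x)| - 0) 0) (real n + 1 - 0)) + ennreal (young_const p) * ennreal (LINT x|M. h x)"
   using young_nonneg h0 by (subst ennreal_plus) (auto intro!: integral_nonneg_AE mult_nonneg_nonneg simp: ennreal_mult')
  also have "ennreal (LINT x|M. |(f x)| * min (max ( |(u x)| - 0) 0) (real n + 1 - 0)) = (\<integral>\<^sup>+x. ennreal ( |(f x)| * min (max ( |(u x)| - 0) 0) (real n + 1 - 0)) \<partial>M)"
   by (rule nn_integral_eq_integral[symmetric, OF i1]) auto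
  also have "\<dots> \<le> (\<integral>\<^sup>+x. ennreal |(f x)| * ennreal |(u x)| \<partial>M)"
   by (intro nn_integral_mono) (auto simp flip: ennreal_mult' intro!: ennreal_leI mult_left_mono)
  also have "\<dots> \<le> HL" unfolding HL_def by (rule Hardy_Littlewood) unfold_locales
  finally show ?thesis by (simp add: add_right_mono)
 qed
 have "(%n. LINT x|M. ind (J n) (u x) * en x) \<leadsto> (LINT x|M. en x)"
 proof (rule integral_dominated_convergence[where s = "%n x. ind (J n) (u x) * en x" and f = en and w = en])
  show "AE x in M. (%n. ind (J n) (u x) * en x) \<leadsto> en x"
  proof (intro AE_I2 tendsto_eventually)
   fix x
   obtain m :: nat where "|(u x)| \<le> real m" using real_arch_simple by blast
   thus "eventually (%n. ind (J n) (u x) * en x = en x) sequentially"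
    unfolding eventually_sequentially by (intro exI[of _ m]) (auto simp: J_def indicator_def)
  qed
  show "AE x in M. norm (ind (J n) (u x) * en x) \<le> en x" for n by (intro AE_I2) (simp add: en0 indicator_def)
 qed (use en_int in auto)
 hence "(%n. ennreal (1/2 * (LINT x|M. ind (J n) (u x) * en x))) \<leadsto> ennreal (1/2 * (LINT x|M. en x))"
  by (intro tendsto_ennrealI tendsto_mult_left)
 hence "ennreal (1/2 * (LINT x|M. en x)) \<le> HL + ennreal (young_const p) * ennreal (LINT x|M. h x)" by (rule LIMSEQ_le_const2) (use step in auto)
 thus ?thesis by (simp add: en_def HL_def)
qed

end

section \<open>The symmetrized problem\<close>

lemma nn_integral_powr_0:
 assumes "a > -1" "0 \<le> c"
 shows "(NN x. ennreal (x powr a) * ind {0<..<c} x) = ennreal (c powr (a + 1) / (a + 1))"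
proof -
 have "(NN x. ennreal (x powr a) * ind {0<..<c} x) = (NN x. ennreal (ind {0..c} x * x powr a))"
 proof (rule nn_integral_cong_AE)
  show "AE x in lborel. ennreal (x powr a) * ind {0<..<c} x = ennreal (ind {0..c} x * x powr a)"
   using AE_lborel_singleton[of 0] AE_lborel_singleton[of c] by eventually_elim (auto simp: indicator_def)
 qed
 also have "\<dots> = ennreal (c powr (a + 1) / (a + 1))" by (rule nn_integral_has_integral_lebesgue[OF _ has_integral_powr_from_0[OF assms]]) auto
 finally show ?thesis .
qed

lemma nn_integral_powr_inf:
 assumes "a < -1" "0 < c"
 shows "(NN x. ennreal (x powr a) * ind {c<..} x) = ennreal (- (c powr (a + 1)) / (a + 1))"
proof -
 have "(NN x. ennreal (x powr a) * ind {c<..} x) = (NN x. ennreal (ind {c..} x * x powr a))"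
 proof (rule nn_integral_cong_AE)
  show "AE x in lborel. ennreal (x powr a) * ind {c<..} x = ennreal (ind {c..} x * x powr a)"
   using AE_lborel_singleton[of c] by eventually_elim (auto simp: indicator_def)
 qed
 also have "\<dots> = ennreal (- (c powr (a + 1)) / (a + 1))"
  by (rule nn_integral_has_integral_lebesgue[OF _ has_integral_powr_to_inf[OF assms]]) auto
 finally show ?thesis .
qed

text \<open>Hoelder's inequality with the weight \<open>r powr \<alpha>\<close>, \<open>1 / N < \<alpha> < 1 / P\<close>,
 turns the power of the primitive into an integral to which Tonelli's theorem applies.\<close>

lemma Hardy:
 fixes g :: "real => real" and N P T :: real
 assumes [measurable]: "g \<in> BM borel" and g0: "!!r. 0 \<le> g r" and P: "1 < P" "P < N" and T: "0 \<le> T"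
  and A: "(NN r. ennreal ((r powr (1/N) * g r) powr conj_exp P) * ind {0<..<T} r) < \<infinity>"
 defines "I \<equiv> %s. NN r. ennreal (g r) * ind {0<..<s} r"
 shows "!!s. s \<le> T ==> I s < \<infinity>"
  "(NN s. ennreal ((s powr (1/N - 1) * enn2real (I s)) powr conj_exp P) * ind {0<..<T} s) < \<infinity>"
proof -
 define q where "q = conj_exp P"
 have q: "q > 1" "1/P + 1/q = 1" "1/q = 1 - 1/P" using conj_exp_props[OF P(1)] by (auto simp: q_def)
 have qP: "q / P = q - 1" using q(3) q(1) P by (simp add: field_simps)
 \<comment> \<open>\<alpha> < 1/P makes r^(-\<alpha> P) integrable at 0; \<alpha> > 1/N makes b
   positive, hence s^(-1-b) integrable at infinity. Any value in between would do.\<close>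
 define \<alpha> where "\<alpha> = (1/N + 1/P) / 2"
 have NP: "1/N < 1/P" using P by (simp add: frac_less2)
 have \<alpha>: "1/N < \<alpha>" "\<alpha> < 1/P" using NP by (auto simp: \<alpha>_def)
 have \<alpha>P: "\<alpha> * P < 1" using \<alpha>(2) P by (simp add: pos_less_divide_eq)
 define W where "W s = (NN r. ennreal ((r powr \<alpha> * g r) powr q) * ind {0<..<s} r)" for s
 have W_mono: "s \<le> t ==> W s \<le> W t" for s t unfolding W_def by (intro nn_integral_mono) (auto simp: indicator_def)
 \<comment> \<open>On the bounded interval the weight r^\<alpha> is at most a constant times
   r^(1/N), so finiteness follows from \<open>A\<close>.\<close>
 have WT: "W T < \<infinity>"
 proof -
  have "W T \<le> (NN r. ennreal (T powr ((\<alpha> - 1/N) * q)) * (ennreal ((r powr (1/N) * g r) powr q) * ind {0<..<T} r))" unfolding W_def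
  proof (intro nn_integral_mono)
   fix r
   show "ennreal ((r powr \<alpha> * g r) powr q) * ind {0<..<T} r \<le> ennreal (T powr ((\<alpha> - 1/N) * q)) * (ennreal ((r powr (1/N) * g r) powr q) * ind {0<..<T} r)"
   proof (cases "r \<in> {0<..<T}")
    case True
    have "r powr \<alpha> * g r = r powr (\<alpha> - 1/N) * (r powr (1/N) * g r)" using True by (simp add: mult.assoc[symmetric] powr_add[symmetric])
    also have "\<dots> \<le> T powr (\<alpha> - 1/N) * (r powr (1/N) * g r)" using True \<alpha> g0 by (intro mult_right_mono powr_mono2) auto
    finally have "(r powr \<alpha> * g r) powr q \<le> (T powr (\<alpha> - 1/N) * (r powr (1/N) * g r)) powr q" using q g0 by (intro powr_mono2) auto
    also have "\<dots> = T powr ((\<alpha> - 1/N) * q) * (r powr (1/N) * g r) powr q" by (simp add: powr_mult powr_powr)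
    finally show ?thesis using True by (simp flip: ennreal_mult')
   qed simp
  qed
  also have "\<dots> = ennreal (T powr ((\<alpha> - 1/N) * q)) * (NN r. ennreal ((r powr (1/N) * g r) powr q) * ind {0<..<T} r)"
   by (rule nn_integral_cmult) measurable
  also have "\<dots> < \<infinity>" using A by (simp add: q_def ennreal_mult_less_top)
  finally show ?thesis .
 qed
 have Ibound: "I s \<le> ennreal (enn2real (W s) powr (1/q) * (s powr (1 - \<alpha> * P) / (1 - \<alpha> * P)) powr (1/P))" if s: "0 \<le> s" "s \<le> T" for s
 proof -
  have Ws: "W s = ennreal (enn2real (W s))" using WT W_mono[OF s(2)] by (auto simp: less_top intro!: ennreal_enn2real[symmetric] le_less_trans)
  have "(NN r. ennreal |((r powr \<alpha> * g r * ind {0<..<s} r) * (r powr (- \<alpha>) * ind {0<..<s} r))|)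
   \<le> ennreal (enn2real (W s) powr (1/q) * (s powr (1 - \<alpha> * P) / (1 - \<alpha> * P)) powr (1/P))"
  proof (rule nn_Holder)
   have "(NN r. ennreal ( |(r powr \<alpha> * g r * ind {0<..<s} r)| powr q)) = W s"
    unfolding W_def using g0 q by (intro nn_integral_cong) (auto simp: indicator_def abs_mult)
   thus "(NN r. ennreal ( |(r powr \<alpha> * g r * ind {0<..<s} r)| powr q)) \<le> ennreal (enn2real (W s))" using Ws by simp
   have "(NN r. ennreal ( |(r powr - \<alpha> * ind {0<..<s} r)| powr P)) = (NN r. ennreal (r powr (- \<alpha> * P)) * ind {0<..<s} r)"
    using P by (intro nn_integral_cong) (auto simp: indicator_def powr_powr)
   also have "\<dots> = ennreal (s powr (- \<alpha> * P + 1) / (- \<alpha> * P + 1))" using \<alpha>P s by (intro nn_integral_powr_0) auto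
   finally show "(NN r. ennreal ( |(r powr - \<alpha> * ind {0<..<s} r)| powr P)) \<le> ennreal (s powr (1 - \<alpha> * P) / (1 - \<alpha> * P))"
    by simp
  qed (use q P \<alpha>P in auto)
  also have "(NN r. ennreal |((r powr \<alpha> * g r * ind {0<..<s} r) * (r powr (- \<alpha>) * ind {0<..<s} r))|) = I s" unfolding I_def
  proof (intro nn_integral_cong)
   fix r :: real
   have "r powr \<alpha> * g r * r powr - \<alpha> = g r" if "r > 0" using that by (simp add: powr_minus)
   thus "ennreal |((r powr \<alpha> * g r * ind {0<..<s} r) * (r powr (- \<alpha>) * ind {0<..<s} r))| = ennreal (g r) * ind {0<..<s} r"
    using g0[of r] by (auto simp: indicator_def)
  qed
  finally show ?thesis .
 qed
 show Ifin: "I s < \<infinity>" if "s \<le> T" for s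
 proof (cases "s \<ge> 0")
  case True
  thus ?thesis using le_less_trans[OF Ibound[OF True that]] by auto
 next
  case False
  hence "{0<..<s} = {}" by auto
  thus ?thesis by (simp add: I_def)
 qed
 define k where "k = (1 / (1 - \<alpha> * P)) powr (q / P)"
 define b where "b = (\<alpha> - 1/N) * q"
 have b: "b > 0" using \<alpha> q by (simp add: b_def)
 have ptw: "(s powr (1/N - 1) * enn2real (I s)) powr q \<le> k * (s powr (- 1 - b) * enn2real (W s))" if s: "s \<in> {0<..<T}" for s
 proof -
  have "enn2real (I s) \<le> enn2real (W s) powr (1/q) * (s powr (1 - \<alpha> * P) / (1 - \<alpha> * P)) powr (1/P)"
   using Ibound[of s] s by (intro enn2real_leI) auto
  hence "(s powr (1/N - 1) * enn2real (I s)) powr q \<le> (s powr (1/N - 1) * (enn2real (W s) powr (1/q) * (s powr (1 - \<alpha> * P) / (1 - \<alpha> * P)) powr (1/P))) powr q"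
   using q by (intro powr_mono2 mult_left_mono) auto
  also have "\<dots> = s powr ((1/N - 1) * q) * (enn2real (W s) * ((s powr (1 - \<alpha> * P) / (1 - \<alpha> * P)) powr (q / P)))"
   using q(1) by (simp add: powr_mult powr_powr)
  also have "(s powr (1 - \<alpha> * P) / (1 - \<alpha> * P)) powr (q / P) = k * s powr ((1 - \<alpha> * P) * (q / P))"
   using \<alpha>P by (simp add: k_def powr_divide powr_powr)
  also have "s powr ((1/N - 1) * q) * (enn2real (W s) * (k * s powr ((1 - \<alpha> * P) * (q / P)))) = k * ((s powr ((1/N - 1) * q) * s powr ((1 - \<alpha> * P) * (q / P))) * enn2real (W s))"
   by (simp add: mult_ac)
  \<comment> \<open>With q/P = q - 1 the exponents add up to -1 - (\<alpha> - 1/N) q.\<close>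
  also have "s powr ((1/N - 1) * q) * s powr ((1 - \<alpha> * P) * (q / P)) = s powr (- 1 - b)"
  proof -
   have "(1 - \<alpha> * P) * (q / P) = q / P - \<alpha> * q" using P by (simp add: field_simps)
   hence "(1 - \<alpha> * P) * (q / P) = (q - 1) - \<alpha> * q" unfolding qP .
   hence "(1/N - 1) * q + (1 - \<alpha> * P) * (q / P) = - 1 - b" by (simp add: b_def algebra_simps)
   thus ?thesis by (simp flip: powr_add)
  qed
  finally show ?thesis .
 qed
 have "(NN s. ennreal ((s powr (1/N - 1) * enn2real (I s)) powr q) * ind {0<..<T} s)
  \<le> (NN s. (NN r. ennreal k * (ennreal (s powr (- 1 - b)) * (ennreal ((r powr \<alpha> * g r) powr q) * ind {r. 0 < r & r < s} r * ind {0<..<T} s))))"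
 proof (intro nn_integral_mono)
  fix s
  show "ennreal ((s powr (1/N - 1) * enn2real (I s)) powr q) * ind {0<..<T} s
   \<le> (NN r. ennreal k * (ennreal (s powr (- 1 - b)) * (ennreal ((r powr \<alpha> * g r) powr q) * ind {r. 0 < r & r < s} r * ind {0<..<T} s)))"
  proof (cases "s \<in> {0<..<T}")
   case True
   have Ws: "ennreal (enn2real (W s)) = W s"
   proof -
    have "W s < \<infinity>" using le_less_trans[OF W_mono WT, of s] True by simp
    thus ?thesis by (simp add: ennreal_enn2real less_top)
   qed
   have "{r. 0 < r & r < s} = {0<..<s}" by auto
   hence "(NN r. ennreal k * (ennreal (s powr (- 1 - b)) * (ennreal ((r powr \<alpha> * g r) powr q) * ind {r. 0 < r & r < s} r * ind {0<..<T} s)))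
    = ennreal k * (ennreal (s powr (- 1 - b)) * W s)" using True by (simp add: nn_integral_cmult W_def)
   also have "\<dots> = ennreal (k * (s powr (- 1 - b) * enn2real (W s)))" by (subst Ws[symmetric]) (simp add: ennreal_mult k_def)
   finally show ?thesis using ptw[OF True] True by (simp add: ennreal_leI)
  qed simp
 qed
 also have "\<dots> = (NN r. (NN s. ennreal k * (ennreal (s powr (- 1 - b)) * (ennreal ((r powr \<alpha> * g r) powr q) * ind {r. 0 < r & r < s} r * ind {0<..<T} s))))"
  by (rule lborel_pair.Fubini'[symmetric]) measurable
 also have "\<dots> \<le> (NN r. ennreal (k / b) * (ennreal ((r powr (1/N) * g r) powr q) * ind {0<..<T} r))"
 proof (intro nn_integral_mono)
  fix r :: real
  show "(NN s. ennreal k * (ennreal (s powr (- 1 - b)) * (ennreal ((r powr \<alpha> * g r) powr q) * ind {r. 0 < r & r < s} r * ind {0<..<T} s)))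
   \<le> ennreal (k / b) * (ennreal ((r powr (1/N) * g r) powr q) * ind {0<..<T} r)"
  proof (cases "r \<in> {0<..<T}")
   case True
   have "(NN s. ennreal k * (ennreal (s powr (- 1 - b)) * (ennreal ((r powr \<alpha> * g r) powr q) * ind {r. 0 < r & r < s} r * ind {0<..<T} s)))
    \<le> (NN s. ennreal (k * (r powr \<alpha> * g r) powr q) * (ennreal (s powr (- 1 - b)) * ind {r<..} s))"
    using True by (intro nn_integral_mono) (auto simp: indicator_def ennreal_mult' k_def mult_ac)
   also have "\<dots> = ennreal (k * (r powr \<alpha> * g r) powr q) * (NN s. ennreal (s powr (- 1 - b)) * ind {r<..} s)"
    by (rule nn_integral_cmult) measurable
   also have "(NN s. ennreal (s powr (- 1 - b)) * ind {r<..} s) = ennreal (- (r powr (- 1 - b + 1)) / (- 1 - b + 1))"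
    using True b by (intro nn_integral_powr_inf) auto
   also have "- (r powr (- 1 - b + 1)) / (- 1 - b + 1) = r powr (- b) / b" using b by simp
   also have "ennreal (k * (r powr \<alpha> * g r) powr q) * ennreal (r powr (- b) / b) = ennreal (k * (r powr \<alpha> * g r) powr q * (r powr (- b) / b))"
    using b by (subst ennreal_mult'') auto
   also have "k * (r powr \<alpha> * g r) powr q * (r powr (- b) / b) = k / b * (r powr (\<alpha> * q) * r powr (- b) * g r powr q)"
    by (simp add: powr_mult powr_powr)
   also have "r powr (\<alpha> * q) * r powr (- b) = r powr (1/N * q)"
   proof -
    have "\<alpha> * q + - b = 1/N * q" by (simp add: b_def algebra_simps)
    thus ?thesis by (simp flip: powr_add)
   qed
   also have "r powr (1/N * q) * g r powr q = (r powr (1/N) * g r) powr q" by (simp add: powr_mult powr_powr)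
   finally show ?thesis using True b by (simp add: ennreal_mult'[symmetric] k_def)
  next
   case False
   hence "(%s. ennreal k * (ennreal (s powr (- 1 - b)) * (ennreal ((r powr \<alpha> * g r) powr q) * ind {r. 0 < r & r < s} r * ind {0<..<T} s))) = (%_. 0)"
    by (auto simp: indicator_def fun_eq_iff)
   thus ?thesis by simp
  qed
 qed
 also have "\<dots> = ennreal (k / b) * (NN r. ennreal ((r powr (1/N) * g r) powr q) * ind {0<..<T} r)" by (rule nn_integral_cmult) measurable
 also have "\<dots> < \<infinity>" using A by (simp add: q_def ennreal_mult_less_top)
 finally show "(NN s. ennreal ((s powr (1/N - 1) * enn2real (I s)) powr conj_exp P) * ind {0<..<T} s) < \<infinity>" by (simp add: q_def)
qed

section \<open>Exponents, constants and the data of the symmetrized problem\<close>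

locale aniso =
 fixes p lam :: "'n::finite => real"
 assumes N2: "CARD('n) \<ge> 2" and lam: "!!i. lam i > 0" and p: "!!i. p i > 1"
  and P_less: "harm_mean p < real CARD('n)"
begin

definition "N = real CARD('n)"
definition "P = harm_mean p"
definition "q = conj_exp P"
definition "\<omega> = unit_ball_vol N"
definition "\<Lambda> = Lambda p lam"

lemma P1: "P > 1" unfolding P_def by (rule harm_mean_gt_1[OF p])
lemma PN: "P < N" using P_less by (simp add: P_def N_def)
lemma N_ge: "N \<ge> 2" using N2 by (simp add: N_def)
lemma q1: "q > 1" "1/P + 1/q = 1" "1/q = 1 - 1/P"
 using conj_exp_props[OF P1] by (auto simp: q_def)
lemma q_eq: "1 / (P - 1) = q / P" "1 / (P - 1) * P = q" "1 / (P - 1) + 1 = q" "1/q / (P - 1) = 1/P"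
 using P1 by (auto simp: q_def conj_exp_def field_simps)
lemma \<omega>_pos: "\<omega> > 0" unfolding \<omega>_def using N_ge by (intro unit_ball_vol_pos) auto

lemma \<Lambda>_pos: "\<Lambda> > 0"
proof -
 have c: "conj_exp (p i) > 1" for i using conj_exp_props[OF p] by simp
 have a: "(\<Prod>i\<in>UNIV. p i powr (1/p i) * conj_exp (p i) powr (1 / conj_exp (p i)) * Gamma (1 + 1 / conj_exp (p i))) > 0"
 proof (intro prod_pos ballI mult_pos_pos Gamma_real_pos)
  fix i show "0 < p i powr (1/p i)" using p[of i] by simp
  show "0 < conj_exp (p i) powr (1 / conj_exp (p i))" using c[of i] by simp
  show "0 < 1 + 1 / conj_exp (p i)" using c[of i] by (simp add: add_pos_pos)
 qed
 have b: "(\<Prod>i\<in>UNIV. lam i powr (1/p i)) > 0" using lam by (intro prod_pos) (metis less_irrefl powr_gt_zero)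
 have d: "unit_ball_vol N * Gamma (1 + N / conj_exp P) > 0"
  using \<omega>_pos q1 N_ge by (intro mult_pos_pos Gamma_real_pos) (auto simp: \<omega>_def q_def intro!: add_pos_pos divide_pos_pos)
 have e1: "0 < 2 powr P * (P - 1) powr (P - 1) / P powr P" using P1 by simp
 have e2: "0 < ((\<Prod>i\<in>UNIV. p i powr (1/p i) * conj_exp (p i) powr (1 / conj_exp (p i)) * Gamma (1 + 1 / conj_exp (p i)))
   / (unit_ball_vol N * Gamma (1 + N / conj_exp P))) powr (P / N)" using divide_pos_pos[OF a d] by (subst powr_gt_zero) linarith
 have e3: "0 < (\<Prod>i\<in>UNIV. lam i powr (1/p i)) powr (P / N)" using b by (subst powr_gt_zero) linarith
 show ?thesis unfolding \<Lambda>_def Lambda_def Let_def P_def[symmetric] N_def[symmetric] by (intro mult_pos_pos e1 e2 e3)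
qed

end

locale sym_data = aniso p lam for p lam :: "'n::finite => real" +
 fixes \<Omega> :: "(real^'n) set" and f :: "real^'n => real" and G :: "real => real"
 assumes op: "open \<Omega>" and bd: "bounded \<Omega>"
  and Lor: "Lorentz \<Omega> (conj_exp (sobolev_exp p)) (conj_exp (harm_mean p)) f"
  and G_meas: "G \<in> BM (LB {0<..<measure lebesgue \<Omega>})"
  and G_AE: "AE t in LB {0<..<measure lebesgue \<Omega>}. 0 \<le> G t"
  and G_fin: "(\<integral>\<^sup>+t. ennreal (G t) * ind {0<..<measure lebesgue \<Omega>} t \<partial>lebesgue) < \<infinity>"
begin

lemma \<Omega>_borel: "\<Omega> \<in> sets borel" using op by simp
lemma \<Omega>_lm: "\<Omega> \<in> lmeasurable" using op bd by (intro bounded_set_imp_lmeasurable) auto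

sublocale f: rearr \<Omega> f using Lor \<Omega>_borel \<Omega>_lm by unfold_locales (auto simp: Lorentz_def)

definition "TT = measure lebesgue \<Omega>"
definition "fs r = ind {0<..} r * decr_rearr \<Omega> f r"
definition "F s = (LINT r|LB {0<..<s}. decr_rearr \<Omega> f r)"
text \<open>In the variable t, the volume enclosed by a sphere: X is the modulus of the flux
  \<Lambda> |\<nabla>v|^(P-1), Y is |\<nabla>v|, and \<psi> is minus the derivative of the profile
  of v with respect to t.\<close>

definition "X t = t powr (1/N) * max_rearr \<Omega> f t / (N * \<omega> powr (1/N)) + G_term p lam G t"
definition "Y t = \<Lambda> powr (- 1 / (P - 1)) * X t powr (1 / (P - 1))"
definition "\<psi> t = 1 / (\<Lambda> powr (1 / (P - 1)) * N * \<omega> powr (1/N) * t powr (1 / conj_exp N)) * X t powr (1 / (P - 1))"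

lemma TT0: "TT \<ge> 0" by (simp add: TT_def)

lemma fs_borel [measurable]: "fs \<in> BM borel"
 unfolding fs_def[abs_def] by (rule f.us_borel)

lemma fs0: "0 \<le> fs r" by (auto simp: fs_def indicator_def f.us_nonneg)

text \<open>The reciprocal of the first Lorentz exponent is 1/q + 1/N. The summand 1/q, raised to
  the power q, cancels the factor 1/s, and what remains is precisely the hypothesis of
  \<open>Hardy\<close>.\<close>

lemma Lor_fs: "(NN r. ennreal ((r powr (1/N) * fs r) powr q) * ind {0<..<TT} r) < \<infinity>"
proof -
 have S: "sobolev_exp p = N * P / (N - P)" by (simp add: sobolev_exp_def N_def P_def)
 have "sobolev_exp p > 1"
  unfolding S using P1 PN N_ge mult_strict_left_mono[OF P1, of N] by (subst less_divide_eq_1_pos) (simp_all only: diff_gt_0_iff_gt, linarith)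
 hence "1 / conj_exp (sobolev_exp p) = 1 - 1 / sobolev_exp p" by (rule conj_exp_props)
 also have "1 / sobolev_exp p = 1/P - 1/N" unfolding S using P1 PN N_ge by (simp add: field_simps)
 finally have e: "1 / conj_exp (sobolev_exp p) = 1/q + 1/N" using q1 by simp
 have "(NN r. ennreal ((r powr (1/N) * fs r) powr q) * ind {0<..<TT} r)
  = (NN s. ennreal ((s powr (1 / conj_exp (sobolev_exp p)) * decr_rearr \<Omega> f s) powr q / s) * ind {0<..<TT} s)"
 proof (intro nn_integral_cong)
  fix r
  show "ennreal ((r powr (1/N) * fs r) powr q) * ind {0<..<TT} r = ennreal ((r powr (1 / conj_exp (sobolev_exp p)) * decr_rearr \<Omega> f r) powr q / r) * ind {0<..<TT} r"
  proof (cases "r \<in> {0<..<TT}")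
   case True
   have "(1/q + 1/N) * q = 1 + 1/N * q" using q1 by (simp add: field_simps)
   hence "(r powr (1 / conj_exp (sobolev_exp p)) * decr_rearr \<Omega> f r) powr q / r = r powr (1 + 1/N * q) * decr_rearr \<Omega> f r powr q / r"
    unfolding e by (simp add: powr_mult powr_powr)
   also have "\<dots> = (r powr (1/N) * fs r) powr q" using True by (simp add: powr_add powr_mult powr_powr fs_def)
   finally show ?thesis by simp
  qed simp
 qed
 also have "\<dots> < \<infinity>" using Lor unfolding Lorentz_def by (simp add: nn_integral_lebesgue_on q_def P_def TT_def)
 finally show ?thesis .
qed

definition "I s = (NN r. ennreal (fs r) * ind {0<..<s} r)"

lemma I_fin: "s \<le> TT ==> I s < \<infinity>"
 unfolding I_def by (rule Hardy(1)[OF fs_borel fs0 P1 PN TT0]) (use Lor_fs in \<open>simp_all add: q_def\<close>)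

lemma fs_int: "s \<le> TT ==> integrable (LB {0<..<s}) (decr_rearr \<Omega> f)"
 and F_I: "s \<le> TT ==> F s = enn2real (I s)"
proof -
 assume s: "s \<le> TT"
 have e: "AE x in lborel. x \<in> {0<..<s} --> decr_rearr \<Omega> f x = fs x" by (intro AE_I2) (auto simp: fs_def)
 have ii: "integrable lborel (%x. ind {0<..<s} x * fs x)"
 proof (rule integrableI_bounded)
  have "(NN x. ennreal (norm (ind {0<..<s} x * fs x))) = I s" unfolding I_def by (intro nn_integral_cong) (auto simp: indicator_def fs0)
  thus "(NN x. ennreal (norm (ind {0<..<s} x * fs x))) < \<infinity>" using I_fin[OF s] by simp
 qed measurable
 show "integrable (LB {0<..<s}) (decr_rearr \<Omega> f)" using integral_lebesgue_on_cong_borel(1)[OF _ fs_borel e] ii by simp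
 have "F s = (LBINT x. ind {0<..<s} x * fs x)" unfolding F_def using integral_lebesgue_on_cong_borel(2)[OF _ fs_borel e] by simp
 also have "\<dots> = enn2real (NN x. ennreal (ind {0<..<s} x * fs x))" by (rule integral_eq_nn_integral) (auto simp: fs0)
 also have "(NN x. ennreal (ind {0<..<s} x * fs x)) = I s" unfolding I_def by (intro nn_integral_cong) (auto simp: indicator_def)
 finally show "F s = enn2real (I s)" .
qed

lemma F0: "s \<le> TT ==> 0 \<le> F s" by (simp add: F_I)

lemma nn_F: "s \<le> TT ==> (NN r. ennreal (fs r) * ind {0<..<s} r) = ennreal (F s)"
 using I_fin[of s] by (simp add: F_I ennreal_enn2real less_top flip: I_def)

lemma max_F: "t > 0 ==> max_rearr \<Omega> f t = F t / t"
 by (simp add: max_rearr_def F_def)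

lemma load_eq: "t > 0 ==> t powr (1/N) * max_rearr \<Omega> f t = t powr (1/N - 1) * F t"
 by (simp add: max_F powr_diff)

lemma G_term0: "0 \<le> G_term p lam G t" by (simp add: G_term_def)

lemma load0: "0 < t ==> t \<le> TT ==> 0 \<le> t powr (1/N) * max_rearr \<Omega> f t / (N * \<omega> powr (1/N))"
 using N_ge F0[of t] by (intro divide_nonneg_nonneg mult_nonneg_nonneg) (auto simp: max_F)

lemma X0: "0 < t ==> t \<le> TT ==> 0 \<le> X t"
 unfolding X_def by (intro add_nonneg_nonneg load0 G_term0)

lemma I_meas: "I \<in> BM borel"
proof -
 have "I = (%s. NN r. ennreal (fs r) * ind {r. 0 < r & r < s} r)" by (auto simp: I_def fun_eq_iff indicator_def intro!: nn_integral_cong)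
 thus ?thesis by simp
qed

lemma F_meas: "F \<in> BM (LB {0<..<TT})"
proof -
 note [measurable] = I_meas
 have "(%s. enn2real (I s)) \<in> BM borel" by measurable
 hence "(%s. enn2real (I s)) \<in> BM (LB {0<..<TT})" by (rule borel_imp_lebesgue_on)
 thus ?thesis by (rule measurable_lebesgue_cong[THEN iffD2, rotated]) (simp add: F_I)
qed

lemma id_meas: "(%t::real. t) \<in> BM (LB S)" by (rule borel_imp_lebesgue_on) simp

lemma X_meas: "X \<in> BM (LB {0<..<TT})"
proof -
 note [measurable] = F_meas G_meas[folded TT_def] id_meas
 have "(%t. t powr (1/N - 1) * F t / (N * \<omega> powr (1/N)) + G_term p lam G t) \<in> BM (LB {0<..<TT})" unfolding G_term_def by measurable
 thus ?thesis by (rule measurable_lebesgue_cong[THEN iffD2, rotated]) (simp add: X_def load_eq)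
qed

lemma Y_meas: "Y \<in> BM (LB {0<..<TT})"
proof -
 note [measurable] = X_meas
 show ?thesis unfolding Y_def[abs_def] by measurable
qed

lemma \<psi>0: "0 \<le> \<psi> t" unfolding \<psi>_def using N_ge by (intro mult_nonneg_nonneg divide_nonneg_nonneg) auto
lemma Y0: "0 \<le> Y t" unfolding Y_def by simp

lemma \<psi>_Y: "\<psi> t = Y t / (N * \<omega> powr (1/N) * t powr (1 - 1/N))"
proof -
 have "1 / conj_exp N = 1 - 1/N" using N_ge by (intro conj_exp_props) auto
 moreover have "\<Lambda> powr (- 1 / (P - 1)) = 1 / \<Lambda> powr (1 / (P - 1))" using powr_minus_divide[of \<Lambda> "1 / (P - 1)"] by simp
 ultimately show ?thesis by (simp add: \<psi>_def Y_def)
qed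

lemma G_term_powr: "0 \<le> G t ==> G_term p lam G t powr q = (P * \<Lambda>) powr (q / P) * q * G t"
 using P1 q1(1) \<Lambda>_pos by (simp add: G_term_def powr_mult powr_powr flip: P_def \<Lambda>_def q_def)

text \<open>The load part lies in L^q by Hardy's inequality, and the q-th power of
  \<open>G_term\<close> is a multiple of the integrable function G.\<close>

lemma Xq_fin: "(\<integral>\<^sup>+t. ennreal (X t powr q) * ind {0<..<TT} t \<partial>lebesgue) < \<infinity>"
proof -
 define c where "c = 1 / (N * \<omega> powr (1/N))"
 have c: "c > 0" using N_ge \<omega>_pos by (simp add: c_def)
 define k1 where "k1 = 2 powr q * c powr q"
 define k2 where "k2 = 2 powr q * ((P * \<Lambda>) powr (q / P) * q)"
 have k: "k1 \<ge> 0" "k2 \<ge> 0" using q1 by (auto simp: k1_def k2_def)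
 have le: "AE t in lebesgue. ennreal (X t powr q) * ind {0<..<TT} t
   \<le> ennreal k1 * (ennreal ((t powr (1/N - 1) * enn2real (I t)) powr q) * ind {0<..<TT} t) + ennreal k2 * (ennreal (G t) * ind {0<..<TT} t)"
 proof -
  have "AE t in lebesgue. t \<in> {0<..<TT} --> 0 \<le> G t" using G_AE by (simp add: AE_restrict_space_iff TT_def)
  thus ?thesis
  proof eventually_elim
   case (elim t)
   show ?case
   proof (cases "t \<in> {0<..<TT}")
    case True
    hence t: "0 < t" "t \<le> TT" "0 \<le> G t" using elim by auto
    have "X t powr q = |(t powr (1/N - 1) * F t * c + G_term p lam G t)| powr q" using X0[OF t(1,2)] by (simp add: X_def load_eq[OF t(1)] c_def)
    also have "\<dots> \<le> 2 powr q * ( |(t powr (1/N - 1) * F t * c)| powr q + |(G_term p lam G t)| powr q)"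
     using q1 by (intro abs_add_powr_le) auto
    also have "\<dots> = k1 * (t powr (1/N - 1) * enn2real (I t)) powr q + k2 * G t"
     using c t G_term0 F0[OF t(2)] by (simp add: k1_def k2_def F_I[OF t(2), symmetric] abs_mult powr_mult G_term_powr algebra_simps)
    finally have "ennreal (X t powr q) \<le> ennreal (k1 * (t powr (1/N - 1) * enn2real (I t)) powr q + k2 * G t)" by (rule ennreal_leI)
    also have "\<dots> = ennreal k1 * ennreal ((t powr (1/N - 1) * enn2real (I t)) powr q) + ennreal k2 * ennreal (G t)"
     using k t by (simp add: ennreal_plus ennreal_mult')
    finally show ?thesis using True by simp
   qed simp
  qed
 qed
 have Im: "(%t. ennreal ((t powr (1/N - 1) * enn2real (I t)) powr q) * ind {0<..<TT} t) \<in> BM borel"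
 proof -
  note [measurable] = I_meas
  show ?thesis by measurable
 qed
 hence Im': "(%t. ennreal ((t powr (1/N - 1) * enn2real (I t)) powr q) * ind {0<..<TT} t) \<in> BM lebesgue" by (intro measurable_completion) simp
 have Gm: "(%t. ennreal (G t) * ind {0<..<TT} t) \<in> BM lebesgue"
 proof -
  have "(%t. ennreal (G t)) \<in> BM (LB {0<..<TT})" using G_meas by (simp add: TT_def)
  thus ?thesis by (subst (asm) borel_measurable_restrict_space_iff_ennreal) auto
 qed
 have "(\<integral>\<^sup>+t. ennreal (X t powr q) * ind {0<..<TT} t \<partial>lebesgue)
   \<le> (\<integral>\<^sup>+t. ennreal k1 * (ennreal ((t powr (1/N - 1) * enn2real (I t)) powr q) * ind {0<..<TT} t) + ennreal k2 * (ennreal (G t) * ind {0<..<TT} t) \<partial>lebesgue)"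
  by (rule nn_integral_mono_AE[OF le])
 also have "\<dots> = ennreal k1 * (\<integral>\<^sup>+t. ennreal ((t powr (1/N - 1) * enn2real (I t)) powr q) * ind {0<..<TT} t \<partial>lebesgue)
   + ennreal k2 * (\<integral>\<^sup>+t. ennreal (G t) * ind {0<..<TT} t \<partial>lebesgue)"
  using Im' Gm by (simp add: nn_integral_add nn_integral_cmult)
 also have "\<dots> < \<infinity>"
 proof -
  have "(NN t. ennreal ((t powr (1/N - 1) * enn2real (I t)) powr q) * ind {0<..<TT} t) < \<infinity>"
   unfolding I_def q_def by (rule Hardy(2)[OF fs_borel fs0 P1 PN TT0]) (use Lor_fs in \<open>simp add: q_def\<close>)
  thus ?thesis using G_fin by (simp add: nn_integral_completion ennreal_mult_less_top TT_def)
 qed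
 finally show ?thesis .
qed

lemma YP: "Y t powr P = \<Lambda> powr (- q) * X t powr q"
proof -
 have "- 1 / (P - 1) * P = - q" using q_eq(2) by simp
 thus ?thesis unfolding Y_def powr_mult powr_powr q_eq(2) by simp
qed

lemma YP_fin: "(\<integral>\<^sup>+t. ennreal (Y t powr P) * ind {0<..<TT} t \<partial>lebesgue) < \<infinity>"
proof -
 have m: "(%t. ennreal (X t powr q) * ind {0<..<TT} t) \<in> BM lebesgue"
 proof -
  have "(%t. ennreal (X t powr q)) \<in> BM (LB {0<..<TT})" using X_meas by measurable
  thus ?thesis by (subst (asm) borel_measurable_restrict_space_iff_ennreal) auto
 qed
 have "(\<integral>\<^sup>+t. ennreal (Y t powr P) * ind {0<..<TT} t \<partial>lebesgue) = (\<integral>\<^sup>+t. ennreal (\<Lambda> powr (- q)) * (ennreal (X t powr q) * ind {0<..<TT} t) \<partial>lebesgue)"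
  by (intro nn_integral_cong) (auto simp: indicator_def YP ennreal_mult')
 also have "\<dots> = ennreal (\<Lambda> powr (- q)) * (\<integral>\<^sup>+t. (ennreal (X t powr q) * ind {0<..<TT} t) \<partial>lebesgue)"
  by (rule nn_integral_cmult[OF m])
 also have "\<dots> < \<infinity>" using Xq_fin by (simp add: ennreal_mult_less_top)
 finally show ?thesis .
qed

end

context aniso begin

definition "c\<omega> = N * \<omega> powr (1/N)"
text \<open>The factor in the identity that expresses the q-th power of \<open>G_term\<close>
  through G.\<close>

definition "kG = (P * \<Lambda>) powr (q / P) * q"
text \<open>The two summands are the coefficients left when the load and G are each bounded by X in
  the comparison integrand; the last factor converts t^(1/N - 1) X^(1/(P-1)) into \<psi>.\<close>

definition "Ccmp gc yp = ((4 * gc powr P * c\<omega>) powr (1 / (P - 1)) + (4 * gc powr P * yp / kG) powr (1/P)) * (c\<omega> * \<Lambda> powr (1 / (P - 1)))"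

lemma c\<omega>_pos: "c\<omega> > 0" using N_ge \<omega>_pos by (simp add: c\<omega>_def)
lemma kG_pos: "kG > 0" using P1 q1(1) \<Lambda>_pos by (simp add: kG_def)
lemma Ccmp_pos: assumes "gc > 0" shows "Ccmp gc yp > 0"
proof -
 have "0 < (4 * gc powr P * c\<omega>) powr (1 / (P - 1))" using assms c\<omega>_pos by simp
 thus ?thesis unfolding Ccmp_def using c\<omega>_pos \<Lambda>_pos by (intro mult_pos_pos add_pos_nonneg) auto
qed

end

context sym_data begin

lemma \<psi>_eq: assumes "t > 0" shows "\<psi> t = Y t * t powr (1/N - 1) / c\<omega>"
proof -
 have "t powr (1 - 1/N) = 1/t powr (1/N - 1)" using powr_minus_divide[of t "1/N - 1"] by simp
 thus ?thesis by (simp add: \<psi>_Y c\<omega>_def)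
qed

lemma load_le_X: assumes "0 < t" shows "t powr (1/N - 1) * F t \<le> c\<omega> * X t"
proof -
 have "t powr (1/N - 1) * F t / c\<omega> \<le> X t" using G_term0[of t] by (simp add: X_def load_eq[OF assms] c\<omega>_def)
 thus ?thesis using c\<omega>_pos by (simp add: pos_divide_le_eq mult.commute)
qed

lemma G_le_X: "0 < t ==> t \<le> TT ==> 0 \<le> G t ==> G t \<le> X t powr q / kG"
proof -
 assume t: "0 < t" "t \<le> TT" "0 \<le> G t"
 have "G_term p lam G t powr q \<le> X t powr q" using q1(1) load0[OF t(1,2)] by (intro powr_mono2) (auto simp: G_term0 X_def)
 thus ?thesis using kG_pos by (simp add: G_term_powr[OF t(3), folded kG_def] pos_le_divide_eq mult.commute)
qed

text \<open>The comparison yields a sum of two powers, while \<psi> contains one power of the sum X.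
  Both parts of X are nonnegative, so X dominates each separately: the load linearly, and G after
  raising X to the power q.\<close>

lemma comparison_integrand_le:
 assumes gc: "gc > 0" and yp: "yp \<ge> 0" and t: "0 < t" "t \<le> TT" "0 \<le> G t"
 shows "(2 * ((gc * t powr (1/N) / t) powr P * (2 * F t))) powr (1 / (P - 1))
   + (2 * ((gc * t powr (1/N) / t) powr P * (2 * yp * G t))) powr (1/P) \<le> Ccmp gc yp * \<psi> t"
proof -
 define a where "a = t powr (1/N - 1)"
 have a: "a > 0" using t by (simp add: a_def)
 have e: "gc * t powr (1/N) / t = gc * a" using t by (simp add: a_def powr_diff)
 have X: "X t \<ge> 0" by (rule X0[OF t(1,2)])
 have aP: "a powr P = a powr (P - 1) * a" using a by (simp add: powr_diff)
 have ap: "(a powr (P - 1)) powr (1 / (P - 1)) = a" "(a powr P) powr (1/P) = a" using a P1 by (simp_all add: powr_powr)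
 have "2 * ((gc * a) powr P * (2 * F t)) = 4 * gc powr P * a powr (P - 1) * (a * F t)" by (simp add: powr_mult aP)
 also have "\<dots> \<le> 4 * gc powr P * a powr (P - 1) * (c\<omega> * X t)" using load_le_X[OF t(1)] by (intro mult_left_mono) (auto simp: a_def)
 also have "\<dots> = (4 * gc powr P * c\<omega>) * (a powr (P - 1) * X t)" by simp
 finally have "(2 * ((gc * a) powr P * (2 * F t))) powr (1 / (P - 1)) \<le> ((4 * gc powr P * c\<omega>) * (a powr (P - 1) * X t)) powr (1 / (P - 1))"
  using P1 F0[OF t(2)] by (intro powr_mono2) auto
 also have "\<dots> = (4 * gc powr P * c\<omega>) powr (1 / (P - 1)) * (a * X t powr (1 / (P - 1)))"
  unfolding powr_mult[of "4 * gc powr P * c\<omega>"] powr_mult[of "a powr (P - 1)"] ap ..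
 finally have 1: "(2 * ((gc * a) powr P * (2 * F t))) powr (1 / (P - 1)) \<le> (4 * gc powr P * c\<omega>) powr (1 / (P - 1)) * (a * X t powr (1 / (P - 1)))" .
 have "2 * ((gc * a) powr P * (2 * yp * G t)) = (4 * gc powr P * yp) * (a powr P * G t)" by (simp add: powr_mult)
 also have "\<dots> \<le> (4 * gc powr P * yp) * (a powr P * (X t powr q / kG))" using G_le_X[OF t] yp by (intro mult_left_mono) auto
 also have "\<dots> = (4 * gc powr P * yp / kG) * (a powr P * X t powr q)" by simp
 finally have "(2 * ((gc * a) powr P * (2 * yp * G t))) powr (1/P) \<le> ((4 * gc powr P * yp / kG) * (a powr P * X t powr q)) powr (1/P)"
  using P1 t(3) yp by (intro powr_mono2) auto
 also have "\<dots> = (4 * gc powr P * yp / kG) powr (1/P) * (a * X t powr (1 / (P - 1)))"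
  unfolding powr_mult[of "4 * gc powr P * yp / kG"] powr_mult[of "a powr P"] ap powr_powr q_eq(1) using a P1 by simp
 finally have 2: "(2 * ((gc * a) powr P * (2 * yp * G t))) powr (1/P) \<le> (4 * gc powr P * yp / kG) powr (1/P) * (a * X t powr (1 / (P - 1)))" .
 have "\<Lambda> powr (- 1 / (P - 1)) * \<Lambda> powr (1 / (P - 1)) = 1" using \<Lambda>_pos by (simp flip: powr_add)
 hence 3: "a * X t powr (1 / (P - 1)) = (c\<omega> * \<Lambda> powr (1 / (P - 1))) * \<psi> t"
  using c\<omega>_pos unfolding \<psi>_eq[OF t(1)] Y_def a_def[symmetric] by (simp add: field_simps)
 have "(2 * ((gc * a) powr P * (2 * F t))) powr (1 / (P - 1)) + (2 * ((gc * a) powr P * (2 * yp * G t))) powr (1/P)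
  \<le> ((4 * gc powr P * c\<omega>) powr (1 / (P - 1)) + (4 * gc powr P * yp / kG) powr (1/P)) * (a * X t powr (1 / (P - 1)))"
  using add_mono[OF 1 2] by (simp add: algebra_simps)
 also have "\<dots> = Ccmp gc yp * \<psi> t" unfolding 3 Ccmp_def by simp
 finally show ?thesis unfolding e .
qed

text \<open>A Borel representative of Y, fixed once so that product-measure arguments can refer to
  it. Being zero outside (0,TT), it makes many cut-offs implicit.\<close>

definition "Yb = (SOME g. g \<in> BM borel & (\<forall>t. 0 \<le> g t) & (\<forall>t. t \<notin> {0<..<TT} --> g t = 0) &
  (AE t in lborel. t \<in> {0<..<TT} --> Y t = g t))"

lemma Yb: "Yb \<in> BM borel" "0 \<le> Yb t" "t \<notin> {0<..<TT} ==> Yb t = 0"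
 "AE t in lborel. t \<in> {0<..<TT} --> Y t = Yb t"
proof -
 obtain g where g: "g \<in> BM borel" "!!x. x \<notin> {0<..<TT} ==> g x = 0" "AE x in lborel. x \<in> {0<..<TT} --> Y x = g x"
  by (rule borel_version[OF Y_meas]) (simp, rule that)
 have "\<exists>g. g \<in> BM borel & (\<forall>t. 0 \<le> g t) & (\<forall>t. t \<notin> {0<..<TT} --> g t = 0) &
  (AE t in lborel. t \<in> {0<..<TT} --> Y t = g t)"
 proof (intro exI[of _ "%t. |(g t)|"] conjI)
  show "(%t. |(g t)|) \<in> BM borel" using g(1) by measurable
  show "AE t in lborel. t \<in> {0<..<TT} --> Y t = |(g t)|" using g(3) by eventually_elim (metis Y0 abs_of_nonneg)
 qed (use g(2) in auto)
 from someI_ex[OF this, folded Yb_def]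
 show "Yb \<in> BM borel" "0 \<le> Yb t" "t \<notin> {0<..<TT} ==> Yb t = 0"
  "AE t in lborel. t \<in> {0<..<TT} --> Y t = Yb t" by auto
qed

declare Yb(1) [measurable]

definition "\<psi>b t = Yb t * t powr (1/N - 1) / c\<omega>"

lemma \<psi>b_borel [measurable]: "\<psi>b \<in> BM borel" unfolding \<psi>b_def[abs_def] by measurable
lemma \<psi>b0: "0 \<le> \<psi>b t" using Yb(2) c\<omega>_pos by (simp add: \<psi>b_def)
lemma \<psi>b_out: "t \<notin> {0<..<TT} ==> \<psi>b t = 0" by (simp add: \<psi>b_def Yb(3))

lemma \<psi>b_eq: "AE t in lborel. t \<in> {0<..<TT} --> \<psi> t = \<psi>b t"
 using Yb(4) by eventually_elim (auto simp: \<psi>b_def \<psi>_eq)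

lemma YbP_fin: "(NN t. ennreal (Yb t powr P)) < \<infinity>"
proof -
 have "(NN t. ennreal (Y t powr P) * ind {0<..<TT} t) = (NN t. ennreal (Yb t powr P))"
 proof (rule nn_integral_cong_AE)
  show "AE t in lborel. ennreal (Y t powr P) * ind {0<..<TT} t = ennreal (Yb t powr P)"
   using Yb(4) by eventually_elim (auto simp: indicator_def Yb(3))
 qed
 thus ?thesis using YP_fin by (simp add: nn_integral_completion)
qed

text \<open>This number turns out to be the energy of v; both parts of the energy of u are compared
  with it.\<close>

definition "EY = (LBINT t. Yb t powr P)"

lemma EY_nn: "(NN t. ennreal (Yb t powr P)) = ennreal EY"
 and Yb_int: "integrable lborel (%t. Yb t powr P)"
 and EY0: "EY \<ge> 0"
proof -
 show i: "integrable lborel (%t. Yb t powr P)" by (rule integrableI_bounded) (use YbP_fin in auto)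
 show "(NN t. ennreal (Yb t powr P)) = ennreal EY" unfolding EY_def by (rule nn_integral_eq_integral[OF i]) auto
 show "EY \<ge> 0" unfolding EY_def by simp
qed

text \<open>Away from t = 0 the weight t^(1/N - 1) is bounded, and Y is at most 1 + Y^P. Near 0 the
  profile may be unbounded, hence the condition s > 0.\<close>

lemma \<psi>b_fin: assumes s: "0 < s" shows "(NN t. ennreal (\<psi>b t) * ind {s<..<TT} t) < \<infinity>"
proof -
 define k where "k = s powr (1/N - 1) / c\<omega>"
 have k: "k \<ge> 0" using c\<omega>_pos by (simp add: k_def)
 have le: "\<psi>b t \<le> k * (1 + Yb t powr P)" if "t > s" for t
 proof -
  have "Yb t \<le> 1 + Yb t powr P" using le_one_plus_powr[OF Yb(2)] P1 by simp
  moreover have "t powr (1/N - 1) \<le> s powr (1/N - 1)" using N_ge s that by (intro powr_mono2') auto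
  ultimately have "Yb t * t powr (1/N - 1) \<le> (1 + Yb t powr P) * s powr (1/N - 1)" using Yb(2)[of t] by (intro mult_mono) auto
  thus ?thesis using c\<omega>_pos by (simp add: \<psi>b_def k_def divide_right_mono mult.commute)
 qed
 have "(NN t. ennreal (\<psi>b t) * ind {s<..<TT} t) \<le> (NN t. ennreal k * (ind {s<..<TT} t + ennreal (Yb t powr P)))"
 proof (intro nn_integral_mono)
  fix t
  show "ennreal (\<psi>b t) * ind {s<..<TT} t \<le> ennreal k * (ind {s<..<TT} t + ennreal (Yb t powr P))"
  proof (cases "t \<in> {s<..<TT}")
   case True
   have "ennreal (\<psi>b t) \<le> ennreal (k * (1 + Yb t powr P))" using True by (intro ennreal_leI le) auto
   also have "\<dots> = ennreal k * (1 + ennreal (Yb t powr P))" using k by (simp add: ennreal_mult')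
   finally show ?thesis using True by simp
  qed simp
 qed
 also have "\<dots> = ennreal k * (emeasure lborel {s<..<TT} + ennreal EY)" by (simp add: nn_integral_cmult nn_integral_add EY_nn)
 also have "\<dots> < \<infinity>" by (cases "s \<le> TT") (auto simp: ennreal_mult_less_top)
 finally show ?thesis .
qed

definition "\<Psi> s = (LINT t|LB {s<..<TT}. \<psi> t)"

lemma \<Psi>_b: "0 \<le> s ==> \<Psi> s = (LBINT t. ind {s<..<TT} t * \<psi>b t)"
 unfolding \<Psi>_def
proof (rule integral_lebesgue_on_cong_borel)
 assume "0 \<le> s"
 thus "AE x in lborel. x \<in> {s<..<TT} --> \<psi> x = \<psi>b x" using \<psi>b_eq by (auto elim!: eventually_mono)
qed auto

lemma \<psi>b_int: assumes "0 < s" shows "integrable lborel (%t. ind {s<..<TT} t * \<psi>b t)"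
proof (rule integrableI_bounded)
 have "(NN t. ennreal (norm (ind {s<..<TT} t * \<psi>b t))) = (NN t. ennreal (\<psi>b t) * ind {s<..<TT} t)"
  by (intro nn_integral_cong) (auto simp: indicator_def \<psi>b0)
 thus "(NN t. ennreal (norm (ind {s<..<TT} t * \<psi>b t))) < \<infinity>" using \<psi>b_fin[OF assms] by simp
qed measurable

lemma \<Psi>_nn: assumes "0 < s" shows "(NN t. ennreal (\<psi>b t) * ind {s<..<TT} t) = ennreal (\<Psi> s)"
proof -
 have "(NN t. ennreal (\<psi>b t) * ind {s<..<TT} t) = (NN t. ennreal (ind {s<..<TT} t * \<psi>b t))"
  by (intro nn_integral_cong) (auto simp: indicator_def)
 also have "\<dots> = ennreal (LBINT t. ind {s<..<TT} t * \<psi>b t)"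
  by (rule nn_integral_eq_integral[OF \<psi>b_int[OF assms]]) (auto simp: \<psi>b0)
 finally show ?thesis using assms by (simp add: \<Psi>_b)
qed

lemma \<Psi>0: "0 \<le> \<Psi> s" unfolding \<Psi>_def by (simp add: \<psi>0)

lemma sym_sol_\<Psi>: "sym_sol \<Omega> p lam f G x = \<Psi> (\<omega> * norm x ^ CARD('n))"
 unfolding sym_sol_def Let_def \<Psi>_def TT_def[symmetric] \<psi>_def[abs_def] X_def N_def[symmetric] \<omega>_def[symmetric] P_def[symmetric] \<Lambda>_def[symmetric] ..

lemma G_AE': "AE t in lborel. t \<in> {0<..<TT} --> 0 \<le> G t"
 using G_AE by (simp add: AE_lebesgue_on_iff TT_def)

lemma le_\<Psi>:
 assumes gc: "gc > 0" and yp: "yp \<ge> 0" and s: "0 < s"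
  and U: "ennreal U \<le> (\<integral>\<^sup>+t. ennreal ((2 * ((gc * t powr (1/N) / t) powr P * (2 * F t))) powr (1 / (P - 1))
   + (2 * ((gc * t powr (1/N) / t) powr P * (2 * yp * G t))) powr (1/P)) * ind {s<..<TT} t \<partial>lebesgue)"
 shows "U \<le> Ccmp gc yp * \<Psi> s"
proof -
 have "AE t in lborel. ennreal ((2 * ((gc * t powr (1/N) / t) powr P * (2 * F t))) powr (1 / (P - 1))
   + (2 * ((gc * t powr (1/N) / t) powr P * (2 * yp * G t))) powr (1/P)) * ind {s<..<TT} t
  \<le> ennreal (Ccmp gc yp) * (ennreal (\<psi>b t) * ind {s<..<TT} t)" using G_AE' \<psi>b_eq
 proof eventually_elim
  case (elim t)
  show ?case
  proof (cases "t \<in> {s<..<TT}")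
   case True
   hence "0 < t" "t \<le> TT" "0 \<le> G t" "\<psi> t = \<psi>b t" using elim s by auto
   hence "ennreal ((2 * ((gc * t powr (1/N) / t) powr P * (2 * F t))) powr (1 / (P - 1))
    + (2 * ((gc * t powr (1/N) / t) powr P * (2 * yp * G t))) powr (1/P)) \<le> ennreal (Ccmp gc yp * \<psi>b t)"
    using ennreal_leI[OF comparison_integrand_le[OF gc yp, of t]] by simp
   also have "\<dots> = ennreal (Ccmp gc yp) * ennreal (\<psi>b t)" using Ccmp_pos[OF gc, of yp] by (simp add: ennreal_mult')
   finally show ?thesis using True by simp
  qed simp
 qed
 hence "AE t in lebesgue. ennreal ((2 * ((gc * t powr (1/N) / t) powr P * (2 * F t))) powr (1 / (P - 1))
   + (2 * ((gc * t powr (1/N) / t) powr P * (2 * yp * G t))) powr (1/P)) * ind {s<..<TT} t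
  \<le> ennreal (Ccmp gc yp) * (ennreal (\<psi>b t) * ind {s<..<TT} t)" by (rule AE_completion)
 from order_trans[OF U nn_integral_mono_AE[OF this]]
 have "ennreal U \<le> (NN t. ennreal (Ccmp gc yp) * (ennreal (\<psi>b t) * ind {s<..<TT} t))" by (simp add: nn_integral_completion)
 also have "\<dots> = ennreal (Ccmp gc yp * \<Psi> s)" using Ccmp_pos[OF gc, of yp] s by (simp add: nn_integral_cmult \<Psi>_nn ennreal_mult')
 finally show ?thesis using Ccmp_pos[OF gc, of yp] \<Psi>0[of s] by (simp add: ennreal_le_iff)
qed

text \<open>From Y = (X / \<Lambda>)^(1/(P-1)) one has Y X = \<Lambda> Y^P, and the load is only a
  part of X. This turns the work of the load into energy of v.\<close>

lemma \<psi>F_le: "0 < t ==> t \<le> TT ==> \<psi> t * F t \<le> \<Lambda> * Y t powr P"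
proof -
 assume t: "0 < t" "t \<le> TT"
 have e: "- 1 / (P - 1) = 1 - q" using q_eq(3) by simp
 have X: "0 \<le> X t" by (rule X0[OF t])
 have "X t powr (1 / (P - 1)) * X t = X t powr q" unfolding q_eq(3)[symmetric] powr_add using X by simp
 moreover have "\<Lambda> * \<Lambda> powr (- q) = \<Lambda> powr (1 - q)" using \<Lambda>_pos by (simp add: powr_diff powr_minus divide_inverse)
 moreover have "Y t * X t = \<Lambda> powr (1 - q) * (X t powr (1 / (P - 1)) * X t)" unfolding Y_def e by simp
 ultimately have YX: "Y t * X t = \<Lambda> * Y t powr P" unfolding YP by (simp add: mult.assoc[symmetric])
 have "\<psi> t * F t = Y t * (t powr (1/N - 1) * F t) / c\<omega>" by (simp add: \<psi>_eq[OF t(1)])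
 also have "\<dots> \<le> Y t * (c\<omega> * X t) / c\<omega>"
  using c\<omega>_pos by (intro divide_right_mono mult_left_mono load_le_X[OF t(1)] Y0) auto
 finally show ?thesis using YX c\<omega>_pos by simp
qed

text \<open>Insert the bound U <= c \<Psi>, write \<Psi> as the integral of \<psi> over (s,TT), and
  exchange the integrals. The inner integral of the rearranged load is F(t), and
  \<open>\<psi>F_le\<close> finishes.\<close>

lemma load_energy:
 assumes U: "!!s. 0 < s ==> s < TT ==> U s \<le> c * \<Psi> s" "!!s. TT \<le> s ==> 0 < s ==> U s = 0" and c: "c \<ge> 0"
 shows "(NN s. ennreal (decr_rearr \<Omega> f s) * ennreal (U s) * ind {0<..} s) \<le> ennreal (c * \<Lambda> * EY)"
proof -
 have "(NN s. ennreal (decr_rearr \<Omega> f s) * ennreal (U s) * ind {0<..} s)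
  \<le> (NN s. (NN t. ennreal c * (ennreal (fs s) * (ennreal (\<psi>b t) * (ind {0<..} s * ind {r. s < r & r < TT} t)))))"
 proof (intro nn_integral_mono)
  fix s
  show "ennreal (decr_rearr \<Omega> f s) * ennreal (U s) * ind {0<..} s
   \<le> (NN t. ennreal c * (ennreal (fs s) * (ennreal (\<psi>b t) * (ind {0<..} s * ind {r. s < r & r < TT} t))))"
  proof (cases "0 < s & s < TT")
   case True
   have "{r. s < r & r < TT} = {s<..<TT}" by auto
   hence "(NN t. ennreal c * (ennreal (fs s) * (ennreal (\<psi>b t) * (ind {0<..} s * ind {r. s < r & r < TT} t))))
    = ennreal c * (ennreal (fs s) * ennreal (\<Psi> s))" using True by (simp add: nn_integral_cmult \<Psi>_nn)
   also have "\<dots> = ennreal (fs s) * ennreal (c * \<Psi> s)" using c by (simp add: ennreal_mult' mult_ac)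
   finally show ?thesis using True U(1)[of s] by (auto simp: fs_def intro!: mult_left_mono ennreal_leI)
  next
   case False
   thus ?thesis using U(2)[of s] by (cases "0 < s") auto
  qed
 qed
 also have "\<dots> = (NN t. (NN s. ennreal c * (ennreal (fs s) * (ennreal (\<psi>b t) * (ind {0<..} s * ind {r. s < r & r < TT} t)))))"
  by (rule lborel_pair.Fubini'[symmetric]) measurable
 also have "\<dots> \<le> (NN t. ennreal (c * \<Lambda>) * ennreal (Yb t powr P))"
 proof (rule nn_integral_mono_AE)
  show "AE t in lborel. (NN s. ennreal c * (ennreal (fs s) * (ennreal (\<psi>b t) * (ind {0<..} s * ind {r. s < r & r < TT} t))))
   \<le> ennreal (c * \<Lambda>) * ennreal (Yb t powr P)" using Yb(4) \<psi>b_eq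
  proof eventually_elim
   case (elim t)
   show ?case
   proof (cases "t \<in> {0<..<TT}")
    case True
    hence t: "0 < t" "t \<le> TT" by auto
    have "(NN s. ennreal c * (ennreal (fs s) * (ennreal (\<psi>b t) * (ind {0<..} s * ind {r. s < r & r < TT} t))))
     = (NN s. ennreal (c * \<psi>b t) * (ennreal (fs s) * ind {0<..<t} s))"
     using True c by (intro nn_integral_cong) (auto simp: indicator_def ennreal_mult' mult_ac)
    also have "\<dots> = ennreal (c * \<psi>b t) * ennreal (F t)" using nn_F[OF t(2)] by (simp add: nn_integral_cmult)
    also have "\<dots> = ennreal (c * (\<psi> t * F t))" using elim True c \<psi>b0[of t] F0[OF t(2)] by (simp add: ennreal_mult'[symmetric] mult.assoc)
    also have "\<dots> \<le> ennreal (c * (\<Lambda> * Y t powr P))" by (intro ennreal_leI mult_left_mono \<psi>F_le t c)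
    also have "\<dots> = ennreal (c * \<Lambda>) * ennreal (Yb t powr P)"
     using elim True c \<Lambda>_pos by (simp add: ennreal_mult'[symmetric] mult.assoc)
    finally show ?thesis .
   next
    case False
    hence "\<psi>b t = 0" by (rule \<psi>b_out)
    thus ?thesis by simp
   qed
  qed
 qed
 also have "\<dots> = ennreal (c * \<Lambda> * EY)" using c \<Lambda>_pos EY0 by (simp add: nn_integral_cmult EY_nn ennreal_mult')
 finally show ?thesis .
qed

text \<open>Pointwise, G is at most X^q / kG, and X^q is \<Lambda>^q Y^P.\<close>

lemma G_energy: "(\<integral>\<^sup>+s. ennreal (G s) * ind {0<..<TT} s \<partial>lebesgue) \<le> ennreal (\<Lambda> powr q / kG * EY)"
proof -
 define \<kappa> where "\<kappa> = \<Lambda> powr q / kG"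
 have \<kappa>: "\<kappa> \<ge> 0" using kG_pos by (simp add: \<kappa>_def)
 have "(NN s. ennreal (G s) * ind {0<..<TT} s) \<le> (NN t. ennreal (\<kappa>) * ennreal (Yb t powr P))"
 proof (rule nn_integral_mono_AE)
  show "AE s in lborel. ennreal (G s) * ind {0<..<TT} s \<le> ennreal (\<kappa>) * ennreal (Yb s powr P)" using Yb(4) G_AE'
  proof eventually_elim
   case (elim t)
   show ?case
   proof (cases "t \<in> {0<..<TT}")
    case True
    hence t: "0 < t" "t \<le> TT" "0 \<le> G t" using elim by auto
    have "\<Lambda> powr q * \<Lambda> powr (- q) = 1" using \<Lambda>_pos by (simp flip: powr_add)
    hence "X t powr q = \<Lambda> powr q * Y t powr P" unfolding YP by (simp add: mult.assoc[symmetric])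
    hence "G t \<le> \<kappa> * Yb t powr P" using G_le_X[OF t] elim True by (simp add: \<kappa>_def)
    hence "ennreal (G t) \<le> ennreal (\<kappa> * Yb t powr P)" by (rule ennreal_leI)
    thus ?thesis using True \<kappa> by (simp add: ennreal_mult')
   qed simp
  qed
 qed
 also have "\<dots> = ennreal (\<kappa> * EY)" using \<kappa> EY0 by (simp add: nn_integral_cmult EY_nn ennreal_mult')
 finally show ?thesis by (simp add: nn_integral_completion \<kappa>_def)
qed

end

section \<open>Radial functions in the variable of enclosed volume\<close>

context aniso begin

definition \<tau> :: "real^'n => real" where "\<tau> x = \<omega> * norm x ^ CARD('n)"
definition "rad t = (t / \<omega>) powr (1/N)"

lemma \<tau>0: "0 \<le> \<tau> x" using \<omega>_pos by (simp add: \<tau>_def)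
lemma \<tau>_pos: "x \<noteq> 0 ==> 0 < \<tau> x" using \<omega>_pos by (simp add: \<tau>_def)
lemma \<tau>_borel [measurable]: "\<tau> \<in> BM borel" unfolding \<tau>_def[abs_def] by measurable
lemma rad_borel [measurable]: "rad \<in> BM borel" unfolding rad_def[abs_def] by measurable
lemma rad_pos: "0 < t ==> 0 < rad t" using \<omega>_pos by (simp add: rad_def)
lemma rad0: "0 \<le> rad t" by (simp add: rad_def)

lemma rad_pow: assumes "0 \<le> t" shows "\<omega> * rad t ^ CARD('n) = t"
proof (cases "t = 0")
 case False
 hence t: "0 < t / \<omega>" using assms \<omega>_pos by simp
 have "0 < t" using assms False by simp
 hence "rad t ^ CARD('n) = rad t powr N" using powr_realpow[OF rad_pos, of t "CARD('n)"] by (simp add: N_def)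
 also have "\<dots> = (t / \<omega>) powr (1/N * N)" by (simp only: rad_def powr_powr)
 also have "1/N * N = 1" using N_ge by simp
 also have "(t / \<omega>) powr 1 = t / \<omega>" using t by (simp add: abs_of_pos del: abs_divide)
 finally show ?thesis using \<omega>_pos by simp
qed (simp add: rad_def)

lemma rad_\<tau>: "rad (\<tau> x) = norm x"
proof -
 have "\<omega> * rad (\<tau> x) ^ CARD('n) = \<omega> * norm x ^ CARD('n)" using rad_pow[OF \<tau>0, of x] by (simp add: \<tau>_def)
 hence "rad (\<tau> x) ^ CARD('n) = norm x ^ CARD('n)" using \<omega>_pos by simp
 thus ?thesis by (rule power_eq_imp_eq_base) (auto simp: rad0)
qed

lemma pow_less_iff: "0 \<le> (x::real) ==> 0 \<le> y ==> 0 < n ==> x ^ n < y ^ n \<longleftrightarrow> x < y"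
 by (meson not_le power_mono_iff)

lemma rad_less_iff: "0 \<le> s ==> 0 \<le> t ==> rad s < rad t \<longleftrightarrow> s < t"
proof -
 assume st: "0 \<le> s" "0 \<le> t"
 have "s < t \<longleftrightarrow> \<omega> * rad s ^ CARD('n) < \<omega> * rad t ^ CARD('n)" unfolding rad_pow[OF st(1)] rad_pow[OF st(2)] ..
 also have "\<dots> \<longleftrightarrow> rad s < rad t" using \<omega>_pos by (simp add: pow_less_iff rad0)
 finally show ?thesis by simp
qed

lemma norm_less_rad: "0 \<le> t ==> norm x < rad t \<longleftrightarrow> \<tau> x < t"
 using rad_less_iff[OF \<tau>0, of t x] by (simp add: rad_\<tau>)

lemma rad_deriv: assumes "0 < t" shows "(rad has_real_derivative t powr (1/N - 1) / c\<omega>) (at t)"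
proof -
 have e: "rad s = s powr (1/N) / \<omega> powr (1/N)" for s by (simp add: rad_def powr_divide)
 have "((%s. s powr (1/N) / \<omega> powr (1/N)) has_real_derivative (1/N * t powr (1/N - 1)) / \<omega> powr (1/N)) (at t)"
  using assms by (intro DERIV_cdivide has_real_derivative_powr)
 thus ?thesis by (simp add: e[abs_def] c\<omega>_def)
qed

text \<open>The sublevel set of \<tau> at a > 0 is the centred ball of volume a. Half-lines generate
  the Borel sets, so \<tau> carries Lebesgue measure to Lebesgue measure on (0,\<infinity>), and
  polar coordinates need no further Jacobian.\<close>

lemma distr_\<tau>: "distr lborel borel \<tau> = density lborel (%t. ind {0<..} t)"
proof (rule measure_eqI_generator_eq[where E = "range lessThan" and \<Omega> = UNIV and A = "%i. {..<real i}"])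
 show "Int_stable (range lessThan :: real set set)"
 proof (rule Int_stableI)
  fix A B :: "real set" assume "A \<in> range lessThan" "B \<in> range lessThan"
  then obtain a b where "A = {..<a}" "B = {..<b}" by auto
  hence "A \<inter> B = {..<min a b}" by auto
  thus "A \<inter> B \<in> range lessThan" by simp
 qed
 have *: "emeasure (distr lborel borel \<tau>) {..<a} = ennreal (max 0 a)" for a
 proof -
  have "emeasure (distr lborel borel \<tau>) {..<a} = emeasure lborel {x. \<tau> x < a}" by (subst emeasure_distr) (auto simp: vimage_def)
  also have "\<dots> = ennreal (max 0 a)"
  proof (cases "a > 0")
   case True
   have "{x. \<tau> x < a} = ball 0 (rad a)" using norm_less_rad[of a] True by (intro set_eqI) (simp only: mem_Collect_eq mem_ball_0 less_imp_le)
   hence "emeasure lborel {x. \<tau> x < a} = ennreal (unit_ball_vol (real (DIM(real^'n))) * rad a ^ DIM(real^'n))" by (simp add: emeasure_ball rad0)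
   also have "unit_ball_vol (real (DIM(real^'n))) * rad a ^ DIM(real^'n) = a" using rad_pow[of a] True by (simp add: \<omega>_def N_def)
   finally show ?thesis using True by simp
  next
   case False
   hence "{x. \<tau> x < a} = {}" using \<tau>0 by (auto simp: not_less intro: order_trans)
   thus ?thesis using False by simp
  qed
  finally show ?thesis .
 qed
 have "emeasure (density lborel (%t. ind {0<..} t)) {..<a} = ennreal (max 0 a)" for a :: real
 proof -
  have "emeasure (density lborel (%t. ind {0<..} t)) {..<a} = (NN t. ind {0<..<a} t)"
   by (subst emeasure_density) (auto intro!: nn_integral_cong split: split_indicator simp del: nn_integral_indicator)
  also have "\<dots> = ennreal (max 0 a)" by (cases "a > 0") auto
  finally show ?thesis .
 qed
 thus "emeasure (distr lborel borel \<tau>) X = emeasure (density lborel (%t. ind {0<..} t)) X" if "X \<in> range lessThan" for X using that * by auto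
 show "emeasure (distr lborel borel \<tau>) {..<real i} \<noteq> \<infinity>" for i by (simp add: *)
 show "(\<Union>i. {..<real i}) = UNIV" using reals_Archimedean2 by auto
 have "sets (borel :: real measure) = sigma_sets UNIV (range lessThan)" by (subst borel_Iio) simp
 thus "sets (distr lborel borel \<tau>) = sigma_sets UNIV (range lessThan)"
  "sets (density lborel (%t::real. ind {0<..} t)) = sigma_sets UNIV (range lessThan)" by simp_all
qed auto

lemma nn_radial:
 assumes [measurable]: "h \<in> BM borel"
 shows "(NN x. h (\<tau> x)) = (NN t. h t * ind {0<..} t)"
proof -
 have "(NN x. h (\<tau> x)) = (\<integral>\<^sup>+t. h t \<partial>distr lborel borel \<tau>)" by (rule nn_integral_distr[symmetric]) auto
 also have "\<dots> = (NN t. ind {0<..} t * h t)" unfolding distr_\<tau> by (rule nn_integral_density) auto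
 finally show ?thesis by (simp add: mult.commute)
qed

lemma AE_radial:
 assumes "AE t in lborel. Q t"
 shows "AE x in lborel. Q (\<tau> x)"
proof -
 obtain A where A: "A \<in> null_sets lborel" "{t. \<not> Q t} \<subseteq> A" using assms by (auto simp: eventually_ae_filter)
 have [measurable]: "A \<in> sets borel" using A(1) by (auto simp: null_sets_def)
 have vm: "\<tau> -` A \<in> sets borel" using measurable_sets[OF \<tau>_borel, of A] by simp
 have "emeasure lborel (\<tau> -` A) = (NN x. ind (\<tau> -` A) x)" using vm by (subst nn_integral_indicator) auto
 also have "\<dots> = (NN x. ind A (\<tau> x))" by (intro nn_integral_cong) (auto simp: indicator_def)
 also have "\<dots> = (NN t. ind A t * ind {0<..} t)" by (rule nn_radial) measurable
 also have "\<dots> \<le> (NN t. ind A t)" by (intro nn_integral_mono) (auto simp: indicator_def)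
 also have "\<dots> = 0" using A(1) by (simp add: null_sets_def)
 finally have "emeasure lborel (\<tau> -` A) = 0" by simp
 hence "\<tau> -` A \<in> null_sets lborel" using vm by (auto simp: null_sets_def)
 thus ?thesis by (rule AE_I') (use A(2) in auto)
qed

end

lemma smooth1_real_polynomial: "real_polynomial_function (g :: real => real) ==> smooth1 g"
proof (induction g rule: real_polynomial_function.induct)
 case (linear f)
 hence "f = (%x. f 1 * x)" using linear_cmul[OF bounded_linear.linear[OF linear]] by (metis mult.commute mult.right_neutral real_scaleR_def)
 moreover have "smooth1 (%x. f 1 * x)" by (intro smooth1_mult) auto
 ultimately show ?case by simp
qed (auto intro: smooth1_add smooth1_mult)

lemma continuous_approx_AE:
 fixes h :: "real => real"
 assumes "h \<in> BM borel"
 obtains g where "!!n::nat. continuous_on UNIV (g n)" "AE t in lborel. (%n. g n t) \<leadsto> h t"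
proof -
 have "h measurable_on UNIV" using borel_imp_lebesgue_on[OF assms, of UNIV] by (simp add: measurable_on_iff_borel_measurable)
 then obtain A g where Ag: "negligible A" "!!n::nat. continuous_on UNIV (g n)" "!!x. x \<notin> A ==> (%n. g n x) \<leadsto> h x"
  unfolding measurable_on_def by auto
 have "AE t in lebesgue. (%n. g n t) \<leadsto> h t" using Ag(1,3) by (intro AE_I'[of A]) (auto simp: negligible_iff_null_sets)
 from Ag(2) this[unfolded AE_completion_iff] show ?thesis by (rule that)
qed

context sym_data begin

text \<open>Y cut off in height and away from both ends: the lower end is the origin, where dividing
  by the radius would be singular, and the upper end leaves room for compact support in the
  ball.\<close>

definition "Ym m t = ind {1 / real (Suc m)<..<TT - 1 / real (Suc m)} t * min (Yb t) (real m)"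

lemma Ym_borel [measurable]: "Ym m \<in> BM borel" unfolding Ym_def[abs_def] by measurable

text \<open>A smooth radial function of |x|^2 has gradient \<beta>(|x|^2) x, so \<beta>(r^2) r has
  to approximate minus \<open>Ym\<close>. Continuous functions converging a.e. to Y are clipped to
  [0,m], divided by the radius, replaced by polynomials in r^2 by the Weierstrass theorem, and cut
  off smoothly.\<close>

lemma density_step:
 "\<exists>\<beta> a b. smooth1 \<beta> & 0 < a & b < (rad TT)\<^sup>2 & (\<forall>\<rho>. \<rho> \<notin> {a<..<b} --> \<beta> \<rho> = 0) &
   integrable lborel (%t. |(ind {0<..<TT} t * (\<beta> ((rad t)\<^sup>2) * rad t + Ym m t))| powr P) &
   (LBINT t. |(ind {0<..<TT} t * (\<beta> ((rad t)\<^sup>2) * rad t + Ym m t))| powr P) < 1 / real (Suc m)"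
proof -
 define d where "d = 1 / real (Suc m)"
 have d: "d > 0" by (simp add: d_def)
 show ?thesis
 proof (cases "d < TT - d")
  case False
  \<comment> \<open>The cut-off interval is empty. The zero function works, and 1 and -1 are just an
    admissible pair a, b describing an empty support.\<close>
  hence "Ym m = (%_. 0)" by (auto simp: Ym_def d_def indicator_def fun_eq_iff)
  thus ?thesis by (intro exI[of _ "%_. 0"] exI[of _ 1] exI[of _ "-1"]) (auto intro: less_le_trans[of "-1" 0])
 next
  case True
  define a b where "a = (rad d)\<^sup>2" and "b = (rad (TT - d))\<^sup>2"
  have ab: "0 < a" "b < (rad TT)\<^sup>2" using d True rad_pos[OF d] by (auto simp: a_def b_def rad0 rad_less_iff intro!: power_strict_mono)
  obtain g where g: "!!n::nat. continuous_on UNIV (g n)" "AE t in lborel. (%n. g n t) \<leadsto> Yb t"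
   by (rule continuous_approx_AE[OF Yb(1)]) (rule that)
  define cl where "cl y = max 0 (min y (real m))" for y
  have cl: "0 \<le> cl y" "cl y \<le> real m" for y by (auto simp: cl_def)
  \<comment> \<open>The target profile as a function of \<rho> = r^2; it is continuous on [a,b]
    because a is positive.\<close>
  define Q where "Q n \<rho> = cl (g n (\<omega> * sqrt \<rho> ^ CARD('n))) / sqrt \<rho>" for n \<rho>
  have "continuous_on {a..b} (Q n)" for n unfolding Q_def cl_def using ab by (intro continuous_intros continuous_on_compose2[OF g(1)]) auto
  hence "\<exists>pl. real_polynomial_function pl & (\<forall>\<rho>\<in>{a..b}. |(Q n \<rho> - pl \<rho>)| < 1 / real (Suc n))" for n
   using Stone_Weierstrass_real_polynomial_function[of "{a..b}" "Q n" "1 / real (Suc n)"] by (metis compact_Icc of_nat_0_less_iff zero_less_Suc zero_less_divide_1_iff)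
  then obtain pl where pl: "!!n. real_polynomial_function (pl n)" "!!n \<rho>. \<rho> \<in> {a..b} ==> |(Q n \<rho> - pl n \<rho>)| < 1 / real (Suc n)"
   by metis
  \<comment> \<open>The sign is negative because v decreases with the radius.\<close>
  define \<beta> where "\<beta> n \<rho> = - 1 * (pl n \<rho> * step_approx a b n \<rho>)" for n \<rho>
  have \<beta>s: "smooth1 (\<beta> n)" for n
   unfolding \<beta>_def by (rule smooth1_mult[OF smooth1_const smooth1_mult[OF smooth1_real_polynomial[OF pl(1)] step_approx_smooth]])
  have [measurable]: "\<beta> n \<in> BM borel" for n by (rule borel_measurable_continuous_onI[OF smooth1_continuous[OF \<beta>s]])
  have \<beta>0: "\<beta> n \<rho> = 0" if "\<rho> \<notin> {a<..<b}" for n \<rho> using that by (simp add: \<beta>_def step_approx_outside)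
  have in_iff: "(rad t)\<^sup>2 \<in> {a<..<b} \<longleftrightarrow> t \<in> {d<..<TT - d}" if "t \<in> {0<..<TT}" for t
  proof -
   have "rad d < rad t \<longleftrightarrow> (rad d)\<^sup>2 < (rad t)\<^sup>2" "rad t < rad (TT - d) \<longleftrightarrow> (rad t)\<^sup>2 < (rad (TT - d))\<^sup>2"
    by (simp_all add: pow_less_iff rad0)
   thus ?thesis using that d True by (auto simp: a_def b_def rad_less_iff)
  qed
  have Qr: "Q n ((rad t)\<^sup>2) = cl (g n t) / rad t" if "t \<in> {0<..<TT}" for n t using that rad0 rad_pow[of t] by (simp add: Q_def)
  define z where "z n t = ind {0<..<TT} t * (\<beta> n ((rad t)\<^sup>2) * rad t + Ym m t)" for n t
  have [measurable]: "z n \<in> BM borel" for n unfolding z_def[abs_def] by measurable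
  have key: "|(pl n ((rad t)\<^sup>2) * rad t - cl (g n t))| \<le> rad TT / real (Suc n)" if t: "t \<in> {d<..<TT - d}" for n t
  proof -
   have t0: "t \<in> {0<..<TT}" using t d by auto
   have r: "0 < rad t" "rad t \<le> rad TT" using t0 rad_less_iff[of t TT] by (auto intro: rad_pos)
   have "|(pl n ((rad t)\<^sup>2) * rad t - cl (g n t))| = |(cl (g n t) / rad t - pl n ((rad t)\<^sup>2))| * rad t"
   proof -
    have "(cl (g n t) / rad t - pl n ((rad t)\<^sup>2)) * rad t = - (pl n ((rad t)\<^sup>2) * rad t - cl (g n t))"
     using r by (simp add: left_diff_distrib)
    hence "|((cl (g n t) / rad t - pl n ((rad t)\<^sup>2)) * rad t)| = |(pl n ((rad t)\<^sup>2) * rad t - cl (g n t))|" by simp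
    thus ?thesis using r by (simp add: abs_mult)
   qed
   also have "\<dots> \<le> 1 / real (Suc n) * rad TT" using in_iff[OF t0] t pl(2)[of "(rad t)\<^sup>2" n] Qr[OF t0, of n] r by (intro mult_mono) auto
   finally show ?thesis by simp
  qed
  have zb: "|(z n t)| powr P \<le> ind {0<..<TT} t * (2 * real m + rad TT) powr P" for n t
  proof (cases "t \<in> {0<..<TT}")
   case t: True
   have "|(z n t)| \<le> 2 * real m + rad TT"
   proof (cases "t \<in> {d<..<TT - d}")
    case True
    have "|(pl n ((rad t)\<^sup>2) * rad t)| \<le> real m + rad TT"
    proof -
     have "rad TT / real (Suc n) \<le> rad TT" using rad0[of TT] by (simp add: divide_le_eq mult_le_cancel_left1)
     thus ?thesis using key[OF True, of n] cl[of "g n t"] by linarith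
    qed
    moreover have "|(\<beta> n ((rad t)\<^sup>2) * rad t)| \<le> |(pl n ((rad t)\<^sup>2) * rad t)|"
    proof -
     have "|(\<beta> n ((rad t)\<^sup>2) * rad t)| = |(pl n ((rad t)\<^sup>2) * rad t)| * |(step_approx a b n ((rad t)\<^sup>2))|"
      by (simp add: \<beta>_def abs_mult)
     also have "\<dots> \<le> |(pl n ((rad t)\<^sup>2) * rad t)| * 1"
      using step_approx_bounds[of a b n "(rad t)\<^sup>2"] by (intro mult_left_mono) auto
     finally show ?thesis by simp
    qed
    moreover have "|(Ym m t)| \<le> real m" using Yb(2)[of t] by (auto simp: Ym_def indicator_def)
    ultimately show ?thesis using t by (simp add: z_def)
   next
    case False
    hence "Ym m t = 0" "\<beta> n ((rad t)\<^sup>2) = 0" using \<beta>0 in_iff[OF t] by (auto simp: Ym_def d_def)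
    thus ?thesis by (simp add: z_def rad0)
   qed
   thus ?thesis using t P1 by (simp add: powr_mono2)
  qed (simp add: z_def)
  have w: "integrable lborel (%t. ind {0<..<TT} t * (2 * real m + rad TT) powr P)"
   using TT0 by (intro integrable_mult_left integrable_real_indicator) auto
  have zi: "integrable lborel (%t. |(z n t)| powr P)" for n
   by (rule Bochner_Integration.integrable_bound[OF w]) (use zb in \<open>auto intro!: AE_I2\<close>)
  have "(%n. LBINT t. |(z n t)| powr P) \<leadsto> (LINT t::real|lborel. 0)"
  proof (rule integral_dominated_convergence[where s = "%n t. |(z n t)| powr P" and f = "%_. 0" and w = "%t. ind {0<..<TT} t * (2 * real m + rad TT) powr P"])
   show "AE t in lborel. (%n. |(z n t)| powr P) \<leadsto> 0" using g(2)
   proof eventually_elim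
    case (elim t)
    have "(%n. z n t) \<leadsto> 0"
    proof (cases "t \<in> {d<..<TT - d}")
     case t: True
     hence t0: "t \<in> {0<..<TT}" using d by auto
     have c: "(%n. cl (g n t)) \<leadsto> cl (Yb t)" unfolding cl_def by (intro tendsto_intros elim)
     have "(%n. pl n ((rad t)\<^sup>2) * rad t - cl (g n t)) \<leadsto> 0"
     proof (rule Lim_null_comparison)
      show "\<forall>\<^sub>F n in sequentially. norm (pl n ((rad t)\<^sup>2) * rad t - cl (g n t)) \<le> rad TT / real (Suc n)"
       using key[OF t] by (intro always_eventually) auto
      show "(%n. rad TT / real (Suc n)) \<leadsto> 0" by real_asymp
     qed
     from tendsto_add[OF this c] have "(%n. pl n ((rad t)\<^sup>2) * rad t) \<leadsto> cl (Yb t)" by simp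
     from tendsto_mult[OF this step_approx_tendsto[of a b "(rad t)\<^sup>2"]]
     have "(%n. pl n ((rad t)\<^sup>2) * rad t * step_approx a b n ((rad t)\<^sup>2)) \<leadsto> cl (Yb t)" using in_iff[OF t0] t by simp
     from tendsto_diff[OF tendsto_const[of "cl (Yb t)"] this] show ?thesis
      using t t0 Yb(2)[of t] by (simp add: z_def \<beta>_def Ym_def d_def cl_def mult_ac)
    next
     case False
     have "z n t = 0" for n
     proof (cases "t \<in> {0<..<TT}")
      case True
      thus ?thesis using False \<beta>0 in_iff[OF True] by (auto simp: z_def Ym_def d_def)
     qed (simp add: z_def)
     thus ?thesis by simp
    qed
    thus ?case using P1 by (intro tendsto_zero_powrI[OF tendsto_rabs_zero tendsto_const]) auto
   qed
   show "AE t in lborel. norm ( |(z n t)| powr P) \<le> ind {0<..<TT} t * (2 * real m + rad TT) powr P" for n using zb by (intro AE_I2) simp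
  qed (use w in auto)
  hence "(%n. LBINT t. |(z n t)| powr P) \<leadsto> 0" by simp
  from order_tendstoD(2)[OF this, of d] d obtain n where n: "(LBINT t. |(z n t)| powr P) < d" by (auto simp: eventually_sequentially)
  show ?thesis by (rule exI[of _ "\<beta> n"], rule exI[of _ a], rule exI[of _ b])
    (use \<beta>s \<beta>0 ab n zi[of n] in \<open>auto simp: z_def d_def\<close>)
 qed
qed

text \<open>The radial component of the gradient error. It is a sum because the gradient of v has
  radial component \<open>- Yb\<close>.\<close>

definition "err \<beta> t = ind {0<..<TT} t * (\<beta> ((rad t)\<^sup>2) * rad t + Yb t)"

text \<open>Adds to \<open>density_step\<close> the convergence of \<open>Ym\<close> to
  \<open>Yb\<close> in L^P, which is dominated by \<open>Yb\<close>.\<close>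

lemma radial_density:
 obtains \<beta> a b where "!!k::nat. smooth1 (\<beta> k)" "!!k. 0 < a k" "!!k. b k < (rad TT)\<^sup>2"
  "!!k \<rho>. \<rho> \<notin> {a k<..<b k} ==> \<beta> k \<rho> = 0"
  "!!k. integrable lborel (%t. |(err (\<beta> k) t)| powr P)"
  "(%k. LBINT t. |(err (\<beta> k) t)| powr P) \<leadsto> 0"
proof -
 define z where "z \<beta> m t = ind {0<..<TT} t * (\<beta> ((rad t)\<^sup>2) * rad t + Ym m t)" for \<beta> m t
 define A where "A m \<beta> a b \<longleftrightarrow> smooth1 \<beta> & 0 < a & b < (rad TT)\<^sup>2 & (\<forall>\<rho>. \<rho> \<notin> {a<..<b} --> \<beta> \<rho> = 0) &
   integrable lborel (%t. |(z \<beta> m t)| powr P) & (LBINT t. |(z \<beta> m t)| powr P) < 1 / real (Suc m)" for m \<beta> a b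
 have "\<exists>\<beta> a b. A m \<beta> a b" for m unfolding A_def z_def by (rule density_step)
 then obtain \<beta> a b where A: "!!k. A k (\<beta> k) (a k) (b k)" by metis
 hence B: "!!k. smooth1 (\<beta> k)" "!!k. 0 < a k" "!!k. b k < (rad TT)\<^sup>2"
  "!!k \<rho>. \<rho> \<notin> {a k<..<b k} ==> \<beta> k \<rho> = 0"
  "!!k. integrable lborel (%t. |(z (\<beta> k) k t)| powr P)"
  "!!k. (LBINT t. |(z (\<beta> k) k t)| powr P) < 1 / real (Suc k)" unfolding A_def by blast+
 have [measurable]: "\<beta> k \<in> BM borel" for k by (rule borel_measurable_continuous_onI[OF smooth1_continuous[OF B(1)]])
 have [measurable]: "err (\<beta> k) \<in> BM borel" for k unfolding err_def[abs_def] by measurable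
 have Yd: "|(Yb t - Ym k t)| powr P \<le> Yb t powr P" for k t using Yb(2)[of t] P1 by (intro powr_mono2) (auto simp: Ym_def indicator_def)
 have Ydi: "integrable lborel (%t. |(Yb t - Ym k t)| powr P)" for k
  by (rule Bochner_Integration.integrable_bound[OF Yb_int]) (use Yd in \<open>auto intro!: AE_I2\<close>)
 have "(%k. LBINT t. |(Yb t - Ym k t)| powr P) \<leadsto> (LINT t::real|lborel. 0)"
 proof (rule integral_dominated_convergence[where s = "%k t. |(Yb t - Ym k t)| powr P" and f = "%_. 0" and w = "%t. Yb t powr P"])
  show "AE t in lborel. (%k. |(Yb t - Ym k t)| powr P) \<leadsto> 0"
  proof (rule AE_I2)
   fix t
   have "eventually (%k. Yb t - Ym k t = 0) sequentially"
   proof (cases "t \<in> {0<..<TT}")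
    case True
    have "eventually (%k. 1 / real (Suc k) < t) sequentially" "eventually (%k. 1 / real (Suc k) < TT - t) sequentially"
     using True order_tendstoD(2)[OF LIMSEQ_inverse_real_of_nat[unfolded inverse_eq_divide]] by simp_all
    moreover have "eventually (%k. Yb t \<le> real k) sequentially"
     using filterlim_real_sequentially by (rule filterlim_at_top[THEN iffD1, rule_format])
    ultimately show ?thesis by eventually_elim (auto simp: Ym_def)
   next
    case False
    have "Yb t = 0" using False by (rule Yb(3))
    thus ?thesis by (auto simp: Ym_def)
   qed
   hence "eventually (%k. |(Yb t - Ym k t)| powr P = 0) sequentially" by eventually_elim simp
   thus "(%k. |(Yb t - Ym k t)| powr P) \<leadsto> 0" by (rule tendsto_eventually)
  qed
  show "AE t in lborel. norm ( |(Yb t - Ym k t)| powr P) \<le> Yb t powr P" for k using Yd by (intro AE_I2) simp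
 qed (use Yb_int in auto)
 hence lim2: "(%k. LBINT t. |(Yb t - Ym k t)| powr P) \<leadsto> 0" by simp
 have le: "|(err (\<beta> k) t)| powr P \<le> 2 powr P * ( |(z (\<beta> k) k t)| powr P + |(Yb t - Ym k t)| powr P)" for k t
 proof (cases "t \<in> {0<..<TT}")
  case True
  have "err (\<beta> k) t = z (\<beta> k) k t + (Yb t - Ym k t)" using True by (simp add: err_def z_def)
  thus ?thesis using P1 abs_add_powr_le[of P "z (\<beta> k) k t" "Yb t - Ym k t"] by simp
 qed (simp add: err_def)
 have int2: "integrable lborel (%t. 2 powr P * ( |(z (\<beta> k) k t)| powr P + |(Yb t - Ym k t)| powr P))" for k using B(5) Ydi by simp
 have ei: "integrable lborel (%t. |(err (\<beta> k) t)| powr P)" for k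
  by (rule Bochner_Integration.integrable_bound[OF int2[of k]]) (use le in \<open>auto intro!: AE_I2 elim: order_trans\<close>)
 have "(%k. LBINT t. |(err (\<beta> k) t)| powr P) \<leadsto> 0"
 proof (rule tendsto_sandwich[OF _ _ tendsto_const])
  show "\<forall>\<^sub>F k in sequentially. 0 \<le> (LBINT t. |(err (\<beta> k) t)| powr P)" by simp
  show "\<forall>\<^sub>F k in sequentially. (LBINT t. |(err (\<beta> k) t)| powr P) \<le> 2 powr P * (1 / real (Suc k) + (LBINT t. |(Yb t - Ym k t)| powr P))"
  proof (intro always_eventually allI)
   fix k
   have "(LBINT t. |(err (\<beta> k) t)| powr P) \<le> (LBINT t. 2 powr P * ( |(z (\<beta> k) k t)| powr P + |(Yb t - Ym k t)| powr P))"
    by (rule integral_mono[OF ei int2 le])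
   also have "\<dots> = 2 powr P * ((LBINT t. |(z (\<beta> k) k t)| powr P) + (LBINT t. |(Yb t - Ym k t)| powr P))" using B(5) Ydi by simp
   also have "\<dots> \<le> 2 powr P * (1 / real (Suc k) + (LBINT t. |(Yb t - Ym k t)| powr P))"
    using B(6)[of k] by (intro mult_left_mono add_right_mono) auto
   finally show "(LBINT t. |(err (\<beta> k) t)| powr P) \<le> 2 powr P * (1 / real (Suc k) + (LBINT t. |(Yb t - Ym k t)| powr P))" .
  qed
  have "(%k. 2 powr P * (1 / real (Suc k) + (LBINT t. |(Yb t - Ym k t)| powr P))) \<leadsto> 2 powr P * (0 + 0)"
   by (intro tendsto_mult tendsto_const tendsto_add lim2 LIMSEQ_inverse_real_of_nat[unfolded inverse_eq_divide])
  thus "(%k. 2 powr P * (1 / real (Suc k) + (LBINT t. |(Yb t - Ym k t)| powr P))) \<leadsto> 0" by simp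
 qed
 thus ?thesis using that[OF B(1-4) ei] by simp
qed

end

section \<open>Weak gradients and membership in the Sobolev closure\<close>

lemma partial_deriv_minus:
 assumes "\<phi> differentiable (at x)" "\<psi> differentiable (at x)"
 shows "pd i (%x. \<phi> x - \<psi> x) x = pd i \<phi> x - pd i \<psi> x" using partial_deriv_has_derivative[OF has_derivative_diff[OF
   assms[unfolded frechet_derivative_works]]] by (simp add: partial_deriv_def)

lemma test_funs_minus:
 assumes "\<phi> \<in> test_funs \<Omega>" "\<psi> \<in> test_funs \<Omega>"
 shows "(%x. \<phi> x - \<psi> x) \<in> test_funs \<Omega>"
proof -
 let ?S = "%f. closure {x. f x \<noteq> (0::real)}"
 have sub: "?S (%x. \<phi> x - \<psi> x) \<subseteq> ?S \<phi> \<union> ?S \<psi>" unfolding closure_Un[symmetric] by (rule closure_mono) auto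
 have "compact (?S \<phi> \<union> ?S \<psi>)" using assms by (intro compact_Un) (auto simp: test_funs_def)
 hence "compact ((?S \<phi> \<union> ?S \<psi>) \<inter> ?S (%x. \<phi> x - \<psi> x))" by (rule compact_Int_closed) simp
 hence c: "compact (?S (%x. \<phi> x - \<psi> x))" using sub by (simp add: Int_absorb1)
 have "Ck k (%x. \<phi> x + (- 1) * \<psi> x)" for k by (intro Ck_add Ck_mult Ck_const test_funs_Ck[OF assms(1)] test_funs_Ck[OF assms(2)])
 hence "Ck k (%x. \<phi> x - \<psi> x)" for k by simp
 thus ?thesis using c sub assms unfolding test_funs_def by blast
qed

lemma L1_loc_integrable_test:
 assumes h: "L1_loc \<Omega> h" and \<phi>: "\<phi> \<in> test_funs \<Omega>" and \<Omega>: "\<Omega> \<in> sets borel"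
 shows "integrable (LB \<Omega>) (%x. h x * \<phi> x)"
proof -
 define K where "K = closure {x. \<phi> x \<noteq> 0}"
 have K: "compact K" "K \<subseteq> \<Omega>" using \<phi> by (auto simp: K_def test_funs_def)
 have out: "\<phi> x = 0" if "x \<notin> K" for x using that closure_subset[of "{x. \<phi> x \<noteq> 0}"] unfolding K_def by blast
 obtain B where B: "B \<ge> 0" "!!x. |(\<phi> x)| \<le> B" using test_fun_bounded[OF \<phi>] by metis
 have Ks: "K \<in> sets lebesgue" using K(1) by (simp add: borel_compact)
 have i: "integrable lebesgue (%x. ind K x * h x)" using h[unfolded L1_loc_def, rule_format, of K] K Ks by (simp add: integrable_restrict_space)
 have m: "\<phi> \<in> BM lebesgue" using C1_borel[OF test_funs_C1[OF \<phi>]] by (intro measurable_completion) simp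
 have "integrable lebesgue (%x. ind K x * h x * \<phi> x)"
 proof (rule Bochner_Integration.integrable_bound)
  show "integrable lebesgue (%x. ind K x * h x * B)" using i by simp
  show "AE x in lebesgue. norm (ind K x * h x * \<phi> x) \<le> norm (ind K x * h x * B)"
   using B by (intro AE_I2) (auto simp: abs_mult intro!: mult_left_mono)
  show "(%x. ind K x * h x * \<phi> x) \<in> BM lebesgue" by (rule borel_measurable_times[OF borel_measurable_integrable[OF i] m])
 qed
 moreover have "ind K x * h x * \<phi> x = ind \<Omega> x * (h x * \<phi> x)" for x using K(2) out[of x] by (auto simp: indicator_def)
 ultimately show ?thesis using \<Omega> by (simp add: integrable_restrict_space)
qed

lemma integrable_imp_L1_loc:
 assumes "integrable (LB \<Omega>) h" "\<Omega> \<in> sets borel"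
 shows "L1_loc \<Omega> h" unfolding L1_loc_def
proof (intro allI impI, elim conjE)
 fix K assume K: "compact K" "K \<subseteq> \<Omega>"
 have Ks: "K \<in> sets lebesgue" using K(1) by (simp add: borel_compact)
 have "integrable lebesgue (%x. ind \<Omega> x *\<^sub>R h x)" using assms by (simp add: integrable_restrict_space)
 hence "integrable lebesgue (%x. ind K x *\<^sub>R (ind \<Omega> x *\<^sub>R h x))" by (rule integrable_mult_indicator[OF Ks])
 moreover have "ind K x *\<^sub>R (ind \<Omega> x *\<^sub>R h x) = ind K x *\<^sub>R h x" for x using K(2) by (auto simp: indicator_def)
 ultimately have "integrable lebesgue (%x. ind K x *\<^sub>R h x)" by (simp only:)
 thus "integrable (LB K) h" using Ks by (simp add: integrable_restrict_space)
qed

lemma integral_lebesgue_on_outside: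
 fixes f :: "'a::euclidean_space => real"
 assumes S: "S \<in> sets borel" and f: "f \<in> BM borel" and out: "!!x. x \<notin> S ==> f x = 0"
 shows "(LINT x|LB S. f x) = (LBINT x. f x)"
proof -
 have "(%x. ind S x * f x) = f" using out by (auto simp: indicator_def fun_eq_iff)
 moreover have "(LINT x|LB S. f x) = (LBINT x. ind S x * f x)" by (rule integral_lebesgue_on_cong_borel(2)[OF S f]) simp
 ultimately show ?thesis by (simp only:)
qed

lemma is_weak_grad_unique:
 assumes "is_weak_grad \<Omega> u D" "is_weak_grad \<Omega> u D'" "open \<Omega>"
 shows "AE x in LB \<Omega>. D x = D' x"
proof -
 have \<Omega>: "\<Omega> \<in> sets borel" using assms(3) by simp
 have L: "L1_loc \<Omega> (%x. D x $ i)" "L1_loc \<Omega> (%x. D' x $ i)" for i using assms by (auto simp: is_weak_grad_def)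
 have "AE x in LB \<Omega>. D x $ i - D' x $ i = 0" for i
 proof (rule fundamental_lemma[OF assms(3)])
  show "L1_loc \<Omega> (%x. D x $ i - D' x $ i)" using L[of i] by (auto simp: L1_loc_def)
  show "(LINT x|LB \<Omega>. (D x $ i - D' x $ i) * \<phi> x) = 0" if "\<phi> \<in> test_funs \<Omega>" for \<phi>
  proof -
   have "(LINT x|LB \<Omega>. (D x $ i - D' x $ i) * \<phi> x)
    = (LINT x|LB \<Omega>. D x $ i * \<phi> x) - (LINT x|LB \<Omega>. D' x $ i * \<phi> x)" unfolding left_diff_distrib using L that \<Omega>
    by (intro Bochner_Integration.integral_diff L1_loc_integrable_test)
   also have "\<dots> = 0" using assms(1,2) that by (simp add: is_weak_grad_def)
   finally show ?thesis .
  qed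
 qed
 hence "AE x in LB \<Omega>. \<forall>i\<in>UNIV. D x $ i - D' x $ i = 0" by (intro AE_finite_allI) auto
 thus ?thesis by eventually_elim (simp add: vec_eq_iff)
qed

lemma integrable_powr_imp_integrable:
 fixes f :: "'a => real"
 assumes "finite_measure M" and [measurable]: "f \<in> BM M" and "p \<ge> 1" "integrable M (%x. |(f x)| powr p)"
 shows "integrable M f"
proof -
 interpret finite_measure M by fact
 show ?thesis
 proof (rule Bochner_Integration.integrable_bound)
  show "integrable M (%x. 1 + |(f x)| powr p)" using assms(4) by simp
  show "AE x in M. norm (f x) \<le> norm (1 + |(f x)| powr p)" using le_one_plus_powr[OF abs_ge_zero assms(3)] by (intro AE_I2) auto
 qed measurable
qed

context w0_approx begin

lemma \<phi>_int: "integrable M (\<phi> k)"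
proof -
 obtain B where "!!x. |(\<phi> k x)| \<le> B" using test_fun_bounded[OF \<phi>] by metis
 thus ?thesis by (intro integrable_const_bound[where B = B]) auto
qed

text \<open>Integration by parts is exact for the test functions \<phi>_k. On one side L^1
  convergence suffices, because the derivative of \<psi> is bounded; on the other, the derivatives
  converge in the p_i-norm and are paired with \<psi>.\<close>

lemma weak_gradient: "is_weak_grad \<Omega> u D"
 unfolding is_weak_grad_def
proof (intro conjI allI ballI)
 show "L1_loc \<Omega> u" by (rule integrable_imp_L1_loc[OF u_int \<Omega>_borel])
 fix i
 show "L1_loc \<Omega> (%x. D x $ i)"
  using p[of i] by (intro integrable_imp_L1_loc[OF integrable_powr_imp_integrable[OF fin D_meas _ D_int] \<Omega>_borel]) auto
 fix \<psi> assume \<psi>: "\<psi> \<in> test_funs \<Omega>"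
 obtain B where B: "B \<ge> 0" "!!x. |(\<psi> x)| \<le> B" "!!i x. |(pd i \<psi> x)| \<le> B" using test_fun_bounded[OF \<psi>] by metis
 note [measurable] = test_meas[OF \<psi>]
 have C: "C1 \<psi>" "C1 (\<phi> k)" for k using \<psi> \<phi> by (auto intro: test_funs_C1)
 note [measurable] = C1_borel[OF C(1)] C1_pd_borel[OF C(1)] C1_borel[OF C(2)] C1_pd_borel[OF C(2)]
 have parts: "(LINT x|M. \<phi> k x * pd i \<psi> x) = - (LINT x|M. \<psi> x * (1 * pd i (\<phi> k) x))" for k
 proof -
  have "compact (closure {x. \<phi> k x \<noteq> 0})" using \<phi>[of k] by (simp add: test_funs_def)
  moreover have "\<phi> k x = 0" if "x \<notin> closure {x. \<phi> k x \<noteq> 0}" for x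
   using that closure_subset[of "{x. \<phi> k x \<noteq> 0}"] by blast
  ultimately have "(LBINT x. \<phi> k x * pd i \<psi> x) = - (LBINT x. pd i (\<phi> k) x * \<psi> x)" by (rule integration_by_parts[OF C(2) C(1)])
  moreover have "(LINT x|M. \<phi> k x * pd i \<psi> x) = (LBINT x. \<phi> k x * pd i \<psi> x)"
   by (rule integral_lebesgue_on_outside) (use test_funs_outside[OF \<phi>] in auto)
  moreover have "(LINT x|M. \<psi> x * (1 * pd i (\<phi> k) x)) = (LBINT x. \<psi> x * (1 * pd i (\<phi> k) x))"
   by (rule integral_lebesgue_on_outside) (use test_funs_outside[OF \<psi>] in auto)
  ultimately show ?thesis by (simp add: mult.commute)
 qed
 have "integrable M (%x. |(\<psi> x)| powr conj_exp (p i))"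
  using conj_exp_props[OF p[of i]] B by (intro integrable_const_bound[where B = "B powr conj_exp (p i)"]) (auto intro!: AE_I2 powr_mono2)
 hence r: "(%k. LINT x|M. \<psi> x * (1 * pd i (\<phi> k) x)) \<leadsto> (LINT x|M. \<psi> x * (1 * D x $ i))"
  by (intro pairing(3)[where \<theta> = "%_. 1" and B = 1]) auto
 have bi: "integrable M (%x. h x * pd i \<psi> x)" if h: "integrable M h" for h
 proof (rule Bochner_Integration.integrable_bound[OF integrable_mult_right[OF h, of B]])
  have [measurable]: "h \<in> BM M" using h by simp
  show "(%x. h x * pd i \<psi> x) \<in> BM M" by measurable
  show "AE x in M. norm (h x * pd i \<psi> x) \<le> norm (B * h x)"
  proof (rule AE_I2)
   fix x
   have "|(h x)| * |(pd i \<psi> x)| \<le> |(h x)| * B" by (intro mult_left_mono B) simp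
   thus "norm (h x * pd i \<psi> x) \<le> norm (B * h x)" using B(1) by (simp add: abs_mult mult.commute)
  qed
 qed
 have l: "(%k. LINT x|M. \<phi> k x * pd i \<psi> x) \<leadsto> (LINT x|M. u x * pd i \<psi> x)"
 proof (rule LIM_zero_cancel, rule Lim_null_comparison)
  show "\<forall>\<^sub>F k in sequentially. norm ((LINT x|M. \<phi> k x * pd i \<psi> x) - (LINT x|M. u x * pd i \<psi> x)) \<le> B * (LINT x|M. |(\<phi> k x - u x)|)"
  proof (intro always_eventually allI)
   fix k
   have d: "integrable M (%x. |(\<phi> k x - u x)|)" using \<phi>_int u_int by simp
   have "(LINT x|M. u x * pd i \<psi> x) - (LINT x|M. \<phi> k x * pd i \<psi> x) = (LINT x|M. (u x - \<phi> k x) * pd i \<psi> x)"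
    unfolding left_diff_distrib using bi[OF u_int] bi[OF \<phi>_int] by simp
   also have "norm \<dots> \<le> (LINT x|M. norm ((u x - \<phi> k x) * pd i \<psi> x))" by (rule integral_norm_bound)
   also have "\<dots> \<le> (LINT x|M. B * |(\<phi> k x - u x)|)"
   proof (rule integral_mono)
    show "integrable M (%x. norm ((u x - \<phi> k x) * pd i \<psi> x))"
     using bi[of "%x. u x - \<phi> k x"] u_int \<phi>_int by (intro integrable_norm) auto
    show "integrable M (%x. B * |(\<phi> k x - u x)|)" using d by simp
    fix x
    have "|(u x - \<phi> k x)| * |(pd i \<psi> x)| \<le> |(u x - \<phi> k x)| * B" by (intro mult_left_mono B) simp
    thus "norm ((u x - \<phi> k x) * pd i \<psi> x) \<le> B * |(\<phi> k x - u x)|" by (simp add: abs_mult abs_minus_commute mult.commute)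
   qed
   finally show "norm ((LINT x|M. \<phi> k x * pd i \<psi> x) - (LINT x|M. u x * pd i \<psi> x)) \<le> B * (LINT x|M. |(\<phi> k x - u x)|)" by (simp add: abs_minus_commute)
  qed
  show "(%k. B * (LINT x|M. |(\<phi> k x - u x)|)) \<leadsto> 0" using tendsto_mult_right_zero[OF L1] .
 qed
 have "(LINT x|M. u x * pd i \<psi> x) = - (LINT x|M. \<psi> x * (1 * D x $ i))"
  by (rule LIMSEQ_unique[OF l]) (use tendsto_minus[OF r] in \<open>simp only: parts\<close>)
 thus "(LINT x|M. u x * pd i \<psi> x) = - (LINT x|M. D x $ i * \<psi> x)" by (simp add: mult.commute)
qed

text \<open>\<open>weak_grad\<close> is an unspecified choice; uniqueness of weak gradients ties it
  a.e. to the concrete D.\<close>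

lemma weak_grad_eq: "AE x in M. weak_grad \<Omega> u x = D x"
 unfolding weak_grad_def by (rule is_weak_grad_unique[OF someI[of "is_weak_grad \<Omega> u"] weak_gradient op]) (rule weak_gradient)

text \<open>Since nothing but a.e. equality is known about the chosen gradient, measurability itself
  has to be transferred along it, which completeness of the measure allows.\<close>

lemma weak_grad_cong:
 assumes [measurable]: "!!i. f i \<in> BM M" and "(!!i. AE x in M. F i x = f i x)"
 shows "F i \<in> BM M" "integrable M (F i) \<longleftrightarrow> integrable M (f i)" "(LINT x|M. F i x) = (LINT x|M. f i x :: real)"
proof -
 obtain g where g: "g \<in> BM borel" "AE x in lborel. x \<in> \<Omega> --> f i x = g x"
  by (rule borel_version[OF assms(1) \<Omega>_borel]) (rule that)
 have e: "AE x in lborel. x \<in> \<Omega> --> F i x = f i x" using assms(2)[of i] by (simp add: AE_lebesgue_on_iff)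
 have e2: "AE x in lborel. x \<in> \<Omega> --> F i x = g x" using g(2) e by eventually_elim auto
 note a = integral_lebesgue_on_cong_borel[OF \<Omega>_borel g(1) e2] and b = integral_lebesgue_on_cong_borel[OF \<Omega>_borel g(1) g(2)]
 show "F i \<in> BM M" by (rule a(3))
 show "integrable M (F i) \<longleftrightarrow> integrable M (f i)" using a(1) b(1) by simp
 show "(LINT x|M. F i x) = (LINT x|M. f i x)" using a(2) b(2) by simp
qed

lemma W0_u: "W0 \<Omega> p u"
 unfolding W0_def
proof (intro conjI allI)
 have ei: "AE x in M. weak_grad \<Omega> u x $ i = D x $ i" for i using weak_grad_eq by eventually_elim simp
 have wm: "(%x. weak_grad \<Omega> u x $ i) \<in> BM M" for i by (rule weak_grad_cong(1)[where f = "%i x. D x $ i"]) (use ei in auto)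
 show "Lp \<Omega> 1 u" using u_int by (simp add: Lp_def)
 show "\<exists>D. is_weak_grad \<Omega> u D" using weak_gradient by blast
 show "Lp \<Omega> (p i) (%x. weak_grad \<Omega> u x $ i)" for i
 proof -
  have "integrable M (%x. |(weak_grad \<Omega> u x $ i)| powr p i) \<longleftrightarrow> integrable M (%x. |(D x $ i)| powr p i)"
  proof (rule weak_grad_cong(2)[where f = "%i x. |(D x $ i)| powr p i" and F = "%i x. |(weak_grad \<Omega> u x $ i)| powr p i"])
   show "AE x in M. |(weak_grad \<Omega> u x $ i)| powr p i = |(D x $ i)| powr p i" for i using ei[of i] by eventually_elim simp
  qed measurable
  thus ?thesis using D_int wm by (simp add: Lp_def)
 qed
 show "\<exists>\<phi>. (\<forall>k. \<phi> k \<in> test_funs \<Omega>) &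
     (%k. Lp_norm \<Omega> 1 (%x. \<phi> k x - u x)) \<leadsto> 0 &
     (%k::nat. \<Sum>i\<in>UNIV. Lp_norm \<Omega> (p i) (%x. pd i (\<phi> k) x - weak_grad \<Omega> u x $ i)) \<leadsto> 0"
 proof (intro exI[of _ \<phi>] conjI allI \<phi>)
  show "(%k. Lp_norm \<Omega> 1 (%x. \<phi> k x - u x)) \<leadsto> 0" using L1 by (simp add: Lp_norm_def integral_nonneg_AE)
  have "(LINT x|M. |(pd i (\<phi> k) x - weak_grad \<Omega> u x $ i)| powr p i) = (LINT x|M. |(pd i (\<phi> k) x - D x $ i)| powr p i)" for i k
  proof (rule integral_cong_AE)
   show "AE x in M. |(pd i (\<phi> k) x - weak_grad \<Omega> u x $ i)| powr p i = |(pd i (\<phi> k) x - D x $ i)| powr p i"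
    using ei[of i] by eventually_elim simp
  qed (use wm[of i] in measurable)
  hence "(%k. Lp_norm \<Omega> (p i) (%x. pd i (\<phi> k) x - weak_grad \<Omega> u x $ i)) \<leadsto> 0" for i
   using p[of i] by (simp add: Lp_norm_def) (intro tendsto_zero_powrI[OF Lp_lim tendsto_const], auto)
  hence "(%k. \<Sum>i\<in>UNIV. Lp_norm \<Omega> (p i) (%x. pd i (\<phi> k) x - weak_grad \<Omega> u x $ i)) \<leadsto> (\<Sum>i\<in>(UNIV::'n set). 0)"
   by (intro tendsto_sum)
  thus "(%k. \<Sum>i\<in>UNIV. Lp_norm \<Omega> (p i) (%x. pd i (\<phi> k) x - weak_grad \<Omega> u x $ i)) \<leadsto> 0" by simp
 qed
qed

end

section \<open>The radial solution lies in the Sobolev closure\<close>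

context sym_data begin

abbreviation "B \<equiv> sym_dom \<Omega>"
abbreviation "R \<equiv> rad TT"

lemma B_eq: "B = ball 0 R"
proof -
 have "root CARD('n) (TT / \<omega>) = R"
 proof (cases "TT = 0")
  case False
  hence "TT / \<omega> > 0" using TT0 \<omega>_pos by simp
  thus ?thesis by (simp add: rad_def N_def root_powr_inverse)
 qed (simp add: rad_def)
 thus ?thesis by (simp add: sym_dom_def TT_def \<omega>_def N_def)
qed

lemma B_iff: "x \<in> B \<longleftrightarrow> \<tau> x < TT"
 using norm_less_rad[OF TT0, of x] by (simp add: B_eq)

lemma B_open: "open B" and B_bdd: "bounded B" and B_borel: "B \<in> sets borel"
 by (simp_all add: B_eq)

lemma R_sq_iff: "(norm x)\<^sup>2 < R\<^sup>2 \<longleftrightarrow> x \<in> B"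
 by (simp add: B_eq pow_less_iff rad0)

text \<open>The inward radial field of modulus \<open>Yb\<close>; at the origin it is 0.\<close>

definition Dv :: "real^'n => real^'n" where "Dv x = (- Yb (\<tau> x) / norm x) *\<^sub>R x"

lemma Dv_nth: "Dv x $ i = - Yb (\<tau> x) * (x $ i / norm x)" by (simp add: Dv_def)

lemma Dv_borel [measurable]: "(%x. Dv x $ i) \<in> BM borel"
 unfolding Dv_nth[abs_def] by measurable

lemma norm_Dv: "norm (Dv x) = Yb (\<tau> x)"
proof (cases "x = 0")
 case True
 hence "\<tau> x \<notin> {0<..<TT}" by (simp add: \<tau>_def power_0_left)
 thus ?thesis using Yb(3)[of "\<tau> x"] True by (simp add: Dv_def)
qed (use Yb(2) in \<open>simp add: Dv_def\<close>)

lemma Dv_nth_le: "|(Dv x $ i)| \<le> Yb (\<tau> x)"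
 using component_le_norm_cart[of "Dv x" i] by (simp add: norm_Dv)

lemma nn_Dv: "(NN x. ennreal (norm (Dv x) powr P)) = ennreal EY"
proof -
 have "(NN x. ennreal (norm (Dv x) powr P)) = (NN x. ennreal (Yb (\<tau> x) powr P))" by (simp add: norm_Dv)
 also have "\<dots> = (NN t. ennreal (Yb t powr P) * ind {0<..} t)" by (rule nn_radial) measurable
 also have "\<dots> = (NN t. ennreal (Yb t powr P))" using Yb(3) by (intro nn_integral_cong) (auto simp: indicator_def)
 finally show ?thesis by (simp add: EY_nn)
qed

text \<open>\<beta> vanishes beyond b < R^2, so its antiderivative is constant there and can be
  normalized to 0, which gives compact support in the ball. The last formula is the fundamental
  theorem of calculus in the volume variable.\<close>

lemma radial_test:
 assumes \<beta>: "smooth1 \<beta>" and b: "b < R\<^sup>2" and out: "!!\<rho>. \<rho> \<notin> {a<..<b} ==> \<beta> \<rho> = 0"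
 obtains V where "smooth1 V" "(%x::real^'n. V ((norm x)\<^sup>2)) \<in> test_funs B"
  "!!x i. pd i (%x::real^'n. V ((norm x)\<^sup>2)) x = \<beta> ((norm x)\<^sup>2) * x $ i"
  "!!s. 0 < s ==> s < TT ==>
    V ((rad s)\<^sup>2) = - (LBINT t. ind {s<..<TT} t * (\<beta> ((rad t)\<^sup>2) * rad t * (t powr (1/N - 1) / c\<omega>)))"
proof -
 obtain \<eta> where \<eta>: "smooth1 \<eta>" "!!x. (\<eta> has_real_derivative \<beta> x) (at x)"
  by (rule smooth1_antiderivative[OF \<beta>]) (rule that)
 \<comment> \<open>The factor 1/2 compensates the 2 in the gradient 2 x of |x|^2.\<close>
 define V where "V \<rho> = 1 / 2 * (\<eta> \<rho> - \<eta> (R\<^sup>2))" for \<rho>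
 have Vs: "smooth1 V" unfolding V_def by (intro smooth1_mult smooth1_diff \<eta> smooth1_const)
 have Vd: "(V has_real_derivative \<beta> \<rho> / 2) (at \<rho>)" for \<rho> unfolding V_def by (auto intro!: derivative_eq_intros \<eta>(2))
 have "\<exists>c. \<forall>\<rho>\<in>{b..}. \<eta> \<rho> = c"
 proof (rule has_field_derivative_zero_constant)
  show "(\<eta> has_field_derivative 0) (at \<rho> within {b..})" if "\<rho> \<in> {b..}" for \<rho>
   using \<eta>(2)[of \<rho>] out[of \<rho>] that by (auto intro: has_field_derivative_at_within)
 qed simp
 then obtain c where "\<forall>\<rho>\<in>{b..}. \<eta> \<rho> = c" by blast
 hence V0: "V \<rho> = 0" if "\<rho> \<ge> b" for \<rho> using b that by (simp add: V_def)
 define \<phi> where "\<phi> x = V ((norm x)\<^sup>2)" for x :: "real^'n"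
 have Ck: "Ck k \<phi>" for k unfolding \<phi>_def by (rule Ck_compose[OF Vs Ck_norm_sq])
 have cl: "closure {x. \<phi> x \<noteq> 0} \<subseteq> {x. (norm x)\<^sup>2 \<le> b}"
 proof (rule closure_minimal)
  show "{x. \<phi> x \<noteq> 0} \<subseteq> {x. (norm x)\<^sup>2 \<le> b}" using V0 by (auto simp: \<phi>_def not_le intro: ccontr)
  show "closed {x::real^'n. (norm x)\<^sup>2 \<le> b}" by (intro closed_Collect_le continuous_intros)
 qed
 also have sub: "{x. (norm x)\<^sup>2 \<le> b} \<subseteq> B" using b by (auto simp flip: R_sq_iff)
 finally have "closure {x. \<phi> x \<noteq> 0} \<subseteq> B" .
 moreover from bounded_subset[OF B_bdd this] have "compact (closure {x. \<phi> x \<noteq> 0})" by (simp add: compact_eq_bounded_closed)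
 ultimately have T: "\<phi> \<in> test_funs B" using Ck by (simp add: test_funs_def)
 have pd: "pd i \<phi> x = \<beta> ((norm x)\<^sup>2) * x $ i" for i x
 proof -
  have "(%x::real^'n. (norm x)\<^sup>2) differentiable (at x)" using Ck_norm_sq[of "Suc 0"] by simp
  thus ?thesis unfolding \<phi>_def by (subst partial_deriv_compose(2)[OF Vd]) (simp_all add: partial_deriv_norm_sq)
 qed
 have ftc: "V ((rad s)\<^sup>2) = - (LBINT t. ind {s<..<TT} t * (\<beta> ((rad t)\<^sup>2) * rad t * (t powr (1/N - 1) / c\<omega>)))"
  if s: "0 < s" "s < TT" for s
 proof -
  define w where "w t = \<beta> ((rad t)\<^sup>2) * rad t * (t powr (1/N - 1) / c\<omega>)" for t
  have d: "((%t. V ((rad t)\<^sup>2)) has_real_derivative w t) (at t)" if t: "0 < t" for t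
  proof -
   have "((%t. (rad t)\<^sup>2) has_real_derivative 2 * rad t * (t powr (1/N - 1) / c\<omega>)) (at t)"
    by (auto intro!: derivative_eq_intros rad_deriv[OF t])
   from DERIV_chain2[OF Vd this] show ?thesis by (simp add: w_def mult_ac)
  qed
  have cr: "continuous_on {s..TT} rad" using s by (intro continuous_at_imp_continuous_on ballI DERIV_isCont[OF rad_deriv]) auto
  have "(LBINT t. ind {s..TT} t *\<^sub>R w t) = V ((rad TT)\<^sup>2) - V ((rad s)\<^sup>2)"
  proof (rule integral_FTC_atLeastAtMost)
   show "((%t. V ((rad t)\<^sup>2)) has_vector_derivative w t) (at t within {s..TT})" if "s \<le> t" "t \<le> TT" for t using d[of t] s that
    by (simp add: has_real_derivative_iff_has_vector_derivative has_vector_derivative_at_within)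
   show "continuous_on {s..TT} w" unfolding w_def using s cr N_ge c\<omega>_pos
    by (intro continuous_intros continuous_on_compose2[OF smooth1_continuous[OF \<beta>, of UNIV]]) auto
  qed (use s in simp)
  also have "(LBINT t. ind {s..TT} t *\<^sub>R w t) = (LBINT t. ind {s<..<TT} t * w t)"
  proof (rule integral_cong_AE)
   have [measurable]: "\<beta> \<in> BM borel" by (rule borel_measurable_continuous_onI[OF smooth1_continuous[OF \<beta>]])
   show "(%t. ind {s..TT} t *\<^sub>R w t) \<in> BM lborel" "(%t. ind {s<..<TT} t * w t) \<in> BM lborel" unfolding w_def by measurable
   show "AE t in lborel. ind {s..TT} t *\<^sub>R w t = ind {s<..<TT} t * w t"
    using AE_lborel_singleton[of s] AE_lborel_singleton[of TT] by eventually_elim (auto simp: indicator_def)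
  qed
  finally show ?thesis using V0[of "(rad TT)\<^sup>2"] b unfolding w_def by simp
 qed
 from that[OF Vs T[unfolded \<phi>_def] pd[unfolded \<phi>_def] ftc] show ?thesis .
qed

lemma err_int:
 assumes [measurable]: "\<beta> \<in> BM borel" and e: "integrable lborel (%t. |(err \<beta> t)| powr P)"
 shows "integrable lborel (err \<beta>)"
  "(LBINT t. |(err \<beta> t)|) \<le> (LBINT t. |(err \<beta> t)| powr P) powr (1/P) * TT powr (1/q)"
proof -
 have [measurable]: "err \<beta> \<in> BM lborel" unfolding err_def[abs_def] by measurable
 have b: "|(ind {0<..<TT} t)| powr conj_exp P = ind {0<..<TT} t" for t :: real by (simp add: indicator_def)
 have c: "ind {0<..<TT} t * err \<beta> t = err \<beta> t" for t by (simp add: err_def indicator_def)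
 have bi: "integrable lborel (%t::real. |(ind {0<..<TT} t)| powr conj_exp P)" unfolding b using TT0 by (intro integrable_real_indicator) auto
 have m: "(%t. ind {0<..<TT} t :: real) \<in> BM lborel" by measurable
 note H = Holder_integrable[OF m \<open>err \<beta> \<in> _\<close> P1 bi e]
 show "integrable lborel (err \<beta>)" using H(1) unfolding c .
 have "(LBINT t. ind {0<..<TT} t :: real) = TT" using TT0 by simp
 thus "(LBINT t. |(err \<beta> t)|) \<le> (LBINT t. |(err \<beta> t)| powr P) powr (1/P) * TT powr (1/q)"
  using H(2) unfolding c b unfolding q_def[symmetric] by simp
qed

text \<open>On (s,TT) the weight t^(1/N - 1) is at most its value at s. Small gradient error in L^1
  thus yields convergence of the values at every point other than the origin.\<close>

lemma radial_value:
 assumes [measurable]: "\<beta> \<in> BM borel" and e: "integrable lborel (err \<beta>)" and s: "0 < s" "s < TT"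
 shows "|(- (LBINT t. ind {s<..<TT} t * (\<beta> ((rad t)\<^sup>2) * rad t * (t powr (1/N - 1) / c\<omega>))) - \<Psi> s)|
  \<le> s powr (1/N - 1) / c\<omega> * (LBINT t. |(err \<beta> t)|)"
proof -
 have [measurable]: "err \<beta> \<in> BM borel" unfolding err_def[abs_def] by measurable
 define e1 where "e1 t = ind {s<..<TT} t * (err \<beta> t * (t powr (1/N - 1) / c\<omega>))" for t
 have le: "|(e1 t)| \<le> s powr (1/N - 1) / c\<omega> * |(err \<beta> t)|" for t
 proof (cases "t \<in> {s<..<TT}")
  case True
  have "t powr (1/N - 1) \<le> s powr (1/N - 1)" using N_ge s True by (intro powr_mono2') auto
  hence "t powr (1/N - 1) / c\<omega> * |(err \<beta> t)| \<le> s powr (1/N - 1) / c\<omega> * |(err \<beta> t)|"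
   using c\<omega>_pos by (intro mult_right_mono divide_right_mono) auto
  thus ?thesis using True c\<omega>_pos by (simp add: e1_def abs_mult mult.commute)
 qed (use c\<omega>_pos in \<open>simp add: e1_def\<close>)
 have bi: "integrable lborel (%t. s powr (1/N - 1) / c\<omega> * |(err \<beta> t)|)" using integrable_mult_right[OF integrable_abs[OF e]] .
 have e1i: "integrable lborel e1"
 proof (rule Bochner_Integration.integrable_bound[OF bi])
  show "e1 \<in> BM lborel" unfolding e1_def[abs_def] by measurable
  show "AE t in lborel. norm (e1 t) \<le> norm (s powr (1/N - 1) / c\<omega> * |(err \<beta> t)|)"
   using le by (intro AE_I2) (metis abs_ge_self order_trans real_norm_def)
 qed
 have "ind {s<..<TT} t * (\<beta> ((rad t)\<^sup>2) * rad t * (t powr (1/N - 1) / c\<omega>)) = e1 t - ind {s<..<TT} t * \<psi>b t" for t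
  using s by (auto simp: indicator_def e1_def err_def \<psi>b_def algebra_simps add_divide_distrib)
 hence "(LBINT t. ind {s<..<TT} t * (\<beta> ((rad t)\<^sup>2) * rad t * (t powr (1/N - 1) / c\<omega>)))
  = (LBINT t. e1 t) - \<Psi> s" using e1i \<psi>b_int[OF s(1)] s by (simp add: \<Psi>_b)
 moreover have "|(LBINT t. e1 t)| \<le> s powr (1/N - 1) / c\<omega> * (LBINT t. |(err \<beta> t)|)"
 proof -
  have "|(LBINT t. e1 t)| \<le> (LBINT t. |(e1 t)|)" by (rule integral_abs_bound)
  also have "\<dots> \<le> (LBINT t. s powr (1/N - 1) / c\<omega> * |(err \<beta> t)|)" by (rule integral_mono[OF integrable_abs[OF e1i] bi le])
  finally show ?thesis by simp
 qed
 ultimately show ?thesis by simp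
qed

lemma radial_grad_err:
 assumes out: "!!\<rho>. \<rho> \<notin> {a<..<b} ==> \<beta> \<rho> = 0" and b: "b < R\<^sup>2"
 shows "\<beta> ((norm x)\<^sup>2) * x $ i - Dv x $ i = err \<beta> (\<tau> x) * (x $ i / norm x)"
proof (cases "x \<in> B & x \<noteq> 0")
 case True
 hence "\<tau> x \<in> {0<..<TT}" using \<tau>_pos[of x] by (simp add: B_iff)
 thus ?thesis using True by (simp add: err_def rad_\<tau> Dv_nth field_simps)
next
 case out_B: False
 show ?thesis
 proof (cases "x = 0")
  case False
  with out_B have "\<not> \<tau> x < TT" "\<not> (norm x)\<^sup>2 < R\<^sup>2" by (auto simp: B_iff R_sq_iff)
  thus ?thesis using out[of "(norm x)\<^sup>2"] b Yb(3)[of "\<tau> x"] by (simp add: err_def Dv_nth)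
 qed (simp add: Dv_nth)
qed

lemma radial_grad_le:
 assumes "!!\<rho>. \<rho> \<notin> {a<..<b} ==> \<beta> \<rho> = 0" "b < R\<^sup>2"
 shows "|(\<beta> ((norm x)\<^sup>2) * x $ i - Dv x $ i)| \<le> |(err \<beta> (\<tau> x))|"
proof -
 have "|(x $ i / norm x)| \<le> 1" using component_le_norm_cart[of x i] by (simp add: abs_divide divide_le_eq)
 hence "|(err \<beta> (\<tau> x))| * |(x $ i / norm x)| \<le> |(err \<beta> (\<tau> x))|" by (rule mult_left_le) simp
 moreover have "\<beta> ((norm x)\<^sup>2) * x $ i - Dv x $ i = err \<beta> (\<tau> x) * (x $ i / norm x)"
  by (rule radial_grad_err) (use assms in auto)
 ultimately show ?thesis by (simp only: abs_mult)
qed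

lemma nn_err:
 assumes [measurable]: "\<beta> \<in> BM borel" and i: "integrable lborel (%t. |(err \<beta> t)| powr r)" and r: "r > 0"
 shows "(NN x. ennreal ( |(err \<beta> (\<tau> x))| powr r)) = ennreal (LBINT t. |(err \<beta> t)| powr r)"
proof -
 have [measurable]: "err \<beta> \<in> BM borel" unfolding err_def[abs_def] by measurable
 have "(NN x. ennreal ( |(err \<beta> (\<tau> x))| powr r)) = (NN t. ennreal ( |(err \<beta> t)| powr r) * ind {0<..} t)"
  by (rule nn_radial) measurable
 also have "\<dots> = (NN t. ennreal ( |(err \<beta> t)| powr r))" by (intro nn_integral_cong) (auto simp: indicator_def err_def)
 also have "\<dots> = ennreal (LBINT t. |(err \<beta> t)| powr r)" by (rule nn_integral_eq_integral[OF i]) simp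
 finally show ?thesis .
qed

end

context sym_data begin

abbreviation "v \<equiv> sym_sol \<Omega> p lam f G"

lemma v_eq: "v x = \<Psi> (\<tau> x)" by (simp add: sym_sol_\<Psi> \<tau>_def)

text \<open>The values converge off the origin by \<open>radial_value\<close>. The L^1 convergence
  follows from the Poincare inequality with exponent 1 for the differences of two approximants and
  from Fatou's lemma, and gradient convergence is that of \<open>err\<close> in the volume
  variable.\<close>

lemma symmetric_approx: obtains \<phi> where "w0_approx B (%i. P) v Dv \<phi>"
proof -
 obtain \<beta> a b where \<beta>: "!!k::nat. smooth1 (\<beta> k)" "!!k. b k < R\<^sup>2"
  "!!k \<rho>. \<rho> \<notin> {a k<..<b k} ==> \<beta> k \<rho> = 0"
  "!!k. integrable lborel (%t. |(err (\<beta> k) t)| powr P)"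
  "(%k. LBINT t. |(err (\<beta> k) t)| powr P) \<leadsto> 0" by (rule radial_density) (rule that)
 have \<beta>m [measurable]: "\<beta> k \<in> BM borel" for k by (rule borel_measurable_continuous_onI[OF smooth1_continuous[OF \<beta>(1)]])
 have em [measurable]: "err (\<beta> k) \<in> BM borel" for k unfolding err_def[abs_def] by measurable
 define \<epsilon> where "\<epsilon> k = (LBINT t. |(err (\<beta> k) t)|)" for k
 have \<epsilon>0: "0 \<le> \<epsilon> k" for k by (simp add: \<epsilon>_def)
 have ei: "integrable lborel (err (\<beta> k))" for k by (rule err_int(1)[OF \<beta>m \<beta>(4)])
 have \<epsilon>: "\<epsilon> \<leadsto> 0"
 proof (rule tendsto_sandwich[OF _ _ tendsto_const])
  show "\<forall>\<^sub>F k in sequentially. 0 \<le> \<epsilon> k" by (simp add: \<epsilon>0)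
  show "\<forall>\<^sub>F k in sequentially. \<epsilon> k \<le> (LBINT t. |(err (\<beta> k) t)| powr P) powr (1/P) * TT powr (1/q)"
   unfolding \<epsilon>_def by (intro always_eventually allI err_int(2)[OF \<beta>m \<beta>(4)])
  have "(%k. (LBINT t. |(err (\<beta> k) t)| powr P) powr (1/P)) \<leadsto> 0"
   using P1 by (intro tendsto_zero_powrI[OF \<beta>(5) tendsto_const]) auto
  thus "(%k. (LBINT t. |(err (\<beta> k) t)| powr P) powr (1/P) * TT powr (1/q)) \<leadsto> 0" by (rule tendsto_mult_left_zero)
 qed
 define A where "A k V \<longleftrightarrow> (%x::real^'n. V ((norm x)\<^sup>2)) \<in> test_funs B &
  (\<forall>x i. pd i (%x::real^'n. V ((norm x)\<^sup>2)) x = \<beta> k ((norm x)\<^sup>2) * x $ i) &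
  (\<forall>s. 0 < s --> s < TT -->
    V ((rad s)\<^sup>2) = - (LBINT t. ind {s<..<TT} t * (\<beta> k ((rad t)\<^sup>2) * rad t * (t powr (1/N - 1) / c\<omega>))))" for k V
 have "\<exists>V. A k V" for k
 proof -
  show ?thesis by (rule radial_test[OF \<beta>(1)[of k] \<beta>(2)[of k] \<beta>(3)[where k = k]]) (use A_def in blast)+
 qed
 then obtain V where "!!k. A k (V k)" by metis
 hence V: "!!k. (%x::real^'n. V k ((norm x)\<^sup>2)) \<in> test_funs B"
  "!!k x i. pd i (%x::real^'n. V k ((norm x)\<^sup>2)) x = \<beta> k ((norm x)\<^sup>2) * x $ i"
  "!!k s. 0 < s ==> s < TT ==>
    V k ((rad s)\<^sup>2) = - (LBINT t. ind {s<..<TT} t * (\<beta> k ((rad t)\<^sup>2) * rad t * (t powr (1/N - 1) / c\<omega>)))"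
  unfolding A_def by blast+
 define \<phi> where "\<phi> k x = V k ((norm x)\<^sup>2)" for k and x :: "real^'n"
 have T: "\<phi> k \<in> test_funs B" for k unfolding \<phi>_def by (rule V(1))
 have pd: "pd i (\<phi> k) x = \<beta> k ((norm x)\<^sup>2) * x $ i" for i k x unfolding \<phi>_def by (rule V(2))
 have pd_le: "|(pd i (\<phi> k) x - Dv x $ i)| \<le> |(err (\<beta> k) (\<tau> x))|" for i k x
  unfolding pd by (rule radial_grad_le[OF \<beta>(3) \<beta>(2)])
 have [measurable]: "\<phi> k \<in> BM borel" "pd i (\<phi> k) \<in> BM borel" for k i
  by (rule C1_borel[OF test_funs_C1[OF T]], rule C1_pd_borel[OF test_funs_C1[OF T]])
 \<comment> \<open>The Borel version of v extended by 0. The origin is excluded because the integral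
   that defines v there may fail to converge.\<close>
 define g where "g x = (if x \<in> B - {0} then v x else 0)" for x
 have ptw: "(%k. \<phi> k x) \<leadsto> g x" if x: "x \<noteq> 0" for x
 proof (cases "x \<in> B")
  case True
  hence s: "0 < \<tau> x" "\<tau> x < TT" using \<tau>_pos[OF x] by (auto simp: B_iff)
  have "(%k. \<phi> k x) \<leadsto> v x"
  proof (rule LIM_zero_cancel, rule Lim_null_comparison)
   show "\<forall>\<^sub>F k in sequentially. norm (\<phi> k x - v x) \<le> \<tau> x powr (1/N - 1) / c\<omega> * \<epsilon> k"
   proof (intro always_eventually allI)
    fix k
    have "\<phi> k x = V k ((rad (\<tau> x))\<^sup>2)" by (simp add: \<phi>_def rad_\<tau>)
    thus "norm (\<phi> k x - v x) \<le> \<tau> x powr (1/N - 1) / c\<omega> * \<epsilon> k"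
     using radial_value[OF \<beta>m ei s, of k] unfolding V(3)[OF s] v_eq \<epsilon>_def real_norm_def by simp
   qed
   show "(%k. \<tau> x powr (1/N - 1) / c\<omega> * \<epsilon> k) \<leadsto> 0" by (rule tendsto_mult_right_zero[OF \<epsilon>])
  qed
  thus ?thesis using True x by (simp add: g_def)
 next
  case False
  thus ?thesis using test_funs_outside[OF T False] by (simp add: g_def)
 qed
 have g_meas [measurable]: "g \<in> BM borel"
 proof (rule borel_measurable_LIMSEQ_real)
  show "(%k. (if x = 0 then 0 else \<phi> k x)) \<leadsto> g x" for x using ptw[of x] by (cases "x = 0") (auto simp: g_def)
  show "(%x. if x = 0 then 0 else \<phi> k x) \<in> BM borel" for k by measurable
 qed
 have ae0: "AE x in lborel. (x::real^'n) \<noteq> 0" by (rule AE_lborel_singleton)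
 have vg: "AE x in lborel. x \<in> B --> v x = g x" using ae0 by eventually_elim (simp add: g_def)
 obtain L where L: "L > 0" "!!x i. x \<in> B ==> x + axis i L \<notin> B" by (rule bounded_shift_outside[OF B_bdd]) (rule that)
 have nn1: "(NN x. ennreal |(err (\<beta> k) (\<tau> x))|) = ennreal (\<epsilon> k)" for k
  using nn_err[OF \<beta>m, of k 1] integrable_abs[OF ei, of k] by (simp add: \<epsilon>_def)
 \<comment> \<open>Bounding differences of approximants in place of their distance to v keeps both
   functions within the test functions, for which \<open>Poincare\<close> is stated; the second
   index then tends to infinity.\<close>
 have cauchy: "(NN x. ennreal |(\<phi> k x - \<phi> l x)|) \<le> ennreal (L * (\<epsilon> k + \<epsilon> l))" for k l
 proof -
  define i where "i = (undefined :: 'n)"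
  have "(NN x. ennreal ( |(\<phi> k x - \<phi> l x)| powr 1))
   \<le> ennreal (L powr 1) * (NN x. ennreal ( |(pd i (%x. \<phi> k x - \<phi> l x) x)| powr 1))"
   by (rule Poincare[OF test_funs_minus[OF T T]]) (use L in auto)
  also have "(NN x. ennreal ( |(pd i (%x. \<phi> k x - \<phi> l x) x)| powr 1))
   \<le> (NN x. ennreal |(err (\<beta> k) (\<tau> x))| + ennreal |(err (\<beta> l) (\<tau> x))|)"
  proof (intro nn_integral_mono)
   fix x
   have "|(pd i (%x. \<phi> k x - \<phi> l x) x)| \<le> |(err (\<beta> k) (\<tau> x))| + |(err (\<beta> l) (\<tau> x))|"
    using pd_le[of i k x] pd_le[of i l x] by (subst partial_deriv_minus) (auto intro: test_funs_diff[OF T])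
   thus "ennreal ( |(pd i (%x. \<phi> k x - \<phi> l x) x)| powr 1) \<le> ennreal |(err (\<beta> k) (\<tau> x))| + ennreal |(err (\<beta> l) (\<tau> x))|"
    by (simp add: ennreal_leI flip: ennreal_plus)
  qed
  also have "(NN x. ennreal |(err (\<beta> k) (\<tau> x))| + ennreal |(err (\<beta> l) (\<tau> x))|) = ennreal (\<epsilon> k + \<epsilon> l)"
   by (subst nn_integral_add) (auto simp: nn1 \<epsilon>0 ennreal_plus)
  finally show ?thesis using L(1) by (simp add: ennreal_mult' mult_left_mono)
 qed
 have dist_g: "(NN x. ennreal |(\<phi> k x - g x)|) \<le> ennreal (L * \<epsilon> k)" for k
 proof -
  have "(NN x. ennreal |(\<phi> k x - g x)|) = (NN x. liminf (%l. ennreal |(\<phi> k x - \<phi> l x)|))"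
  proof (rule nn_integral_cong_AE)
   show "AE x in lborel. ennreal |(\<phi> k x - g x)| = liminf (%l. ennreal |(\<phi> k x - \<phi> l x)|)" using ae0
   proof eventually_elim
    case (elim x)
    have "(%l. ennreal |(\<phi> k x - \<phi> l x)|) \<leadsto> ennreal |(\<phi> k x - g x)|"
     by (intro tendsto_ennrealI tendsto_rabs tendsto_diff tendsto_const ptw elim)
    thus ?case by (rule lim_imp_Liminf[OF sequentially_bot, symmetric])
   qed
  qed
  also have "\<dots> \<le> liminf (%l. NN x. ennreal |(\<phi> k x - \<phi> l x)|)" by (rule nn_integral_liminf) measurable
  also have "\<dots> \<le> liminf (%l. ennreal (L * (\<epsilon> k + \<epsilon> l)))" by (intro Liminf_mono always_eventually allI cauchy)
  also have "\<dots> = ennreal (L * (\<epsilon> k + 0))"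
   by (intro lim_imp_Liminf tendsto_ennrealI tendsto_mult_left tendsto_add \<epsilon> tendsto_const) auto
  finally show ?thesis by simp
 qed
 have dgi: "integrable lborel (%x. \<phi> k x - g x)" for k
 proof (rule integrableI_bounded)
  have "(NN x. ennreal (norm (\<phi> k x - g x))) \<le> ennreal (L * \<epsilon> k)" using dist_g[of k] by simp
  thus "(NN x. ennreal (norm (\<phi> k x - g x))) < \<infinity>" by (rule le_less_trans) simp
 qed measurable
 have g_out: "g x = 0" if "x \<notin> B" for x using that by (simp add: g_def)
 have "integrable lborel (\<phi> 0)" using T[of 0] closure_subset[of "{x. \<phi> 0 x \<noteq> 0}"]
  by (intro continuous_compact_support_integrable[where K = "closure {x. \<phi> 0 x \<noteq> 0}"] test_funs_continuous[OF T]) (auto simp: test_funs_def)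
 from Bochner_Integration.integrable_diff[OF this dgi[of 0]] have gi: "integrable lborel g" by simp
 have gB: "ind B x * g x = g x" for x using g_out[of x] by (cases "x \<in> B") auto
 note vB = integral_lebesgue_on_cong_borel[OF B_borel g_meas vg, unfolded gB]
 have vae: "AE x in LB B. v x = g x" using vg by (simp add: AE_lebesgue_on_iff[OF B_borel])
 have L1: "(LINT x|LB B. |(\<phi> k x - v x)|) \<le> L * \<epsilon> k" for k
 proof -
  have e: "AE x in lborel. x \<in> B --> |(\<phi> k x - v x)| = |(\<phi> k x - g x)|" using vg by eventually_elim simp
  have m: "(%x. |(\<phi> k x - g x)|) \<in> BM borel" by measurable
  have o: "ind B x * |(\<phi> k x - g x)| = |(\<phi> k x - g x)|" for x using g_out[of x] test_funs_outside[OF T, of x k] by (cases "x \<in> B") auto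
  have "(LINT x|LB B. |(\<phi> k x - v x)|) = (LBINT x. |(\<phi> k x - g x)|)" using integral_lebesgue_on_cong_borel(2)[OF B_borel m e] unfolding o .
  also have "\<dots> = enn2real (NN x. ennreal |(\<phi> k x - g x)|)" by (rule integral_eq_nn_integral) auto
  also have "\<dots> \<le> L * \<epsilon> k" using L(1) \<epsilon>0 by (intro enn2real_leI dist_g) auto
  finally show ?thesis .
 qed
 have "w0_approx B (%i. P) v Dv \<phi>"
 proof
  show "v \<in> BM (LB B)" by (rule vB(3))
  show "integrable (LB B) v" using vB(1) gi by simp
  show "(%x. Dv x $ i) \<in> BM (LB B)" for i by (rule borel_imp_lebesgue_on[OF Dv_borel])
  show "integrable (LB B) (%x. |(Dv x $ i)| powr P)" for i
  proof (rule integrableI_bounded)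
   show "(%x. |(Dv x $ i)| powr P) \<in> BM (LB B)" by (rule borel_imp_lebesgue_on) measurable
   have "(\<integral>\<^sup>+x. ennreal (norm ( |(Dv x $ i)| powr P)) \<partial>lebesgue_on B) \<le> (NN x. ennreal (norm (Dv x) powr P))"
    unfolding nn_integral_lebesgue_on[OF B_borel] using P1
    by (intro nn_integral_mono) (auto simp: indicator_def norm_Dv intro!: ennreal_leI powr_mono2 Dv_nth_le)
   thus "(\<integral>\<^sup>+x. ennreal (norm ( |(Dv x $ i)| powr P)) \<partial>lebesgue_on B) < \<infinity>" unfolding nn_Dv by (rule le_less_trans) simp
  qed
  show "(%k. LINT x|LB B. |(\<phi> k x - v x)|) \<leadsto> 0"
  proof (rule tendsto_sandwich[OF _ _ tendsto_const])
   show "\<forall>\<^sub>F k in sequentially. (LINT x|LB B. |(\<phi> k x - v x)|) \<le> L * \<epsilon> k" using L1 by simp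
   show "(%k. L * \<epsilon> k) \<leadsto> 0" by (rule tendsto_mult_right_zero[OF \<epsilon>])
  qed simp
  show "AE x in LB B. (%k. \<phi> k x) \<leadsto> v x"
  proof -
   have "AE x in LB B. x \<noteq> 0" unfolding AE_lebesgue_on_iff[OF B_borel] using ae0 by eventually_elim simp
   with vae show ?thesis by eventually_elim (simp add: ptw)
  qed
  show "(%k. LINT x|LB B. |(pd i (\<phi> k) x - Dv x $ i)| powr P) \<leadsto> 0" for i
  proof (rule tendsto_sandwich[OF _ _ tendsto_const \<beta>(5)])
   show "\<forall>\<^sub>F k in sequentially. (LINT x|LB B. |(pd i (\<phi> k) x - Dv x $ i)| powr P) \<le> (LBINT t. |(err (\<beta> k) t)| powr P)"
   proof (intro always_eventually allI)
    fix k
    have "(LINT x|LB B. |(pd i (\<phi> k) x - Dv x $ i)| powr P)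
     = enn2real (\<integral>\<^sup>+x. ennreal ( |(pd i (\<phi> k) x - Dv x $ i)| powr P) \<partial>lebesgue_on B)"
    proof (rule integral_eq_nn_integral)
     have "(%x. |(pd i (\<phi> k) x - Dv x $ i)| powr P) \<in> BM borel" by measurable
     thus "(%x. |(pd i (\<phi> k) x - Dv x $ i)| powr P) \<in> BM (LB B)" by (rule borel_imp_lebesgue_on)
    qed auto
    also have "\<dots> \<le> (LBINT t. |(err (\<beta> k) t)| powr P)"
    proof (rule enn2real_leI)
     have "(\<integral>\<^sup>+x. ennreal ( |(pd i (\<phi> k) x - Dv x $ i)| powr P) \<partial>lebesgue_on B)
      \<le> (NN x. ennreal ( |(err (\<beta> k) (\<tau> x))| powr P))" unfolding nn_integral_lebesgue_on[OF B_borel] using P1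
      by (intro nn_integral_mono) (auto simp: indicator_def intro!: ennreal_leI powr_mono2 pd_le)
     also have "\<dots> = ennreal (LBINT t. |(err (\<beta> k) t)| powr P)" using P1 by (intro nn_err[OF \<beta>m \<beta>(4)]) simp
     finally show "(\<integral>\<^sup>+x. ennreal ( |(pd i (\<phi> k) x - Dv x $ i)| powr P) \<partial>lebesgue_on B) \<le> ennreal (LBINT t. |(err (\<beta> k) t)| powr P)" .
    qed simp
    finally show "(LINT x|LB B. |(pd i (\<phi> k) x - Dv x $ i)| powr P) \<le> (LBINT t. |(err (\<beta> k) t)| powr P)" .
   qed
  qed simp
 qed (use B_open B_bdd P1 T in auto)
 thus ?thesis by (rule that)
qed

lemma energy_v: "(LINT x|LB B. norm (weak_grad B v x) powr P) = EY"
proof -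
 obtain \<phi> where "w0_approx B (%i. P) v Dv \<phi>" by (rule symmetric_approx)
 then interpret V: w0_approx B "%i. P" v Dv \<phi> .
 have "(%x. norm (Dv x) powr P) \<in> BM borel" unfolding norm_Dv by measurable
 hence m: "(%x. norm (Dv x) powr P) \<in> BM (LB B)" by (rule borel_imp_lebesgue_on)
 have "AE x in LB B. norm (weak_grad B v x) powr P = norm (Dv x) powr P" using V.weak_grad_eq by eventually_elim simp
 hence "(LINT x|LB B. norm (weak_grad B v x) powr P) = (LINT x|LB B. norm (Dv x) powr P)"
  by (intro V.weak_grad_cong(3)[where F = "%_ x. norm (weak_grad B v x) powr P" and f = "%_ x. norm (Dv x) powr P"] m) auto
 also have "\<dots> = enn2real (\<integral>\<^sup>+x. ennreal (norm (Dv x) powr P) \<partial>lebesgue_on B)"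
  by (rule integral_eq_nn_integral) (use m in auto)
 also have "(\<integral>\<^sup>+x. ennreal (norm (Dv x) powr P) \<partial>lebesgue_on B) = (NN x. ennreal (norm (Dv x) powr P))"
  unfolding nn_integral_lebesgue_on[OF B_borel] norm_Dv by (intro nn_integral_cong) (auto simp: indicator_def B_iff Yb(3))
 finally show ?thesis by (simp add: nn_Dv EY0)
qed

end

section \<open>Dilations and the divergence of the radial flux\<close>

lemma nn_integral_scale:
 fixes h :: "'a::euclidean_space => ennreal"
 assumes [measurable]: "h \<in> BM borel" and c: "c > 0"
 shows "(NN x. h x) = ennreal (c ^ DIM('a)) * (NN x. h (c *\<^sub>R x))"
proof -
 have "(NN x. h x) = (\<integral>\<^sup>+x. h x \<partial>density (distr lborel borel (%x::'a. 0 + c *\<^sub>R x)) (%_. ennreal ( |(c)| ^ DIM('a))))"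
  using lborel_affine[of c "0::'a"] c by simp
 also have "\<dots> = (NN x. ennreal ( |(c)| ^ DIM('a)) * h (c *\<^sub>R x))" by (subst nn_integral_density, simp, simp, subst nn_integral_distr) auto
 also have "\<dots> = ennreal (c ^ DIM('a)) * (NN x. h (c *\<^sub>R x))" using c by (simp add: nn_integral_cmult)
 finally show ?thesis .
qed

lemma lborel_integral_scale:
 fixes h :: "'a::euclidean_space => real"
 assumes [measurable]: "h \<in> BM borel" and c: "c > 0"
 shows "(LBINT x. h x) = c ^ DIM('a) * (LBINT x. h (c *\<^sub>R x))"
proof -
 have "(LBINT x. h x) = (LINT x|density (distr lborel borel (%x::'a. 0 + c *\<^sub>R x)) (%_. ennreal ( |(c)| ^ DIM('a))). h x)"
  using lborel_affine[of c "0::'a"] c by simp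
 also have "\<dots> = (LBINT x. |(c)| ^ DIM('a) * h (c *\<^sub>R x))" by (subst integral_real_density, simp, simp, simp, subst integral_distr) auto
 also have "\<dots> = c ^ DIM('a) * (LBINT x. h (c *\<^sub>R x))" using c by simp
 finally show ?thesis .
qed

lemma nn_integral_power_substitution:
 fixes h :: "real => ennreal"
 assumes [measurable]: "h \<in> BM borel" and c: "c > 0" and n: "n > 0"
 shows "(NN r. h r * ind {0<..<c} r) = (NN s. h (c * s ^ n) * ennreal (c * real n * s ^ (n - 1)) * ind {0<..<1} s)"
proof -
 have "(NN r. h r * ind {0<..<c} r) = (NN r. h r * ind {c * 0 ^ n..c * 1 ^ n} r)"
  using n by (intro nn_integral_cong_AE eventually_mono[OF AE_conjI[OF AE_lborel_singleton[of 0] AE_lborel_singleton[of c]]])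
   (auto simp: indicator_def power_0_left)
 also have "\<dots> = (NN s. h (c * s ^ n) * ennreal (c * real n * s ^ (n - 1)) * ind {0..1} s)"
 proof (rule nn_integral_substitution_aux)
  show "((%s. c * s ^ n) has_real_derivative c * real n * s ^ (n - 1)) (at s)" for s by (auto intro!: derivative_eq_intros)
  show "continuous_on {0..1} (%s. c * real n * s ^ (n - 1))" by (intro continuous_intros)
  show "0 \<le> c * real n * s ^ (n - 1)" if "s \<in> {0..1}" for s using c that by simp
 qed auto
 also have "\<dots> = (NN s. h (c * s ^ n) * ennreal (c * real n * s ^ (n - 1)) * ind {0<..<1} s)"
  by (intro nn_integral_cong_AE eventually_mono[OF AE_conjI[OF AE_lborel_singleton[of 0] AE_lborel_singleton[of 1]]])
   (auto simp: indicator_def)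
 finally show ?thesis .
qed

context sym_data begin

definition "Fb t = enn2real (I t)"

lemma Fb_borel [measurable]: "Fb \<in> BM borel"
 unfolding Fb_def[abs_def] using I_meas by measurable

lemma Fb_eq: "t \<le> TT ==> Fb t = F t" by (simp add: Fb_def F_I)
lemma Fb0: "0 \<le> Fb t" by (simp add: Fb_def)

lemma \<tau>_scale: "\<tau> (c *\<^sub>R x) = |(c)| ^ CARD('n) * \<tau> x"
 by (simp add: \<tau>_def power_mult_distrib)

lemma rad_ratio: assumes "x \<noteq> 0" shows "\<tau> x powr (1/N - 1) / c\<omega> = norm x / (N * \<tau> x)"
proof -
 have t: "\<tau> x > 0" by (rule \<tau>_pos[OF assms])
 have "\<tau> x powr (1/N - 1) / c\<omega> = (\<tau> x powr (1/N) / \<omega> powr (1/N)) / (N * \<tau> x)"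
  using t by (simp add: powr_diff c\<omega>_def)
 also have "\<tau> x powr (1/N) / \<omega> powr (1/N) = rad (\<tau> x)" by (simp add: rad_def powr_divide)
 finally show ?thesis by (simp add: rad_\<tau>)
qed

text \<open>\<tau>(s x) = s^N \<tau>(x), so the substitution r = \<tau>(x) s^N in the integral for F
  expresses it through the load at the dilated points s x.\<close>

lemma flux_nn_dilation:
 assumes "x \<in> B" "x \<noteq> 0"
 shows "(NN s. ennreal (fs (\<tau> (s *\<^sub>R x)) * s ^ (CARD('n) - 1)) * ind {0<..<1} s) = ennreal (Fb (\<tau> x) / (N * \<tau> x))"
proof -
 define c where "c = \<tau> x"
 have c: "0 < c" "c \<le> TT" using \<tau>_pos[OF assms(2)] assms(1) by (auto simp: c_def B_iff)
 have N0: "N > 0" using N_ge by simp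
 have "ennreal (Fb c) = (NN r. ennreal (fs r) * ind {0<..<c} r)" using nn_F[OF c(2)] Fb_eq[OF c(2)] by simp
 also have "\<dots> = (NN s. ennreal (fs (c * s ^ CARD('n))) * ennreal (c * real CARD('n) * s ^ (CARD('n) - 1)) * ind {0<..<1} s)"
  by (rule nn_integral_power_substitution[OF _ c(1)]) auto
 also have "\<dots> = (NN s. ennreal (N * c) * (ennreal (fs (\<tau> (s *\<^sub>R x)) * s ^ (CARD('n) - 1)) * ind {0<..<1} s))"
 proof (intro nn_integral_cong)
  fix s
  show "ennreal (fs (c * s ^ CARD('n))) * ennreal (c * real CARD('n) * s ^ (CARD('n) - 1)) * ind {0<..<1} s
   = ennreal (N * c) * (ennreal (fs (\<tau> (s *\<^sub>R x)) * s ^ (CARD('n) - 1)) * ind {0<..<1} s)"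
  proof (cases "s \<in> {0<..<1}")
   case True
   hence "\<tau> (s *\<^sub>R x) = c * s ^ CARD('n)" by (simp add: \<tau>_scale c_def mult.commute)
   thus ?thesis using True c fs0 N0 by (simp add: N_def ennreal_mult'[symmetric] ennreal_mult''[symmetric] mult_ac)
  qed simp
 qed
 also have "\<dots> = ennreal (N * c) * (NN s. ennreal (fs (\<tau> (s *\<^sub>R x)) * s ^ (CARD('n) - 1)) * ind {0<..<1} s)"
  by (rule nn_integral_cmult) measurable
 finally have e: "ennreal (Fb c) = ennreal (N * c) * (NN s. ennreal (fs (\<tau> (s *\<^sub>R x)) * s ^ (CARD('n) - 1)) * ind {0<..<1} s)" .
 have "ennreal (Fb c / (N * c)) = ennreal (1 / (N * c)) * ennreal (Fb c)" using N0 c by (simp flip: ennreal_mult')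
 also have "\<dots> = (ennreal (1 / (N * c)) * ennreal (N * c)) * (NN s. ennreal (fs (\<tau> (s *\<^sub>R x)) * s ^ (CARD('n) - 1)) * ind {0<..<1} s)"
  unfolding e by (simp only: mult.assoc)
 also have "ennreal (1 / (N * c)) * ennreal (N * c) = 1" using N0 c by (simp flip: ennreal_mult')
 finally show ?thesis by (simp add: c_def)
qed

text \<open>\<open>rad_ratio\<close> brings the flux to the form t^(1/N - 1) F(t), which is in L^q
  by Hardy's inequality, hence integrable on the bounded interval. The load is integrable because F
  TT is finite.\<close>

lemma flux_load_int:
 assumes m: "h \<in> BM borel" and C: "!!x. |(h x)| \<le> C" and out: "!!x. x \<notin> B ==> h x = 0"
 shows "integrable lborel (%x. Fb (\<tau> x) / (N * \<tau> x) * norm x * h x)" "integrable lborel (%x. fs (\<tau> x) * h x)"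
proof -
 note [measurable] = m
 have C0: "C \<ge> 0" using C[of 0] by linarith
 define H where "H t = t powr (1/N - 1) * Fb t" for t
 have [measurable]: "H \<in> BM borel" unfolding H_def[abs_def] by measurable
 have H0: "0 \<le> H t" for t using Fb0 by (simp add: H_def)
 show "integrable lborel (%x. Fb (\<tau> x) / (N * \<tau> x) * norm x * h x)"
 proof (rule integrableI_bounded)
  have "(NN x. ennreal (norm (Fb (\<tau> x) / (N * \<tau> x) * norm x * h x)))
   \<le> (NN x. ennreal (C / c\<omega>) * (ennreal (H (\<tau> x)) * ind {..<TT} (\<tau> x)))"
  proof (intro nn_integral_mono)
   fix x
   show "ennreal (norm (Fb (\<tau> x) / (N * \<tau> x) * norm x * h x)) \<le> ennreal (C / c\<omega>) * (ennreal (H (\<tau> x)) * ind {..<TT} (\<tau> x))"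
   proof (cases "x \<in> B & x \<noteq> 0")
    case True
    have "H (\<tau> x) / c\<omega> = (\<tau> x powr (1/N - 1) / c\<omega>) * Fb (\<tau> x)" by (simp add: H_def)
    also have "\<dots> = Fb (\<tau> x) / (N * \<tau> x) * norm x" unfolding rad_ratio[OF conjunct2[OF True]] by simp
    finally have "Fb (\<tau> x) / (N * \<tau> x) * norm x = H (\<tau> x) / c\<omega>" ..
    hence "norm (Fb (\<tau> x) / (N * \<tau> x) * norm x * h x) = H (\<tau> x) / c\<omega> * |(h x)|" using H0 c\<omega>_pos by (simp add: abs_mult)
    also have "\<dots> \<le> H (\<tau> x) / c\<omega> * C" using H0 c\<omega>_pos by (intro mult_left_mono C) auto
    finally have "ennreal (norm (Fb (\<tau> x) / (N * \<tau> x) * norm x * h x)) \<le> ennreal (C / c\<omega> * H (\<tau> x))"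
     by (intro ennreal_leI) (simp add: mult.commute)
    also have "\<dots> = ennreal (C / c\<omega>) * ennreal (H (\<tau> x))" using C0 c\<omega>_pos by (intro ennreal_mult') simp
    finally show ?thesis using True by (simp add: B_iff)
   next
    case False
    hence "norm x = 0 \<or> h x = 0" using out by auto
    thus ?thesis by auto
   qed
  qed
  also have "\<dots> = ennreal (C / c\<omega>) * (NN x. (ennreal (H (\<tau> x)) * ind {..<TT} (\<tau> x)))" by (rule nn_integral_cmult) measurable
  also have "(NN x. (ennreal (H (\<tau> x)) * ind {..<TT} (\<tau> x))) = (NN t. ennreal (H t) * ind {..<TT} t * ind {0<..} t)"
   by (rule nn_radial[of "%t. ennreal (H t) * ind {..<TT} t"]) measurable
  also have "\<dots> \<le> (NN t. ind {0<..<TT} t + ennreal (H t powr q) * ind {0<..<TT} t)"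
  proof (intro nn_integral_mono)
   fix t
   have "H t \<le> 1 + H t powr q" using le_one_plus_powr[OF H0] q1(1) by simp
   hence "ennreal (H t) \<le> ennreal (1 + H t powr q)" by (rule ennreal_leI)
   also have "\<dots> = 1 + ennreal (H t powr q)" by simp
   finally show "ennreal (H t) * ind {..<TT} t * ind {0<..} t \<le> ind {0<..<TT} t + ennreal (H t powr q) * ind {0<..<TT} t"
    by (auto simp: indicator_def)
  qed
  also have "\<dots> = ennreal TT + (NN t. ennreal (H t powr q) * ind {0<..<TT} t)" by (subst nn_integral_add) (auto simp: TT0)
  finally have le: "(NN x. ennreal (norm (Fb (\<tau> x) / (N * \<tau> x) * norm x * h x)))
   \<le> ennreal (C / c\<omega>) * (ennreal TT + (NN t. ennreal (H t powr q) * ind {0<..<TT} t))" by (simp add: mult_left_mono)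
  have "(NN t. ennreal (H t powr q) * ind {0<..<TT} t) < \<infinity>"
   unfolding H_def Fb_def I_def q_def by (rule Hardy(2)[OF fs_borel fs0 P1 PN TT0]) (use Lor_fs in \<open>simp add: q_def\<close>)
  thus "(NN x. ennreal (norm (Fb (\<tau> x) / (N * \<tau> x) * norm x * h x))) < \<infinity>"
   by (intro le_less_trans[OF le]) (simp add: ennreal_mult_less_top)
 qed measurable
 show "integrable lborel (%x. fs (\<tau> x) * h x)"
 proof (rule integrableI_bounded)
  have "(NN x. ennreal (norm (fs (\<tau> x) * h x))) \<le> (NN x. ennreal C * (ennreal (fs (\<tau> x)) * ind {..<TT} (\<tau> x)))"
  proof (intro nn_integral_mono)
   fix x
   show "ennreal (norm (fs (\<tau> x) * h x)) \<le> ennreal C * (ennreal (fs (\<tau> x)) * ind {..<TT} (\<tau> x))"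
   proof (cases "x \<in> B")
    case True
    have "norm (fs (\<tau> x) * h x) \<le> C * fs (\<tau> x)"
     using mult_left_mono[OF C[of x] fs0[of "\<tau> x"]] fs0[of "\<tau> x"] by (simp add: abs_mult mult.commute)
    hence "ennreal (norm (fs (\<tau> x) * h x)) \<le> ennreal (C * fs (\<tau> x))" by (rule ennreal_leI)
    thus ?thesis using True C0 by (simp add: B_iff ennreal_mult')
   qed (simp add: out)
  qed
  also have "\<dots> = ennreal C * (NN x. (ennreal (fs (\<tau> x)) * ind {..<TT} (\<tau> x)))" by (rule nn_integral_cmult) measurable
  also have "(NN x. (ennreal (fs (\<tau> x)) * ind {..<TT} (\<tau> x))) = (NN t. ennreal (fs t) * ind {..<TT} t * ind {0<..} t)"
   by (rule nn_radial[of "%t. ennreal (fs t) * ind {..<TT} t"]) measurable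
  also have "\<dots> = ennreal (F TT)" unfolding nn_F[OF order_refl, symmetric] by (intro nn_integral_cong) (auto simp: indicator_def)
  also have "ennreal C * ennreal (F TT) < \<infinity>" by (simp add: ennreal_mult_less_top)
  finally show "(NN x. ennreal (norm (fs (\<tau> x) * h x))) < \<infinity>" .
 qed measurable
qed

text \<open>Writing the flux as a superposition of dilations of the load reduces its divergence to the
 fundamental theorem of calculus along rays.\<close>

lemma flux_identity:
 assumes \<phi>: "\<phi> \<in> test_funs B"
 shows "integrable lborel (%x. Fb (\<tau> x) / (N * \<tau> x) * (gradient \<phi> x \<bullet> x))"
  "integrable lborel (%x. fs (\<tau> x) * \<phi> x)"
  "(LBINT x. Fb (\<tau> x) / (N * \<tau> x) * (gradient \<phi> x \<bullet> x)) = - (LBINT x. fs (\<tau> x) * \<phi> x)"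
proof -
 define n where "n = CARD('n)"
 have C1: "C1 \<phi>" by (rule test_funs_C1[OF \<phi>])
 note [measurable] = C1_borel[OF C1] C1_pd_borel[OF C1]
 define \<psi>' where "\<psi>' x = gradient \<phi> x \<bullet> x" for x
 have \<psi>'m [measurable]: "\<psi>' \<in> BM borel" unfolding \<psi>'_def[abs_def] gradient_inner by measurable
 obtain C where C: "C \<ge> 0" "!!x. |(\<phi> x)| \<le> C" "!!i x. |(pd i \<phi> x)| \<le> C" using test_fun_bounded[OF \<phi>] by metis
 have out: "\<phi> x = 0" "\<psi>' x = 0" if "x \<notin> B" for x
  using test_funs_outside[OF \<phi> that] partial_deriv_outside[OF \<phi> that] by (simp_all add: \<psi>'_def gradient_inner)
 have \<psi>'_le: "|(\<psi>' x)| \<le> norm x * (real n * C)" for x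
 proof -
  have "|(\<psi>' x)| \<le> (\<Sum>i\<in>UNIV. |(pd i \<phi> x * x $ i)|)" unfolding \<psi>'_def gradient_inner by (rule sum_abs)
  also have "\<dots> \<le> (\<Sum>i\<in>(UNIV::'n set). C * norm x)" unfolding abs_mult by (intro sum_mono mult_mono C component_le_norm_cart) auto
  finally show ?thesis by (simp add: n_def mult_ac)
 qed
 \<comment> \<open>The quotient by |x| is bounded since the derivatives of \<phi> are, so
   \<open>flux_load_int\<close> applies with |x| as separate factor.\<close>
 define h where "h x = \<psi>' x / norm x" for x
 have h: "h \<in> BM borel" "!!x. |(h x)| \<le> real n * C" "!!x. x \<notin> B ==> h x = 0"
 proof -
  show "h \<in> BM borel" unfolding h_def[abs_def] by measurable
  show "|(h x)| \<le> real n * C" for x using \<psi>'_le[of x] C(1) by (cases "x = 0") (auto simp: h_def divide_le_eq mult.commute)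
 qed (simp add: h_def out)
 have nh: "norm x * h x = \<psi>' x" for x using \<psi>'_le[of x] by (cases "x = 0") (auto simp: h_def)
 have i1: "integrable lborel (%x. Fb (\<tau> x) / (N * \<tau> x) * \<psi>' x)" using flux_load_int(1)[OF h] unfolding mult.assoc nh .
 thus "integrable lborel (%x. Fb (\<tau> x) / (N * \<tau> x) * (gradient \<phi> x \<bullet> x))" by (simp only: \<psi>'_def)
 show i2: "integrable lborel (%x. fs (\<tau> x) * \<phi> x)" by (rule flux_load_int(2)[OF _ C(2)]) (use out in auto)
 \<comment> \<open>\<open>K1\<close> integrates over s to the flux paired with the gradient of
   \<phi>. \<open>K2\<close> is the same kernel in the variable y = s x, where the load no longer
   depends on s; \<open>K12\<close> records the Jacobian.\<close>
 define K1 where "K1 x s = ind {0<..<1} s * (fs (\<tau> (s *\<^sub>R x)) * s ^ (n - 1)) * \<psi>' x" for x and s :: real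
 define K2 where "K2 y s = ind {0<..<1} s * (fs (\<tau> y) * (\<psi>' (y /\<^sub>R s) / s))" for y and s :: real
 have K1m [measurable]: "(%z. K1 (fst z) (snd z)) \<in> BM (lborel \<Otimes>\<^sub>M lborel)" unfolding K1_def by measurable
 have K2m [measurable]: "(%z. K2 (fst z) (snd z)) \<in> BM (lborel \<Otimes>\<^sub>M lborel)" unfolding K2_def by measurable
 have K12: "K1 x s = s ^ n * K2 (s *\<^sub>R x) s" for x s
 proof (cases "s \<in> {0<..<1}")
  case True
  have "s ^ n = s * s ^ (n - 1)" using power_Suc[of s "n - 1"] by (simp add: n_def)
  thus ?thesis using True by (simp add: K1_def K2_def)
 qed (simp add: K1_def K2_def)
 have ae0: "AE x in lborel. (x::real^'n) \<noteq> 0" by (rule AE_lborel_singleton)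
 have K1n: "(NN s. ennreal (norm (K1 x s))) = ennreal (norm (Fb (\<tau> x) / (N * \<tau> x) * \<psi>' x))" if "x \<noteq> 0" for x
 proof (cases "x \<in> B")
  case True
  have "(NN s. ennreal (norm (K1 x s))) = (NN s. ennreal |(\<psi>' x)| * (ennreal (fs (\<tau> (s *\<^sub>R x)) * s ^ (n - 1)) * ind {0<..<1} s))"
  proof (intro nn_integral_cong)
   fix s
   show "ennreal (norm (K1 x s)) = ennreal |(\<psi>' x)| * (ennreal (fs (\<tau> (s *\<^sub>R x)) * s ^ (n - 1)) * ind {0<..<1} s)"
   proof (cases "s \<in> {0<..<1}")
    case True
    hence "norm (K1 x s) = |(\<psi>' x)| * (fs (\<tau> (s *\<^sub>R x)) * s ^ (n - 1))"
     using fs0[of "\<tau> (s *\<^sub>R x)"] by (simp add: K1_def abs_mult)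
    thus ?thesis using True by (simp add: ennreal_mult')
   qed (simp add: K1_def)
  qed
  also have "\<dots> = ennreal |(\<psi>' x)| * (NN s. (ennreal (fs (\<tau> (s *\<^sub>R x)) * s ^ (n - 1)) * ind {0<..<1} s))"
   by (rule nn_integral_cmult) measurable
  also have "\<dots> = ennreal |(\<psi>' x)| * ennreal (Fb (\<tau> x) / (N * \<tau> x))" using flux_nn_dilation[OF True that] by (simp add: n_def)
  also have "\<dots> = ennreal (norm (Fb (\<tau> x) / (N * \<tau> x) * \<psi>' x))"
   using Fb0[of "\<tau> x"] N_ge \<tau>0[of x] by (simp add: ennreal_mult'[symmetric] abs_mult mult.commute)
  finally show ?thesis .
 qed (simp add: K1_def out)
 have pair: "integrable (lborel \<Otimes>\<^sub>M lborel) (%z. K (fst z) (snd z))"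
  if [measurable]: "(%z. K (fst z) (snd z)) \<in> BM (lborel \<Otimes>\<^sub>M lborel)"
   and fin: "(NN x. (NN s. ennreal (norm (K x s)))) < \<infinity>" for K :: "real^'n => real => real"
 proof (rule integrableI_bounded)
  have "(\<integral>\<^sup>+z. ennreal (norm (K (fst z) (snd z))) \<partial>(lborel \<Otimes>\<^sub>M lborel)) = (NN x. (NN s. ennreal (norm (K x s))))"
   by (subst lborel.nn_integral_fst[symmetric]) auto
  thus "(\<integral>\<^sup>+z. ennreal (norm (K (fst z) (snd z))) \<partial>(lborel \<Otimes>\<^sub>M lborel)) < \<infinity>" using fin by simp
 qed measurable
 have swap: "(NN x. (NN s. ennreal (norm (K x s)))) = (NN s. (NN x. ennreal (norm (K x s))))"
  if [measurable]: "(%z. K (fst z) (snd z)) \<in> BM (lborel \<Otimes>\<^sub>M lborel)" for K :: "real^'n => real => real"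
  by (rule lborel_pair.Fubini'[of "%x s. ennreal (norm (K x s))", symmetric]) (use that in \<open>simp add: split_beta'\<close>)
 have fin1: "(NN x. (NN s. ennreal (norm (K1 x s)))) < \<infinity>"
 proof -
  have "(NN x. (NN s. ennreal (norm (K1 x s)))) = (NN x. ennreal (norm (Fb (\<tau> x) / (N * \<tau> x) * \<psi>' x)))"
   by (rule nn_integral_cong_AE, rule eventually_mono[OF ae0], rule K1n)
  thus ?thesis using i1 by (simp only: integrable_iff_bounded)
 qed
 have sc: "(NN y. ennreal (norm (K2 y s))) = (NN x. ennreal (norm (K1 x s)))"
  "(LBINT y. K2 y s) = (LBINT x. K1 x s)" for s
 proof -
  have m: "(%y. K2 y s) \<in> BM borel" unfolding K2_def by measurable
  show "(NN y. ennreal (norm (K2 y s))) = (NN x. ennreal (norm (K1 x s)))"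
  proof (cases "s \<in> {0<..<1}")
   case True
   have "(NN y. ennreal (norm (K2 y s))) = ennreal (s ^ n) * (NN x. ennreal (norm (K2 (s *\<^sub>R x) s)))"
    using nn_integral_scale[of "%y. ennreal (norm (K2 y s))" s] m True by (simp add: n_def)
   also have "\<dots> = (NN x. ennreal (s ^ n) * ennreal (norm (K2 (s *\<^sub>R x) s)))"
    by (rule nn_integral_cmult[symmetric]) (unfold K2_def, measurable)
   also have "\<dots> = (NN x. ennreal (norm (K1 x s)))" using True by (intro nn_integral_cong) (simp add: K12 abs_mult ennreal_mult')
   finally show ?thesis .
  qed (simp add: K1_def K2_def)
  show "(LBINT y. K2 y s) = (LBINT x. K1 x s)"
  proof (cases "s \<in> {0<..<1}")
   case True
   thus ?thesis using lborel_integral_scale[OF m, of s] by (simp add: K12 n_def)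
  qed (simp add: K1_def K2_def)
 qed
 have fin2: "(NN y. (NN s. ennreal (norm (K2 y s)))) < \<infinity>" using fin1 unfolding swap[OF K1m] swap[OF K2m] sc(1) .
 have in1: "(LBINT s. K1 x s) = Fb (\<tau> x) / (N * \<tau> x) * \<psi>' x" if "x \<noteq> 0" for x
 proof (cases "x \<in> B")
  case True
  have e: "K1 x s = (fs (\<tau> (s *\<^sub>R x)) * s ^ (n - 1) * ind {0<..<1} s) * \<psi>' x" for s by (simp add: K1_def)
  have "(LBINT s. fs (\<tau> (s *\<^sub>R x)) * s ^ (n - 1) * ind {0<..<1} s)
   = enn2real (NN s. ennreal (fs (\<tau> (s *\<^sub>R x)) * s ^ (n - 1) * ind {0<..<1} s))"
   by (rule integral_eq_nn_integral) (auto simp: indicator_def fs0)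
  also have "(NN s. ennreal (fs (\<tau> (s *\<^sub>R x)) * s ^ (n - 1) * ind {0<..<1} s)) = ennreal (Fb (\<tau> x) / (N * \<tau> x))"
   unfolding flux_nn_dilation[OF True that, symmetric] n_def by (intro nn_integral_cong) (auto simp: indicator_def)
  finally have "(LBINT s. fs (\<tau> (s *\<^sub>R x)) * s ^ (n - 1) * ind {0<..<1} s) = Fb (\<tau> x) / (N * \<tau> x)"
   using Fb0[of "\<tau> x"] N_ge \<tau>0[of x] by simp
  thus ?thesis unfolding e by simp
 qed (simp add: K1_def out)
 \<comment> \<open>For fixed y the kernel is the load at y times the s-derivative of -\<phi>(y/s).
   The boundary term at s = 1 is -\<phi>(y), and for small s the point y/s has left the
   ball.\<close>
 have in2: "(LBINT s. K2 y s) = - (fs (\<tau> y) * \<phi> y)" if "y \<noteq> 0" for y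
 proof (cases "y \<in> B")
  case True
  \<comment> \<open>At s = \<delta> the point y/s reaches the sphere of radius R. Starting the
    integral there avoids the singularity at s = 0.\<close>
  define \<delta> where "\<delta> = norm y / R"
  have nR: "norm y < R" using True by (simp add: B_eq)
  have R: "R > 0" using le_less_trans[OF norm_ge_zero nR] .
  have \<delta>: "0 < \<delta>" "\<delta> < 1" using that nR R by (auto simp: \<delta>_def)
  have small: "y /\<^sub>R s \<notin> B" if s: "0 < s" "s \<le> \<delta>" for s
  proof -
   have "R \<le> norm y / s" using s R by (simp add: \<delta>_def field_simps)
   thus ?thesis using s by (simp add: B_eq divide_inverse mult.commute)
  qed
  have d: "((%s. - \<phi> (y /\<^sub>R s)) has_real_derivative \<psi>' (y /\<^sub>R s) / s) (at s)" if s: "s > 0" for s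
  proof -
   have "((%r. \<phi> (0 + r *\<^sub>R y)) has_real_derivative gradient \<phi> (0 + inverse s *\<^sub>R y) \<bullet> y) (at (inverse s))"
    by (rule C1_line_deriv[OF C1])
   moreover have "(inverse has_real_derivative - (inverse s * inverse s)) (at s)" using DERIV_inverse[of s] s by (simp add: power2_eq_square)
   ultimately have "((%s. \<phi> (0 + inverse s *\<^sub>R y)) has_real_derivative (gradient \<phi> (0 + inverse s *\<^sub>R y) \<bullet> y) * - (inverse s * inverse s)) (at s)"
    by (rule DERIV_chain2)
   from DERIV_minus[OF this] show ?thesis by (simp add: \<psi>'_def divide_inverse mult_ac)
  qed
  have "(LBINT s. ind {\<delta>..1} s *\<^sub>R (\<psi>' (y /\<^sub>R s) / s)) = - \<phi> (y /\<^sub>R 1) - - \<phi> (y /\<^sub>R \<delta>)"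
  proof (rule integral_FTC_atLeastAtMost)
   show "((%s. - \<phi> (y /\<^sub>R s)) has_vector_derivative \<psi>' (y /\<^sub>R s) / s) (at s within {\<delta>..1})" if "\<delta> \<le> s" "s \<le> 1" for s
    using d[of s] \<delta> that by (simp add: has_real_derivative_iff_has_vector_derivative has_vector_derivative_at_within)
   show "continuous_on {\<delta>..1} (%s. \<psi>' (y /\<^sub>R s) / s)" unfolding \<psi>'_def gradient_inner using \<delta>
    by (intro continuous_intros continuous_on_compose2[OF C1_pd[OF C1]]) auto
  qed (use \<delta> in simp)
  also have "\<phi> (y /\<^sub>R \<delta>) = 0" using small[of \<delta>] \<delta> by (intro out) auto
  finally have f: "(LBINT s. ind {\<delta>..1} s *\<^sub>R (\<psi>' (y /\<^sub>R s) / s)) = - \<phi> y" by simp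
  have "(LBINT s. K2 y s) = (LBINT s. fs (\<tau> y) * (ind {\<delta>..1} s *\<^sub>R (\<psi>' (y /\<^sub>R s) / s)))"
  proof (rule integral_cong_AE)
   show "AE s in lborel. K2 y s = fs (\<tau> y) * (ind {\<delta>..1} s *\<^sub>R (\<psi>' (y /\<^sub>R s) / s))" using AE_lborel_singleton[of 1]
   proof eventually_elim
    case (elim s)
    show ?case
    proof (cases "0 < s & s < \<delta>")
     case True
     thus ?thesis using out(2)[OF small[of s]] by (simp add: K2_def)
    qed (use elim \<delta> in \<open>auto simp: K2_def indicator_def\<close>)
   qed
  qed (unfold K2_def, measurable)
  also have "\<dots> = fs (\<tau> y) * - \<phi> y" by (simp only: integral_mult_right_zero f)
  finally show ?thesis by simp
 next
  case False
  have "y /\<^sub>R s \<notin> B" if "s \<in> {0<..<1}" for s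
  proof -
   have "norm y * 1 \<le> norm y * inverse s" using that by (intro mult_left_mono) (auto simp: one_le_inverse_iff)
   thus ?thesis using False that by (simp add: B_eq mult.commute)
  qed
  hence "K2 y s = 0" for s using out(2)[of "y /\<^sub>R s"] by (cases "s \<in> {0<..<1}") (auto simp: K2_def)
  thus ?thesis using out(1)[OF False] by simp
 qed
 have sw: "(LBINT x. (LBINT s. K x s)) = (LBINT s. (LBINT x. K x s))"
  if "integrable (lborel \<Otimes>\<^sub>M lborel) (%z. K (fst z) (snd z))" for K :: "real^'n => real => real"
  by (rule lborel_pair.Fubini_integral[of K, symmetric]) (use that in \<open>simp add: split_beta'\<close>)
 have "(LBINT x. Fb (\<tau> x) / (N * \<tau> x) * \<psi>' x) = (LBINT x. (LBINT s. K1 x s))"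
  by (rule integral_cong_AE) (use ae0 in \<open>auto elim!: eventually_mono simp: in1\<close>)
 also have "\<dots> = (LBINT s. (LBINT x. K1 x s))" by (rule sw[OF pair[OF K1m fin1]])
 also have "\<dots> = (LBINT s. (LBINT y. K2 y s))" by (simp only: sc(2))
 also have "\<dots> = (LBINT y. (LBINT s. K2 y s))" by (rule sw[OF pair[OF K2m fin2], symmetric])
 also have "\<dots> = (LBINT y. - (fs (\<tau> y) * \<phi> y))"
  by (rule integral_cong_AE) (use ae0 in \<open>auto elim!: eventually_mono simp: in2\<close>)
 finally show "(LBINT x. Fb (\<tau> x) / (N * \<tau> x) * (gradient \<phi> x \<bullet> x)) = - (LBINT x. fs (\<tau> x) * \<phi> x)"
  by (simp add: \<psi>'_def)
qed

end

section \<open>Uniqueness for the p-Laplacian\<close>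

lemma norm_powr_scaleR: "norm (norm \<xi> powr (P - 2) *\<^sub>R \<xi>) = norm \<xi> powr (P - 1)" for \<xi> :: "'a::real_normed_vector"
proof (cases "\<xi> = 0")
 case False
 have "norm \<xi> powr ((P - 2) + 1) = norm \<xi> powr (P - 2) * norm \<xi> powr 1" by (rule powr_add)
 moreover have "P - 2 + 1 = P - 1" by simp
 ultimately have "norm \<xi> powr (P - 1) = norm \<xi> powr (P - 2) * norm \<xi>" by (simp only:) simp
 thus ?thesis by simp
qed simp

text \<open>The product splits as in \<open>e\<close> into a radial term, nonnegative because the
  power P - 1 is increasing, and a nonnegative multiple of the defect in the Cauchy-Schwarz
  inequality. If both vanish, the lengths agree, and so do the directions.\<close>

lemma p_laplace_monotone:
 fixes \<xi> \<eta> :: "'a::real_inner"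
 assumes P: "P > 1"
 shows "0 \<le> (norm \<xi> powr (P - 2) *\<^sub>R \<xi> - norm \<eta> powr (P - 2) *\<^sub>R \<eta>) \<bullet> (\<xi> - \<eta>)"
  "(norm \<xi> powr (P - 2) *\<^sub>R \<xi> - norm \<eta> powr (P - 2) *\<^sub>R \<eta>) \<bullet> (\<xi> - \<eta>) = 0 ==> \<xi> = \<eta>"
proof -
 define x y where "x = norm \<xi>" and "y = norm \<eta>"
 define a b where "a = x powr (P - 2)" and "b = y powr (P - 2)"
 define z where "z = \<xi> \<bullet> \<eta>"
 have xy: "x \<ge> 0" "y \<ge> 0" "a \<ge> 0" "b \<ge> 0" by (auto simp: x_def y_def a_def b_def)
 have ax: "a * x = x powr (P - 1)" using norm_powr_scaleR[of \<xi> P] by (simp add: a_def x_def)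
 have bY: "b * y = y powr (P - 1)" using norm_powr_scaleR[of \<eta> P] by (simp add: b_def y_def)
 have z: "z \<le> x * y" unfolding z_def x_def y_def by (rule norm_cauchy_schwarz)
 have e: "(norm \<xi> powr (P - 2) *\<^sub>R \<xi> - norm \<eta> powr (P - 2) *\<^sub>R \<eta>) \<bullet> (\<xi> - \<eta>) = (a * x - b * y) * (x - y) + (a + b) * (x * y - z)"
 proof -
  have "\<xi> \<bullet> \<xi> = x * x" "\<eta> \<bullet> \<eta> = y * y" by (simp_all add: x_def y_def power2_norm_eq_inner flip: power2_eq_square)
  thus ?thesis
   by (simp add: inner_diff_left inner_diff_right a_def[symmetric, unfolded x_def] b_def[symmetric, unfolded y_def] inner_commute[of \<eta> \<xi>] z_def[symmetric] algebra_simps)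
 qed
 have m: "0 \<le> (a * x - b * y) * (x - y)"
 proof (cases "x \<le> y")
  case True
  hence "a * x \<le> b * y" unfolding ax bY using xy P by (intro powr_mono2) auto
  thus ?thesis using True by (simp add: mult_nonpos_nonpos)
 next
  case False
  hence "b * y \<le> a * x" unfolding ax bY using xy P by (intro powr_mono2) auto
  thus ?thesis using False by simp
 qed
 have m2: "0 \<le> (a + b) * (x * y - z)" using xy z by simp
 show "0 \<le> (norm \<xi> powr (P - 2) *\<^sub>R \<xi> - norm \<eta> powr (P - 2) *\<^sub>R \<eta>) \<bullet> (\<xi> - \<eta>)" unfolding e using m m2 by simp
 assume "(norm \<xi> powr (P - 2) *\<^sub>R \<xi> - norm \<eta> powr (P - 2) *\<^sub>R \<eta>) \<bullet> (\<xi> - \<eta>) = 0"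
 hence 0: "(a * x - b * y) * (x - y) = 0" "(a + b) * (x * y - z) = 0" unfolding e using m m2 by linarith+
 have xy_eq: "x = y"
 proof (rule ccontr)
  assume n: "x \<noteq> y"
  hence "x powr (P - 1) = y powr (P - 1)" using 0(1) by (simp add: ax bY)
  thus False using n xy P powr_less_mono2[of "P - 1" x y] powr_less_mono2[of "P - 1" y x] by (cases "x < y") auto
 qed
 show "\<xi> = \<eta>"
 proof (cases "x = 0")
  case True
  thus ?thesis using xy_eq by (simp add: x_def y_def)
 next
  case False
  hence "a > 0" using xy by (simp add: a_def)
  hence "x * y = z" using 0(2) xy by auto
  hence "norm \<xi> * norm \<eta> = \<xi> \<bullet> \<eta>" by (simp add: x_def y_def z_def)
  hence "norm \<xi> *\<^sub>R \<eta> = norm \<eta> *\<^sub>R \<xi>" using norm_cauchy_schwarz_eq[of \<xi> \<eta>] by simp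
  thus ?thesis using xy_eq False by (simp add: x_def y_def)
 qed
qed

lemma w0_approx_norm_int:
 assumes "w0_approx \<Omega> (%i. P) u D \<phi>"
 shows "integrable (LB \<Omega>) (%x. norm (D x) powr P)"
proof -
 interpret w0_approx \<Omega> "%i. P" u D \<phi> by fact
 have P: "P > 1" by (rule p)
 have [measurable]: "D \<in> BM M" unfolding borel_measurable_euclidean_space[of D] using D_meas by (auto simp: Basis_vec_def inner_axis)
 show ?thesis
 proof (rule Bochner_Integration.integrable_bound)
  show "integrable M (%x. real CARD('a) powr P * (\<Sum>i\<in>UNIV. |(D x $ i)| powr P))" using D_int by simp
  show "AE x in M. norm (norm (D x) powr P) \<le> norm (real CARD('a) powr P * (\<Sum>i\<in>UNIV. |(D x $ i)| powr P))"
  proof (rule AE_I2)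
   fix x
   define m where "m = Max (range (%i. |(D x $ i)|))"
   have m: "|(D x $ i)| \<le> m" for i unfolding m_def by (rule Max_ge) auto
   have "m \<in> range (%i. |(D x $ i)|)" unfolding m_def by (rule Max_in) auto
   then obtain j where j: "m = |(D x $ j)|" by auto
   have "norm (D x) \<le> (\<Sum>i\<in>UNIV. |(D x $ i)|)" by (rule norm_le_l1_cart)
   also have "\<dots> \<le> (\<Sum>i\<in>(UNIV::'a set). m)" by (intro sum_mono m)
   finally have "norm (D x) powr P \<le> (real CARD('a) * m) powr P" using P by (intro powr_mono2) auto
   also have "\<dots> = real CARD('a) powr P * |(D x $ j)| powr P" by (simp add: powr_mult j)
   also have "\<dots> \<le> real CARD('a) powr P * (\<Sum>i\<in>UNIV. |(D x $ i)| powr P)"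
    by (intro mult_left_mono member_le_sum[where f = "%i. |(D x $ i)| powr P"]) auto
   finally show "norm (norm (D x) powr P) \<le> norm (real CARD('a) powr P * (\<Sum>i\<in>UNIV. |(D x $ i)| powr P))" by (simp add: sum_nonneg)
  qed
 qed measurable
qed

text \<open>Both equations extend by density from test functions to u and w themselves. The
  difference tested with u - w vanishes, so strict monotonicity gives equal gradients a.e., and
  Poincare's inequality then forces u = w.\<close>

lemma p_laplace_unique:
 fixes \<Omega> :: "(real^'n::finite) set"
 assumes op: "open \<Omega>" and bd: "bounded \<Omega>" and P: "P > 1" and \<Lambda>: "\<Lambda> > 0"
  and u: "weak_solution \<Omega> (%i. P) (%x s \<xi>. \<Lambda> *\<^sub>R (norm \<xi> powr (P - 2) *\<^sub>R \<xi>)) f g u"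
  and w: "weak_solution \<Omega> (%i. P) (%x s \<xi>. \<Lambda> *\<^sub>R (norm \<xi> powr (P - 2) *\<^sub>R \<xi>)) f g w"
 shows "AE x in LB \<Omega>. w x = u x"
proof -
 let ?M = "LB \<Omega>"
 define U W where "U = weak_grad \<Omega> u" and "W = weak_grad \<Omega> w"
 obtain \<phi> where \<phi>: "w0_approx \<Omega> (%i. P) u U \<phi>"
  unfolding U_def by (rule W0_imp_approx[OF op bd, of "%i. P" u]) (use P u in \<open>auto simp: weak_solution_def\<close>)
 obtain \<psi> where \<psi>: "w0_approx \<Omega> (%i. P) w W \<psi>"
  unfolding W_def by (rule W0_imp_approx[OF op bd, of "%i. P" w]) (use P w in \<open>auto simp: weak_solution_def\<close>)
 interpret U: w0_approx \<Omega> "%i. P" u U \<phi> by (rule \<phi>)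
 interpret W: w0_approx \<Omega> "%i. P" w W \<psi> by (rule \<psi>)
 have [measurable]: "U \<in> BM ?M" "W \<in> BM ?M" unfolding borel_measurable_euclidean_space[of U] borel_measurable_euclidean_space[of W]
  using U.D_meas W.D_meas by (auto simp: Basis_vec_def inner_axis)
 define a where "a \<xi> = \<Lambda> *\<^sub>R (norm \<xi> powr (P - 2) *\<^sub>R \<xi>)" for \<xi> :: "real^'n"
 have Pq: "(P - 1) * conj_exp P = P" using P by (simp add: conj_exp_def)
 have q: "conj_exp P > 1" using conj_exp_props[OF P] by simp
 have aint: "integrable ?M (%x. |(a (V x) $ i)| powr conj_exp P)" "(%x. a (V x) $ i) \<in> BM ?M"
  if [measurable]: "V \<in> BM ?M" "!!i. (%x. V x $ i) \<in> BM ?M" and V: "integrable ?M (%x. norm (V x) powr P)" for V i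
 proof -
  show m [measurable]: "(%x. a (V x) $ i) \<in> BM ?M" unfolding a_def by simp measurable
  show "integrable ?M (%x. |(a (V x) $ i)| powr conj_exp P)"
  proof (rule Bochner_Integration.integrable_bound)
   show "integrable ?M (%x. \<Lambda> powr conj_exp P * norm (V x) powr P)" using V by simp
   show "AE x in ?M. norm ( |(a (V x) $ i)| powr conj_exp P) \<le> norm (\<Lambda> powr conj_exp P * norm (V x) powr P)"
   proof (rule AE_I2)
    fix x
    have "|(a (V x) $ i)| \<le> norm (a (V x))" by (rule component_le_norm_cart)
    also have "\<dots> = \<Lambda> * norm (V x) powr (P - 1)" using \<Lambda> by (simp only: a_def norm_scaleR[of \<Lambda>] norm_powr_scaleR abs_of_pos)
    finally have "|(a (V x) $ i)| powr conj_exp P \<le> (\<Lambda> * norm (V x) powr (P - 1)) powr conj_exp P" using q by (intro powr_mono2) auto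
    also have "\<dots> = \<Lambda> powr conj_exp P * norm (V x) powr P" by (simp only: powr_mult powr_powr Pq)
    finally show "norm ( |(a (V x) $ i)| powr conj_exp P) \<le> norm (\<Lambda> powr conj_exp P * norm (V x) powr P)" by simp
   qed
  qed measurable
 qed
 note aU = aint[OF \<open>U \<in> _\<close> U.D_meas w0_approx_norm_int[OF \<phi>]] and aW = aint[OF \<open>W \<in> _\<close> W.D_meas w0_approx_norm_int[OF \<psi>]]
 define b where "b i x = a (U x) $ i - a (W x) $ i" for i x
 have bm [measurable]: "b i \<in> BM ?M" for i unfolding b_def using aU(2) aW(2) by measurable
 have bi: "integrable ?M (%x. |(b i x)| powr conj_exp P)" for i unfolding b_def using q by (intro Lp_diff_integrable aU aW) auto
 \<comment> \<open>The factor 1 is the constant \<theta> of \<open>pairing\<close>, kept so that the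
   limit lemma matches.\<close>
 have zero: "(\<Sum>i\<in>UNIV. LINT x|?M. b i x * (1 * pd i \<theta> x)) = 0" if \<theta>: "\<theta> \<in> test_funs \<Omega>" for \<theta>
 proof -
  have pi: "integrable ?M (%x. b i x * pd i \<theta> x)" for i
   using P by (intro Holder_integrable(1)[OF bm _ P bi] U.test_pd_Lp[OF \<theta>] U.test_meas[OF \<theta>]) auto
  have e: "(LINT x|?M. a (U x) \<bullet> gradient \<theta> x) = (LINT x|?M. a (W x) \<bullet> gradient \<theta> x)"
   "integrable ?M (%x. a (U x) \<bullet> gradient \<theta> x)" "integrable ?M (%x. a (W x) \<bullet> gradient \<theta> x)"
   using u w \<theta> by (auto simp: weak_solution_def a_def U_def W_def)
  have "(\<Sum>i\<in>UNIV. LINT x|?M. b i x * (1 * pd i \<theta> x)) = (LINT x|?M. (\<Sum>i\<in>UNIV. b i x * pd i \<theta> x))" using pi by simp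
  also have "\<dots> = (LINT x|?M. a (U x) \<bullet> gradient \<theta> x - a (W x) \<bullet> gradient \<theta> x)"
   by (simp add: inner_vec_def gradient_def b_def left_diff_distrib sum_subtractf)
  also have "\<dots> = 0" using e by simp
  finally show ?thesis .
 qed
 have lim: "(\<Sum>i\<in>UNIV. LINT x|?M. b i x * (1 * V x $ i)) = 0" if "w0_approx \<Omega> (%i. P) v V \<theta>" for v V \<theta>
 proof -
  interpret V: w0_approx \<Omega> "%i. P" v V \<theta> by fact
  have "(%k. \<Sum>i\<in>UNIV. LINT x|?M. b i x * (1 * pd i (\<theta> k) x)) \<leadsto> (\<Sum>i\<in>UNIV. LINT x|?M. b i x * (1 * V x $ i))"
   by (intro tendsto_sum V.pairing(3)[where \<theta> = "%_. 1" and B = 1] bm bi) auto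
  thus ?thesis unfolding zero[OF V.\<phi>] by (simp add: LIMSEQ_const_iff)
 qed
 have bU: "integrable ?M (%x. b i x * U x $ i)" "integrable ?M (%x. b i x * W x $ i)" for i
  using Holder_integrable(1)[OF bm U.D_meas P bi U.D_int] Holder_integrable(1)[OF bm W.D_meas P bi W.D_int] by auto
 have ip: "(a (U x) - a (W x)) \<bullet> (U x - W x) = (\<Sum>i\<in>UNIV. b i x * U x $ i) - (\<Sum>i\<in>UNIV. b i x * W x $ i)" for x
  by (simp add: inner_vec_def b_def right_diff_distrib sum_subtractf)
 have i0: "integrable ?M (%x. (a (U x) - a (W x)) \<bullet> (U x - W x))" unfolding ip using bU by simp
 have "(LINT x|?M. (a (U x) - a (W x)) \<bullet> (U x - W x)) = 0" unfolding ip using bU lim[OF \<phi>] lim[OF \<psi>] by simp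
 moreover have pos: "0 \<le> (a \<xi> - a \<eta>) \<bullet> (\<xi> - \<eta>)" "(a \<xi> - a \<eta>) \<bullet> (\<xi> - \<eta>) = 0 ==> \<xi> = \<eta>" for \<xi> \<eta>
  using p_laplace_monotone[OF P, of \<xi> \<eta>] \<Lambda> unfolding a_def scaleR_diff_right[symmetric] inner_scaleR_left by auto
 ultimately have "AE x in ?M. (a (U x) - a (W x)) \<bullet> (U x - W x) = 0" using integral_nonneg_eq_0_iff_AE[OF i0] by (simp add: pos)
 hence UW: "AE x in ?M. U x = W x" by eventually_elim (rule pos(2))
 \<comment> \<open>The gradients of u and w agree a.e., so the differences of the two approximating
   sequences have gradients tending to 0; hence 0 is an admissible gradient for w - u.\<close>
 have "w0_approx \<Omega> (%i. P) (%x. w x - u x) (%x. 0) (%k x. \<psi> k x - \<phi> k x)"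
 proof
  show "(%k. LINT x|?M. |(\<psi> k x - \<phi> k x - (w x - u x))|) \<leadsto> 0"
  proof (rule tendsto_sandwich[OF _ _ tendsto_const])
   show "(%k. (LINT x|?M. |(\<psi> k x - w x)|) + (LINT x|?M. |(\<phi> k x - u x)|)) \<leadsto> 0" using tendsto_add[OF W.L1 U.L1] by simp
   show "\<forall>\<^sub>F k in sequentially. (LINT x|?M. |(\<psi> k x - \<phi> k x - (w x - u x))|) \<le> (LINT x|?M. |(\<psi> k x - w x)|) + (LINT x|?M. |(\<phi> k x - u x)|)"
   proof (intro always_eventually allI)
    fix k
    have i: "integrable ?M (%x. |(\<psi> k x - w x)|)" "integrable ?M (%x. |(\<phi> k x - u x)|)" "integrable ?M (%x. |(\<psi> k x - \<phi> k x - (w x - u x))|)"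
     using W.\<phi>_int U.\<phi>_int W.u_int U.u_int by auto
    have "(LINT x|?M. |(\<psi> k x - \<phi> k x - (w x - u x))|) \<le> (LINT x|?M. |(\<psi> k x - w x)| + |(\<phi> k x - u x)|)"
     using i by (intro integral_mono) auto
    thus "(LINT x|?M. |(\<psi> k x - \<phi> k x - (w x - u x))|) \<le> (LINT x|?M. |(\<psi> k x - w x)|) + (LINT x|?M. |(\<phi> k x - u x)|)"
     using i by simp
   qed
  qed simp
  show "AE x in ?M. (%k. \<psi> k x - \<phi> k x) \<leadsto> w x - u x" using W.ae U.ae by eventually_elim (rule tendsto_diff)
  show "(%k. LINT x|?M. |(pd i (%x. \<psi> k x - \<phi> k x) x - 0 $ i)| powr P) \<leadsto> 0" for i
  proof (rule tendsto_sandwich[OF _ _ tendsto_const])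
   show "(%k. 2 powr P * ((LINT x|?M. |(pd i (\<psi> k) x - W x $ i)| powr P) + (LINT x|?M. |(pd i (\<phi> k) x - U x $ i)| powr P))) \<leadsto> 0"
    using tendsto_mult_right_zero[OF tendsto_add_zero[OF W.Lp_lim U.Lp_lim]] .
   show "\<forall>\<^sub>F k in sequentially. (LINT x|?M. |(pd i (%x. \<psi> k x - \<phi> k x) x - 0 $ i)| powr P)
    \<le> 2 powr P * ((LINT x|?M. |(pd i (\<psi> k) x - W x $ i)| powr P) + (LINT x|?M. |(pd i (\<phi> k) x - U x $ i)| powr P))"
   proof (intro always_eventually allI)
    fix k
    have pd: "pd i (%x. \<psi> k x - \<phi> k x) x = pd i (\<psi> k) x - pd i (\<phi> k) x" for x
     by (rule partial_deriv_minus) (auto intro: test_funs_diff[OF W.\<phi>] test_funs_diff[OF U.\<phi>])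
    have i: "integrable ?M (%x. 2 powr P * ( |(pd i (\<psi> k) x - W x $ i)| powr P + |(pd i (\<phi> k) x - U x $ i)| powr P))"
     using W.pd_diff_int U.pd_diff_int by simp
    have "(LINT x|?M. |(pd i (%x. \<psi> k x - \<phi> k x) x - 0 $ i)| powr P)
     \<le> (LINT x|?M. 2 powr P * ( |(pd i (\<psi> k) x - W x $ i)| powr P + |(pd i (\<phi> k) x - U x $ i)| powr P))"
    proof (rule integral_mono_AE[OF _ i])
     show "AE x in ?M. |(pd i (%x. \<psi> k x - \<phi> k x) x - 0 $ i)| powr P
      \<le> 2 powr P * ( |(pd i (\<psi> k) x - W x $ i)| powr P + |(pd i (\<phi> k) x - U x $ i)| powr P)" using UW
     proof eventually_elim
      case (elim x)
      show ?case using abs_add_powr_le[of P "pd i (\<psi> k) x - W x $ i" "- (pd i (\<phi> k) x - U x $ i)"] P elim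
       unfolding pd by (simp add: abs_minus_commute)
     qed
     show "integrable ?M (%x. |(pd i (%x. \<psi> k x - \<phi> k x) x - 0 $ i)| powr P)"
      using U.test_pd_Lp[OF test_funs_minus[OF W.\<phi>[of k] U.\<phi>[of k]], of P i] P by simp
    qed
    also have "\<dots> = 2 powr P * ((LINT x|?M. |(pd i (\<psi> k) x - W x $ i)| powr P) + (LINT x|?M. |(pd i (\<phi> k) x - U x $ i)| powr P))"
     using W.pd_diff_int U.pd_diff_int by simp
    finally show "(LINT x|?M. |(pd i (%x. \<psi> k x - \<phi> k x) x - 0 $ i)| powr P)
     \<le> 2 powr P * ((LINT x|?M. |(pd i (\<psi> k) x - W x $ i)| powr P) + (LINT x|?M. |(pd i (\<phi> k) x - U x $ i)| powr P))" .
   qed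
  qed simp
 qed (use op bd P test_funs_minus[OF W.\<phi> U.\<phi>] W.u_int U.u_int in auto)
 then interpret Z: w0_approx \<Omega> "%i. P" "%x. w x - u x" "%x. 0" "%k x. \<psi> k x - \<phi> k x" .
 have "(\<integral>\<^sup>+x. ennreal ( |(w x - u x)| powr P) \<partial>?M) \<le> 0"
 proof -
  obtain L where "(\<integral>\<^sup>+x. ennreal ( |(w x - u x)| powr P) \<partial>?M) \<le> ennreal (L powr P * (2 powr P * (LINT x|?M. |((0::real^'n) $ undefined)| powr P)))"
   by (rule Z.Poincare_limit) (rule that)
  thus ?thesis by simp
 qed
 hence "AE x in ?M. ennreal ( |(w x - u x)| powr P) = 0" by (subst nn_integral_0_iff_AE[symmetric]) auto
 thus ?thesis by eventually_elim auto
qed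

context sym_data begin

text \<open>The definition of Y inverts the power law: the flux \<Lambda> |\<nabla>v|^(P-1) is X.
  \<open>AE_radial\<close> carries the exceptional null set from the volume variable to
  space.\<close>

lemma Yb_X: "AE x in lborel. x \<in> B & x \<noteq> 0 --> \<Lambda> * Yb (\<tau> x) powr (P - 1) = X (\<tau> x)"
 using AE_radial[OF Yb(4)]
proof eventually_elim
 case (elim x)
 show ?case
 proof (intro impI)
  assume x: "x \<in> B & x \<noteq> 0"
  hence t: "0 < \<tau> x" "\<tau> x \<le> TT" "\<tau> x \<in> {0<..<TT}" using \<tau>_pos[of x] by (auto simp: B_iff)
  have "- 1 / (P - 1) * (P - 1) = -1" "1 / (P - 1) * (P - 1) = 1" using P1 by auto
  hence "Y (\<tau> x) powr (P - 1) = \<Lambda> powr (-1) * X (\<tau> x) powr 1" unfolding Y_def powr_mult powr_powr by (simp only:)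
  also have "\<dots> = X (\<tau> x) / \<Lambda>" using \<Lambda>_pos X0[OF t(1,2)] by (simp add: powr_minus divide_inverse)
  finally show "\<Lambda> * Yb (\<tau> x) powr (P - 1) = X (\<tau> x)" using elim t(3) \<Lambda>_pos by simp
 qed
qed

text \<open>X is the sum of a load part and \<open>G_term\<close>. The \<open>G_term\<close> part is
  literally the divergence term of the right-hand side, and the load part is balanced against the
  source by \<open>flux_identity\<close>.\<close>

lemma symmetric_weak_solution: "sym_weak_solution \<Omega> p lam f G v"
 unfolding sym_weak_solution_def weak_solution_def P_def[symmetric] \<Lambda>_def[symmetric] N_def[symmetric] \<omega>_def[symmetric] \<tau>_def[symmetric]
proof (intro conjI ballI)
 obtain \<phi>k where "w0_approx B (%i. P) v Dv \<phi>k" by (rule symmetric_approx)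
 then interpret V: w0_approx B "%i. P" v Dv \<phi>k .
 show "W0 B (%i. P) v" by (rule V.W0_u)
 fix \<phi> assume \<phi>: "\<phi> \<in> test_funs B"
 have C1: "C1 \<phi>" by (rule test_funs_C1[OF \<phi>])
 note [measurable] = C1_borel[OF C1] C1_pd_borel[OF C1]
 define D where "D x = gradient \<phi> x \<bullet> x" for x
 have [measurable]: "D \<in> BM borel" unfolding D_def[abs_def] gradient_inner by measurable
 obtain C where C: "C \<ge> 0" "!!i x. |(pd i \<phi> x)| \<le> C" using test_fun_bounded[OF \<phi>] by metis
 have out: "\<phi> x = 0" "D x = 0" if "x \<notin> B" for x
  using test_funs_outside[OF \<phi> that] partial_deriv_outside[OF \<phi> that] by (simp_all add: D_def gradient_inner)
 have D_le: "|(D x / norm x)| \<le> real CARD('n) * C" for x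
 proof -
  have "|(D x)| \<le> (\<Sum>i\<in>UNIV. |(pd i \<phi> x * x $ i)|)" unfolding D_def gradient_inner by (rule sum_abs)
  also have "\<dots> \<le> (\<Sum>i\<in>(UNIV::'n set). C * norm x)" unfolding abs_mult by (intro sum_mono mult_mono C component_le_norm_cart) auto
  finally show ?thesis using C(1) by (cases "x = 0") (auto simp: divide_le_eq mult_ac)
 qed
 \<comment> \<open>A is the integrand of the left side, E the load part of the flux and S the
   source. The right side becomes S + A + E, where S and E cancel after integration.\<close>
 define A where "A x = - (\<Lambda> * Yb (\<tau> x) powr (P - 1) * (D x / norm x))" for x
 define E where "E x = Fb (\<tau> x) / (N * \<tau> x) * D x" for x
 define S where "S x = fs (\<tau> x) * \<phi> x" for x
 have Am [measurable]: "A \<in> BM borel" unfolding A_def[abs_def] by measurable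
 have Em [measurable]: "E \<in> BM borel" unfolding E_def[abs_def] by measurable
 have Sm [measurable]: "S \<in> BM borel" unfolding S_def[abs_def] by measurable
 have off: "ind B x * A x = A x" "ind B x * (S x + (A x + E x)) = S x + (A x + E x)" for x by (cases "x \<in> B"; simp add: A_def E_def S_def out)+
 have Ai: "integrable lborel A"
 proof (rule Bochner_Integration.integrable_bound)
  have Yi: "integrable lborel (%x. Yb (\<tau> x) powr P)" using nn_Dv unfolding norm_Dv by (intro integrableI_bounded) auto
  show "integrable lborel (%x. \<Lambda> * (real CARD('n) * C) * (ind B x + Yb (\<tau> x) powr P))" using Yi B_borel emeasure_bounded_finite[OF B_bdd]
   by (intro integrable_mult_right Bochner_Integration.integrable_add integrable_real_indicator) auto
  show "AE x in lborel. norm (A x) \<le> norm (\<Lambda> * (real CARD('n) * C) * (ind B x + Yb (\<tau> x) powr P))"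
  proof (rule AE_I2)
   fix x
   have y: "y powr (P - 1) \<le> 1 + y powr P" if "y \<ge> 0" for y :: real
   proof (cases "y \<le> 1")
    case True
    hence "y powr (P - 1) \<le> 1" using that P1 by (intro powr_le1) auto
    thus ?thesis by (rule order_trans) simp
   next
    case False
    hence "y powr (P - 1) \<le> y powr P" by (intro powr_mono) auto
    thus ?thesis by simp
   qed
   show "norm (A x) \<le> norm (\<Lambda> * (real CARD('n) * C) * (ind B x + Yb (\<tau> x) powr P))"
   proof (cases "x \<in> B")
    case True
    have "norm (A x) = \<Lambda> * Yb (\<tau> x) powr (P - 1) * |(D x / norm x)|"
     using \<Lambda>_pos by (simp only: A_def real_norm_def abs_minus_cancel abs_mult abs_of_pos powr_ge_zero abs_of_nonneg)
    also have "\<dots> \<le> \<Lambda> * (1 + Yb (\<tau> x) powr P) * (real CARD('n) * C)"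
     using \<Lambda>_pos D_le[of x] y[OF Yb(2)] by (intro mult_mono mult_nonneg_nonneg) auto
    finally show ?thesis using True \<Lambda>_pos C(1) by (simp add: mult_ac)
   qed (simp add: A_def out)
  qed
 qed measurable
 note fl = flux_identity[OF \<phi>, folded D_def, folded E_def S_def]
 have ae0: "AE x in lborel. (x::real^'n) \<noteq> 0" by (rule AE_lborel_singleton)
 have We: "AE x in lborel. x \<in> B --> weak_grad B v x = Dv x" using V.weak_grad_eq by (simp add: AE_lebesgue_on_iff[OF B_borel])
 have l: "AE x in lborel. x \<in> B -->
   \<Lambda> *\<^sub>R (norm (weak_grad B v x) powr (P - 2) *\<^sub>R weak_grad B v x) \<bullet> gradient \<phi> x = A x" using We ae0
 proof eventually_elim
  case (elim x)
  have "norm (Dv x) powr (P - 2) * Yb (\<tau> x) = Yb (\<tau> x) powr (P - 1)" using norm_powr_scaleR[of "Dv x" P] by (simp add: norm_Dv Yb(2))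
  hence "norm (Dv x) powr (P - 2) *\<^sub>R Dv x = (- (Yb (\<tau> x) powr (P - 1) / norm x)) *\<^sub>R x"
   unfolding Dv_def[of x] scaleR_scaleR by (simp add: Dv_def[symmetric])
  thus ?case using elim by (auto simp: A_def D_def inner_commute[of x])
 qed
 have r: "AE x in lborel. x \<in> B -->
   sym_rearr \<Omega> f x * \<phi> x + (\<Sum>i\<in>UNIV. - (G_term p lam G (\<tau> x) * (x $ i / norm x)) * pd i \<phi> x) = S x + (A x + E x)"
  using Yb_X ae0
 proof eventually_elim
  case (elim x)
  show ?case
  proof
   assume x: "x \<in> B"
   with elim have x0: "x \<noteq> 0" and YX: "\<Lambda> * Yb (\<tau> x) powr (P - 1) = X (\<tau> x)" by auto
   have t: "0 < \<tau> x" "\<tau> x \<le> TT" using \<tau>_pos[OF x0] x by (auto simp: B_iff)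
   have S: "sym_rearr \<Omega> f x * \<phi> x = S x"
    using t by (simp add: sym_rearr_def S_def fs_def \<tau>_def[unfolded \<omega>_def N_def, symmetric])
   have g: "(\<Sum>i\<in>UNIV. - (G_term p lam G (\<tau> x) * (x $ i / norm x)) * pd i \<phi> x) = - (G_term p lam G (\<tau> x) * (D x / norm x))"
    unfolding D_def gradient_inner sum_divide_distrib sum_distrib_left sum_negf[symmetric] by (intro sum.cong refl) simp
   have "X (\<tau> x) = (\<tau> x powr (1/N - 1) / c\<omega>) * F (\<tau> x) + G_term p lam G (\<tau> x)"
    by (simp add: X_def load_eq[OF t(1)] c\<omega>_def)
   hence "X (\<tau> x) = norm x / (N * \<tau> x) * Fb (\<tau> x) + G_term p lam G (\<tau> x)" unfolding rad_ratio[OF x0] Fb_eq[OF t(2)] .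
   hence "A x = - (norm x / (N * \<tau> x) * Fb (\<tau> x) * (D x / norm x)) - G_term p lam G (\<tau> x) * (D x / norm x)"
    unfolding A_def YX by (simp only: distrib_right minus_add_distrib diff_conv_add_uminus)
   moreover have "norm x / (N * \<tau> x) * Fb (\<tau> x) * (D x / norm x) = E x" using x0 by (simp add: E_def)
   ultimately show "sym_rearr \<Omega> f x * \<phi> x + (\<Sum>i\<in>UNIV. - (G_term p lam G (\<tau> x) * (x $ i / norm x)) * pd i \<phi> x) = S x + (A x + E x)"
    unfolding S g by simp
  qed
 qed
 have SAEm: "(%x. S x + (A x + E x)) \<in> BM borel" by measurable
 note L = integral_lebesgue_on_cong_borel[OF B_borel Am l, unfolded off] and RR = integral_lebesgue_on_cong_borel[OF B_borel SAEm r, unfolded off]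
 show "integrable (LB B) (%x. \<Lambda> *\<^sub>R (norm (weak_grad B v x) powr (P - 2) *\<^sub>R weak_grad B v x) \<bullet> gradient \<phi> x)"
  using L(1) Ai by simp
 show "integrable (LB B) (%x. sym_rearr \<Omega> f x * \<phi> x + (\<Sum>i\<in>UNIV. - (G_term p lam G (\<tau> x) * (x $ i / norm x)) * pd i \<phi> x))"
  using RR(1) Ai fl(1,2) by simp
 have "(LBINT x. S x + (A x + E x)) = (LBINT x. A x)" using Ai fl by simp
 thus "(LINT x|LB B. \<Lambda> *\<^sub>R (norm (weak_grad B v x) powr (P - 2) *\<^sub>R weak_grad B v x) \<bullet> gradient \<phi> x)
  = (LINT x|LB B. sym_rearr \<Omega> f x * \<phi> x + (\<Sum>i\<in>UNIV. - (G_term p lam G (\<tau> x) * (x $ i / norm x)) * pd i \<phi> x))"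
  using L(2) RR(2) by simp
qed

lemma symmetric_weak_solution_unique:
 assumes "sym_weak_solution \<Omega> p lam f G w"
 shows "AE x in LB B. w x = v x" using p_laplace_unique[OF B_open B_bdd P1 \<Lambda>_pos]
  symmetric_weak_solution assms unfolding sym_weak_solution_def P_def \<Lambda>_def by blast

lemma v_symmetric: "spherically_symmetric B v"
 by (simp add: spherically_symmetric_def v_eq \<tau>_def)

end

section \<open>Assembly of the estimates and constants\<close>

lemma g_density_nonneg: "g_density p lam g x \<ge> 0" if "!!i. p i > 1" "!!i. lam i > 0"
 unfolding g_density_def
proof (intro sum_nonneg divide_nonneg_nonneg mult_nonneg_nonneg powr_ge_zero)
 show "0 \<le> conj_exp (p i)" for i using conj_exp_props(1)[OF that(1), of i] by simp
qed

context aniso begin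

definition "cU = Ccmp (geo_const p lam) (young_const p)"
text \<open>The 2 undoes the half of the energy lost to Young's inequality; the two summands come
  from \<open>load_energy\<close> and \<open>G_energy\<close>.\<close>

definition "cE = 2 * (cU * \<Lambda> + young_const p * (\<Lambda> powr q / kG))"
text \<open>Each \<open>lam i\<close> times its component of the energy is at most the full weighted
  energy, and the components are then added without weights.\<close>

definition "cD = (\<Sum>i\<in>UNIV. 1 / lam i) * cE"

theorem symmetrization:
 fixes \<Omega> :: "(real^'n) set"
 assumes op: "open \<Omega>" and bd: "bounded \<Omega>"
  and st: "structure_conds \<Omega> p lam \<beta> h a"
  and Lor: "Lorentz \<Omega> (conj_exp (sobolev_exp p)) (conj_exp (harm_mean p)) f"
  and g: "!!i. Lp \<Omega> (conj_exp (p i)) (g i)"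
  and sol: "weak_solution \<Omega> p a f g u"
  and G: "pseudo_rearr \<Omega> u (g_density p lam g) G"
 defines "v \<equiv> sym_sol \<Omega> p lam f G"
 shows "sym_weak_solution \<Omega> p lam f G v" "spherically_symmetric (sym_dom \<Omega>) v"
  "!!w. sym_weak_solution \<Omega> p lam f G w ==> AE x in LB (sym_dom \<Omega>). w x = v x"
  "AE x in LB (sym_dom \<Omega>). sym_rearr \<Omega> u x \<le> cU * v x"
  "(\<Sum>i\<in>UNIV. LINT x|LB \<Omega>. |(weak_grad \<Omega> u x $ i)| powr p i)
   \<le> cD * (LINT x|LB (sym_dom \<Omega>). norm (weak_grad (sym_dom \<Omega>) v x) powr harm_mean p)"
proof -
 have \<Omega>b: "\<Omega> \<in> sets borel" using op by simp
 have \<Omega>l: "\<Omega> \<in> lmeasurable" using op bd by (intro bounded_set_imp_lmeasurable) auto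
 define gd where "gd = g_density p lam g"
 have gd0: "gd x \<ge> 0" for x unfolding gd_def by (rule g_density_nonneg[OF p lam])
 obtain \<phi> where \<phi>: "w0_approx \<Omega> p u (weak_grad \<Omega> u) \<phi>"
  by (rule W0_imp_approx[OF op bd p]) (use sol in \<open>auto simp: weak_solution_def\<close>)
 interpret U: w0_approx \<Omega> p u "weak_grad \<Omega> u" \<phi> by (rule \<phi>)
 obtain E where E: "pseudo \<Omega> u gd E G" by (rule pseudo_rearr_pseudo[OF \<Omega>b \<Omega>l G[folded gd_def] gd0])
 interpret ps: pseudo \<Omega> u gd E G by (rule E)
 interpret ac: ac_primitive "measure lebesgue \<Omega>" ps.K G "LINT x|LB \<Omega>. gd x" by (rule ps.ac)
 interpret sym_data p lam \<Omega> f G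
 proof
  show "(\<integral>\<^sup>+t. ennreal (G t) * ind {0<..<measure lebesgue \<Omega>} t \<partial>lebesgue) < \<infinity>"
   using ac.nn_G_le by (rule le_less_trans) simp
 qed (use op bd Lor ac.G_measurable ac.AE_nonneg in auto)
 have fs_i: "integrable (LB {0<..<measure lebesgue \<Omega>}) (decr_rearr \<Omega> f)" using fs_int[OF order_refl] by (simp add: TT_def)
 have f_int: "integrable (LB \<Omega>) f"
 proof (rule integrableI_bounded)
  show "f \<in> BM (LB \<Omega>)" using Lor by (simp add: Lorentz_def)
  have em: "emeasure lborel \<Omega> \<le> ennreal TT"
  proof -
   have "emeasure lborel \<Omega> = (\<integral>\<^sup>+x. ind \<Omega> x \<partial>lebesgue)"
    using \<Omega>b by (simp only: nn_integral_completion nn_integral_indicator sets_lborel)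
   also have "\<dots> = emeasure lebesgue \<Omega>" using \<Omega>b by (intro nn_integral_indicator) simp
   also have "\<dots> = ennreal TT" unfolding TT_def by (rule emeasure_eq_measure2[OF \<Omega>l])
   finally show ?thesis by simp
  qed
  have "(\<integral>\<^sup>+x. ennreal (norm (f x)) \<partial>lebesgue_on \<Omega>) = (\<integral>\<^sup>+x. ennreal |(f x)| * ind \<Omega> x \<partial>lebesgue_on \<Omega>)"
   by (intro nn_integral_cong) (auto simp: indicator_def)
  also have "\<dots> \<le> (NN s. ennreal (decr_rearr \<Omega> f s) * ind {0<..<TT} s)" by (rule f.integral_le_rearr[OF \<Omega>b order_refl em TT0])
  also have "\<dots> = (NN s. ennreal (fs s) * ind {0<..<TT} s)" by (intro nn_integral_cong) (auto simp: indicator_def fs_def)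
  also have "\<dots> < \<infinity>" unfolding nn_F[OF order_refl] by simp
  finally show "(\<integral>\<^sup>+x. ennreal (norm (f x)) \<partial>lebesgue_on \<Omega>) < \<infinity>" .
 qed
 interpret cmp: comparison \<Omega> p u "weak_grad \<Omega> u" \<phi> gd E G f lam
 proof
  show "1/2 * (LINT x|LB \<Omega>. ind J (u x) * (\<Sum>i\<in>UNIV. lam i * |(weak_grad \<Omega> u x $ i)| powr p i))
   \<le> (LINT x|LB \<Omega>. |(f x)| * min (max ( |(u x)| - s) 0) (t - s))
    + young_const p * (LINT x|LB \<Omega>. ind J (u x) * gd x)"
   if "0 \<le> s" "s < t" "J = {r. s < |(r)| & |(r)| < t} \<or> (s = 0 & J = {r. |(r)| < t})" for s t J unfolding young_const_def gd_def
   by (rule weak_solution_energy_slice[OF \<phi> st sol lam f_int g that])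
 qed (use lam f_int fs_i in auto)
 have gc: "geo_const p lam > 0" and yc: "young_const p \<ge> 0" by (rule cmp.geo_pos, rule cmp.young_nonneg)
 have cU0: "cU > 0" unfolding cU_def by (rule Ccmp_pos[OF gc])
 have us: "decr_rearr \<Omega> u s \<le> cU * \<Psi> s" if s: "0 < s" "s < TT" for s unfolding cU_def using cmp.us_le_nn[of s] s
  by (intro le_\<Psi>[OF gc yc s(1)])
   (simp only: TT_def P_def N_def F_def cmp.F_def)
 show "sym_weak_solution \<Omega> p lam f G v" unfolding v_def by (rule symmetric_weak_solution)
 show "spherically_symmetric (sym_dom \<Omega>) v" unfolding v_def by (rule v_symmetric)
 show "AE x in LB (sym_dom \<Omega>). w x = v x" if "sym_weak_solution \<Omega> p lam f G w" for w
  unfolding v_def by (rule symmetric_weak_solution_unique[OF that])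
 show "AE x in LB (sym_dom \<Omega>). sym_rearr \<Omega> u x \<le> cU * v x" unfolding AE_lebesgue_on_iff[OF B_borel] using AE_lborel_singleton[of 0]
 proof eventually_elim
  case (elim x)
  show ?case
  proof
   assume "x \<in> sym_dom \<Omega>"
   hence "0 < \<tau> x" "\<tau> x < TT" using \<tau>_pos[OF elim] by (auto simp: B_iff)
   from us[OF this] show "sym_rearr \<Omega> u x \<le> cU * v x" by (simp add: v_def v_eq sym_rearr_def \<tau>_def \<omega>_def N_def)
  qed
 qed
 have cK: "0 \<le> \<Lambda> powr q / kG" using kG_pos by simp
 have "ennreal (1/2 * (LINT x|LB \<Omega>. (\<Sum>i\<in>UNIV. lam i * |(weak_grad \<Omega> u x $ i)| powr p i)))
  \<le> ennreal (cU * \<Lambda> * EY) + ennreal (young_const p) * ennreal (\<Lambda> powr q / kG * EY)"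
 proof (rule order_trans[OF cmp.total_energy], intro add_mono mult_left_mono)
  show "(NN s. ennreal (decr_rearr \<Omega> f s) * ennreal (decr_rearr \<Omega> u s) * ind {0<..} s) \<le> ennreal (cU * \<Lambda> * EY)"
   by (rule load_energy) (use us cU0 ps.us_zero in \<open>auto simp: TT_def\<close>)
  show "ennreal (LINT x|LB \<Omega>. gd x) \<le> ennreal (\<Lambda> powr q / kG * EY)"
   using order_trans[OF ps.total_le_nn_G G_energy[unfolded TT_def]] .
 qed simp
 also have "\<dots> = ennreal ((cU * \<Lambda> + young_const p * (\<Lambda> powr q / kG)) * EY)" using cU0 \<Lambda>_pos EY0 yc cK
  by (simp only: ennreal_mult'[symmetric, OF yc] distrib_right mult.assoc ennreal_plus mult_nonneg_nonneg less_imp_le)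
 finally have "1/2 * (LINT x|LB \<Omega>. (\<Sum>i\<in>UNIV. lam i * |(weak_grad \<Omega> u x $ i)| powr p i)) \<le> (cU * \<Lambda> + young_const p * (\<Lambda> powr q / kG)) * EY"
  using cU0 \<Lambda>_pos EY0 yc cK by (subst (asm) ennreal_le_iff) (auto intro!: mult_nonneg_nonneg add_nonneg_nonneg simp del: times_divide_eq_right)
 hence en: "(LINT x|LB \<Omega>. (\<Sum>i\<in>UNIV. lam i * |(weak_grad \<Omega> u x $ i)| powr p i)) \<le> cE * EY"
  unfolding cE_def by (simp only: mult.assoc)
 have "(LINT x|LB \<Omega>. |(weak_grad \<Omega> u x $ i)| powr p i) \<le> 1 / lam i * (cE * EY)" for i
 proof -
  have "lam i * (LINT x|LB \<Omega>. |(weak_grad \<Omega> u x $ i)| powr p i) = (LINT x|LB \<Omega>. lam i * |(weak_grad \<Omega> u x $ i)| powr p i)"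
   by simp
  also have "\<dots> \<le> (LINT x|LB \<Omega>. (\<Sum>i\<in>UNIV. lam i * |(weak_grad \<Omega> u x $ i)| powr p i))"
  proof (rule integral_mono)
   show "lam i * |(weak_grad \<Omega> u x $ i)| powr p i \<le> (\<Sum>i\<in>UNIV. lam i * |(weak_grad \<Omega> u x $ i)| powr p i)" for x
    using lam by (intro member_le_sum[where f = "%i. lam i * |(weak_grad \<Omega> u x $ i)| powr p i"]) (auto simp: less_imp_le)
  qed (use U.D_int in auto)
  also note en
  finally show ?thesis using lam[of i] by (simp add: field_simps)
 qed
 hence "(\<Sum>i\<in>UNIV. LINT x|LB \<Omega>. |(weak_grad \<Omega> u x $ i)| powr p i) \<le> (\<Sum>i\<in>UNIV. 1 / lam i * (cE * EY))"
  by (intro sum_mono)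
 also have "\<dots> = cD * EY" by (simp only: cD_def sum_distrib_right[symmetric] mult.assoc)
 also have "EY = (LINT x|LB (sym_dom \<Omega>). norm (weak_grad (sym_dom \<Omega>) v x) powr harm_mean p)" using energy_v by (simp add: v_def P_def)
 finally show "(\<Sum>i\<in>UNIV. LINT x|LB \<Omega>. |(weak_grad \<Omega> u x $ i)| powr p i)
   \<le> cD * (LINT x|LB (sym_dom \<Omega>). norm (weak_grad (sym_dom \<Omega>) v x) powr harm_mean p)" .
qed

end

theorem corollary4p2:
  fixes p lam :: "'n::finite \<Rightarrow> real"
  assumes "CARD('n) \<ge> 2"
    and "\<And>i. lam i > 0" and "\<And>i. p i > 1"
    and "harm_mean p < real CARD('n)"
  shows "\<exists>C>0. \<forall>(\<Omega> :: (real^'n) set) \<beta> h a f g u G.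
     open \<Omega> \<and> bounded \<Omega> \<and>
     structure_conds \<Omega> p lam \<beta> h a \<and>
     Lorentz \<Omega> (conj_exp (sobolev_exp p)) (conj_exp (harm_mean p)) f \<and>
     (\<forall>i. Lp \<Omega> (conj_exp (p i)) (g i)) \<and>
     weak_solution \<Omega> p a f g u \<and>
     pseudo_rearr \<Omega> u (g_density p lam g) G \<longrightarrow>
     (let v = sym_sol \<Omega> p lam f G in
        sym_weak_solution \<Omega> p lam f G v \<and> spherically_symmetric (sym_dom \<Omega>) v \<and>
        (\<forall>w. sym_weak_solution \<Omega> p lam f G w \<and> spherically_symmetric (sym_dom \<Omega>) w \<longrightarrow>
             (AE x in lebesgue_on (sym_dom \<Omega>). w x = v x)) \<and>
        (AE x in lebesgue_on (sym_dom \<Omega>). sym_rearr \<Omega> u x \<le> C * v x) \<and>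
        (\<Sum>i\<in>UNIV. LINT x|lebesgue_on \<Omega>. \<bar>weak_grad \<Omega> u x $ i\<bar> powr p i)
          \<le> C * (LINT x|lebesgue_on (sym_dom \<Omega>). norm (weak_grad (sym_dom \<Omega>) v x) powr harm_mean p))"
proof -
 interpret aniso p lam using assms by unfold_locales
 \<comment> \<open>A single constant for both estimates, chosen before the domain and the data; the
   1 guarantees positivity.\<close>
 define C where "C = max 1 (max cU cD)"
 have C: "C > 0" "cU \<le> C" "cD \<le> C" by (auto simp: C_def)
 show ?thesis
 proof (intro exI[of _ C] conjI[OF C(1)] allI impI, elim conjE)
  fix \<Omega> :: "(real^'n) set" and \<beta> h a f g u G
  assume H: "open \<Omega>" "bounded \<Omega>" "structure_conds \<Omega> p lam \<beta> h a"
   "Lorentz \<Omega> (conj_exp (sobolev_exp p)) (conj_exp (harm_mean p)) f"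
   "\<forall>i. Lp \<Omega> (conj_exp (p i)) (g i)" "weak_solution \<Omega> p a f g u"
   "pseudo_rearr \<Omega> u (g_density p lam g) G"
  note S = symmetrization[OF H(1-4) spec[OF H(5)] H(6-7)]
  define v where "v = sym_sol \<Omega> p lam f G"
  \<comment> \<open>Replacing cU by the larger C requires that v be nonnegative.\<close>
  have v0: "0 \<le> v x" for x unfolding v_def sym_sol_def Let_def by (rule Bochner_Integration.integral_nonneg) simp
  have 4: "AE x in LB (sym_dom \<Omega>). sym_rearr \<Omega> u x \<le> C * v x" using S(4)
  proof eventually_elim
   case (elim x)
   thus ?case using mult_right_mono[OF C(2) v0[of x]] by (simp add: v_def)
  qed
  have 5: "(\<Sum>i\<in>UNIV. LINT x|LB \<Omega>. |(weak_grad \<Omega> u x $ i)| powr p i)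
     \<le> C * (LINT x|LB (sym_dom \<Omega>). norm (weak_grad (sym_dom \<Omega>) v x) powr harm_mean p)"
   unfolding v_def by (rule order_trans[OF S(5) mult_right_mono[OF C(3)]]) simp
  show "let v = sym_sol \<Omega> p lam f G in
    sym_weak_solution \<Omega> p lam f G v & spherically_symmetric (sym_dom \<Omega>) v &
    (\<forall>w. sym_weak_solution \<Omega> p lam f G w & spherically_symmetric (sym_dom \<Omega>) w -->
       (AE x in LB (sym_dom \<Omega>). w x = v x)) &
    (AE x in LB (sym_dom \<Omega>). sym_rearr \<Omega> u x \<le> C * v x) &
    (\<Sum>i\<in>UNIV. LINT x|LB \<Omega>. |(weak_grad \<Omega> u x $ i)| powr p i)
     \<le> C * (LINT x|LB (sym_dom \<Omega>). norm (weak_grad (sym_dom \<Omega>) v x) powr harm_mean p)"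
   using S(1-3) 4 5 unfolding Let_def v_def by blast
 qed
qed

end
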